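(* Let $L$ be either $\mathbb{Q}_p$ ($p$ a prime) or a finite field extension of $\mathbb{Q}_p$, and let $K$ be one of the fields $L$, $L((t_1))$, $L((t_1))((t_2))$, $L((t_1))((t_2))((t_3))$, and so on (i.e. $K=L((t_1))\cdots((t_n))$ for some integer $n\ge 0$, with $K=L$ when $n=0$). Let $\mathcal{L}_{\rm ring}=(+,-,\cdot,0,1)$ be the language of rings. Then $K_0(K,\mathcal{L}_{\rm ring})=0$, and there exists an $\mathcal{L}_{\rm ring}$-definable bijection $K\to K^\times$, where $K^\times=K\setminus\{0\}$.
   Context: Iterated Laurent series fields: $L((t_1))$ is the field of formal Laurent series in $t_1$ over $L$, and inductively $L((t_1))\cdots((t_n))$ is the field of formal Laurent series in $t_n$ over $L((t_1))\cdots((t_{n-1}))$. Definable always means definable with parameters. A function is definable if its graph is. Grothendieck ring: let $\mathcal{L}$ be a language and $M$ an $\mathcal{L}$-structure. For $\mathcal{L}$-definable sets $X\subset M^m$, $Y\subset M^n$ ($m,n>0$), write $X\cong_{\mathcal{L}}Y$ if there is an $\mathcal{L}$-definable bijection $X\to Y$. $K_0(M,\mathcal{L})$ is the abelian group generated by symbols $[A]$, for $A$ an $\mathcal{L}$-definable set, with the relations $[A]=[A']$ if $A\cong_{\mathcal{L}}A'$, and $[A]=[B]+[C]$ if $A$ is the disjoint union of the definable sets $B$ and $C$; it is a ring with multiplication induced by $[A\times B]=[A][B]$ (the unit is the class of a point). *)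

theory Defs
  imports
    Complex_Main
    "HOL-Computational_Algebra.Primes"
    "HOL-Algebra.QuotRing"
    "HOL-Algebra.Embedded_Algebras"
    "HOL-Algebra.Weak_Morphisms"
    "HOL-Algebra.Free_Abelian_Groups"
begin

section \<open>The field of p-adic numbers and its finite extensions\<close>

definition padic_abs :: "nat \<Rightarrow> rat \<Rightarrow> real" where
  "padic_abs p q =
     (if q = 0 then 0
      else real p powi (int (multiplicity (int p) (snd (quotient_of q)))
                        - int (multiplicity (int p) (fst (quotient_of q)))))"

definition padic_cauchy :: "nat \<Rightarrow> (nat \<Rightarrow> rat) \<Rightarrow> bool" where
  "padic_cauchy p x \<longleftrightarrow> (\<forall>e>0. \<exists>N. \<forall>i\<ge>N. \<forall>j\<ge>N. padic_abs p (x i - x j) < e)"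

definition padic_cauchy_ring :: "nat \<Rightarrow> (nat \<Rightarrow> rat) ring" where
  "padic_cauchy_ring p =
     \<lparr>carrier = {x. padic_cauchy p x},
      monoid.mult = (\<lambda>x y i. x i * y i), monoid.one = (\<lambda>i. 1),
      ring.zero = (\<lambda>i. 0), ring.add = (\<lambda>x y i. x i + y i)\<rparr>"

definition padic_null :: "nat \<Rightarrow> (nat \<Rightarrow> rat) set" where
  "padic_null p = {x. (\<lambda>i. padic_abs p (x i)) \<longlonglongrightarrow> 0}"

text \<open>The completion of the rationals for the p-adic absolute value: Cauchy sequences
  modulo null sequences.\<close>

definition padic_field :: "nat \<Rightarrow> (nat \<Rightarrow> rat) set ring" where
  "padic_field p = padic_cauchy_ring p Quot padic_null p"

text \<open>The extension is given by an embedding, so that \<open>E\<close> may live on any type;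
  \<open>E = F\<close> (with the identity embedding) is included.\<close>

definition finite_field_extension :: "'a ring \<Rightarrow> 'b ring \<Rightarrow> bool" where
  "finite_field_extension F E \<longleftrightarrow>
     field F \<and> field E \<and>
     (\<exists>h \<in> ring_hom F E. ring.finite_dimension E (h ` carrier F) (carrier E))"


section \<open>Iterated Laurent series\<close>

text \<open>A series is the function sending an exponent to its coefficient. The library type
  of formal Laurent series is built over a type class, and so can not be iterated
  a variable number of times.\<close>

definition laurent_ring :: "'a ring \<Rightarrow> (int \<Rightarrow> 'a) ring" where
  "laurent_ring R =
     \<lparr>carrier = {f. (\<forall>k. f k \<in> carrier R) \<and> (\<exists>N. \<forall>k<N. f k = \<zero>\<^bsub>R\<^esub>)},
      monoid.mult = (\<lambda>f g k. \<Oplus>\<^bsub>R\<^esub>i \<in> {i. f i \<noteq> \<zero>\<^bsub>R\<^esub> \<and> g (k - i) \<noteq> \<zero>\<^bsub>R\<^esub>}. f i \<otimes>\<^bsub>R\<^esub> g (k - i)),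
      monoid.one = (\<lambda>k. if k = 0 then \<one>\<^bsub>R\<^esub> else \<zero>\<^bsub>R\<^esub>),
      ring.zero = (\<lambda>k. \<zero>\<^bsub>R\<^esub>),
      ring.add = (\<lambda>f g k. f k \<oplus>\<^bsub>R\<^esub> g k)\<rparr>"

text \<open>A single type containing the elements of all the rings of the tower over \<open>'a\<close>.\<close>

datatype 'a tower = Base 'a | Series "int \<Rightarrow> 'a tower"

text \<open>As both constructors are injective, \<open>image_ring\<close> only renames elements here:
  stage \<open>0\<close> is a copy of \<open>L\<close>, and stage \<open>n + 1\<close> is a copy of the ring of Laurent series
  over stage \<open>n\<close>.\<close>

primrec iterated_laurent :: "'a ring \<Rightarrow> nat \<Rightarrow> 'a tower ring" where
  "iterated_laurent L 0 = image_ring Base L"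
| "iterated_laurent L (Suc n) = image_ring Series (laurent_ring (iterated_laurent L n))"


section \<open>Definable sets in the language of rings\<close>

datatype ring_term =
    Var nat
  | Zero
  | One
  | Plus ring_term ring_term
  | Minus ring_term ring_term
  | Times ring_term ring_term

datatype ring_formula =
    Equal ring_term ring_term
  | Neg ring_formula
  | And ring_formula ring_formula
  | Exists nat ring_formula

primrec term_val :: "'a ring \<Rightarrow> (nat \<Rightarrow> 'a) \<Rightarrow> ring_term \<Rightarrow> 'a" where
  "term_val R v (Var i) = v i"
| "term_val R v Zero = \<zero>\<^bsub>R\<^esub>"
| "term_val R v One = \<one>\<^bsub>R\<^esub>"
| "term_val R v (Plus s t) = term_val R v s \<oplus>\<^bsub>R\<^esub> term_val R v t"
| "term_val R v (Minus s t) = term_val R v s \<ominus>\<^bsub>R\<^esub> term_val R v t"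
| "term_val R v (Times s t) = term_val R v s \<otimes>\<^bsub>R\<^esub> term_val R v t"

primrec satisfies :: "'a ring \<Rightarrow> (nat \<Rightarrow> 'a) \<Rightarrow> ring_formula \<Rightarrow> bool" where
  "satisfies R v (Equal s t) \<longleftrightarrow> term_val R v s = term_val R v t"
| "satisfies R v (Neg \<phi>) \<longleftrightarrow> \<not> satisfies R v \<phi>"
| "satisfies R v (And \<phi> \<psi>) \<longleftrightarrow> satisfies R v \<phi> \<and> satisfies R v \<psi>"
| "satisfies R v (Exists i \<phi>) \<longleftrightarrow> (\<exists>a \<in> carrier R. satisfies R (v(i := a)) \<phi>)"

definition tuples :: "'a ring \<Rightarrow> nat \<Rightarrow> 'a list set" where
  "tuples R m = {xs. length xs = m \<and> set xs \<subseteq> carrier R}"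

text \<open>The first \<open>m\<close> variables range over the point of the set; the remaining ones stand
  for parameters, of which a formula uses only finitely many.\<close>

definition definable :: "'a ring \<Rightarrow> nat \<Rightarrow> 'a list set \<Rightarrow> bool" where
  "definable R m X \<longleftrightarrow>
     (\<exists>\<phi> c. (\<forall>i. c i \<in> carrier R) \<and>
        X = {xs \<in> tuples R m. satisfies R (\<lambda>i. if i < m then xs ! i else c i) \<phi>})"

definition definable_sets :: "'a ring \<Rightarrow> 'a list set set" where
  "definable_sets R = {X. \<exists>m>0. definable R m X}"

definition definable_bij :: "'a ring \<Rightarrow> ('a list \<Rightarrow> 'a list) \<Rightarrow> 'a list set \<Rightarrow> 'a list set \<Rightarrow> bool" where
  "definable_bij R f X Y \<longleftrightarrow>
     (\<exists>m>0. \<exists>n>0. definable R m X \<and> definable R n Y \<and> bij_betw f X Y \<and>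
        definable R (m + n) {xs @ f xs |xs. xs \<in> X})"

definition definably_isomorphic :: "'a ring \<Rightarrow> 'a list set \<Rightarrow> 'a list set \<Rightarrow> bool" where
  "definably_isomorphic R X Y \<longleftrightarrow> (\<exists>f. definable_bij R f X Y)"


section \<open>The Grothendieck ring of definable sets\<close>

definition times_set :: "'a list set \<Rightarrow> 'a list set \<Rightarrow> 'a list set" where
  "times_set A B = {xs @ ys |xs ys. xs \<in> A \<and> ys \<in> B}"

text \<open>The free abelian group on the definable sets, with the biadditive extension of the
  cartesian product. The class of a point is a unit only modulo the relations below,
  since there are no tuples of length \<open>0\<close>.\<close>

definition free_definable_ring :: "'a ring \<Rightarrow> ('a list set \<Rightarrow>\<^sub>0 int) ring" where
  "free_definable_ring R =
     \<lparr>carrier = carrier (free_Abelian_group (definable_sets R)),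
      monoid.mult = (\<lambda>x y. frag_extend (\<lambda>A. frag_extend (\<lambda>B. frag_of (times_set A B)) y) x),
      monoid.one = frag_of {[\<zero>\<^bsub>R\<^esub>]},
      ring.zero = 0, ring.add = (+)\<rparr>"

definition K0_relators :: "'a ring \<Rightarrow> ('a list set \<Rightarrow>\<^sub>0 int) set" where
  "K0_relators R =
     {frag_of A - frag_of A' |A A'.
        A \<in> definable_sets R \<and> A' \<in> definable_sets R \<and> definably_isomorphic R A A'} \<union>
     {frag_of A - (frag_of B + frag_of C) |A B C.
        A \<in> definable_sets R \<and> B \<in> definable_sets R \<and> C \<in> definable_sets R \<and>
        A = B \<union> C \<and> B \<inter> C = {}}"

text \<open>The subgroup generated by the relators is closed under multiplication by arbitrary
  elements, so \<open>Quot\<close> yields the quotient group with the induced multiplication.\<close>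

definition K0 :: "'a ring \<Rightarrow> ('a list set \<Rightarrow>\<^sub>0 int) set ring" where
  "K0 R = free_definable_ring R Quot
            generate (free_Abelian_group (definable_sets R)) (K0_relators R)"

end

theory Submission
  imports Defs
begin

text \<open>The triviality of the Grothendieck ring follows from a definable bijection between \<open>K\<close>
  and \<open>K - {0}\<close> (\<open>K0_trivial\<close>): multiplied by a definable set \<open>X\<close>, it identifies the class
  of \<open>K \<times> X\<close> with that of \<open>(K - {0}) \<times> X\<close>, and the difference of these two classes is that
  of \<open>{0} \<times> X\<close>, which is the class of \<open>X\<close>.

  For the bijection, think of \<open>K\<close> with its valuation into \<open>\<int>\<^sup>r\<close>, where \<open>r = n + 1\<close> and the
  order is lexicographic, the variable adjoined last coming first. Let \<open>A\<close> be a subgroup of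
  finite index \<open>c\<close> in \<open>K - {0}\<close> that consists of one-units times one chosen element for each
  of the values that occur in \<open>A\<close>. Here one-units are the elements of \<open>1 + B\<close> for a fixed
  ball \<open>B\<close> around \<open>0\<close> inside the maximal ideal. Let \<open>D\<close> be the set of elements of positive
  value in \<open>A\<close>, and \<open>T\<close> the set of one-units. It is enough to find a definable bijection
  from \<open>D\<close> to \<open>D\<close> with one more point; the other elements of \<open>K\<close> are left alone.
  Multiplication by an element of least positive value gives \<open>D \<union> T \<cong> D\<close>. Translating \<open>T\<close> by
  \<open>-1\<close> gives the ball \<open>B\<close>, which is \<open>0\<close> together with one copy of \<open>D\<close> for each of the \<open>c\<close>
  cosets of \<open>A\<close>. So \<open>D\<close> is equivalent to \<open>1 + c\<close> copies of itself and a point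
  (\<open>D_absorbs_point\<close>), and it remains to see that \<open>1 + c\<close> copies of \<open>D\<close> are equivalent to
  \<open>D\<close> (\<open>D_absorbs_copies\<close>).

  Here the powers with exponent \<open>m = p + 1\<close> come in. They permute the one-units, and act on
  values as multiplication by \<open>m\<close>. Since \<open>{1, 2, ...}\<close> is the disjoint union of \<open>m\<close>
  translates of its multiples of \<open>m\<close>, a set of elements of \<open>A\<close> whose values form a copy of
  \<open>{1, 2, ...} \<times> \<int>\<^sup>k\<close> is equivalent to \<open>m^(k+1)\<close> copies of itself. The set \<open>D\<close> is not of
  this form, but it is the disjoint union of \<open>r\<close> layers that are, one for each \<open>k < r\<close>: the
  position of the leading nonzero coordinate of the value determines the layer. A layer
  absorbs \<open>m^(k+1) - 1\<close> copies of itself at a time, hence any multiple of that number. All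
  layers absorb \<open>c\<close> copies if \<open>m^(k+1) - 1\<close> divides \<open>c\<close> for all \<open>k < r\<close>, which is arranged
  by making \<open>A\<close> small: in the base field the values of \<open>A\<close> are the multiples of a number
  \<open>E\<close>, and \<open>E\<close> divides \<open>c\<close>.

  All these sets have to be definable in the language of rings, in which the valuation is
  not available. The group \<open>A\<close> is a finite union of cosets of the group of \<open>M\<close>-th powers for
  some \<open>M\<close>. Inside \<open>A\<close>, the elements of value at least \<open>0\<close> are those for which \<open>1 + q x^m\<close>
  is an \<open>m\<close>-th power in \<open>A\<close>, where \<open>q\<close> is an element of small positive value. The layers are
  obtained from \<open>D\<close> by comparing values of squares with fixed ones.

  The locale \<open>tame_field\<close> collects these properties without mentioning a valuation, and
  \<open>definable_bij_nonzero\<close> is the argument above. The properties pass from a field \<open>F\<close> of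
  characteristic zero to \<open>F((t))\<close>, with the same \<open>c\<close>, \<open>m\<close>, \<open>M\<close> and with \<open>r\<close> replaced by
  \<open>r + 1\<close> (\<open>tame_field_laurent\<close>), because everything there depends on order and leading
  coefficient only. For a finite extension of the p-adic field they are proved without
  extending the valuation (\<open>tame_field_lattice\<close>): the span over the p-adic integers of a
  basis is a compact lattice, and its multiples by powers of \<open>p\<close> serve as balls around \<open>0\<close>.
  In both cases one-units are \<open>m\<close>-th powers by Newton iteration in a complete filtered ring
  (\<open>one_unit_root\<close>).\<close>

section \<open>Definable predicates\<close>

lemma rename_term:
  "\<exists>t'. \<forall>v. term_val R v t' = term_val R (\<lambda>i. v (\<sigma> i)) t"
proof (induction t)
  case (Var i)
  show ?case by (rule exI[of _ "Var (\<sigma> i)"]) simp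
next
  case Zero
  show ?case by (rule exI[of _ Zero]) simp
next
  case One
  show ?case by (rule exI[of _ One]) simp
next
  case (Plus s t)
  then obtain s' t' where "\<forall>v. term_val R v s' = term_val R (\<lambda>i. v (\<sigma> i)) s"
    "\<forall>v. term_val R v t' = term_val R (\<lambda>i. v (\<sigma> i)) t" by blast
  then show ?case by (intro exI[of _ "Plus s' t'"]) simp
next
  case (Minus s t)
  then obtain s' t' where "\<forall>v. term_val R v s' = term_val R (\<lambda>i. v (\<sigma> i)) s"
    "\<forall>v. term_val R v t' = term_val R (\<lambda>i. v (\<sigma> i)) t" by blast
  then show ?case by (intro exI[of _ "Minus s' t'"]) simp
next
  case (Times s t)
  then obtain s' t' where "\<forall>v. term_val R v s' = term_val R (\<lambda>i. v (\<sigma> i)) s"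
    "\<forall>v. term_val R v t' = term_val R (\<lambda>i. v (\<sigma> i)) t" by blast
  then show ?case by (intro exI[of _ "Times s' t'"]) simp
qed

primrec term_vars :: "ring_term \<Rightarrow> nat set" where
  "term_vars (Var i) = {i}"
| "term_vars Zero = {}"
| "term_vars One = {}"
| "term_vars (Plus s t) = term_vars s \<union> term_vars t"
| "term_vars (Minus s t) = term_vars s \<union> term_vars t"
| "term_vars (Times s t) = term_vars s \<union> term_vars t"

primrec formula_vars :: "ring_formula \<Rightarrow> nat set" where
  "formula_vars (Equal s t) = term_vars s \<union> term_vars t"
| "formula_vars (Neg \<phi>) = formula_vars \<phi>"
| "formula_vars (And \<phi> \<psi>) = formula_vars \<phi> \<union> formula_vars \<psi>"
| "formula_vars (Exists i \<phi>) = insert i (formula_vars \<phi>)"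

lemma finite_term_vars: "finite (term_vars t)"
  by (induction t) auto

lemma finite_formula_vars: "finite (formula_vars \<phi>)"
  by (induction \<phi>) (auto simp: finite_term_vars)

lemma term_val_cong: "(\<And>i. i \<in> term_vars t \<Longrightarrow> v i = w i) \<Longrightarrow> term_val R v t = term_val R w t"
  by (induction t) auto

lemma satisfies_cong:
  "(\<And>i. i \<in> formula_vars \<phi> \<Longrightarrow> v i = w i) \<Longrightarrow> satisfies R v \<phi> \<longleftrightarrow> satisfies R w \<phi>"
proof (induction \<phi> arbitrary: v w)
  case (Equal s t)
  have "term_val R v s = term_val R w s" "term_val R v t = term_val R w t"
    using Equal by (auto intro!: term_val_cong)
  then show ?case by simp
next
  case (Neg \<phi>)
  have "satisfies R v \<phi> \<longleftrightarrow> satisfies R w \<phi>" by (rule Neg.IH) (use Neg.prems in auto)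
  then show ?case by simp
next
  case (And \<phi> \<psi>)
  have "satisfies R v \<phi> \<longleftrightarrow> satisfies R w \<phi>" by (rule And.IH) (use And.prems in auto)
  moreover have "satisfies R v \<psi> \<longleftrightarrow> satisfies R w \<psi>" by (rule And.IH) (use And.prems in auto)
  ultimately show ?case by simp
next
  case (Exists i \<phi>)
  have "satisfies R (v(i := a)) \<phi> \<longleftrightarrow> satisfies R (w(i := a)) \<phi>" for a
    by (rule Exists.IH) (use Exists.prems in auto)
  then show ?case by simp
qed

text \<open>A renaming of variables may identify them, so the bound variable is sent to an index
  that no variable of the body is sent to.\<close>

lemma rename_formula:
  "\<exists>\<phi>'. \<forall>v. satisfies R v \<phi>' \<longleftrightarrow> satisfies R (\<lambda>i. v (\<sigma> i)) \<phi>"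
proof (induction \<phi> arbitrary: \<sigma>)
  case (Equal s t)
  obtain s' t' where "\<forall>v. term_val R v s' = term_val R (\<lambda>i. v (\<sigma> i)) s"
    "\<forall>v. term_val R v t' = term_val R (\<lambda>i. v (\<sigma> i)) t" using rename_term by blast
  then show ?case by (intro exI[of _ "Equal s' t'"]) simp
next
  case (Neg \<phi>)
  then obtain \<phi>' where "\<forall>v. satisfies R v \<phi>' \<longleftrightarrow> satisfies R (\<lambda>i. v (\<sigma> i)) \<phi>" by blast
  then show ?case by (intro exI[of _ "Neg \<phi>'"]) simp
next
  case (And \<phi> \<psi>)
  obtain \<phi>' where "\<forall>v. satisfies R v \<phi>' \<longleftrightarrow> satisfies R (\<lambda>i. v (\<sigma> i)) \<phi>"
    using And.IH(1) by blast
  moreover obtain \<psi>' where "\<forall>v. satisfies R v \<psi>' \<longleftrightarrow> satisfies R (\<lambda>i. v (\<sigma> i)) \<psi>"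
    using And.IH(2) by blast
  ultimately show ?case by (intro exI[of _ "And \<phi>' \<psi>'"]) simp
next
  case (Exists i \<phi>)
  obtain j where j: "j \<notin> \<sigma> ` formula_vars \<phi>"
    using ex_new_if_finite[of "\<sigma> ` formula_vars \<phi>"] finite_formula_vars by auto
  obtain \<phi>' where \<phi>': "\<forall>v. satisfies R v \<phi>' \<longleftrightarrow> satisfies R (\<lambda>l. v ((\<sigma>(i := j)) l)) \<phi>"
    using Exists.IH[of "\<sigma>(i := j)"] by blast
  have "satisfies R (v(j := a)) \<phi>' \<longleftrightarrow> satisfies R ((\<lambda>l. v (\<sigma> l))(i := a)) \<phi>" for v a
  proof -
    have "satisfies R (v(j := a)) \<phi>' \<longleftrightarrow> satisfies R (\<lambda>l. (v(j := a)) ((\<sigma>(i := j)) l)) \<phi>"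
      using \<phi>' by blast
    also have "\<dots> \<longleftrightarrow> satisfies R ((\<lambda>l. v (\<sigma> l))(i := a)) \<phi>"
      by (rule satisfies_cong) (use j in auto)
    finally show ?thesis .
  qed
  then show ?case by (intro exI[of _ "Exists j \<phi>'"]) simp
qed

text \<open>Even indices carry the variables and odd indices the parameters. So neither the number
  of variables nor the number of parameters has to be known when predicates are combined.\<close>

definition interleave :: "(nat \<Rightarrow> 'a) \<Rightarrow> (nat \<Rightarrow> 'a) \<Rightarrow> nat \<Rightarrow> 'a" where
  "interleave v c i = (if even i then v (i div 2) else c (i div 2))"

lemma interleave_simps [simp]:
  "interleave v c (2 * i) = v i" "interleave v c (Suc (2 * i)) = c i"
  by (auto simp: interleave_def)

definition definable_pred :: "'a ring \<Rightarrow> ((nat \<Rightarrow> 'a) \<Rightarrow> bool) \<Rightarrow> bool" where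
  "definable_pred R P \<longleftrightarrow>
     (\<exists>\<phi> c. range c \<subseteq> carrier R \<and>
        (\<forall>v. range v \<subseteq> carrier R \<longrightarrow> (P v \<longleftrightarrow> satisfies R (interleave v c) \<phi>)))"

text \<open>Functions given by a single term, that is by a polynomial with parameters. This is
  narrower than having a definable graph, and terms can be substituted into each other.\<close>

definition definable_fun :: "'a ring \<Rightarrow> ((nat \<Rightarrow> 'a) \<Rightarrow> 'a) \<Rightarrow> bool" where
  "definable_fun R f \<longleftrightarrow>
     (\<exists>t c. range c \<subseteq> carrier R \<and>
        (\<forall>v. range v \<subseteq> carrier R \<longrightarrow> f v = term_val R (interleave v c) t))"

lemma definable_predI:
  assumes "range c \<subseteq> carrier R"
    "\<And>v. range v \<subseteq> carrier R \<Longrightarrow> P v \<longleftrightarrow> satisfies R (interleave v c) \<phi>"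
  shows "definable_pred R P"
  using assms unfolding definable_pred_def by blast

lemma definable_funI:
  assumes "range c \<subseteq> carrier R"
    "\<And>v. range v \<subseteq> carrier R \<Longrightarrow> f v = term_val R (interleave v c) t"
  shows "definable_fun R f"
  using assms unfolding definable_fun_def by blast

lemma definable_pred_cong:
  assumes "definable_pred R P" "\<And>v. range v \<subseteq> carrier R \<Longrightarrow> P v \<longleftrightarrow> Q v"
  shows "definable_pred R Q"
  using assms unfolding definable_pred_def by metis

lemma range_interleave: "range c \<subseteq> S \<Longrightarrow> range d \<subseteq> S \<Longrightarrow> range (interleave c d) \<subseteq> S"
  by (auto simp: interleave_def)

text \<open>If two sequences of parameters are interleaved to a single one, then \<open>ren_left\<close> and
  \<open>ren_right\<close> locate the variables together with the first, respectively the second,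
  sequence.\<close>

definition ren_left :: "nat \<Rightarrow> nat" where
  "ren_left i = (if even i then i else 2 * i - 1)"

definition ren_right :: "nat \<Rightarrow> nat" where
  "ren_right i = (if even i then i else 2 * i + 1)"

lemma interleave_ren_left: "interleave v (interleave c d) (ren_left i) = interleave v c i"
proof (cases "even i")
  case True
  then show ?thesis by (simp add: ren_left_def interleave_def)
next
  case False
  then obtain j where j: "i = Suc (2 * j)" by (metis oddE Suc_eq_plus1)
  have "ren_left i = Suc (2 * (2 * j))" unfolding j ren_left_def by simp
  then show ?thesis by (simp only: j interleave_simps)
qed

lemma interleave_ren_right: "interleave v (interleave c d) (ren_right i) = interleave v d i"
proof (cases "even i")
  case True
  then show ?thesis by (simp add: ren_right_def interleave_def)
next
  case False
  then obtain j where j: "i = Suc (2 * j)" by (metis oddE Suc_eq_plus1)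
  have "ren_right i = Suc (2 * Suc (2 * j))" unfolding j ren_right_def by simp
  then show ?thesis by (simp only: j interleave_simps)
qed

text \<open>Two formulas can only be joined by a connective if they have the same parameters, so
  both are rewritten over the interleaving of their parameter sequences.\<close>

lemma definable_pred_merge:
  assumes "definable_pred R P" "definable_pred R Q"
  obtains \<phi> \<psi> c where "range c \<subseteq> carrier R"
    "\<And>v. range v \<subseteq> carrier R \<Longrightarrow> P v \<longleftrightarrow> satisfies R (interleave v c) \<phi>"
    "\<And>v. range v \<subseteq> carrier R \<Longrightarrow> Q v \<longleftrightarrow> satisfies R (interleave v c) \<psi>"
proof -
  obtain \<phi> c where c: "range c \<subseteq> carrier R"
    "\<And>v. range v \<subseteq> carrier R \<Longrightarrow> P v \<longleftrightarrow> satisfies R (interleave v c) \<phi>"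
    using assms(1) unfolding definable_pred_def by blast
  obtain \<psi> d where d: "range d \<subseteq> carrier R"
    "\<And>v. range v \<subseteq> carrier R \<Longrightarrow> Q v \<longleftrightarrow> satisfies R (interleave v d) \<psi>"
    using assms(2) unfolding definable_pred_def by blast
  obtain \<phi>' where \<phi>': "\<And>w. satisfies R w \<phi>' \<longleftrightarrow> satisfies R (\<lambda>i. w (ren_left i)) \<phi>"
    using rename_formula by blast
  obtain \<psi>' where \<psi>': "\<And>w. satisfies R w \<psi>' \<longleftrightarrow> satisfies R (\<lambda>i. w (ren_right i)) \<psi>"
    using rename_formula by blast
  show ?thesis
  proof (rule that[of "interleave c d" \<phi>' \<psi>'])
    show "range (interleave c d) \<subseteq> carrier R" by (rule range_interleave[OF c(1) d(1)])
  qed (simp_all only: \<phi>' \<psi>' interleave_ren_left interleave_ren_right c(2) d(2) refl)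
qed

lemma definable_fun_merge:
  assumes "definable_fun R f" "definable_fun R g"
  obtains s t c where "range c \<subseteq> carrier R"
    "\<And>v. range v \<subseteq> carrier R \<Longrightarrow> f v = term_val R (interleave v c) s"
    "\<And>v. range v \<subseteq> carrier R \<Longrightarrow> g v = term_val R (interleave v c) t"
proof -
  obtain s c where c: "range c \<subseteq> carrier R"
    "\<And>v. range v \<subseteq> carrier R \<Longrightarrow> f v = term_val R (interleave v c) s"
    using assms(1) unfolding definable_fun_def by blast
  obtain t d where d: "range d \<subseteq> carrier R"
    "\<And>v. range v \<subseteq> carrier R \<Longrightarrow> g v = term_val R (interleave v d) t"
    using assms(2) unfolding definable_fun_def by blast
  obtain s' where s': "\<And>w. term_val R w s' = term_val R (\<lambda>i. w (ren_left i)) s"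
    using rename_term by blast
  obtain t' where t': "\<And>w. term_val R w t' = term_val R (\<lambda>i. w (ren_right i)) t"
    using rename_term by blast
  show ?thesis
  proof (rule that[of "interleave c d" s' t'])
    show "range (interleave c d) \<subseteq> carrier R" by (rule range_interleave[OF c(1) d(1)])
  qed (simp_all only: s' t' interleave_ren_left interleave_ren_right c(2) d(2) refl)
qed

lemma definable_pred_not: "definable_pred R P \<Longrightarrow> definable_pred R (\<lambda>v. \<not> P v)"
  unfolding definable_pred_def by (metis satisfies.simps(2))

lemma definable_pred_conj:
  assumes "definable_pred R P" "definable_pred R Q"
  shows "definable_pred R (\<lambda>v. P v \<and> Q v)"
proof -
  obtain \<phi> \<psi> c where c: "range c \<subseteq> carrier R"
    "\<And>v. range v \<subseteq> carrier R \<Longrightarrow> P v \<longleftrightarrow> satisfies R (interleave v c) \<phi>"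
    "\<And>v. range v \<subseteq> carrier R \<Longrightarrow> Q v \<longleftrightarrow> satisfies R (interleave v c) \<psi>"
    by (rule definable_pred_merge[OF assms], rule that)
  then show ?thesis by (intro definable_predI[of c R _ "And \<phi> \<psi>"]) (simp_all only: satisfies.simps)
qed

lemma definable_pred_disj:
  assumes "definable_pred R P" "definable_pred R Q"
  shows "definable_pred R (\<lambda>v. P v \<or> Q v)"
proof -
  have "definable_pred R (\<lambda>v. \<not> (\<not> P v \<and> \<not> Q v))"
    by (intro definable_pred_not definable_pred_conj assms)
  then show ?thesis by simp
qed

lemma definable_pred_eq:
  assumes "definable_fun R f" "definable_fun R g"
  shows "definable_pred R (\<lambda>v. f v = g v)"
proof -
  obtain s t c where c: "range c \<subseteq> carrier R"
    "\<And>v. range v \<subseteq> carrier R \<Longrightarrow> f v = term_val R (interleave v c) s"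
    "\<And>v. range v \<subseteq> carrier R \<Longrightarrow> g v = term_val R (interleave v c) t"
    by (rule definable_fun_merge[OF assms], rule that)
  then show ?thesis by (intro definable_predI[of c R _ "Equal s t"]) (simp_all only: satisfies.simps)
qed

lemma definable_fun_var: "carrier R \<noteq> {} \<Longrightarrow> definable_fun R (\<lambda>v. v i)"
  by (rule definable_funI[of "\<lambda>_. SOME a. a \<in> carrier R" R _ "Var (2 * i)"]) (auto simp: some_in_eq)

lemma definable_fun_const: "a \<in> carrier R \<Longrightarrow> definable_fun R (\<lambda>v. a)"
  by (rule definable_funI[of "\<lambda>_. a" R _ "Var 1"]) (auto simp: interleave_def)

lemma definable_fun_add:
  assumes "definable_fun R f" "definable_fun R g"
  shows "definable_fun R (\<lambda>v. f v \<oplus>\<^bsub>R\<^esub> g v)"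
proof -
  obtain s t c where c: "range c \<subseteq> carrier R"
    "\<And>v. range v \<subseteq> carrier R \<Longrightarrow> f v = term_val R (interleave v c) s"
    "\<And>v. range v \<subseteq> carrier R \<Longrightarrow> g v = term_val R (interleave v c) t"
    by (rule definable_fun_merge[OF assms], rule that)
  then show ?thesis by (intro definable_funI[of c R _ "Plus s t"]) (simp_all only: term_val.simps)
qed

lemma definable_fun_mult:
  assumes "definable_fun R f" "definable_fun R g"
  shows "definable_fun R (\<lambda>v. f v \<otimes>\<^bsub>R\<^esub> g v)"
proof -
  obtain s t c where c: "range c \<subseteq> carrier R"
    "\<And>v. range v \<subseteq> carrier R \<Longrightarrow> f v = term_val R (interleave v c) s"
    "\<And>v. range v \<subseteq> carrier R \<Longrightarrow> g v = term_val R (interleave v c) t"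
    by (rule definable_fun_merge[OF assms], rule that)
  then show ?thesis by (intro definable_funI[of c R _ "Times s t"]) (simp_all only: term_val.simps)
qed

lemma definable_fun_pow:
  assumes "monoid R" "definable_fun R f"
  shows "definable_fun R (\<lambda>v. f v [^]\<^bsub>R\<^esub> (n::nat))"
proof (induction n)
  case 0
  have "definable_fun R (\<lambda>v. \<one>\<^bsub>R\<^esub>)" using assms(1) by (intro definable_fun_const monoid.one_closed)
  then show ?case using monoid.nat_pow_0[OF assms(1)] by simp
next
  case (Suc n)
  then have "definable_fun R (\<lambda>v. f v [^]\<^bsub>R\<^esub> n \<otimes>\<^bsub>R\<^esub> f v)" by (intro definable_fun_mult assms)
  then show ?case using monoid.nat_pow_Suc[OF assms(1)] by simp
qed

lemma definable_pred_True: "carrier R \<noteq> {} \<Longrightarrow> definable_pred R (\<lambda>v. True)"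
  using definable_pred_eq[OF definable_fun_var definable_fun_var, of R 0 0] by simp

lemma definable_pred_False: "carrier R \<noteq> {} \<Longrightarrow> definable_pred R (\<lambda>v. False)"
  using definable_pred_not[OF definable_pred_True, of R] by simp

lemma definable_pred_finite_ex:
  assumes "finite I" "carrier R \<noteq> {}" "\<And>i. i \<in> I \<Longrightarrow> definable_pred R (P i)"
  shows "definable_pred R (\<lambda>v. \<exists>i\<in>I. P i v)"
  using assms
proof (induction I)
  case empty
  then show ?case by (simp add: definable_pred_False)
next
  case (insert i I)
  then have "definable_pred R (\<lambda>v. P i v \<or> (\<exists>i\<in>I. P i v))"
    by (intro definable_pred_disj) auto
  then show ?case by simp
qed

lemma definable_pred_rename:
  assumes "definable_pred R P"
  shows "definable_pred R (\<lambda>v. P (\<lambda>i. v (\<sigma> i)))"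
proof -
  obtain \<phi> c where c: "range c \<subseteq> carrier R"
    "\<And>v. range v \<subseteq> carrier R \<Longrightarrow> P v \<longleftrightarrow> satisfies R (interleave v c) \<phi>"
    using assms(1) unfolding definable_pred_def by blast
  obtain \<phi>' where \<phi>': "\<And>w. satisfies R w \<phi>' \<longleftrightarrow>
      satisfies R (\<lambda>i. w (if even i then 2 * \<sigma> (i div 2) else i)) \<phi>"
    using rename_formula[of R "(\<lambda>i. if even i then 2 * \<sigma> (i div 2) else i)" \<phi>] by blast
  have *: "(\<lambda>i. interleave v c (if even i then 2 * \<sigma> (i div 2) else i)) = interleave (\<lambda>i. v (\<sigma> i)) c" for v
    by (rule ext) (auto simp: interleave_def)
  have "P (\<lambda>i. v (\<sigma> i)) \<longleftrightarrow> satisfies R (interleave v c) \<phi>'" if "range v \<subseteq> carrier R" for v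
    unfolding \<phi>' * by (rule c(2)) (use that in auto)
  then show ?thesis unfolding definable_pred_def using c(1) by blast
qed

lemma definable_fun_rename:
  assumes "definable_fun R f"
  shows "definable_fun R (\<lambda>v. f (\<lambda>i. v (\<sigma> i)))"
proof -
  obtain t c where c: "range c \<subseteq> carrier R"
    "\<And>v. range v \<subseteq> carrier R \<Longrightarrow> f v = term_val R (interleave v c) t"
    using assms(1) unfolding definable_fun_def by blast
  obtain t' where t': "\<And>w. term_val R w t' =
      term_val R (\<lambda>i. w (if even i then 2 * \<sigma> (i div 2) else i)) t"
    using rename_term[of R "(\<lambda>i. if even i then 2 * \<sigma> (i div 2) else i)" t] by blast
  have *: "(\<lambda>i. interleave v c (if even i then 2 * \<sigma> (i div 2) else i)) = interleave (\<lambda>i. v (\<sigma> i)) c" for v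
    by (rule ext) (auto simp: interleave_def)
  have "f (\<lambda>i. v (\<sigma> i)) = term_val R (interleave v c) t'" if "range v \<subseteq> carrier R" for v
    unfolding t' * by (rule c(2)) (use that in auto)
  then show ?thesis unfolding definable_fun_def using c(1) by blast
qed

text \<open>The quantified element becomes coordinate \<open>0\<close> and the other ones move up by one, as
  with de Bruijn indices; so no name has to be chosen when quantifiers are nested.\<close>

lemma definable_pred_ex:
  assumes "definable_pred R P"
  shows "definable_pred R (\<lambda>v. \<exists>a\<in>carrier R. P (case_nat a v))"
proof -
  obtain \<phi> c where c: "range c \<subseteq> carrier R"
    "\<And>v. range v \<subseteq> carrier R \<Longrightarrow> P v \<longleftrightarrow> satisfies R (interleave v c) \<phi>"
    using assms(1) unfolding definable_pred_def by blast
  have *: "(interleave v c)(0 := a) = interleave (v(0 := a)) c" for v a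
    by (rule ext) (auto simp: interleave_def elim: evenE)
  have "definable_pred R (\<lambda>v. \<exists>a\<in>carrier R. P (v(0 := a)))"
    unfolding definable_pred_def
  proof (intro exI[of _ "Exists 0 \<phi>"] exI[of _ c] conjI allI impI)
    fix v :: "nat \<Rightarrow> 'a"
    assume v: "range v \<subseteq> carrier R"
    have "P (v(0 := a)) \<longleftrightarrow> satisfies R (interleave (v(0 := a)) c) \<phi>" if "a \<in> carrier R" for a
      by (rule c(2)) (use v that in auto)
    then show "(\<exists>a\<in>carrier R. P (v(0 := a))) \<longleftrightarrow> satisfies R (interleave v c) (Exists 0 \<phi>)"
      by (simp add: *)
  qed (fact c)
  from definable_pred_rename[OF this, of "\<lambda>i. i - 1"]
  have "definable_pred R (\<lambda>v. \<exists>a\<in>carrier R. P ((\<lambda>i. v (i - 1))(0 := a)))" .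
  moreover have "(\<lambda>i. v (i - 1))(0 := a) = case_nat a v" for v :: "nat \<Rightarrow> 'a" and a
    by (rule ext) (auto split: nat.split)
  ultimately show ?thesis by simp
qed

text \<open>Substitution of a term is expressed by the quantified statement
  \<open>\<exists>a. a = f v \<and> a \<in> S\<close>.\<close>

lemma definable_pred_subst:
  assumes "definable_pred R (\<lambda>v. v 0 \<in> S)" "definable_fun R f"
    and "\<And>v. range v \<subseteq> carrier R \<Longrightarrow> f v \<in> carrier R" "carrier R \<noteq> {}"
  shows "definable_pred R (\<lambda>v. f v \<in> S)"
proof -
  have "definable_pred R (\<lambda>v. v 0 = f (\<lambda>i. v (Suc i)) \<and> v 0 \<in> S)"
    by (rule definable_pred_conj[OF definable_pred_eq[OF definable_fun_var[OF assms(4)]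
          definable_fun_rename[OF assms(2), of Suc]] assms(1)])
  from definable_pred_ex[OF this]
  have "definable_pred R (\<lambda>v. \<exists>a\<in>carrier R. a = f v \<and> a \<in> S)"
    by (simp only: nat.case)
  then show ?thesis by (rule definable_pred_cong) (use assms(3) in auto)
qed

text \<open>Closure properties are proved for predicates on sequences; this carries them over to
  definable sets of tuples.\<close>

lemma definable_iff_pred:
  assumes "carrier R \<noteq> {}"
  shows "definable R m X \<longleftrightarrow> X \<subseteq> tuples R m \<and> definable_pred R (\<lambda>v. map v [0..<m] \<in> X)"
proof
  assume "definable R m X"
  then obtain \<phi> c where c: "\<forall>i. c i \<in> carrier R" and
    X: "X = {xs \<in> tuples R m. satisfies R (\<lambda>i. if i < m then xs ! i else c i) \<phi>}"
    unfolding definable_def by blast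
  obtain \<phi>' where \<phi>': "\<And>w. satisfies R w \<phi>' \<longleftrightarrow>
      satisfies R (\<lambda>i. w (if i < m then 2 * i else Suc (2 * i))) \<phi>"
    using rename_formula[of R "\<lambda>i. if i < m then 2 * i else Suc (2 * i)" \<phi>] by blast
  have "map v [0..<m] \<in> X \<longleftrightarrow> satisfies R (interleave v c) \<phi>'" if "range v \<subseteq> carrier R" for v
  proof -
    have eq: "(\<lambda>i. interleave v c (if i < m then 2 * i else Suc (2 * i))) =
          (\<lambda>i. if i < m then map v [0..<m] ! i else c i)"
      by (rule ext) auto
    have "map v [0..<m] \<in> tuples R m" using that by (auto simp: tuples_def)
    then show ?thesis unfolding \<phi>' eq X by simp
  qed
  then show "X \<subseteq> tuples R m \<and> definable_pred R (\<lambda>v. map v [0..<m] \<in> X)"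
    unfolding definable_pred_def using X c by blast
next
  assume *: "X \<subseteq> tuples R m \<and> definable_pred R (\<lambda>v. map v [0..<m] \<in> X)"
  then obtain \<phi> c where c: "range c \<subseteq> carrier R"
    "\<And>v. range v \<subseteq> carrier R \<Longrightarrow> map v [0..<m] \<in> X \<longleftrightarrow> satisfies R (interleave v c) \<phi>"
    unfolding definable_pred_def by blast
  \<comment> \<open>Membership of \<open>map v [0..<m]\<close> does not depend on the coordinates of \<open>v\<close> from \<open>m\<close> on;
    all of them are sent to index \<open>m\<close>, where the first parameter is.\<close>
  let ?\<sigma> = "\<lambda>i. if even i then (if i div 2 < m then i div 2 else m) else m + i div 2"
  obtain \<phi>' where \<phi>': "\<And>w. satisfies R w \<phi>' \<longleftrightarrow> satisfies R (\<lambda>i. w (?\<sigma> i)) \<phi>"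
    using rename_formula[of R ?\<sigma> \<phi>] by blast
  have "xs \<in> X \<longleftrightarrow> satisfies R (\<lambda>i. if i < m then xs ! i else c (i - m)) \<phi>'"
    if xs: "xs \<in> tuples R m" for xs
  proof -
    let ?v = "\<lambda>i. if i < m then xs ! i else c 0"
    have eq: "(\<lambda>i. (\<lambda>i. if i < m then xs ! i else c (i - m)) (?\<sigma> i)) = interleave ?v c"
      by (rule ext) (auto simp: interleave_def)
    have xs': "map ?v [0..<m] = xs"
      using xs by (auto simp: tuples_def intro: nth_equalityI)
    have "range ?v \<subseteq> carrier R" using xs c(1) by (auto simp: tuples_def)
    from c(2)[OF this] show ?thesis unfolding \<phi>' eq xs' by simp
  qed
  then have "X = {xs \<in> tuples R m. satisfies R (\<lambda>i. if i < m then xs ! i else c (i - m)) \<phi>'}"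
    using * by blast
  then show "definable R m X"
    unfolding definable_def using c(1) by (intro exI[of _ \<phi>'] exI[of _ "\<lambda>i. c (i - m)"]) auto
qed

section \<open>Definable equivalence of labelled sets\<close>

definition definable_subset :: "'a ring \<Rightarrow> 'a set \<Rightarrow> bool" where
  "definable_subset R S \<longleftrightarrow> S \<subseteq> carrier R \<and> definable_pred R (\<lambda>v. v 0 \<in> S)"

text \<open>The bijections below are glued from translations, multiplications by constants and
  powers, all of which are polynomial maps.\<close>

definition definable_map :: "'a ring \<Rightarrow> ('a \<Rightarrow> 'a) \<Rightarrow> bool" where
  "definable_map R f \<longleftrightarrow> f \<in> carrier R \<rightarrow> carrier R \<and> definable_fun R (\<lambda>v. f (v 0))"

text \<open>Disjoint unions of several copies of a set of field elements are realised by labels in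
  \<open>nat\<close>. The bijection is given by its graph, so that converse and composition of relations
  can be used. As only finitely many labels occur, it is enough to ask for definability for
  each pair of labels.\<close>

definition definably_equivalent :: "'a ring \<Rightarrow> ('a \<times> nat) set \<Rightarrow> ('a \<times> nat) set \<Rightarrow> bool" where
  "definably_equivalent R X Y \<longleftrightarrow>
     (\<exists>G. Domain G = X \<and> Range G = Y \<and> single_valued G \<and> single_valued (G\<inverse>) \<and>
        X \<subseteq> carrier R \<times> UNIV \<and> Y \<subseteq> carrier R \<times> UNIV \<and> finite (snd ` X) \<and> finite (snd ` Y) \<and>
        (\<forall>i j. definable_pred R (\<lambda>v. ((v 0, i), (v 1, j)) \<in> G)))"

text \<open>Definability refers to records without additional fields; this locale restricts \<open>ring\<close>
  to them.\<close>

locale plain_ring = ring R for R :: "'a ring" (structure)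
begin

lemma carrier_nonempty: "carrier R \<noteq> {}"
  using zero_closed by blast

lemma definable_fun_var': "definable_fun R (\<lambda>v. v i)"
  by (rule definable_fun_var[OF carrier_nonempty])

lemma definable_fun_map:
  assumes "definable_map R f" shows "definable_fun R (\<lambda>v. f (v i))"
  using definable_fun_rename[of R "\<lambda>v. f (v 0)" "\<lambda>_. i"] assms by (simp add: definable_map_def)

lemma definable_subset_closed: "definable_subset R S \<Longrightarrow> x \<in> S \<Longrightarrow> x \<in> carrier R"
  by (auto simp: definable_subset_def)

lemma definable_subset_carrier: "definable_subset R (carrier R)"
proof -
  have "definable_pred R (\<lambda>v. v 0 \<in> carrier R)"
    by (rule definable_pred_cong[OF definable_pred_True[OF carrier_nonempty]]) auto
  then show ?thesis by (simp add: definable_subset_def)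
qed

lemma definable_subset_empty: "definable_subset R {}"
  using definable_pred_False[OF carrier_nonempty] by (simp add: definable_subset_def)

lemma definable_subset_Un:
  assumes "definable_subset R S" "definable_subset R T" shows "definable_subset R (S \<union> T)"
proof -
  have "definable_pred R (\<lambda>v. v 0 \<in> S \<or> v 0 \<in> T)"
    using assms by (intro definable_pred_disj) (simp_all add: definable_subset_def)
  then show ?thesis using assms by (simp add: definable_subset_def)
qed

lemma definable_subset_Diff:
  assumes "definable_subset R S" "definable_subset R T" shows "definable_subset R (S - T)"
proof -
  have "definable_pred R (\<lambda>v. v 0 \<in> S \<and> \<not> v 0 \<in> T)"
    using assms by (intro definable_pred_conj definable_pred_not) (simp_all add: definable_subset_def)
  then show ?thesis using assms by (auto simp: definable_subset_def)
qed

lemma definable_subset_UN: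
  assumes "finite I" "\<And>i. i \<in> I \<Longrightarrow> definable_subset R (S i)"
  shows "definable_subset R (\<Union>i\<in>I. S i)"
  using assms by (induction I) (simp_all add: definable_subset_empty definable_subset_Un)

lemma definable_subset_preimage:
  assumes "definable_subset R S" "definable_subset R T" "definable_map R f"
  shows "definable_subset R {x \<in> S. f x \<in> T}"
proof -
  have "definable_pred R (\<lambda>v. f (v 0) \<in> T)"
    by (rule definable_pred_subst) (use assms carrier_nonempty in \<open>auto simp: definable_subset_def definable_map_def\<close>)
  then have "definable_pred R (\<lambda>v. v 0 \<in> S \<and> f (v 0) \<in> T)"
    using assms(1) by (intro definable_pred_conj) (simp_all add: definable_subset_def)
  then show ?thesis using assms(1) by (auto simp: definable_subset_def)
qed

lemma definable_subset_image:
  assumes "definable_subset R S" "definable_map R f"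
  shows "definable_subset R (f ` S)"
proof -
  have "definable_pred R (\<lambda>v. v 0 \<in> S \<and> v 1 = f (v 0))"
    by (rule definable_pred_conj[OF _ definable_pred_eq[OF definable_fun_var' definable_fun_map]])
      (use assms in \<open>simp_all add: definable_subset_def\<close>)
  from definable_pred_ex[OF this]
  have "definable_pred R (\<lambda>v. \<exists>a\<in>carrier R. a \<in> S \<and> v 0 = f a)" by simp
  then have "definable_pred R (\<lambda>v. v 0 \<in> f ` S)"
    by (rule definable_pred_cong) (use assms in \<open>auto simp: definable_subset_def\<close>)
  then show ?thesis using assms by (auto simp: definable_subset_def definable_map_def)
qed

lemma definable_subset_singleton:
  assumes "a \<in> carrier R" shows "definable_subset R {a}"
  using definable_pred_eq[OF definable_fun_var'[of 0] definable_fun_const[OF assms]] assms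
  by (simp add: definable_subset_def)

lemma definable_map_id: "definable_map R (\<lambda>x. x)"
  using definable_fun_var' by (simp add: definable_map_def)

lemma definable_map_const: "a \<in> carrier R \<Longrightarrow> definable_map R (\<lambda>x. a)"
  using definable_fun_const by (simp add: definable_map_def)

lemma definable_map_add:
  "definable_map R f \<Longrightarrow> definable_map R g \<Longrightarrow> definable_map R (\<lambda>x. f x \<oplus> g x)"
  using definable_fun_add by (auto simp: definable_map_def)

lemma definable_map_mult:
  "definable_map R f \<Longrightarrow> definable_map R g \<Longrightarrow> definable_map R (\<lambda>x. f x \<otimes> g x)"
  using definable_fun_mult by (auto simp: definable_map_def)

lemma definable_map_pow:
  "definable_map R f \<Longrightarrow> definable_map R (\<lambda>x. f x [^] (n::nat))"
  using definable_fun_pow[OF monoid_axioms] by (auto simp: definable_map_def)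

lemmas definable_map_intros = definable_map_id definable_map_const definable_map_add
  definable_map_mult definable_map_pow

lemma definably_equivalent_sym:
  assumes "definably_equivalent R X Y" shows "definably_equivalent R Y X"
proof -
  obtain G where G: "Domain G = X" "Range G = Y" "single_valued G" "single_valued (G\<inverse>)"
    "X \<subseteq> carrier R \<times> UNIV" "Y \<subseteq> carrier R \<times> UNIV" "finite (snd ` X)" "finite (snd ` Y)"
    and def: "\<And>i j. definable_pred R (\<lambda>v. ((v 0, i), (v 1, j)) \<in> G)"
    using assms unfolding definably_equivalent_def by blast
  have "definable_pred R (\<lambda>v. ((v 0, i), (v 1, j)) \<in> G\<inverse>)" for i j
    using definable_pred_rename[OF def[of j i], of "\<lambda>i. 1 - i"] by simp
  then show ?thesis unfolding definably_equivalent_def using G by (intro exI[of _ "G\<inverse>"]) simp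
qed

text \<open>For given labels of the end points, the composite graph is defined by quantifying over
  the element in the middle and over the finitely many labels that it can have.\<close>

lemma definably_equivalent_trans:
  assumes "definably_equivalent R X Y" "definably_equivalent R Y Z"
  shows "definably_equivalent R X Z"
proof -
  obtain G where G: "Domain G = X" "Range G = Y" "single_valued G" "single_valued (G\<inverse>)"
    "X \<subseteq> carrier R \<times> UNIV" "Y \<subseteq> carrier R \<times> UNIV" "finite (snd ` X)" "finite (snd ` Y)"
    and Gdef: "\<And>i j. definable_pred R (\<lambda>v. ((v 0, i), (v 1, j)) \<in> G)"
    using assms(1) unfolding definably_equivalent_def by blast
  obtain H where H: "Domain H = Y" "Range H = Z" "single_valued H" "single_valued (H\<inverse>)"
    "Z \<subseteq> carrier R \<times> UNIV" "finite (snd ` Z)"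
    and Hdef: "\<And>i j. definable_pred R (\<lambda>v. ((v 0, i), (v 1, j)) \<in> H)"
    using assms(2) unfolding definably_equivalent_def by blast
  have "Domain (G O H) = X" "Range (G O H) = Z" using G H by blast+
  moreover have "single_valued (G O H)" "single_valued ((G O H)\<inverse>)"
    using G H by (simp_all add: single_valued_relcomp converse_relcomp)
  moreover have "definable_pred R (\<lambda>v. ((v 0, i), (v 1, k)) \<in> G O H)" for i k
  proof -
    \<comment> \<open>coordinate \<open>0\<close> is the middle element, to be bound by the quantifier; the end points
      are in coordinates \<open>1\<close> and \<open>2\<close>\<close>
    have "definable_pred R (\<lambda>v. ((v 1, i), (v 0, j)) \<in> G \<and> ((v 0, j), (v 2, k)) \<in> H)" for j
      using definable_pred_rename[OF Gdef[of i j], of "\<lambda>i. 1 - i"]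
        definable_pred_rename[OF Hdef[of j k], of "\<lambda>i. 2 * i"]
      by (intro definable_pred_conj) simp_all
    note definable_pred_ex[OF this]
    then have *: "definable_pred R (\<lambda>v. \<exists>y\<in>carrier R. ((v 0, i), (y, j)) \<in> G \<and> ((y, j), (v 1, k)) \<in> H)" for j
      by (simp add: numeral_2_eq_2)
    have "definable_pred R (\<lambda>v. \<exists>j\<in>snd ` Y. \<exists>y\<in>carrier R. ((v 0, i), (y, j)) \<in> G \<and> ((y, j), (v 1, k)) \<in> H)"
      by (rule definable_pred_finite_ex[OF \<open>finite (snd ` Y)\<close> carrier_nonempty *])
    moreover have "(\<exists>j\<in>snd ` Y. \<exists>y\<in>carrier R. ((v 0, i), (y, j)) \<in> G \<and> ((y, j), (v 1, k)) \<in> H)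
        \<longleftrightarrow> ((v 0, i), (v 1, k)) \<in> G O H" for v :: "nat \<Rightarrow> 'a"
    proof
      assume "((v 0, i), (v 1, k)) \<in> G O H"
      then obtain y j where yj: "((v 0, i), (y, j)) \<in> G" "((y, j), (v 1, k)) \<in> H" by auto
      then have "(y, j) \<in> Y" using G(2) by blast
      then have "j \<in> snd ` Y" "y \<in> carrier R" using G(6) by force+
      then show "\<exists>j\<in>snd ` Y. \<exists>y\<in>carrier R. ((v 0, i), (y, j)) \<in> G \<and> ((y, j), (v 1, k)) \<in> H"
        using yj by blast
    qed auto
    ultimately show ?thesis by simp
  qed
  ultimately show ?thesis unfolding definably_equivalent_def
    using G H by (intro exI[of _ "G O H"]) simp
qed

lemma definably_equivalent_Un:
  assumes "definably_equivalent R X Y" "definably_equivalent R X' Y'" "X \<inter> X' = {}" "Y \<inter> Y' = {}"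
  shows "definably_equivalent R (X \<union> X') (Y \<union> Y')"
proof -
  obtain G where G: "Domain G = X" "Range G = Y" "single_valued G" "single_valued (G\<inverse>)"
    "X \<subseteq> carrier R \<times> UNIV" "Y \<subseteq> carrier R \<times> UNIV" "finite (snd ` X)" "finite (snd ` Y)"
    and Gdef: "\<And>i j. definable_pred R (\<lambda>v. ((v 0, i), (v 1, j)) \<in> G)"
    using assms(1) unfolding definably_equivalent_def by blast
  obtain H where H: "Domain H = X'" "Range H = Y'" "single_valued H" "single_valued (H\<inverse>)"
    "X' \<subseteq> carrier R \<times> UNIV" "Y' \<subseteq> carrier R \<times> UNIV" "finite (snd ` X')" "finite (snd ` Y')"
    and Hdef: "\<And>i j. definable_pred R (\<lambda>v. ((v 0, i), (v 1, j)) \<in> H)"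
    using assms(2) unfolding definably_equivalent_def by blast
  have "Domain (G \<union> H) = X \<union> X'" "Range (G \<union> H) = Y \<union> Y'" using G H by auto
  moreover have "single_valued (G \<union> H)"
    using G(1,3) H(1,3) assms(3) unfolding single_valued_def by blast
  moreover have "single_valued ((G \<union> H)\<inverse>)"
    using G(2,4) H(2,4) assms(4) unfolding single_valued_def by blast
  moreover have "definable_pred R (\<lambda>v. ((v 0, i), (v 1, j)) \<in> G \<union> H)" for i j
    using definable_pred_disj[OF Gdef[of i j] Hdef[of i j]] by simp
  ultimately show ?thesis unfolding definably_equivalent_def
    using G H by (intro exI[of _ "G \<union> H"]) (simp add: image_Un)
qed

lemma definably_equivalent_empty: "definably_equivalent R {} {}"
  unfolding definably_equivalent_def
  by (intro exI[of _ "{}"]) (simp add: definable_pred_False[OF carrier_nonempty])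

lemma definably_equivalent_UN:
  assumes "finite I" "\<And>i. i \<in> I \<Longrightarrow> definably_equivalent R (X i) (Y i)"
    "\<And>i j. i \<in> I \<Longrightarrow> j \<in> I \<Longrightarrow> i \<noteq> j \<Longrightarrow> X i \<inter> X j = {}"
    "\<And>i j. i \<in> I \<Longrightarrow> j \<in> I \<Longrightarrow> i \<noteq> j \<Longrightarrow> Y i \<inter> Y j = {}"
  shows "definably_equivalent R (\<Union>i\<in>I. X i) (\<Union>i\<in>I. Y i)"
  using assms
proof (induction I)
  case empty
  then show ?case by (simp add: definably_equivalent_empty)
next
  case (insert i I)
  have "definably_equivalent R (X i \<union> (\<Union>i\<in>I. X i)) (Y i \<union> (\<Union>i\<in>I. Y i))"
  proof (rule definably_equivalent_Un)
    show "definably_equivalent R (\<Union>i\<in>I. X i) (\<Union>i\<in>I. Y i)"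
      by (rule insert.IH) (use insert.prems in blast)+
    show "definably_equivalent R (X i) (Y i)" by (rule insert.prems) simp
    have "X i \<inter> X j = {}" if "j \<in> I" for j
      by (rule insert.prems(2)) (use that insert.hyps in auto)
    then show "X i \<inter> (\<Union>i\<in>I. X i) = {}" by blast
    have "Y i \<inter> Y j = {}" if "j \<in> I" for j
      by (rule insert.prems(3)) (use that insert.hyps in auto)
    then show "Y i \<inter> (\<Union>i\<in>I. Y i) = {}" by blast
  qed
  then show ?case by simp
qed

lemma definably_equivalent_image:
  assumes "definable_subset R S" "definable_map R f" "inj_on f S"
  shows "definably_equivalent R (S \<times> {i}) (f ` S \<times> {j})"
proof -
  let ?G = "{((x, i), (f x, j)) |x. x \<in> S}"
  have "definable_pred R (\<lambda>v. v 0 \<in> S \<and> v 1 = f (v 0))"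
    by (rule definable_pred_conj[OF _ definable_pred_eq[OF definable_fun_var' definable_fun_map]])
      (use assms in \<open>simp_all add: definable_subset_def\<close>)
  then have "definable_pred R (\<lambda>v. ((v 0, i'), (v 1, j')) \<in> ?G)" for i' j'
    by (cases "i' = i \<and> j' = j") (auto simp: definable_pred_False[OF carrier_nonempty] conj_commute)
  moreover have "Domain ?G = S \<times> {i}" "Range ?G = f ` S \<times> {j}" by auto
  moreover have "single_valued ?G" by (auto simp: single_valued_def)
  moreover have "single_valued (?G\<inverse>)"
    using assms(3) by (auto simp: single_valued_def inj_on_def)
  moreover have "finite (snd ` (S \<times> {i}))" "finite (snd ` (f ` S \<times> {j}))"
    by (auto intro: finite_subset[of _ "{i}"] finite_subset[of _ "{j}"])
  moreover have "S \<times> {i} \<subseteq> carrier R \<times> UNIV" "f ` S \<times> {j} \<subseteq> carrier R \<times> UNIV"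
    using assms by (auto simp: definable_subset_def definable_map_def)
  ultimately show ?thesis unfolding definably_equivalent_def by (intro exI[of _ ?G]) simp
qed

lemma definably_equivalent_relabel:
  assumes "definable_subset R S"
  shows "definably_equivalent R (S \<times> {i}) (S \<times> {j})"
  using definably_equivalent_image[OF assms definable_map_id] by simp

lemma definable_singletons:
  assumes "definable_subset R S" shows "definable R 1 {[x] |x. x \<in> S}"
proof -
  have "definable_pred R (\<lambda>v. map v [0..<1] \<in> {[x] |x. x \<in> S})"
    using assms by (simp add: definable_subset_def)
  moreover have "{[x] |x. x \<in> S} \<subseteq> tuples R 1" using assms by (auto simp: definable_subset_def tuples_def)
  ultimately show ?thesis by (simp add: definable_iff_pred[OF carrier_nonempty])
qed

lemma definably_equivalentE:
  assumes "definably_equivalent R X Y"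
  obtains G where "Domain G = X" "Range G = Y" "single_valued G" "single_valued (G\<inverse>)"
    "\<And>i j. definable_pred R (\<lambda>v. ((v 0, i), (v 1, j)) \<in> G)"
  using assms unfolding definably_equivalent_def by blast

lemma definably_equivalent_imp_bij:
  assumes "definably_equivalent R (S \<times> {0}) (T \<times> {0})" "definable_subset R S" "definable_subset R T"
  shows "\<exists>f. definable_bij R f {[x] |x. x \<in> S} {[x] |x. x \<in> T}"
proof -
  obtain G :: "(('a \<times> nat) \<times> ('a \<times> nat)) set" where G: "Domain G = S \<times> {0}" "Range G = T \<times> {0}" "single_valued G" "single_valued (G\<inverse>)"
    and Gdef: "\<And>i j. definable_pred R (\<lambda>v. ((v 0, i), (v 1, j)) \<in> G)"
    by (rule definably_equivalentE[OF assms(1)], rule that)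
  define g where "g x = (THE y. ((x, 0), (y, 0)) \<in> G)" for x
  have g: "((x, 0), (y, 0)) \<in> G \<longleftrightarrow> x \<in> S \<and> y = g x" for x y
  proof
    assume xy: "((x, 0), (y, 0)) \<in> G"
    then have "g x = y" unfolding g_def
      using G(3) by (intro the_equality) (auto simp: single_valued_def)
    moreover have "x \<in> S" using xy G(1) by blast
    ultimately show "x \<in> S \<and> y = g x" by simp
  next
    assume xy: "x \<in> S \<and> y = g x"
    then obtain z where z: "((x, 0), z) \<in> G" using G(1) by blast
    then obtain w where "z = (w, 0)" using G(2) by blast
    then have zz: "((x, 0), (w, 0)) \<in> G" using z by simp
    then have "g x = w" unfolding g_def
      using G(3) by (intro the_equality) (auto simp: single_valued_def)
    then show "((x, 0), (y, 0)) \<in> G" using zz xy by simp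
  qed
  define f where "f xs = [g (hd xs)]" for xs :: "'a list"
  have inj: "x = y" if "x \<in> S" "y \<in> S" "g x = g y" for x y
  proof -
    have "((x, 0), (g x, 0)) \<in> G" "((y, 0), (g x, 0)) \<in> G" using g that by auto
    then show ?thesis using G(4) unfolding single_valued_def by blast
  qed
  have img: "g ` S = T"
  proof
    show "g ` S \<subseteq> T" using g G(2) by blast
    show "T \<subseteq> g ` S"
    proof
      fix y assume "y \<in> T"
      then obtain z where z: "(z, (y, 0)) \<in> G" using G(2) by blast
      then obtain x where "z = (x, 0)" using G(1) by blast
      then show "y \<in> g ` S" using z g by blast
    qed
  qed
  have "bij_betw f {[x] |x. x \<in> S} {[x] |x. x \<in> T}"
    unfolding bij_betw_def
  proof
    show "inj_on f {[x] |x. x \<in> S}" using inj by (auto simp: inj_on_def f_def)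
    have eq: "{[x] |x. x \<in> U} = (\<lambda>x. [x]) ` U" for U :: "'a set" by auto
    show "f ` {[x] |x. x \<in> S} = {[x] |x. x \<in> T}"
      unfolding eq img[symmetric] by (simp add: image_image f_def)
  qed
  moreover have "definable R (1 + 1) {xs @ f xs |xs. xs \<in> {[x] |x. x \<in> S}}"
  proof -
    have eq: "{xs @ f xs |xs. xs \<in> {[x] |x. x \<in> S}} = {[x, g x] |x. x \<in> S}"
      by (auto simp: f_def)
    have "[x, y] \<in> {[x, g x] |x. x \<in> S} \<longleftrightarrow> ((x, 0), (y, 0)) \<in> G" for x y
      using g by auto
    then have "definable_pred R (\<lambda>v. map v [0..<1 + 1] \<in> {[x, g x] |x. x \<in> S})"
      using Gdef[of 0 0] by (simp add: numeral_2_eq_2 upt_conv_Cons)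
    moreover have "{[x, g x] |x. x \<in> S} \<subseteq> tuples R (1 + 1)"
      using assms(2,3) img by (auto simp: definable_subset_def tuples_def subset_iff)
    ultimately show ?thesis unfolding eq by (simp only: definable_iff_pred[OF carrier_nonempty])
  qed
  ultimately show ?thesis unfolding definable_bij_def
    using definable_singletons assms(2,3) by (intro exI[of _ f] exI[of _ "1::nat"] conjI) simp_all
qed

end

section \<open>Triviality of the Grothendieck ring\<close>

lemma map_upt_add: "map v [0..<a + b] = map v [0..<a] @ map (\<lambda>i. v (a + i)) [0..<b]"
proof -
  have "map v [a..<a + b] = map (\<lambda>i. v (a + i)) [0..<b]"
    by (rule nth_equalityI) auto
  then show ?thesis by (simp only: upt_add_eq_append[OF le0] map_append)
qed

lemma times_set_singletons: "times_set {[x] |x. x \<in> S} A = (\<Union>x\<in>S. (#) x ` A)"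
proof (intro Set.set_eqI iffI)
  fix z assume "z \<in> (\<Union>x\<in>S. (#) x ` A)"
  then obtain x ys where "z = [x] @ ys" "x \<in> S" "ys \<in> A" by auto
  then show "z \<in> times_set {[x] |x. x \<in> S} A" unfolding times_set_def by blast
qed (fastforce simp: times_set_def)

context plain_ring
begin

lemma definable_pred_map_eq:
  "definable_pred R (\<lambda>v. map (\<lambda>i. v (\<sigma> i)) [0..<m] = map (\<lambda>i. v (\<tau> i)) [0..<m])"
proof -
  have "definable_pred R (\<lambda>v. \<not> (\<exists>i\<in>{..<m}. \<not> v (\<sigma> i) = v (\<tau> i)))"
    by (rule definable_pred_not[OF definable_pred_finite_ex[OF finite_lessThan carrier_nonempty
            definable_pred_not[OF definable_pred_eq[OF definable_fun_var' definable_fun_var']]]])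
  then show ?thesis by (rule definable_pred_cong) auto
qed

lemma definable_pred_slice:
  assumes "definable R m A"
  shows "definable_pred R (\<lambda>v. map (\<lambda>i. v (\<sigma> i)) [0..<m] \<in> A)"
  using definable_pred_rename[of R "\<lambda>v. map v [0..<m] \<in> A" \<sigma>] assms
  by (simp add: definable_iff_pred[OF carrier_nonempty])

lemma definable_tuples_length: "definable R m A \<Longrightarrow> xs \<in> A \<Longrightarrow> length xs = m \<and> set xs \<subseteq> carrier R"
  unfolding definable_def tuples_def by blast

lemma definable_times_set:
  assumes "definable R m A" "definable R n B"
  shows "definable R (m + n) (times_set A B)"
proof -
  have "map v [0..<m + n] \<in> times_set A B \<longleftrightarrow>
      map v [0..<m] \<in> A \<and> map (\<lambda>i. v (m + i)) [0..<n] \<in> B" for v :: "nat \<Rightarrow> 'a"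
  proof
    assume "map v [0..<m + n] \<in> times_set A B"
    then obtain xs ys where *: "map v [0..<m] @ map (\<lambda>i. v (m + i)) [0..<n] = xs @ ys" "xs \<in> A" "ys \<in> B"
      unfolding map_upt_add times_set_def by blast
    then have "length xs = m" using definable_tuples_length[OF assms(1)] by blast
    then show "map v [0..<m] \<in> A \<and> map (\<lambda>i. v (m + i)) [0..<n] \<in> B" using * by simp
  next
    assume "map v [0..<m] \<in> A \<and> map (\<lambda>i. v (m + i)) [0..<n] \<in> B"
    then show "map v [0..<m + n] \<in> times_set A B" unfolding map_upt_add times_set_def by blast
  qed
  moreover have "definable_pred R (\<lambda>v. map v [0..<m] \<in> A \<and> map (\<lambda>i. v (m + i)) [0..<n] \<in> B)"
    by (rule definable_pred_conj[OF definable_pred_slice[OF assms(1)] definable_pred_slice[OF assms(2)]])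
  moreover have "times_set A B \<subseteq> tuples R (m + n)"
    using definable_tuples_length[OF assms(1)] definable_tuples_length[OF assms(2)]
    unfolding times_set_def tuples_def by fastforce
  ultimately show ?thesis by (simp add: definable_iff_pred[OF carrier_nonempty])
qed

text \<open>A tuple of the product is split at the arity of \<open>X\<close>, respectively \<open>Y\<close>, and the
  bijection acts on its first part.\<close>

lemma definably_isomorphic_times_set:
  assumes "definable_bij R f X Y" "definable R k A" "k > 0"
  shows "definably_isomorphic R (times_set X A) (times_set Y A)"
proof -
  obtain m n where mn: "m > 0" "n > 0" "definable R m X" "definable R n Y" "bij_betw f X Y"
    and graph: "definable R (m + n) {xs @ f xs |xs. xs \<in> X}"
    using assms(1) unfolding definable_bij_def by blast
  note lenX = definable_tuples_length[OF mn(3)] and lenY = definable_tuples_length[OF mn(4)]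
    and lenA = definable_tuples_length[OF assms(2)]
  have fX: "f xs \<in> Y" if "xs \<in> X" for xs using mn(5) that by (auto simp: bij_betw_def)
  define h where "h zs = f (take m zs) @ drop m zs" for zs
  have h: "h (xs @ ys) = f xs @ ys" if "xs \<in> X" for xs ys
    using lenX[OF that] by (simp add: h_def)
  have "bij_betw h (times_set X A) (times_set Y A)"
    unfolding bij_betw_def
  proof
    show "inj_on h (times_set X A)"
    proof (rule inj_onI)
      fix u w assume uw: "u \<in> times_set X A" "w \<in> times_set X A" "h u = h w"
      then obtain xs ys xs' ys' where u: "u = xs @ ys" "xs \<in> X" "ys \<in> A"
        and w: "w = xs' @ ys'" "xs' \<in> X" "ys' \<in> A" unfolding times_set_def by blast
      have "f xs @ ys = f xs' @ ys'" using uw(3) u w h by simp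
      then have "f xs = f xs'" "ys = ys'" using lenY[OF fX[OF u(2)]] lenY[OF fX[OF w(2)]] by auto
      then show "u = w" using u w mn(5) by (auto simp: bij_betw_def dest: inj_onD)
    qed
    show "h ` times_set X A = times_set Y A"
    proof
      show "h ` times_set X A \<subseteq> times_set Y A" using h fX by (fastforce simp: times_set_def)
      show "times_set Y A \<subseteq> h ` times_set X A"
      proof
        fix w assume "w \<in> times_set Y A"
        then obtain y a where w: "w = y @ a" "y \<in> Y" "a \<in> A" unfolding times_set_def by blast
        then obtain x where "x \<in> X" "y = f x" using mn(5) by (auto simp: bij_betw_def)
        then have "w = h (x @ a)" "x @ a \<in> times_set X A" using h w by (auto simp: times_set_def)
        then show "w \<in> h ` times_set X A" by blast
      qed
    qed
  qed
  moreover have "definable R ((m + k) + (n + k)) {zs @ h zs |zs. zs \<in> times_set X A}" (is "definable R _ ?H")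
  proof -
    have H: "?H = {xs @ ys @ f xs @ ys |xs ys. xs \<in> X \<and> ys \<in> A}"
      using h unfolding times_set_def by (auto, metis append.assoc, metis append.assoc)
    let ?a = "\<lambda>v. map v [0..<m]" and ?b = "\<lambda>v. map (\<lambda>i. v (m + i)) [0..<k]"
      and ?c = "\<lambda>v. map (\<lambda>i. v (m + k + i)) [0..<n]" and ?d = "\<lambda>v. map (\<lambda>i. v (m + k + (n + i))) [0..<k]"
    have split: "map v [0..<(m + k) + (n + k)] = ?a v @ ?b v @ ?c v @ ?d v" for v :: "nat \<Rightarrow> 'a"
      by (simp only: map_upt_add append.assoc)
    have mem: "map v [0..<(m + k) + (n + k)] \<in> ?H \<longleftrightarrow>
        (?a v @ ?c v \<in> {xs @ f xs |xs. xs \<in> X} \<and> ?b v \<in> A) \<and> ?b v = ?d v" for v :: "nat \<Rightarrow> 'a"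
    proof
      assume "map v [0..<(m + k) + (n + k)] \<in> ?H"
      then obtain xs ys where *: "?a v @ ?b v @ ?c v @ ?d v = xs @ ys @ f xs @ ys" "xs \<in> X" "ys \<in> A"
        unfolding H split by blast
      have "length xs = m" "length ys = k" "length (f xs) = n"
        using lenX[OF *(2)] lenA[OF *(3)] lenY[OF fX[OF *(2)]] by simp_all
      then have "?a v = xs \<and> ?b v = ys \<and> ?c v = f xs \<and> ?d v = ys" using *(1) by simp
      then show "(?a v @ ?c v \<in> {xs @ f xs |xs. xs \<in> X} \<and> ?b v \<in> A) \<and> ?b v = ?d v" using * by auto
    next
      assume *: "(?a v @ ?c v \<in> {xs @ f xs |xs. xs \<in> X} \<and> ?b v \<in> A) \<and> ?b v = ?d v"
      then obtain xs where xs: "?a v @ ?c v = xs @ f xs" "xs \<in> X" by blast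
      have "length xs = m" using lenX[OF xs(2)] by simp
      then have "?a v = xs \<and> ?c v = f xs" using xs(1) by simp
      then show "map v [0..<(m + k) + (n + k)] \<in> ?H"
        unfolding H split using xs(2) * by (intro CollectI exI[of _ xs] exI[of _ "?b v"]) simp
    qed
    have "definable_pred R (\<lambda>v. ?a v @ ?c v \<in> {xs @ f xs |xs. xs \<in> X})"
    proof -
      have "?a v @ ?c v = map (\<lambda>i. v (if i < m then i else k + i)) [0..<m + n]" for v :: "nat \<Rightarrow> 'a"
        by (rule nth_equalityI) (auto simp: nth_append algebra_simps)
      then show ?thesis using definable_pred_slice[OF graph, of "\<lambda>i. if i < m then i else k + i"] by simp
    qed
    then have "definable_pred R (\<lambda>v. (?a v @ ?c v \<in> {xs @ f xs |xs. xs \<in> X} \<and> ?b v \<in> A) \<and> ?b v = ?d v)"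
      by (rule definable_pred_conj[OF definable_pred_conj[OF _ definable_pred_slice[OF assms(2)]] definable_pred_map_eq])
    moreover have "?H \<subseteq> tuples R ((m + k) + (n + k))"
    proof
      fix z assume "z \<in> ?H"
      then obtain xs ys where *: "z = xs @ ys @ f xs @ ys" "xs \<in> X" "ys \<in> A" unfolding H by blast
      then show "z \<in> tuples R ((m + k) + (n + k))"
        using lenX[OF *(2)] lenA[OF *(3)] lenY[OF fX[OF *(2)]] by (auto simp: tuples_def)
    qed
    ultimately show ?thesis by (simp only: definable_iff_pred[OF carrier_nonempty] mem simp_thms)
  qed
  ultimately show ?thesis
    unfolding definably_isomorphic_def definable_bij_def
    using definable_times_set[OF mn(3) assms(2)] definable_times_set[OF mn(4) assms(2)] mn(1,2)
    by (intro exI[of _ h] exI[of _ "m + k"] exI[of _ "n + k"] conjI) simp_all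
qed

text \<open>The class of a point is a unit only because of this bijection, given by \<open>tl\<close>: there
  are no tuples of length \<open>0\<close>.\<close>

lemma definably_isomorphic_point_times:
  assumes "definable R k A" "k > 0" "a \<in> carrier R"
  shows "definably_isomorphic R (times_set {[a]} A) A"
proof -
  have point: "definable R 1 {[a]}"
    using definable_singletons[OF definable_subset_singleton[OF assms(3)]] by simp
  note lenA = definable_tuples_length[OF assms(1)]
  have times: "times_set {[a]} A = (#) a ` A" by (auto simp: times_set_def)
  have "bij_betw tl (times_set {[a]} A) A"
    unfolding bij_betw_def times by (auto simp: inj_on_def image_image)
  moreover have "definable R ((1 + k) + k) {zs @ tl zs |zs. zs \<in> times_set {[a]} A}" (is "definable R _ ?H")
  proof -
    have H: "?H = {[a] @ ys @ ys |ys. ys \<in> A}"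
    proof
      show "?H \<subseteq> {[a] @ ys @ ys |ys. ys \<in> A}" unfolding times by auto
      show "{[a] @ ys @ ys |ys. ys \<in> A} \<subseteq> ?H"
      proof
        fix z assume "z \<in> {[a] @ ys @ ys |ys. ys \<in> A}"
        then obtain ys where "z = (a # ys) @ tl (a # ys)" "ys \<in> A" by auto
        then show "z \<in> ?H" unfolding times by blast
      qed
    qed
    let ?a = "\<lambda>v. map v [0..<1]" and ?b = "\<lambda>v. map (\<lambda>i. v (1 + i)) [0..<k]"
      and ?c = "\<lambda>v. map (\<lambda>i. v (1 + k + i)) [0..<k]"
    have split: "map v [0..<(1 + k) + k] = ?a v @ ?b v @ ?c v" for v :: "nat \<Rightarrow> 'a"
      by (simp only: map_upt_add append.assoc)
    have mem: "map v [0..<(1 + k) + k] \<in> ?H \<longleftrightarrow> (?a v \<in> {[a]} \<and> ?b v \<in> A) \<and> ?b v = ?c v" for v :: "nat \<Rightarrow> 'a"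
    proof
      assume "map v [0..<(1 + k) + k] \<in> ?H"
      then obtain ys where *: "?a v @ ?b v @ ?c v = [a] @ ys @ ys" "ys \<in> A" unfolding H split by blast
      have "length ys = k" using lenA[OF *(2)] by simp
      then have "?a v = [a] \<and> ?b v = ys \<and> ?c v = ys" using *(1) by simp
      then show "(?a v \<in> {[a]} \<and> ?b v \<in> A) \<and> ?b v = ?c v" using * by simp
    next
      assume "(?a v \<in> {[a]} \<and> ?b v \<in> A) \<and> ?b v = ?c v"
      then show "map v [0..<(1 + k) + k] \<in> ?H"
        unfolding H split by (intro CollectI exI[of _ "?b v"]) simp
    qed
    have "definable_pred R (\<lambda>v. (?a v \<in> {[a]} \<and> ?b v \<in> A) \<and> ?b v = ?c v)"
      by (rule definable_pred_conj[OF definable_pred_conj[OF definable_pred_slice[OF point]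
              definable_pred_slice[OF assms(1)]] definable_pred_map_eq])
    moreover have "?H \<subseteq> tuples R ((1 + k) + k)"
    proof
      fix z assume "z \<in> ?H"
      then obtain ys where *: "z = [a] @ ys @ ys" "ys \<in> A" unfolding H by blast
      then show "z \<in> tuples R ((1 + k) + k)" using lenA[OF *(2)] assms(3) by (auto simp: tuples_def)
    qed
    ultimately show ?thesis by (simp only: definable_iff_pred[OF carrier_nonempty] mem simp_thms)
  qed
  ultimately show ?thesis
    unfolding definably_isomorphic_def definable_bij_def
    using definable_times_set[OF point assms(1)] assms(1,2)
    by (intro exI[of _ tl] exI[of _ "1 + k"] exI[of _ k] conjI) simp_all
qed

text \<open>The given bijection times the identity of \<open>A\<close> shows \<open>[K \<times> A] = [(K - {0}) \<times> A]\<close>, and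
  \<open>K \<times> A\<close> is the disjoint union of \<open>(K - {0}) \<times> A\<close> and \<open>{0} \<times> A\<close>. Hence
  \<open>[A] = [{0} \<times> A] = 0\<close>; so the relators generate the whole free group, and the quotient is
  trivial.\<close>

lemma K0_trivial:
  assumes bij: "definable_bij R f {[x] |x. x \<in> carrier R} {[x] |x. x \<in> carrier R - {\<zero>}}"
  shows "carrier (K0 R) = {\<zero>\<^bsub>K0 R\<^esub>}"
proof -
  define F where "F = free_Abelian_group (definable_sets R)"
  define N where "N = generate F (K0_relators R)"
  have F: "carrier F = {c. Poly_Mapping.keys c \<subseteq> definable_sets R}" "\<And>x y. x \<otimes>\<^bsub>F\<^esub> y = x + y" "\<one>\<^bsub>F\<^esub> = 0"
    unfolding F_def by (simp_all add: free_Abelian_group_def)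
  interpret F: group F unfolding F_def by (rule group_free_Abelian_group)
  have inv: "inv\<^bsub>F\<^esub> x = - x" if "x \<in> carrier F" for x
    using that unfolding F_def by simp
  have rel: "K0_relators R \<subseteq> carrier F"
    unfolding F K0_relators_def
    by (auto dest!: subsetD[OF keys_diff] subsetD[OF keys_add] simp: keys_frag_of split: if_splits)
  have sub: "subgroup N F" unfolding N_def by (rule F.generate_is_subgroup[OF rel])
  have relN: "x \<in> N" if "x \<in> K0_relators R" for x using that unfolding N_def by (rule generate.incl)
  have minus: "x - y \<in> N" if "x \<in> N" "y \<in> N" for x y
  proof -
    have "x \<otimes>\<^bsub>F\<^esub> inv\<^bsub>F\<^esub> y \<in> N" using sub that by (simp add: subgroup.m_closed subgroup.m_inv_closed)
    then show ?thesis using inv subgroup.mem_carrier[OF sub that(2)] by (simp add: F)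
  qed
  have gen: "frag_of A \<in> N" if A: "A \<in> definable_sets R" for A
  proof -
    obtain k where k: "k > 0" "definable R k A" using A unfolding definable_sets_def by blast
    let ?K = "{[x] |x. x \<in> carrier R}" and ?U = "{[x] |x. x \<in> carrier R - {\<zero>}}"
    have defs: "definable R 1 ?K" "definable R 1 ?U" "definable R 1 {[\<zero>]}"
      using definable_singletons[OF definable_subset_carrier]
        definable_singletons[OF definable_subset_Diff[OF definable_subset_carrier definable_subset_singleton[OF zero_closed]]]
        definable_singletons[OF definable_subset_singleton[OF zero_closed]] by simp_all
    have prods: "times_set X A \<in> definable_sets R" if "definable R 1 X" for X
      unfolding definable_sets_def using definable_times_set[OF that k(2)] by (intro CollectI exI[of _ "1 + k"]) simp
    have "frag_of (times_set ?K A) - frag_of (times_set ?U A) \<in> K0_relators R"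
      unfolding K0_relators_def
      using definably_isomorphic_times_set[OF bij k(2,1)] prods[OF defs(1)] prods[OF defs(2)] by blast
    moreover have "frag_of (times_set ?K A) - (frag_of (times_set ?U A) + frag_of (times_set {[\<zero>]} A)) \<in> K0_relators R"
    proof -
      have "times_set ?K A = times_set ?U A \<union> times_set {[\<zero>]} A" "times_set ?U A \<inter> times_set {[\<zero>]} A = {}"
        using times_set_singletons[of "carrier R" A] times_set_singletons[of "carrier R - {\<zero>}" A]
          times_set_singletons[of "{\<zero>}" A] by auto
      then show ?thesis unfolding K0_relators_def
        using prods[OF defs(1)] prods[OF defs(2)] prods[OF defs(3)] by blast
    qed
    ultimately have "frag_of (times_set ?K A) - frag_of (times_set ?U A) -
        (frag_of (times_set ?K A) - (frag_of (times_set ?U A) + frag_of (times_set {[\<zero>]} A))) \<in> N"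
      by (intro minus relN)
    then have Z: "frag_of (times_set {[\<zero>]} A) \<in> N" by simp
    have "frag_of (times_set {[\<zero>]} A) - frag_of A \<in> K0_relators R"
      unfolding K0_relators_def
      using definably_isomorphic_point_times[OF k(2,1) zero_closed] A prods[OF defs(3)] by blast
    then have "frag_of (times_set {[\<zero>]} A) - (frag_of (times_set {[\<zero>]} A) - frag_of A) \<in> N"
      by (intro minus Z relN)
    then show ?thesis by simp
  qed
  have N: "N = carrier F"
  proof
    show "N \<subseteq> carrier F" using sub by (rule subgroup.subset)
    have zero: "0 \<in> N" using subgroup.one_closed[OF sub] F by simp
    show "carrier F \<subseteq> N"
    proof
      fix x assume "x \<in> carrier F"
      then have "Poly_Mapping.keys x \<subseteq> definable_sets R" by (simp add: F)
      then show "x \<in> N"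
        by (induction x rule: frag_induction) (auto intro: zero gen minus)
    qed
  qed
  have ops: "carrier (free_definable_ring R) = carrier F" "\<And>x y. x \<oplus>\<^bsub>free_definable_ring R\<^esub> y = x + y"
    by (simp_all add: free_definable_ring_def F_def)
  have coset: "(\<Union>h\<in>N. {h + a}) = N" if a: "a \<in> carrier F" for a
  proof
    show "(\<Union>h\<in>N. {h + a}) \<subseteq> N" using subgroup.m_closed[OF sub] a N by (auto simp: F(2))
    show "N \<subseteq> (\<Union>h\<in>N. {h + a})"
    proof
      fix x assume "x \<in> N"
      then have "x - a \<in> N" using a N minus by blast
      then show "x \<in> (\<Union>h\<in>N. {h + a})" by (intro UN_I[of "x - a"]) auto
    qed
  qed
  have "0 \<in> carrier F" using F by simp
  then have "a_rcosets\<^bsub>free_definable_ring R\<^esub> N = {N}"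
    unfolding A_RCOSETS_def RCOSETS_def r_coset_def
    using coset by (auto simp: ops)
  then show ?thesis
    unfolding K0_def FactRing_def N_def F_def by simp
qed

end

section \<open>Roots of one-units in complete filtered rings\<close>

text \<open>The setting for Newton iteration. The filtration may start with a proper subset of the
  ring: over a field, \<open>J i\<close> will consist of the power series of order at least \<open>i\<close>, or of a
  multiple of a lattice.\<close>

locale complete_filtration = cring R for R :: "'a ring" (structure) +
  fixes J :: "nat \<Rightarrow> 'a set"
  assumes J_closed: "J i \<subseteq> carrier R" and J_zero: "\<zero> \<in> J i"
    and J_add: "x \<in> J i \<Longrightarrow> y \<in> J i \<Longrightarrow> x \<oplus> y \<in> J i" and J_minus: "x \<in> J i \<Longrightarrow> \<ominus> x \<in> J i"
    and J_Suc: "J (Suc i) \<subseteq> J i"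
    and J_mult: "x \<in> J i \<Longrightarrow> y \<in> J j \<Longrightarrow> x \<otimes> y \<in> J (i + j)"
    and J_separated: "(\<And>i. x \<in> J i) \<Longrightarrow> x = \<zero>"
    and J_complete: "(\<And>i. S i \<in> carrier R) \<Longrightarrow> (\<And>i. S (Suc i) \<ominus> S i \<in> J i) \<Longrightarrow>
      \<exists>x\<in>carrier R. \<forall>i. x \<ominus> S i \<in> J i"
begin

lemma J_carrier: "x \<in> J i \<Longrightarrow> x \<in> carrier R"
  using J_closed by blast

lemma J_antimono: "i \<le> j \<Longrightarrow> J j \<subseteq> J i"
  using J_Suc by (rule lift_Suc_antimono_le)

lemma J_diff: "x \<in> J i \<Longrightarrow> y \<in> J i \<Longrightarrow> x \<ominus> y \<in> J i"
  by (simp add: minus_eq J_add J_minus)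

lemma J_mult_le: "x \<in> J i \<Longrightarrow> y \<in> J j \<Longrightarrow> k \<le> i + j \<Longrightarrow> x \<otimes> y \<in> J k"
  using J_mult J_antimono by blast

lemma J_multiple: "x \<in> J i \<Longrightarrow> [(n::nat)] \<cdot> x \<in> J i"
  by (induction n) (auto simp: J_zero intro: J_add)

lemma one_unit_pow:
  assumes "w \<in> J i" shows "\<exists>w'\<in>J i. (\<one> \<oplus> w) [^] (n::nat) = \<one> \<oplus> w'"
proof (induction n)
  case 0
  show ?case by (rule bexI[OF _ J_zero]) simp
next
  case (Suc n)
  then obtain w' where w': "w' \<in> J i" "(\<one> \<oplus> w) [^] n = \<one> \<oplus> w'" by blast
  note cl = J_carrier[OF assms] J_carrier[OF w'(1)]
  have "(\<one> \<oplus> w) [^] Suc n = \<one> \<oplus> (w \<oplus> (w' \<oplus> w' \<otimes> w))"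
    using cl w'(2) by (simp add: l_distr r_distr a_ac)
  moreover have "w \<oplus> (w' \<oplus> w' \<otimes> w) \<in> J i"
    by (intro J_add assms w' J_mult_le[OF w'(1) assms]) simp
  ultimately show ?case by blast
qed

text \<open>The terms of the binomial expansion beyond the linear one are products with a further
  factor in \<open>J (Suc e)\<close>.\<close>

lemma pow_add_approx:
  assumes w: "w \<in> J (Suc e)" and b: "b \<in> J i" and ei: "Suc e \<le> i"
  shows "\<exists>r\<in>J (i + Suc e). ((\<one> \<oplus> w) \<oplus> b) [^] (n::nat) = (\<one> \<oplus> w) [^] n \<oplus> ([n] \<cdot> b \<oplus> r)"
proof (induction n)
  case 0
  show ?case by (rule bexI[OF _ J_zero]) simp
next
  case (Suc n)
  then obtain r where r: "r \<in> J (i + Suc e)"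
    "((\<one> \<oplus> w) \<oplus> b) [^] n = (\<one> \<oplus> w) [^] n \<oplus> ([n] \<cdot> b \<oplus> r)" by blast
  obtain v where v: "v \<in> J (Suc e)" "(\<one> \<oplus> w) [^] n = \<one> \<oplus> v" using one_unit_pow[OF w] by blast
  define c where "c = [n] \<cdot> b"
  have c: "c \<in> J i" unfolding c_def using b by (rule J_multiple)
  have cb: "[(Suc n)] \<cdot> b = c \<oplus> b" unfolding c_def by simp
  define r' where "r' = (v \<otimes> b \<oplus> c \<otimes> w) \<oplus> (c \<otimes> b \<oplus> (r \<oplus> (r \<otimes> w \<oplus> r \<otimes> b)))"
  note cl = J_carrier[OF w] J_carrier[OF b] J_carrier[OF r(1)] J_carrier[OF v(1)] J_carrier[OF c]
  have "((\<one> \<oplus> w) \<oplus> b) [^] Suc n = ((\<one> \<oplus> v) \<oplus> (c \<oplus> r)) \<otimes> ((\<one> \<oplus> w) \<oplus> b)"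
    using r(2) v(2) c_def by simp
  also have "\<dots> = (\<one> \<oplus> v) \<otimes> (\<one> \<oplus> w) \<oplus> ((c \<oplus> b) \<oplus> r')"
    unfolding r'_def using cl by (simp add: l_distr r_distr a_ac)
  also have "\<dots> = (\<one> \<oplus> w) [^] Suc n \<oplus> ([(Suc n)] \<cdot> b \<oplus> r')"
    using v(2) cb by simp
  finally have "((\<one> \<oplus> w) \<oplus> b) [^] Suc n = (\<one> \<oplus> w) [^] Suc n \<oplus> ([(Suc n)] \<cdot> b \<oplus> r')" .
  moreover have "r' \<in> J (i + Suc e)"
    unfolding r'_def using ei
    by (intro J_add r(1) J_mult_le[OF v(1) b] J_mult_le[OF c w] J_mult_le[OF c b]
        J_mult_le[OF r(1) w] J_mult_le[OF r(1) b]) auto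
  ultimately show ?case by blast
qed

text \<open>Newton iteration for \<open>x^n = 1 + u\<close>. An error in \<open>J (e + i)\<close> is corrected by an element
  of \<open>J i\<close>, where \<open>e\<close> measures what is lost in the division by \<open>n\<close>; the new error lies one
  step deeper. The terms beyond the linear one have a further factor in \<open>J (Suc e)\<close>, the
  depth at which the iteration starts, and do not disturb this.\<close>

lemma one_unit_root:
  assumes u: "u \<in> J (e + Suc e)"
    and approx: "\<And>i a. Suc e \<le> i \<Longrightarrow> a \<in> J (e + i) \<Longrightarrow> \<exists>b\<in>J i. [n] \<cdot> b \<ominus> a \<in> J (Suc (e + i))"
  shows "\<exists>w\<in>J (Suc e). (\<one> \<oplus> w) [^] (n::nat) = \<one> \<oplus> u"
proof -
  define P where "P k w \<longleftrightarrow> w \<in> J (Suc e) \<and> (\<one> \<oplus> u) \<ominus> (\<one> \<oplus> w) [^] n \<in> J (e + (k + Suc e))" for k w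
  have uc: "u \<in> carrier R" by (rule J_carrier[OF u])
  have "\<exists>W. \<forall>k. P k (W k) \<and> W (Suc k) \<ominus> W k \<in> J (k + Suc e)"
  proof (rule dependent_nat_choice)
    have "(\<one> \<oplus> u) \<ominus> (\<one> \<oplus> \<zero>) [^] n = u" using uc by (simp add: minus_eq a_ac r_neg1 r_neg2 r_neg)
    then show "\<exists>w. P 0 w" using u J_zero unfolding P_def by (intro exI[of _ \<zero>]) simp
  next
    fix w k assume "P k w"
    then have w: "w \<in> J (Suc e)" and a: "(\<one> \<oplus> u) \<ominus> (\<one> \<oplus> w) [^] n \<in> J (e + (k + Suc e))"
      unfolding P_def by auto
    let ?a = "(\<one> \<oplus> u) \<ominus> (\<one> \<oplus> w) [^] n" and ?i = "k + Suc e"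
    obtain b where b: "b \<in> J ?i" "[n] \<cdot> b \<ominus> ?a \<in> J (Suc (e + ?i))" using approx[OF _ a] by auto
    obtain r where r: "r \<in> J (?i + Suc e)"
      "((\<one> \<oplus> w) \<oplus> b) [^] n = (\<one> \<oplus> w) [^] n \<oplus> ([n] \<cdot> b \<oplus> r)" using pow_add_approx[OF w b(1)] by auto
    note cl = J_carrier[OF w] J_carrier[OF b(1)] J_carrier[OF r(1)] uc
    define y where "y = (\<one> \<oplus> w) [^] n"
    define c where "c = [n] \<cdot> b"
    have y: "y \<in> carrier R" "c \<in> carrier R" unfolding y_def c_def using cl by simp_all
    have "(\<one> \<oplus> u) \<ominus> (\<one> \<oplus> (w \<oplus> b)) [^] n = (\<one> \<oplus> u) \<ominus> (y \<oplus> (c \<oplus> r))"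
      using r(2) cl unfolding y_def c_def by (simp add: a_assoc)
    also have "\<dots> = \<ominus> ((c \<ominus> ((\<one> \<oplus> u) \<ominus> y)) \<oplus> r)"
      using cl y by (simp add: minus_eq minus_add a_ac)
    also have "\<dots> \<in> J (Suc (e + ?i))"
      using b(2) r(1) unfolding y_def c_def by (intro J_minus J_add) (simp_all add: add.commute add.left_commute)
    finally have "P (Suc k) (w \<oplus> b)"
      unfolding P_def using w b(1) J_antimono[of "Suc e" ?i] by (auto intro: J_add)
    moreover have "(w \<oplus> b) \<ominus> w = b" using cl by (simp add: minus_eq a_ac r_neg1 r_neg2 r_neg)
    then have "(w \<oplus> b) \<ominus> w \<in> J ?i" using b(1) by simp
    ultimately show "\<exists>y. P (Suc k) y \<and> y \<ominus> w \<in> J ?i" by blast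
  qed
  then obtain W where W: "\<And>k. P k (W k)" "\<And>k. W (Suc k) \<ominus> W k \<in> J (k + Suc e)" by blast
  have Wc: "W k \<in> carrier R" for k using W(1) J_carrier unfolding P_def by blast
  \<comment> \<open>The approximations are delayed by \<open>Suc e\<close> steps, as completeness expects consecutive
    differences in \<open>J i\<close>; by truncated subtraction the delayed sequence is constant at
    first.\<close>
  have "\<exists>x\<in>carrier R. \<forall>i. x \<ominus> W (i - Suc e) \<in> J i"
  proof (rule J_complete)
    fix i
    show "W (Suc i - Suc e) \<ominus> W (i - Suc e) \<in> J i"
    proof (cases "Suc e \<le> i")
      case True
      then have "Suc i - Suc e = Suc (i - Suc e)" "i - Suc e + Suc e = i" by auto
      then show ?thesis using W(2)[of "i - Suc e"] by simp
    next
      case False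
      then show ?thesis using Wc J_zero by (simp add: minus_eq r_neg)
    qed
  qed (rule Wc)
  then obtain x where x: "x \<in> carrier R" "\<And>i. x \<ominus> W (i - Suc e) \<in> J i" by blast
  have x': "x \<ominus> W k \<in> J (k + Suc e)" for k using x(2)[of "k + Suc e"] by simp
  have "W 0 \<in> J (Suc e)" using W(1) unfolding P_def by blast
  then have "(x \<ominus> W 0) \<oplus> W 0 \<in> J (Suc e)" using x'[of 0] by (intro J_add) simp_all
  moreover have "(x \<ominus> W 0) \<oplus> W 0 = x" using x(1) Wc by (simp add: minus_eq a_assoc l_neg)
  ultimately have xJ: "x \<in> J (Suc e)" by simp
  have "(\<one> \<oplus> u) \<ominus> (\<one> \<oplus> x) [^] n \<in> J k" for k
  proof -
    let ?d = "x \<ominus> W k"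
    have w: "W k \<in> J (Suc e)" and a: "(\<one> \<oplus> u) \<ominus> (\<one> \<oplus> W k) [^] n \<in> J (e + (k + Suc e))"
      using W(1) unfolding P_def by auto
    obtain r where r: "r \<in> J (k + Suc e + Suc e)"
      "((\<one> \<oplus> W k) \<oplus> ?d) [^] n = (\<one> \<oplus> W k) [^] n \<oplus> ([n] \<cdot> ?d \<oplus> r)"
      using pow_add_approx[OF w x'] by auto
    have eq: "(\<one> \<oplus> W k) \<oplus> ?d = \<one> \<oplus> x" using x(1) Wc by (simp add: minus_eq a_ac r_neg1 r_neg2 r_neg)
    define y where "y = (\<one> \<oplus> W k) [^] n"
    define c where "c = [n] \<cdot> ?d"
    have cl: "y \<in> carrier R" "c \<in> carrier R" "r \<in> carrier R"
      unfolding y_def c_def using x(1) Wc J_carrier[OF r(1)] by simp_all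
    have "(\<one> \<oplus> u) \<ominus> (\<one> \<oplus> x) [^] n = (\<one> \<oplus> u) \<ominus> (y \<oplus> (c \<oplus> r))"
      using r(2) unfolding eq y_def c_def by simp
    also have "\<dots> = ((\<one> \<oplus> u) \<ominus> y) \<ominus> (c \<oplus> r)"
      using cl uc by (simp add: minus_eq minus_add a_ac)
    also have "\<dots> \<in> J k"
    proof (rule J_diff[OF _ J_add])
      show "(\<one> \<oplus> u) \<ominus> y \<in> J k" using a J_antimono[of k "e + (k + Suc e)"] unfolding y_def by auto
      show "c \<in> J k" unfolding c_def using x'[of k] J_antimono[of k "k + Suc e"] by (intro J_multiple) auto
      show "r \<in> J k" using r(1) J_antimono[of k "k + Suc e + Suc e"] by auto
    qed
    finally show ?thesis .
  qed
  then have "(\<one> \<oplus> u) \<ominus> (\<one> \<oplus> x) [^] n = \<zero>" by (rule J_separated)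
  then have "(\<one> \<oplus> x) [^] n = \<one> \<oplus> u" using uc x(1) by simp
  then show ?thesis using xJ by blast
qed

text \<open>If \<open>w\<close> is in \<open>J (Suc i)\<close>, then \<open>1 = (1 + w)^n\<close> agrees with \<open>1 + n w\<close> up to
  \<open>J (Suc (Suc i))\<close>, so \<open>w\<close> lies one step deeper.\<close>

lemma one_unit_root_unique:
  assumes w: "w \<in> J (Suc 0)" and one: "(\<one> \<oplus> w) [^] (n::nat) = \<one>"
    and cancel: "\<And>i b. b \<in> J i \<Longrightarrow> [n] \<cdot> b \<in> J (Suc i) \<Longrightarrow> b \<in> J (Suc i)"
  shows "w = \<zero>"
proof -
  have "w \<in> J (Suc i)" for i
  proof (induction i)
    case (Suc i)
    obtain r where r: "r \<in> J (Suc i + Suc 0)"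
      "((\<one> \<oplus> \<zero>) \<oplus> w) [^] n = (\<one> \<oplus> \<zero>) [^] n \<oplus> ([n] \<cdot> w \<oplus> r)"
      using pow_add_approx[OF J_zero[of "Suc 0"] Suc, of n] by auto
    note cl = J_carrier[OF w] J_carrier[OF r(1)]
    have "\<one> = \<one> \<oplus> ([n] \<cdot> w \<oplus> r)" using r(2) one cl by simp
    then have "[n] \<cdot> w \<oplus> r = \<zero>" using cl by (metis add.nat_pow_closed a_closed one_closed r_zero zero_closed add.right_cancel a_comm)
    then have "[n] \<cdot> w = \<ominus> r" using cl by (metis add.nat_pow_closed minus_equality)
    then have "[n] \<cdot> w \<in> J (Suc (Suc i))" using J_minus[OF r(1)] by simp
    then show ?case by (rule cancel[OF Suc])
  qed (rule w)
  then have "w \<in> J i" for i using J_Suc by blast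
  then show ?thesis by (rule J_separated)
qed

text \<open>If \<open>v\<close> is an approximate inverse of \<open>1 + a\<close> with error \<open>d = (1 + a) v - 1\<close>, then
  \<open>v - d\<close> has the error \<open>- a d\<close>, which lies one step deeper.\<close>

lemma one_unit_inverse:
  assumes a: "a \<in> J (Suc 0)"
  shows "\<exists>w\<in>J (Suc 0). (\<one> \<oplus> a) \<otimes> (\<one> \<oplus> w) = \<one>"
proof -
  define P where "P k v \<longleftrightarrow> v \<in> carrier R \<and> (\<one> \<oplus> a) \<otimes> v \<ominus> \<one> \<in> J (Suc k) \<and> v \<ominus> \<one> \<in> J (Suc 0)" for k v
  have ac: "a \<in> carrier R" by (rule J_carrier[OF a])
  have "\<exists>V. \<forall>k. P k (V k) \<and> V (Suc k) \<ominus> V k \<in> J (Suc k)"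
  proof (rule dependent_nat_choice)
    have "(\<one> \<oplus> a) \<otimes> \<one> \<ominus> \<one> = a" using ac by (simp add: minus_eq a_ac r_neg1 r_neg2 r_neg)
    then show "\<exists>v. P 0 v" using a J_zero unfolding P_def by (intro exI[of _ \<one>]) (simp add: minus_eq r_neg)
  next
    fix v k assume "P k v"
    then have v: "v \<in> carrier R" and d: "(\<one> \<oplus> a) \<otimes> v \<ominus> \<one> \<in> J (Suc k)" and v1: "v \<ominus> \<one> \<in> J (Suc 0)"
      unfolding P_def by auto
    let ?d = "(\<one> \<oplus> a) \<otimes> v \<ominus> \<one>"
    have dc: "?d \<in> carrier R" using J_carrier[OF d] .
    define e where "e = ?d"
    have ec: "e \<in> carrier R" using dc e_def by simp
    have eqe: "(\<one> \<oplus> a) \<otimes> v = e \<oplus> \<one>"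
      unfolding e_def using ac v by (simp add: minus_eq a_assoc l_neg)
    have "(\<one> \<oplus> a) \<otimes> (v \<ominus> e) \<ominus> \<one> = ((\<one> \<oplus> a) \<otimes> v \<ominus> (\<one> \<oplus> a) \<otimes> e) \<ominus> \<one>"
      using ac v ec by (simp add: minus_eq r_distr r_minus)
    also have "\<dots> = \<ominus> (a \<otimes> e)"
    proof -
      have "\<one> \<oplus> (\<ominus> e \<oplus> (\<ominus> \<one> \<oplus> \<ominus> (a \<otimes> e))) = \<ominus> e \<oplus> (\<one> \<oplus> (\<ominus> \<one> \<oplus> \<ominus> (a \<otimes> e)))"
        using ac ec by (intro a_lcomm) simp_all
      then show ?thesis
        unfolding eqe using ac ec by (simp add: minus_eq l_distr minus_add a_ac r_neg1 r_neg2 r_neg)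
    qed
    finally have 1: "(\<one> \<oplus> a) \<otimes> (v \<ominus> e) \<ominus> \<one> \<in> J (Suc (Suc k))"
      using J_minus[OF J_mult[OF a d]] e_def by simp
    have "(v \<ominus> e) \<ominus> \<one> = (v \<ominus> \<one>) \<ominus> e" using v ec by (simp add: minus_eq a_ac)
    then have 2: "(v \<ominus> e) \<ominus> \<one> \<in> J (Suc 0)"
      using J_diff[OF v1] d J_antimono[of "Suc 0" "Suc k"] e_def by auto
    have "(v \<ominus> e) \<ominus> v = \<ominus> e"
      using v ec by (simp add: minus_eq a_comm[of v "\<ominus> e"] a_assoc r_neg)
    then have "(v \<ominus> e) \<ominus> v \<in> J (Suc k)" using J_minus[OF d] e_def by simp
    then show "\<exists>y. P (Suc k) y \<and> y \<ominus> v \<in> J (Suc k)"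
      unfolding P_def using 1 2 v ec by blast
  qed
  then obtain V where V: "\<And>k. P k (V k)" "\<And>k. V (Suc k) \<ominus> V k \<in> J (Suc k)" by blast
  have Vc: "V k \<in> carrier R" for k using V(1) unfolding P_def by blast
  have "\<exists>x\<in>carrier R. \<forall>i. x \<ominus> V i \<in> J i"
    using J_complete[of V] Vc V(2) J_Suc by blast
  then obtain x where x: "x \<in> carrier R" "\<And>i. x \<ominus> V i \<in> J i" by blast
  have "(\<one> \<oplus> a) \<otimes> x \<ominus> \<one> \<in> J k" for k
  proof -
    define d where "d = x \<ominus> V k"
    have d: "d \<in> J k" "d \<in> carrier R" using x Vc d_def by auto
    have xd: "x = V k \<oplus> d" unfolding d_def using x(1) Vc by (simp add: minus_eq a_ac r_neg1 r_neg2 r_neg)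
    have "(\<one> \<oplus> a) \<otimes> x \<ominus> \<one> = ((\<one> \<oplus> a) \<otimes> V k \<ominus> \<one>) \<oplus> (d \<oplus> a \<otimes> d)"
      unfolding xd using ac Vc d(2) by (simp add: minus_eq l_distr r_distr a_ac)
    also have "\<dots> \<in> J k"
      using V(1)[of k] J_Suc[of k] unfolding P_def by (intro J_add d(1) J_mult_le[OF a d(1)]) auto
    finally show ?thesis .
  qed
  then have "(\<one> \<oplus> a) \<otimes> x \<ominus> \<one> = \<zero>" by (rule J_separated)
  then have inv: "(\<one> \<oplus> a) \<otimes> x = \<one>" using ac x(1) by simp
  have "x \<ominus> \<one> = (x \<ominus> V 1) \<oplus> (V 1 \<ominus> \<one>)" using x(1) Vc by (simp add: minus_eq a_assoc r_neg1 r_neg2)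
  also have "\<dots> \<in> J (Suc 0)" using x(2)[of 1] V(1)[of 1] unfolding P_def by (intro J_add) simp_all
  finally have "x \<ominus> \<one> \<in> J (Suc 0)" .
  moreover have "\<one> \<oplus> (x \<ominus> \<one>) = x" using x(1) by (simp add: minus_eq a_ac r_neg1 r_neg2 r_neg)
  ultimately show ?thesis using inv by (intro bexI[of _ "x \<ominus> \<one>"]) simp_all
qed

end

section \<open>A criterion for a definable bijection between a field and its nonzero elements\<close>

definition nonzero :: "'a ring \<Rightarrow> 'a set" where
  "nonzero R = carrier R - {\<zero>\<^bsub>R\<^esub>}"

definition translate :: "'a ring \<Rightarrow> 'a \<Rightarrow> 'a set \<Rightarrow> 'a set" where
  "translate R a S = (\<lambda>x. a \<otimes>\<^bsub>R\<^esub> x) ` S"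

definition powers :: "'a ring \<Rightarrow> nat \<Rightarrow> 'a set \<Rightarrow> 'a set" where
  "powers R n S = (\<lambda>x. x [^]\<^bsub>R\<^esub> n) ` S"

text \<open>If \<open>x \<mapsto> x^m\<close> is injective on \<open>S\<close>, this makes \<open>S\<close> equivalent to \<open>N\<close> copies of itself.
  It is the multiplicative form of the fact that \<open>\<int>\<close> is the union of the \<open>m\<close> cosets of the
  multiples of \<open>m\<close>.\<close>

definition power_partition :: "'a ring \<Rightarrow> nat \<Rightarrow> nat \<Rightarrow> 'a set \<Rightarrow> bool" where
  "power_partition R m N S \<longleftrightarrow>
     (\<exists>a. (\<forall>j<N. a j \<in> nonzero R) \<and> S = (\<Union>j<N. translate R (a j) (powers R m S)) \<and>
        (\<forall>i<N. \<forall>j<N. i \<noteq> j \<longrightarrow>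
           translate R (a i) (powers R m S) \<inter> translate R (a j) (powers R m S) = {}))"

text \<open>In the fields of interest \<open>D\<close> consists of the elements of positive value in a group
  \<open>A\<close> of finite index, and \<open>g\<close> enumerates representatives of the cosets of \<open>A\<close>, chosen such
  that the union of the translates of \<open>D\<close> is a ball around \<open>0\<close> without its centre.\<close>

definition ball :: "'a ring \<Rightarrow> 'a set \<Rightarrow> (nat \<Rightarrow> 'a) \<Rightarrow> nat \<Rightarrow> 'a set" where
  "ball R D g c = insert \<zero>\<^bsub>R\<^esub> (\<Union>i<c. translate R (g i) D)"

definition unit_ball :: "'a ring \<Rightarrow> 'a set \<Rightarrow> (nat \<Rightarrow> 'a) \<Rightarrow> nat \<Rightarrow> 'a set" where
  "unit_ball R D g c = (\<lambda>x. \<one>\<^bsub>R\<^esub> \<oplus>\<^bsub>R\<^esub> x) ` ball R D g c"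

text \<open>The elements of \<open>D\<close> with \<open>2 v(x) > v(b k)\<close>, where \<open>v\<close> is the valuation. If \<open>v\<close> has
  values in \<open>\<int>\<^sup>r\<close>, ordered lexicographically with the last coordinate dominant, and \<open>v(b k)\<close>
  is the unit vector with index \<open>k\<close>, these are the elements whose value is positive already
  in the coordinates of index at least \<open>k\<close>. The layer \<open>k\<close> then has values with \<open>k\<close> arbitrary
  coordinates, followed by a positive one and zeros.\<close>

definition segment :: "'a ring \<Rightarrow> 'a set \<Rightarrow> (nat \<Rightarrow> 'a) \<Rightarrow> nat \<Rightarrow> nat \<Rightarrow> 'a set" where
  "segment R D b r k = (if k < r then {x \<in> D. x \<otimes>\<^bsub>R\<^esub> x \<in> translate R (b k) D} else {})"

definition layer :: "'a ring \<Rightarrow> 'a set \<Rightarrow> (nat \<Rightarrow> 'a) \<Rightarrow> nat \<Rightarrow> nat \<Rightarrow> 'a set" where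
  "layer R D b r k = segment R D b r k - segment R D b r (Suc k)"

locale plain_field = field R for R :: "'a ring" (structure)

sublocale plain_field \<subseteq> plain_ring ..

context plain_field
begin

lemma nonzero_iff: "x \<in> nonzero R \<longleftrightarrow> x \<in> carrier R \<and> x \<noteq> \<zero>"
  by (auto simp: nonzero_def)

lemma nonzero_mult: "x \<in> nonzero R \<Longrightarrow> y \<in> nonzero R \<Longrightarrow> x \<otimes> y \<in> nonzero R"
  by (auto simp: nonzero_def integral_iff)

lemma nonzero_one: "\<one> \<in> nonzero R"
  by (auto simp: nonzero_def)

lemma nonzero_pow: "x \<in> nonzero R \<Longrightarrow> x [^] (n::nat) \<in> nonzero R"
  by (induction n) (auto simp: nonzero_one nonzero_mult)

lemma nonzero_inv: "x \<in> nonzero R \<Longrightarrow> inv x \<in> nonzero R"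
  by (metis Diff_iff field_Units nonzero_def Units_inv_Units)

lemma nonzero_r_inv: "x \<in> nonzero R \<Longrightarrow> x \<otimes> inv x = \<one>"
  by (metis field_Units nonzero_def Units_r_inv)

lemma nonzero_l_inv: "x \<in> nonzero R \<Longrightarrow> inv x \<otimes> x = \<one>"
  by (metis field_Units nonzero_def Units_l_inv)

lemma nonzero_closed: "x \<in> nonzero R \<Longrightarrow> x \<in> carrier R"
  by (simp add: nonzero_def)

lemma nonzero_cancel: "a \<in> nonzero R \<Longrightarrow> x \<in> carrier R \<Longrightarrow> y \<in> carrier R \<Longrightarrow> a \<otimes> x = a \<otimes> y \<longleftrightarrow> x = y"
  by (metis m_lcancel nonzero_iff)

lemma definable_map_translate: "a \<in> carrier R \<Longrightarrow> definable_map R (\<lambda>x. a \<otimes> x)"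
  by (intro definable_map_intros)

lemma definable_subset_translate:
  "definable_subset R S \<Longrightarrow> a \<in> carrier R \<Longrightarrow> definable_subset R (translate R a S)"
  unfolding translate_def by (intro definable_subset_image definable_map_translate)

lemma definable_subset_powers: "definable_subset R S \<Longrightarrow> definable_subset R (powers R n S)"
  unfolding powers_def by (intro definable_subset_image definable_map_intros)

lemma definable_subset_nonzero: "definable_subset R (nonzero R)"
  unfolding nonzero_def
  by (intro definable_subset_Diff definable_subset_carrier definable_subset_singleton zero_closed)

lemma definably_equivalent_translate:
  assumes "definable_subset R S" "a \<in> nonzero R"
  shows "definably_equivalent R (S \<times> {i}) (translate R a S \<times> {j})"
  unfolding translate_def
  by (rule definably_equivalent_image)
    (use assms nonzero_cancel in \<open>auto simp: definable_subset_def inj_on_def subset_iff intro: definable_map_translate nonzero_closed\<close>)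

lemma definably_equivalent_power_translate:
  assumes "definable_subset R S" "a \<in> nonzero R" "inj_on (\<lambda>x. x [^] (m::nat)) S"
  shows "definably_equivalent R (S \<times> {i}) (translate R a (powers R m S) \<times> {j})"
  using definably_equivalent_trans[OF
      definably_equivalent_image[OF assms(1) definable_map_pow[OF definable_map_id] assms(3), of i i]
      definably_equivalent_translate[OF definable_subset_powers[OF assms(1), of m] assms(2), unfolded powers_def, of i j]]
  unfolding powers_def .

lemma definably_equivalent_copies:
  assumes "definable_subset R H" "inj_on (\<lambda>x. x [^] m) H" "power_partition R m N H"
  shows "definably_equivalent R (H \<times> {i}) (H \<times> {n..<n + N})"
proof -
  obtain a where a: "\<forall>j<N. a j \<in> nonzero R" "H = (\<Union>j<N. translate R (a j) (powers R m H))"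
    "\<forall>i<N. \<forall>j<N. i \<noteq> j \<longrightarrow> translate R (a i) (powers R m H) \<inter> translate R (a j) (powers R m H) = {}"
    using assms(3) unfolding power_partition_def by blast
  have "definably_equivalent R (\<Union>j\<in>{..<N}. translate R (a j) (powers R m H) \<times> {i}) (\<Union>j\<in>{..<N}. H \<times> {n + j})"
  proof (rule definably_equivalent_UN)
    show "definably_equivalent R (translate R (a j) (powers R m H) \<times> {i}) (H \<times> {n + j})" if "j \<in> {..<N}" for j
      by (rule definably_equivalent_sym[OF definably_equivalent_power_translate]) (use that a assms in auto)
    show "translate R (a j) (powers R m H) \<times> {i} \<inter> translate R (a k) (powers R m H) \<times> {i} = {}"
      if "j \<in> {..<N}" "k \<in> {..<N}" "j \<noteq> k" for j k using a(3) that by blast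
  qed auto
  moreover have "(\<Union>j\<in>{..<N}. translate R (a j) (powers R m H) \<times> {i}) = H \<times> {i}"
    using a(2) by blast
  moreover have "(\<Union>j\<in>{..<N}. H \<times> {n + j}) = H \<times> {n..<n + N}"
  proof -
    have "x \<in> (\<lambda>j. n + j) ` {..<N}" if "x \<in> {n..<n + N}" for x
      using that by (intro image_eqI[of _ _ "x - n"]) auto
    then show ?thesis by fastforce
  qed
  ultimately show ?thesis by simp
qed

text \<open>Replacing one of the copies by \<open>N\<close> copies increases their number by \<open>N - 1\<close>.\<close>

lemma definably_equivalent_more_copies:
  assumes "definable_subset R H" "inj_on (\<lambda>x. x [^] m) H" "power_partition R m N H" "N > 0"
  shows "definably_equivalent R (H \<times> {0}) (H \<times> {0..<Suc (u * (N - 1))})"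
proof (induction u)
  case 0
  then show ?case using definably_equivalent_relabel[OF assms(1), of 0 0] by simp
next
  case (Suc u)
  let ?n = "u * (N - 1)"
  have "definably_equivalent R (H \<times> {0..<?n} \<union> H \<times> {?n}) (H \<times> {0..<?n} \<union> H \<times> {?n..<?n + N})"
  proof (rule definably_equivalent_Un)
    show "definably_equivalent R (H \<times> {?n}) (H \<times> {?n..<?n + N})"
      by (rule definably_equivalent_copies[OF assms(1-3)])
    have "definably_equivalent R (\<Union>j\<in>{0..<?n}. H \<times> {j}) (\<Union>j\<in>{0..<?n}. H \<times> {j})"
      by (rule definably_equivalent_UN) (auto intro: definably_equivalent_relabel[OF assms(1)])
    moreover have "(\<Union>j\<in>{0..<?n}. H \<times> {j}) = H \<times> {0..<?n}" by auto
    ultimately show "definably_equivalent R (H \<times> {0..<?n}) (H \<times> {0..<?n})" by simp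
  qed auto
  moreover have "H \<times> {0..<?n} \<union> H \<times> {?n} = H \<times> {0..<Suc ?n}" by auto
  moreover have "{0..<?n} \<union> {?n..<?n + N} = {0..<Suc (Suc u * (N - 1))}"
  proof -
    obtain N' where "N = Suc N'" using assms(4) gr0_implies_Suc by blast
    then show ?thesis by auto
  qed
  then have "H \<times> {0..<?n} \<union> H \<times> {?n..<?n + N} = H \<times> {0..<Suc (Suc u * (N - 1))}"
    unfolding Sigma_Un_distrib2[symmetric] by (rule arg_cong)
  ultimately show ?case by (intro definably_equivalent_trans[OF Suc]) (simp only:)
qed

end

text \<open>The properties of a valued field on which the bijection is based, stated without a
  valuation \<open>v\<close>. The group \<open>A\<close> has finite index \<open>c\<close> and no elements of order dividing \<open>m\<close>
  except \<open>1\<close>; \<open>D\<close> stands for its elements with \<open>v > 0\<close>, \<open>T = unit_ball R D g c\<close> for the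
  one-units, and \<open>s\<close> has the least positive value in \<open>A\<close>.

  The conditions on \<open>q\<close> make \<open>D \<union> T\<close>, the set of elements of \<open>A\<close> with \<open>v \<ge> 0\<close>, definable in
  terms of \<open>A\<close>, and \<open>A_powers\<close> makes \<open>A\<close> definable. The last group of conditions splits \<open>D\<close>
  into \<open>r\<close> layers, each of which is equivalent to several copies of itself. The partition of
  \<open>A\<close> itself is what produces the new layer when Laurent series are adjoined.\<close>

locale tame_field = plain_field R for R :: "'a ring" (structure) +
  fixes A D :: "'a set" and s q :: 'a and g b :: "nat \<Rightarrow> 'a" and c r m M :: nat
  assumes A_nonzero: "A \<subseteq> nonzero R" and A_one: "\<one> \<in> A"
    and A_mult: "x \<in> A \<Longrightarrow> y \<in> A \<Longrightarrow> x \<otimes> y \<in> A" and A_inv: "x \<in> A \<Longrightarrow> inv x \<in> A"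
    and D_A: "D \<subseteq> A" and T_A: "unit_ball R D g c \<subseteq> A"
    and D_T: "D \<inter> unit_ball R D g c = {}"
    and s_nonzero: "s \<in> nonzero R" and D_shift: "D = translate R s (D \<union> unit_ball R D g c)"
    and g_nonzero: "i < c \<Longrightarrow> g i \<in> nonzero R"
    and g_cover: "x \<in> nonzero R \<Longrightarrow> \<exists>i<c. x \<in> translate R (g i) A"
    and g_disjoint: "i < c \<Longrightarrow> j < c \<Longrightarrow> i \<noteq> j \<Longrightarrow> translate R (g i) A \<inter> translate R (g j) A = {}"
    and torsion_free: "x \<in> A \<Longrightarrow> x [^] m = \<one> \<Longrightarrow> x = \<one>"
    and q_nonzero: "q \<in> nonzero R"
    and q_power: "x \<in> D \<union> unit_ball R D g c \<Longrightarrow> \<one> \<oplus> q \<otimes> x [^] m \<in> powers R m A"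
    and q_not_power: "x \<in> A - (D \<union> unit_ball R D g c) \<Longrightarrow> \<one> \<oplus> q \<otimes> x [^] m \<in> translate R q (powers R m A)"
    and q_disjoint: "translate R q (powers R m A) \<inter> powers R m A = {}"
    and A_powers: "\<exists>C\<subseteq>nonzero R. finite C \<and> A = (\<Union>a\<in>C. translate R a (powers R M (nonzero R)))"
    and r_pos: "r > 0" and m_pos: "m > 0" and M_pos: "M > 0"
    and b_A: "k < r \<Longrightarrow> b k \<in> A"
    and segment_0: "segment R D b r 0 = D"
    and segment_Suc: "segment R D b r (Suc k) \<subseteq> segment R D b r k"
    and layer_partition: "k < r \<Longrightarrow> power_partition R m (m ^ Suc k) (layer R D b r k)"
    and A_partition: "power_partition R m (m ^ r) A"
begin

lemma inj_power: "inj_on (\<lambda>x. x [^] m) A"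
proof (rule inj_onI)
  fix x y assume xy: "x \<in> A" "y \<in> A" "x [^] m = y [^] m"
  have nz: "x \<in> nonzero R" "y \<in> nonzero R" using xy A_nonzero by auto
  note cl = nz[THEN nonzero_closed] nonzero_inv[OF nz(2), THEN nonzero_closed]
  have "(x \<otimes> inv y) [^] m = x [^] m \<otimes> inv y [^] m"
    using cl by (simp add: nat_pow_distrib)
  also have "\<dots> = (y \<otimes> inv y) [^] m"
    using cl xy(3) by (simp add: nat_pow_distrib)
  also have "\<dots> = \<one>" using nonzero_r_inv[OF nz(2)] by simp
  finally have "x \<otimes> inv y = \<one>"
    using torsion_free A_mult[OF xy(1) A_inv[OF xy(2)]] by blast
  then have "x \<otimes> inv y \<otimes> y = y" using cl by simp
  then show "x = y" using cl nonzero_l_inv[OF nz(2)] by (simp add: m_assoc)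
qed

lemma definable_A: "definable_subset R A"
proof -
  obtain C where C: "C \<subseteq> nonzero R" "finite C" "A = (\<Union>a\<in>C. translate R a (powers R M (nonzero R)))"
    using A_powers by blast
  have "definable_subset R (\<Union>a\<in>C. translate R a (powers R M (nonzero R)))"
    by (intro definable_subset_UN definable_subset_translate definable_subset_powers
        definable_subset_nonzero C(2)) (use C(1) nonzero_closed in blast)
  then show ?thesis using C(3) by simp
qed

text \<open>The test whether \<open>1 + q x^m\<close> is an \<open>m\<close>-th power in \<open>A\<close> cuts out \<open>D \<union> T\<close>, and
  multiplication by \<open>s\<close> maps this set to \<open>D\<close>.\<close>

lemma definable_D: "definable_subset R D"
proof -
  have "D \<union> unit_ball R D g c = {x \<in> A. \<one> \<oplus> q \<otimes> x [^] m \<in> powers R m A}"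
    using q_power q_not_power q_disjoint D_A T_A by blast
  moreover have "definable_subset R {x \<in> A. \<one> \<oplus> q \<otimes> x [^] m \<in> powers R m A}"
    by (intro definable_subset_preimage definable_A definable_subset_powers definable_map_intros
        one_closed nonzero_closed[OF q_nonzero])
  ultimately have "definable_subset R (translate R s (D \<union> unit_ball R D g c))"
    using nonzero_closed[OF s_nonzero] by (intro definable_subset_translate) simp_all
  then show ?thesis using D_shift by simp
qed

lemma D_nonzero: "x \<in> D \<Longrightarrow> x \<in> nonzero R"
  using D_A A_nonzero by blast

lemma definable_segment: "definable_subset R (segment R D b r k)"
  using definable_D subsetD[OF A_nonzero b_A, THEN nonzero_closed]
  by (auto simp: segment_def intro!: definable_subset_empty definable_subset_preimage
      definable_subset_translate definable_map_intros)

lemma definable_layer: "definable_subset R (layer R D b r k)"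
  unfolding layer_def by (intro definable_subset_Diff definable_segment)

lemma segment_antimono: "k \<le> l \<Longrightarrow> segment R D b r l \<subseteq> segment R D b r k"
  using segment_Suc by (rule lift_Suc_antimono_le)

lemma layer_disjoint:
  assumes "k \<noteq> l" shows "layer R D b r k \<inter> layer R D b r l = {}"
proof -
  have "layer R D b r k \<inter> layer R D b r l = {}" if "k < l" for k l
    using segment_antimono[of "Suc k" l] that unfolding layer_def by auto
  then show ?thesis using assms by (metis inf_commute linorder_neqE_nat)
qed

lemma D_layers: "D = (\<Union>k<r. layer R D b r k)"
proof
  show "D \<subseteq> (\<Union>k<r. layer R D b r k)"
  proof
    fix x assume x: "x \<in> D"
    define k where "k = (LEAST k. x \<notin> segment R D b r k)"
    have "x \<notin> segment R D b r r" by (simp add: segment_def)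
    then have k: "x \<notin> segment R D b r k" "k \<le> r"
      unfolding k_def by (rule LeastI, rule Least_le)
    have "k \<noteq> 0" using k(1) x segment_0 by metis
    then obtain l where l: "k = Suc l" using not0_implies_Suc by blast
    then have "x \<in> segment R D b r l"
      using not_less_Least[of l "\<lambda>k. x \<notin> segment R D b r k"] unfolding k_def[symmetric] by simp
    then have "x \<in> layer R D b r l" using k(1) l by (simp add: layer_def)
    then show "x \<in> (\<Union>k<r. layer R D b r k)" using l k(2) by auto
  qed
  have "segment R D b r k \<subseteq> D" for k by (auto simp: segment_def)
  then show "(\<Union>k<r. layer R D b r k) \<subseteq> D" unfolding layer_def by blast
qed

lemma g_translate_disjoint: "i < c \<Longrightarrow> j < c \<Longrightarrow> i \<noteq> j \<Longrightarrow> translate R (g i) D \<inter> translate R (g j) D = {}"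
  using g_disjoint D_A unfolding translate_def by blast

lemma zero_notin_translate: "i < c \<Longrightarrow> \<zero> \<notin> translate R (g i) D"
  using nonzero_mult[OF g_nonzero D_nonzero] unfolding translate_def nonzero_iff by fastforce

lemma definable_ball: "definable_subset R (ball R D g c)"
proof -
  have "definable_subset R ({\<zero>} \<union> (\<Union>i\<in>{..<c}. translate R (g i) D))"
    by (intro definable_subset_Un definable_subset_UN definable_subset_translate definable_D
        definable_subset_singleton zero_closed) (use g_nonzero nonzero_closed in auto)
  then show ?thesis by (simp add: ball_def)
qed

lemma ball_equivalent:
  "definably_equivalent R (ball R D g c \<times> {1}) (D \<times> {1..<Suc c} \<union> {\<zero>} \<times> {Suc c})"
proof -
  have "definably_equivalent R (\<Union>i\<in>{..<c}. translate R (g i) D \<times> {1}) (\<Union>i\<in>{..<c}. D \<times> {Suc i})"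
  proof (rule definably_equivalent_UN)
    show "definably_equivalent R (translate R (g i) D \<times> {1}) (D \<times> {Suc i})" if "i \<in> {..<c}" for i
      by (rule definably_equivalent_sym[OF definably_equivalent_translate[OF definable_D]])
        (use that g_nonzero in auto)
    show "translate R (g i) D \<times> {1} \<inter> translate R (g j) D \<times> {1} = {}"
      if "i \<in> {..<c}" "j \<in> {..<c}" "i \<noteq> j" for i j using g_translate_disjoint that by blast
  qed auto
  then have "definably_equivalent R ((\<Union>i\<in>{..<c}. translate R (g i) D \<times> {1}) \<union> {\<zero>} \<times> {1})
      ((\<Union>i\<in>{..<c}. D \<times> {Suc i}) \<union> {\<zero>} \<times> {Suc c})"
    by (rule definably_equivalent_Un[OF _ definably_equivalent_relabel[OF definable_subset_singleton[OF zero_closed]]])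
      (use zero_notin_translate in auto)
  moreover have "(\<Union>i\<in>{..<c}. translate R (g i) D \<times> {1}) \<union> {\<zero>} \<times> {1::nat} = ball R D g c \<times> {1}"
    unfolding ball_def by blast
  moreover have "(\<Union>i\<in>{..<c}. D \<times> {Suc i}) = D \<times> {1..<Suc c}"
  proof -
    have "x \<in> Suc ` {..<c}" if "x \<in> {1..<Suc c}" for x
      using that by (intro image_eqI[of _ _ "x - 1"]) auto
    then show ?thesis by fastforce
  qed
  ultimately show ?thesis by simp
qed

text \<open>Layer \<open>k\<close> is equivalent to \<open>m^(k+1)\<close> copies of itself, hence to \<open>1 + u (m^(k+1) - 1)\<close>
  copies for every \<open>u\<close>. The divisibility allows a different \<open>u\<close> for each layer such that the
  number of copies is \<open>1 + c\<close> for all of them.\<close>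

lemma D_absorbs_copies:
  assumes "\<And>k. k < r \<Longrightarrow> m ^ Suc k - 1 dvd c"
  shows "definably_equivalent R (D \<times> {0..<Suc c}) (D \<times> {0})"
proof -
  have "definably_equivalent R (\<Union>k\<in>{..<r}. layer R D b r k \<times> {0..<Suc c}) (\<Union>k\<in>{..<r}. layer R D b r k \<times> {0})"
  proof (rule definably_equivalent_UN)
    fix k assume "k \<in> {..<r}"
    then have k: "k < r" by simp
    then obtain u where u: "c = (m ^ Suc k - 1) * u" using assms by (auto elim: dvdE)
    have "layer R D b r k \<subseteq> A" using D_layers k D_A by blast
    then have "inj_on (\<lambda>x. x [^] m) (layer R D b r k)" using inj_power inj_on_subset by blast
    then have "definably_equivalent R (layer R D b r k \<times> {0}) (layer R D b r k \<times> {0..<Suc (u * (m ^ Suc k - 1))})"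
      by (rule definably_equivalent_more_copies[OF definable_layer _ layer_partition[OF k]]) (use m_pos in simp)
    moreover have "u * (m ^ Suc k - 1) = c" using u by (simp only: mult.commute)
    ultimately show "definably_equivalent R (layer R D b r k \<times> {0..<Suc c}) (layer R D b r k \<times> {0})"
      using definably_equivalent_sym by metis
  qed (use layer_disjoint in blast)+
  moreover have "(\<Union>k\<in>{..<r}. layer R D b r k \<times> I) = D \<times> I" for I :: "nat set"
    using D_layers by blast
  ultimately show ?thesis by simp
qed

text \<open>The chain is \<open>D \<cong> D \<union> T \<cong> D + (c D + point) \<cong> D + point\<close>. It combines the
  multiplication by \<open>s\<close>, the translation of \<open>T\<close> to a ball around \<open>0\<close>, and the absorption of
  \<open>c\<close> copies of \<open>D\<close>.\<close>

lemma D_absorbs_point: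
  assumes "\<And>k. k < r \<Longrightarrow> m ^ Suc k - 1 dvd c"
  shows "definably_equivalent R (D \<times> {0}) (D \<times> {0} \<union> {\<zero>} \<times> {0})"
proof -
  let ?T = "unit_ball R D g c"
  have T: "definable_subset R ?T"
    unfolding unit_ball_def by (intro definable_subset_image definable_ball definable_map_intros one_closed)
  have "definably_equivalent R ((D \<union> ?T) \<times> {0}) (translate R s (D \<union> ?T) \<times> {0})"
    by (intro definably_equivalent_translate definable_subset_Un definable_D T s_nonzero)
  then have 1: "definably_equivalent R (D \<times> {0}) ((D \<union> ?T) \<times> {0})"
    using D_shift definably_equivalent_sym by metis
  have "definably_equivalent R (ball R D g c \<times> {1}) (?T \<times> {0})"
    unfolding unit_ball_def
  proof (rule definably_equivalent_image[OF definable_ball])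
    show "definable_map R (\<lambda>x. \<one> \<oplus> x)" by (intro definable_map_intros one_closed)
    show "inj_on (\<lambda>x. \<one> \<oplus> x) (ball R D g c)"
      using definable_subset_closed[OF definable_ball] by (intro inj_onI) (metis a_assoc l_neg one_closed a_inv_closed l_zero)
  qed
  from definably_equivalent_trans[OF definably_equivalent_sym[OF this] ball_equivalent]
  have "definably_equivalent R (D \<times> {0} \<union> ?T \<times> {0}) (D \<times> {0} \<union> (D \<times> {1..<Suc c} \<union> {\<zero>} \<times> {Suc c}))"
    by (rule definably_equivalent_Un[OF definably_equivalent_relabel[OF definable_D]]) (use D_T in auto)
  moreover have "D \<times> {0} \<union> ?T \<times> {0::nat} = (D \<union> ?T) \<times> {0}" by auto
  moreover have "{0} \<union> {1..<Suc c} = {0..<Suc c}" by auto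
  then have "D \<times> {0} \<union> (D \<times> {1..<Suc c} \<union> {\<zero>} \<times> {Suc c}) = D \<times> {0..<Suc c} \<union> {\<zero>} \<times> {Suc c}"
    unfolding Un_assoc[symmetric] Sigma_Un_distrib2[symmetric] by (simp only:)
  ultimately have 2: "definably_equivalent R ((D \<union> ?T) \<times> {0}) (D \<times> {0..<Suc c} \<union> {\<zero>} \<times> {Suc c})"
    by simp
  have 3: "definably_equivalent R (D \<times> {0..<Suc c} \<union> {\<zero>} \<times> {Suc c}) (D \<times> {0} \<union> {\<zero>} \<times> {0})"
    by (rule definably_equivalent_Un[OF D_absorbs_copies[OF assms] definably_equivalent_relabel])
      (use D_nonzero in \<open>auto simp: nonzero_iff intro: definable_subset_singleton\<close>)
  show ?thesis by (rule definably_equivalent_trans[OF 1 definably_equivalent_trans[OF 2 3]])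
qed

text \<open>The bijection is the identity outside of \<open>D\<close> and zero.\<close>

theorem definable_bij_nonzero:
  assumes "\<And>k. k < r \<Longrightarrow> m ^ Suc k - 1 dvd c"
  shows "\<exists>f. definable_bij R f {[x] |x. x \<in> carrier R} {[x] |x. x \<in> carrier R - {\<zero>}}"
proof -
  let ?rest = "carrier R - (D \<union> {\<zero>})"
  have rest: "definable_subset R ?rest"
    by (intro definable_subset_Diff definable_subset_Un definable_subset_carrier definable_D
        definable_subset_singleton zero_closed)
  have "definably_equivalent R (?rest \<times> {0} \<union> D \<times> {0}) (?rest \<times> {0} \<union> (D \<times> {0} \<union> {\<zero>} \<times> {0}))"
    by (rule definably_equivalent_Un[OF definably_equivalent_relabel[OF rest] D_absorbs_point[OF assms]]) auto
  moreover have "?rest \<times> {0} \<union> D \<times> {0::nat} = (carrier R - {\<zero>}) \<times> {0}"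
    "?rest \<times> {0} \<union> (D \<times> {0} \<union> {\<zero>} \<times> {0::nat}) = carrier R \<times> {0}"
    using D_nonzero by (auto simp: nonzero_iff)
  ultimately have "definably_equivalent R (carrier R \<times> {0}) ((carrier R - {\<zero>}) \<times> {0})"
    using definably_equivalent_sym by metis
  then show ?thesis
    by (rule definably_equivalent_imp_bij)
      (intro definable_subset_Diff definable_subset_carrier definable_subset_singleton zero_closed)+
qed

end

section \<open>Laurent series\<close>

definition char_zero :: "'a ring \<Rightarrow> bool" where
  "char_zero R \<longleftrightarrow> (\<forall>n>0. [(n::nat)] \<cdot>\<^bsub>R\<^esub> \<one>\<^bsub>R\<^esub> \<noteq> \<zero>\<^bsub>R\<^esub>)"

text \<open>As for \<open>plain_ring\<close>, the restriction is to records without additional fields, over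
  which \<open>laurent_ring\<close> is defined.\<close>

locale plain_cring = cring R for R :: "'a ring" (structure)

sublocale plain_field \<subseteq> plain_cring ..

definition laurent_ideal :: "'a ring \<Rightarrow> nat \<Rightarrow> (int \<Rightarrow> 'a) set" where
  "laurent_ideal R i = {f \<in> carrier (laurent_ring R). \<forall>k<int i. f k = \<zero>\<^bsub>R\<^esub>}"

definition laurent_monom :: "'a ring \<Rightarrow> int \<Rightarrow> 'a \<Rightarrow> int \<Rightarrow> 'a" where
  "laurent_monom R n a = (\<lambda>k. if k = n then a else \<zero>\<^bsub>R\<^esub>)"

context plain_cring
begin

lemma finsum_swap:
  assumes "finite A" "finite B" "\<And>i j. i \<in> A \<Longrightarrow> j \<in> B \<Longrightarrow> f i j \<in> carrier R"
  shows "(\<Oplus>i\<in>A. \<Oplus>j\<in>B. f i j) = (\<Oplus>j\<in>B. \<Oplus>i\<in>A. f i j)"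
  using assms(1,3)
proof (induction A)
  case empty
  then show ?case by simp
next
  case (insert a A)
  have 1: "(\<lambda>i. \<Oplus>j\<in>B. f i j) \<in> A \<rightarrow> carrier R" using insert.prems by (auto intro!: finsum_closed)
  have 2: "(\<Oplus>j\<in>B. f a j) \<in> carrier R" using insert.prems by (auto intro!: finsum_closed)
  have "(\<Oplus>i\<in>insert a A. \<Oplus>j\<in>B. f i j) = (\<Oplus>j\<in>B. f a j) \<oplus> (\<Oplus>j\<in>B. \<Oplus>i\<in>A. f i j)"
    using insert 1 2 by simp
  also have "\<dots> = (\<Oplus>j\<in>B. f a j \<oplus> (\<Oplus>i\<in>A. f i j))"
    using insert.prems by (intro finsum_addf[symmetric]) (auto intro!: finsum_closed)
  also have "\<dots> = (\<Oplus>j\<in>B. \<Oplus>i\<in>insert a A. f i j)"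
    using insert.prems insert.hyps by (intro finsum_cong') (auto intro!: finsum_closed finsum_insert[symmetric])
  finally show ?case .
qed

abbreviation "G \<equiv> laurent_ring R"

lemma laurent_carrier: "f \<in> carrier G \<longleftrightarrow> (\<forall>k. f k \<in> carrier R) \<and> (\<exists>N. \<forall>k<N. f k = \<zero>)"
  by (simp add: laurent_ring_def)

lemma laurent_ops: "\<one>\<^bsub>G\<^esub> = (\<lambda>k. if k = 0 then \<one> else \<zero>)" "\<zero>\<^bsub>G\<^esub> = (\<lambda>k. \<zero>)" "f \<oplus>\<^bsub>G\<^esub> g = (\<lambda>k. f k \<oplus> g k)"
  by (simp_all add: laurent_ring_def)

lemma laurent_coeff: "f \<in> carrier G \<Longrightarrow> f k \<in> carrier R"
  by (simp add: laurent_carrier)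

lemma laurent_bound:
  assumes "f \<in> carrier G" obtains a where "a \<le> B" "\<And>k. k < a \<Longrightarrow> f k = \<zero>"
proof -
  obtain N where "\<forall>k<N. f k = \<zero>" using assms laurent_carrier by blast
  then show ?thesis by (intro that[of "min N B"]) auto
qed

text \<open>The index set in the definition of the product depends on the supports of both
  factors. It may be replaced by any finite set that contains it, which allows a common
  index set when several products are compared.\<close>

lemma laurent_mult:
  assumes fg: "\<And>k. f k \<in> carrier R" "\<And>k. g k \<in> carrier R"
    and S: "finite S" "\<And>i. f i \<noteq> \<zero> \<Longrightarrow> g (k - i) \<noteq> \<zero> \<Longrightarrow> i \<in> S"
  shows "(f \<otimes>\<^bsub>G\<^esub> g) k = (\<Oplus>i\<in>S. f i \<otimes> g (k - i))"
proof -
  have "(f \<otimes>\<^bsub>G\<^esub> g) k = (\<Oplus>i\<in>{i. f i \<noteq> \<zero> \<and> g (k - i) \<noteq> \<zero>}. f i \<otimes> g (k - i))"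
    by (simp add: laurent_ring_def)
  also have "\<dots> = (\<Oplus>i\<in>S. f i \<otimes> g (k - i))"
    by (rule add.finprod_mono_neutral_cong_left) (use fg S in auto)
  finally show ?thesis .
qed

lemma laurent_mult_interval:
  assumes "f \<in> carrier G" "g \<in> carrier G" "\<And>k. k < a \<Longrightarrow> f k = \<zero>" "\<And>k. k < b \<Longrightarrow> g k = \<zero>"
    and "l \<le> a" "k - b \<le> u"
  shows "(f \<otimes>\<^bsub>G\<^esub> g) k = (\<Oplus>i\<in>{l..u}. f i \<otimes> g (k - i))"
proof (rule laurent_mult)
  fix i assume "f i \<noteq> \<zero>" "g (k - i) \<noteq> \<zero>"
  then have "\<not> i < a" "\<not> k - i < b" using assms by blast+
  then show "i \<in> {l..u}" using assms by auto
qed (use assms laurent_coeff in auto)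

lemma laurent_mult_below:
  assumes "f \<in> carrier G" "g \<in> carrier G" "\<And>k. k < a \<Longrightarrow> f k = \<zero>" "\<And>k. k < b \<Longrightarrow> g k = \<zero>" "k < a + b"
  shows "(f \<otimes>\<^bsub>G\<^esub> g) k = \<zero>"
proof -
  have "(f \<otimes>\<^bsub>G\<^esub> g) k = (\<Oplus>i\<in>{a..k - b}. f i \<otimes> g (k - i))"
    by (rule laurent_mult_interval[OF assms(1-4)]) auto
  moreover have "{a..k - b} = {}" using assms(5) by auto
  ultimately show ?thesis by simp
qed

lemma laurent_mult_lowest:
  assumes "f \<in> carrier G" "g \<in> carrier G" "\<And>k. k < a \<Longrightarrow> f k = \<zero>" "\<And>k. k < b \<Longrightarrow> g k = \<zero>"
  shows "(f \<otimes>\<^bsub>G\<^esub> g) (a + b) = f a \<otimes> g b"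
proof -
  have "(f \<otimes>\<^bsub>G\<^esub> g) (a + b) = (\<Oplus>i\<in>{a..a}. f i \<otimes> g (a + b - i))"
    by (rule laurent_mult_interval[OF assms(1-4)]) auto
  then show ?thesis using assms(1,2) laurent_coeff by simp
qed

lemma laurent_mult_closed:
  assumes "f \<in> carrier G" "g \<in> carrier G" shows "f \<otimes>\<^bsub>G\<^esub> g \<in> carrier G"
proof -
  obtain a where a: "\<And>k. k < a \<Longrightarrow> f k = \<zero>" using laurent_bound[OF assms(1), of 0] by blast
  obtain b where b: "\<And>k. k < b \<Longrightarrow> g k = \<zero>" using laurent_bound[OF assms(2), of 0] by blast
  have "(f \<otimes>\<^bsub>G\<^esub> g) k = \<zero>" if "k < a + b" for k
    using laurent_mult_below[OF assms a b that] by blast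
  moreover have "(f \<otimes>\<^bsub>G\<^esub> g) k \<in> carrier R" for k
  proof -
    have "(f \<otimes>\<^bsub>G\<^esub> g) k = (\<Oplus>i\<in>{a..k - b}. f i \<otimes> g (k - i))"
      by (rule laurent_mult_interval[OF assms a b]) auto
    then show ?thesis using assms laurent_coeff by (auto intro!: finsum_closed)
  qed
  ultimately show ?thesis unfolding laurent_carrier by blast
qed

lemma laurent_mult_comm:
  assumes "f \<in> carrier G" "g \<in> carrier G" shows "f \<otimes>\<^bsub>G\<^esub> g = g \<otimes>\<^bsub>G\<^esub> f"
proof
  fix k
  obtain a where a: "\<And>k. k < a \<Longrightarrow> f k = \<zero>" using laurent_bound[OF assms(1), of 0] by blast
  obtain b where b: "\<And>k. k < b \<Longrightarrow> g k = \<zero>" using laurent_bound[OF assms(2), of 0] by blast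
  have "(f \<otimes>\<^bsub>G\<^esub> g) k = (\<Oplus>i\<in>{a..k - b}. f i \<otimes> g (k - i))"
    by (rule laurent_mult_interval[OF assms a b]) auto
  also have "{a..k - b} = (\<lambda>i. k - i) ` {b..k - a}"
    by (auto intro!: image_eqI[of _ _ "k - _"])
  also have "(\<Oplus>i\<in>(\<lambda>i. k - i) ` {b..k - a}. f i \<otimes> g (k - i)) = (\<Oplus>i\<in>{b..k - a}. f (k - i) \<otimes> g (k - (k - i)))"
    using assms laurent_coeff by (intro finsum_reindex) (auto simp: inj_on_def)
  also have "\<dots> = (\<Oplus>i\<in>{b..k - a}. g i \<otimes> f (k - i))"
    using assms laurent_coeff by (intro finsum_cong') (auto intro: m_comm)
  also have "\<dots> = (g \<otimes>\<^bsub>G\<^esub> f) k"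
    by (rule laurent_mult_interval[OF assms(2,1) b a, symmetric]) auto
  finally show "(f \<otimes>\<^bsub>G\<^esub> g) k = (g \<otimes>\<^bsub>G\<^esub> f) k" .
qed

lemma laurent_mult_assoc:
  assumes "f \<in> carrier G" "g \<in> carrier G" "h \<in> carrier G"
  shows "(f \<otimes>\<^bsub>G\<^esub> g) \<otimes>\<^bsub>G\<^esub> h = f \<otimes>\<^bsub>G\<^esub> (g \<otimes>\<^bsub>G\<^esub> h)"
proof
  fix k
  obtain a1 where a1: "a1 \<le> 0" "\<And>k. k < a1 \<Longrightarrow> f k = \<zero>" using laurent_bound[OF assms(1)] by blast
  obtain a2 where a2: "a2 \<le> a1" "\<And>k. k < a2 \<Longrightarrow> g k = \<zero>" using laurent_bound[OF assms(2)] by blast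
  obtain a where a3: "a \<le> a2" "\<And>k. k < a \<Longrightarrow> h k = \<zero>" using laurent_bound[OF assms(3)] by blast
  have f: "\<And>k. k < a \<Longrightarrow> f k = \<zero>" and g: "\<And>k. k < a \<Longrightarrow> g k = \<zero>" and h: "\<And>k. k < a \<Longrightarrow> h k = \<zero>"
    using a1 a2 a3 by auto
  note c = laurent_coeff[OF assms(1)] laurent_coeff[OF assms(2)] laurent_coeff[OF assms(3)]
  note fg = laurent_mult_closed[OF assms(1,2)] and gh = laurent_mult_closed[OF assms(2,3)]
  have fgb: "\<And>k. k < 2 * a \<Longrightarrow> (f \<otimes>\<^bsub>G\<^esub> g) k = \<zero>"
    by (rule laurent_mult_below[OF assms(1,2) f g]) auto
  have ghb: "\<And>k. k < 2 * a \<Longrightarrow> (g \<otimes>\<^bsub>G\<^esub> h) k = \<zero>"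
    by (rule laurent_mult_below[OF assms(2,3) g h]) auto
  let ?I = "{2 * a..k - a}" and ?W = "{a..k - 2 * a}"
  have "((f \<otimes>\<^bsub>G\<^esub> g) \<otimes>\<^bsub>G\<^esub> h) k = (\<Oplus>i\<in>?I. (f \<otimes>\<^bsub>G\<^esub> g) i \<otimes> h (k - i))"
    by (rule laurent_mult_interval[OF fg assms(3) fgb h]) auto
  also have "\<dots> = (\<Oplus>i\<in>?I. \<Oplus>j\<in>?W. f j \<otimes> (g (i - j) \<otimes> h (k - i)))"
  proof (rule finsum_cong')
    fix i assume i: "i \<in> ?I"
    have "(f \<otimes>\<^bsub>G\<^esub> g) i = (\<Oplus>j\<in>?W. f j \<otimes> g (i - j))"
      by (rule laurent_mult_interval[OF assms(1,2) f g]) (use i in auto)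
    then have "(f \<otimes>\<^bsub>G\<^esub> g) i \<otimes> h (k - i) = (\<Oplus>j\<in>?W. (f j \<otimes> g (i - j)) \<otimes> h (k - i))"
      using c by (simp add: finsum_ldistr)
    also have "\<dots> = (\<Oplus>j\<in>?W. f j \<otimes> (g (i - j) \<otimes> h (k - i)))"
      using c by (intro finsum_cong') (auto simp: m_assoc)
    finally show "(f \<otimes>\<^bsub>G\<^esub> g) i \<otimes> h (k - i) = (\<Oplus>j\<in>?W. f j \<otimes> (g (i - j) \<otimes> h (k - i)))" .
  qed (use c in \<open>auto intro!: finsum_closed\<close>)
  also have "\<dots> = (\<Oplus>j\<in>?W. \<Oplus>i\<in>?I. f j \<otimes> (g (i - j) \<otimes> h (k - i)))"
    using c by (intro finsum_swap) auto
  also have "\<dots> = (\<Oplus>j\<in>?W. f j \<otimes> (g \<otimes>\<^bsub>G\<^esub> h) (k - j))"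
  proof (rule finsum_cong')
    fix j assume j: "j \<in> ?W"
    have "(\<Oplus>i\<in>?I. f j \<otimes> (g (i - j) \<otimes> h (k - i))) = f j \<otimes> (\<Oplus>i\<in>?I. g (i - j) \<otimes> h (k - i))"
      using c by (intro finsum_rdistr[symmetric]) auto
    also have "(\<Oplus>i\<in>?I. g (i - j) \<otimes> h (k - i)) =
        (\<Oplus>i\<in>(\<lambda>l. l + j) ` {2 * a - j..k - a - j}. g (i - j) \<otimes> h (k - i))"
    proof -
      have "?I = (\<lambda>l. l + j) ` {2 * a - j..k - a - j}"
        by (auto intro!: image_eqI[of _ _ "_ - j"])
      then show ?thesis by (rule arg_cong)
    qed
    also have "(\<Oplus>i\<in>(\<lambda>l. l + j) ` {2 * a - j..k - a - j}. g (i - j) \<otimes> h (k - i)) =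
        (\<Oplus>l\<in>{2 * a - j..k - a - j}. g (l + j - j) \<otimes> h (k - (l + j)))"
      using c by (intro finsum_reindex) (auto simp: inj_on_def)
    also have "\<dots> = (\<Oplus>l\<in>{2 * a - j..k - a - j}. g l \<otimes> h (k - j - l))"
      using c by (intro finsum_cong') (auto simp: algebra_simps)
    also have "\<dots> = (g \<otimes>\<^bsub>G\<^esub> h) (k - j)"
      by (rule laurent_mult_interval[OF assms(2,3) g h, symmetric]) (use j in auto)
    finally show "(\<Oplus>i\<in>?I. f j \<otimes> (g (i - j) \<otimes> h (k - i))) = f j \<otimes> (g \<otimes>\<^bsub>G\<^esub> h) (k - j)" .
  qed (use c laurent_coeff[OF gh] in \<open>auto intro!: finsum_closed\<close>)
  also have "\<dots> = (f \<otimes>\<^bsub>G\<^esub> (g \<otimes>\<^bsub>G\<^esub> h)) k"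
    by (rule laurent_mult_interval[OF assms(1) gh f ghb, symmetric]) auto
  finally show "((f \<otimes>\<^bsub>G\<^esub> g) \<otimes>\<^bsub>G\<^esub> h) k = (f \<otimes>\<^bsub>G\<^esub> (g \<otimes>\<^bsub>G\<^esub> h)) k" .
qed

lemma laurent_add_closed:
  assumes "f \<in> carrier G" "g \<in> carrier G" shows "f \<oplus>\<^bsub>G\<^esub> g \<in> carrier G"
proof -
  obtain a where a: "\<And>k. k < a \<Longrightarrow> f k = \<zero>" using laurent_bound[OF assms(1), of 0] by blast
  obtain b where b: "b \<le> a" "\<And>k. k < b \<Longrightarrow> g k = \<zero>" using laurent_bound[OF assms(2)] by blast
  then have "\<forall>k<b. f k \<oplus> g k = \<zero>" using a by simp
  then show ?thesis unfolding laurent_carrier laurent_ops using assms laurent_coeff by blast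
qed

lemma laurent_distr:
  assumes "f \<in> carrier G" "g \<in> carrier G" "h \<in> carrier G"
  shows "(f \<oplus>\<^bsub>G\<^esub> g) \<otimes>\<^bsub>G\<^esub> h = f \<otimes>\<^bsub>G\<^esub> h \<oplus>\<^bsub>G\<^esub> g \<otimes>\<^bsub>G\<^esub> h"
proof
  fix k
  obtain a1 where a1: "\<And>k. k < a1 \<Longrightarrow> f k = \<zero>" using laurent_bound[OF assms(1), of 0] by blast
  obtain a where a2: "a \<le> a1" "\<And>k. k < a \<Longrightarrow> g k = \<zero>" using laurent_bound[OF assms(2)] by blast
  obtain b where b: "\<And>k. k < b \<Longrightarrow> h k = \<zero>" using laurent_bound[OF assms(3), of 0] by blast
  note c = laurent_coeff[OF assms(1)] laurent_coeff[OF assms(2)] laurent_coeff[OF assms(3)]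
  have f: "\<And>k. k < a \<Longrightarrow> f k = \<zero>" using a1 a2 by auto
  have fg: "\<And>k. k < a \<Longrightarrow> (f \<oplus>\<^bsub>G\<^esub> g) k = \<zero>" using f a2 by (simp add: laurent_ops)
  have "((f \<oplus>\<^bsub>G\<^esub> g) \<otimes>\<^bsub>G\<^esub> h) k = (\<Oplus>i\<in>{a..k - b}. (f \<oplus>\<^bsub>G\<^esub> g) i \<otimes> h (k - i))"
    by (rule laurent_mult_interval[OF laurent_add_closed[OF assms(1,2)] assms(3) fg b]) auto
  also have "\<dots> = (\<Oplus>i\<in>{a..k - b}. f i \<otimes> h (k - i) \<oplus> g i \<otimes> h (k - i))"
    using c by (intro finsum_cong') (auto simp: laurent_ops l_distr)
  also have "\<dots> = (\<Oplus>i\<in>{a..k - b}. f i \<otimes> h (k - i)) \<oplus> (\<Oplus>i\<in>{a..k - b}. g i \<otimes> h (k - i))"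
    using c by (intro finsum_addf) auto
  also have "(\<Oplus>i\<in>{a..k - b}. f i \<otimes> h (k - i)) = (f \<otimes>\<^bsub>G\<^esub> h) k"
    by (rule laurent_mult_interval[OF assms(1,3) f b, symmetric]) auto
  also have "(\<Oplus>i\<in>{a..k - b}. g i \<otimes> h (k - i)) = (g \<otimes>\<^bsub>G\<^esub> h) k"
    by (rule laurent_mult_interval[OF assms(2,3) a2(2) b, symmetric]) auto
  finally show "((f \<oplus>\<^bsub>G\<^esub> g) \<otimes>\<^bsub>G\<^esub> h) k = (f \<otimes>\<^bsub>G\<^esub> h \<oplus>\<^bsub>G\<^esub> g \<otimes>\<^bsub>G\<^esub> h) k" by (simp add: laurent_ops)
qed

lemma laurent_monom_closed: "a \<in> carrier R \<Longrightarrow> laurent_monom R n a \<in> carrier G"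
  unfolding laurent_carrier laurent_monom_def by (auto intro: exI[of _ n])

lemma laurent_one_monom: "\<one>\<^bsub>G\<^esub> = laurent_monom R 0 \<one>"
  by (simp add: laurent_ops laurent_monom_def)

lemma laurent_monom_mult:
  assumes "a \<in> carrier R" "f \<in> carrier G"
  shows "(laurent_monom R n a \<otimes>\<^bsub>G\<^esub> f) k = a \<otimes> f (k - n)"
proof -
  have "(laurent_monom R n a \<otimes>\<^bsub>G\<^esub> f) k = (\<Oplus>i\<in>{n}. laurent_monom R n a i \<otimes> f (k - i))"
    by (rule laurent_mult) (use assms laurent_coeff in \<open>auto simp: laurent_monom_def split: if_splits\<close>)
  then show ?thesis using assms laurent_coeff by (simp add: laurent_monom_def)
qed

lemma laurent_cring: "cring G"
proof (rule cringI)
  show "abelian_group G"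
  proof (rule abelian_groupI)
    fix f assume f: "f \<in> carrier G"
    have "(\<lambda>k. \<ominus> f k) \<in> carrier G" using f unfolding laurent_carrier by auto
    moreover have "(\<lambda>k. \<ominus> f k) \<oplus>\<^bsub>G\<^esub> f = \<zero>\<^bsub>G\<^esub>"
      using laurent_coeff[OF f] by (simp add: laurent_ops l_neg)
    ultimately show "\<exists>y\<in>carrier G. y \<oplus>\<^bsub>G\<^esub> f = \<zero>\<^bsub>G\<^esub>" by blast
  next
    show "\<zero>\<^bsub>G\<^esub> \<in> carrier G" by (auto simp: laurent_carrier laurent_ops)
    show "f \<oplus>\<^bsub>G\<^esub> g \<in> carrier G" if "f \<in> carrier G" "g \<in> carrier G" for f g
      by (rule laurent_add_closed[OF that])
  qed (use laurent_coeff in \<open>auto simp: laurent_ops a_ac\<close>)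
  show "comm_monoid G"
  proof (rule comm_monoidI)
    show "\<one>\<^bsub>G\<^esub> \<in> carrier G" unfolding laurent_one_monom by (rule laurent_monom_closed) simp
    show "\<one>\<^bsub>G\<^esub> \<otimes>\<^bsub>G\<^esub> f = f" if "f \<in> carrier G" for f
      unfolding laurent_one_monom using that laurent_coeff by (auto simp: laurent_monom_mult)
  qed (rule laurent_mult_closed laurent_mult_assoc laurent_mult_comm; assumption)+
qed (rule laurent_distr)

lemma laurent_minus:
  assumes "f \<in> carrier G" shows "(\<ominus>\<^bsub>G\<^esub> f) k = \<ominus> f k"
proof -
  interpret G: cring G by (rule laurent_cring)
  have "(f \<oplus>\<^bsub>G\<^esub> \<ominus>\<^bsub>G\<^esub> f) k = \<zero>" using assms G.r_neg laurent_ops(2) by metis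
  then have "\<ominus>\<^bsub>G\<^esub> f \<in> carrier G" "f k \<oplus> (\<ominus>\<^bsub>G\<^esub> f) k = \<zero>" using assms by (auto simp: laurent_ops)
  then show ?thesis using assms laurent_coeff minus_equality a_comm by metis
qed

lemma laurent_diff: "f \<in> carrier G \<Longrightarrow> g \<in> carrier G \<Longrightarrow> (f \<ominus>\<^bsub>G\<^esub> g) k = f k \<ominus> g k"
  using laurent_minus[of g k] by (simp add: a_minus_def laurent_ops)

lemma laurent_add_pow: "f \<in> carrier G \<Longrightarrow> ([(n::nat)] \<cdot>\<^bsub>G\<^esub> f) k = [n] \<cdot> f k"
proof (induction n)
  case 0
  then show ?case by (simp add: add_pow_def laurent_ops)
next
  case (Suc n)
  interpret G: cring G by (rule laurent_cring)
  show ?case using Suc by (simp add: laurent_ops)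
qed

text \<open>Completeness holds since the coefficients of a Cauchy sequence are eventually
  constant.\<close>

lemma laurent_filtration: "complete_filtration G (laurent_ideal R)"
proof -
  interpret G: cring G by (rule laurent_cring)
  show ?thesis
  proof (intro complete_filtration.intro laurent_cring complete_filtration_axioms.intro)
    fix i j and f g :: "int \<Rightarrow> 'a"
    show "laurent_ideal R i \<subseteq> carrier G" "laurent_ideal R (Suc i) \<subseteq> laurent_ideal R i"
      by (auto simp: laurent_ideal_def)
    show "\<zero>\<^bsub>G\<^esub> \<in> laurent_ideal R i" by (simp add: laurent_ideal_def) (simp add: laurent_ops)
    show "f \<oplus>\<^bsub>G\<^esub> g \<in> laurent_ideal R i" if "f \<in> laurent_ideal R i" "g \<in> laurent_ideal R i"
      using that by (simp add: laurent_ideal_def laurent_add_closed) (simp add: laurent_ops)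
    show "\<ominus>\<^bsub>G\<^esub> f \<in> laurent_ideal R i" if "f \<in> laurent_ideal R i"
      using that by (simp add: laurent_ideal_def laurent_minus)
    show "f \<otimes>\<^bsub>G\<^esub> g \<in> laurent_ideal R (i + j)" if "f \<in> laurent_ideal R i" "g \<in> laurent_ideal R j"
      using that laurent_mult_below[of f g "int i" "int j"] by (simp add: laurent_ideal_def)
    show "f = \<zero>\<^bsub>G\<^esub>" if f: "\<And>i. f \<in> laurent_ideal R i"
    proof
      fix k
      have "k < int (nat (k + 1))" by auto
      then show "f k = \<zero>\<^bsub>G\<^esub> k" using f[of "nat (k + 1)"] by (simp add: laurent_ideal_def laurent_ops)
    qed
  next
    fix S :: "nat \<Rightarrow> int \<Rightarrow> 'a"
    assume S: "\<And>i. S i \<in> carrier G" "\<And>i. S (Suc i) \<ominus>\<^bsub>G\<^esub> S i \<in> laurent_ideal R i"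
    have step: "S (Suc i) k = S i k" if "k < int i" for i k
    proof -
      have "S (Suc i) k \<ominus> S i k = \<zero>" using S that laurent_diff by (simp add: laurent_ideal_def)
      then show ?thesis using S(1) laurent_coeff by simp
    qed
    have stable: "S (i + d) k = S i k" if "k < int i" for i d k
      using that by (induction d) (auto simp: step)
    define x where "x k = S (nat (k + 1)) k" for k
    have x: "x k = S i k" if "k < int i" for k i
    proof -
      have "S (nat (k + 1) + (i - nat (k + 1))) k = S (nat (k + 1)) k" by (rule stable) auto
      moreover have "nat (k + 1) + (i - nat (k + 1)) = i" using that by auto
      ultimately show ?thesis by (simp add: x_def)
    qed
    obtain a where a: "a \<le> 0" "\<And>k. k < a \<Longrightarrow> S 0 k = \<zero>" using laurent_bound[OF S(1)] by blast
    have "\<forall>k<a. x k = \<zero>" using x[of _ 0] a by auto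
    then have xG: "x \<in> carrier G" unfolding laurent_carrier x_def using S(1) laurent_coeff by blast
    moreover have "x \<ominus>\<^bsub>G\<^esub> S i \<in> laurent_ideal R i" for i
      using xG S(1) x laurent_coeff by (simp add: laurent_ideal_def laurent_diff r_neg minus_eq)
    ultimately show "\<exists>x\<in>carrier G. \<forall>i. x \<ominus>\<^bsub>G\<^esub> S i \<in> laurent_ideal R i" by blast
  qed
qed

end

definition laurent_ord :: "'a ring \<Rightarrow> (int \<Rightarrow> 'a) \<Rightarrow> int" where
  "laurent_ord R f = (THE k. f k \<noteq> \<zero>\<^bsub>R\<^esub> \<and> (\<forall>j<k. f j = \<zero>\<^bsub>R\<^esub>))"

definition laurent_lead :: "'a ring \<Rightarrow> (int \<Rightarrow> 'a) \<Rightarrow> 'a" where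
  "laurent_lead R f = f (laurent_ord R f)"

text \<open>What is used of the passage from \<open>F\<close> to \<open>K = F((t))\<close>: the order, the leading
  coefficient, and roots of one-units. The stages of the tower are renamed copies of rings
  of Laurent series, and these properties are easier to transport along the renaming than
  the series themselves. The values of \<open>ord\<close> and \<open>lead\<close> at zero are arbitrary.\<close>

locale leading_terms = F: plain_field F + K: plain_field K
  for F :: "'a ring" and K :: "'b ring" +
  fixes ord :: "'b \<Rightarrow> int" and lead :: "'b \<Rightarrow> 'a" and const :: "'a \<Rightarrow> 'b" and t :: 'b
  assumes char_F: "char_zero F" and char_K: "char_zero K"
    and lead_nonzero: "x \<in> nonzero K \<Longrightarrow> lead x \<in> nonzero F"
    and ord_mult: "x \<in> nonzero K \<Longrightarrow> y \<in> nonzero K \<Longrightarrow> ord (x \<otimes>\<^bsub>K\<^esub> y) = ord x + ord y"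
    and lead_mult: "x \<in> nonzero K \<Longrightarrow> y \<in> nonzero K \<Longrightarrow> lead (x \<otimes>\<^bsub>K\<^esub> y) = lead x \<otimes>\<^bsub>F\<^esub> lead y"
    and const_nonzero: "a \<in> nonzero F \<Longrightarrow> const a \<in> nonzero K"
    and ord_const: "a \<in> nonzero F \<Longrightarrow> ord (const a) = 0"
    and lead_const: "a \<in> nonzero F \<Longrightarrow> lead (const a) = a"
    and t_nonzero: "t \<in> nonzero K" and ord_t: "ord t = 1" and lead_t: "lead t = \<one>\<^bsub>F\<^esub>"
    and one_unit_has_root: "x \<in> nonzero K \<Longrightarrow> ord x = 0 \<Longrightarrow> lead x = \<one>\<^bsub>F\<^esub> \<Longrightarrow> (n::nat) > 0 \<Longrightarrow>
      \<exists>y\<in>nonzero K. ord y = 0 \<and> lead y = \<one>\<^bsub>F\<^esub> \<and> y [^]\<^bsub>K\<^esub> n = x"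
    and one_unit_torsion_free: "x \<in> nonzero K \<Longrightarrow> ord x = 0 \<Longrightarrow> lead x = \<one>\<^bsub>F\<^esub> \<Longrightarrow> (n::nat) > 0 \<Longrightarrow>
      x [^]\<^bsub>K\<^esub> n = \<one>\<^bsub>K\<^esub> \<Longrightarrow> x = \<one>\<^bsub>K\<^esub>"
    and add_small: "x \<in> nonzero K \<Longrightarrow> ord x = 0 \<Longrightarrow> y \<in> carrier K \<Longrightarrow> y = \<zero>\<^bsub>K\<^esub> \<or> ord y > 0 \<Longrightarrow>
      x \<oplus>\<^bsub>K\<^esub> y \<in> nonzero K \<and> ord (x \<oplus>\<^bsub>K\<^esub> y) = 0 \<and> lead (x \<oplus>\<^bsub>K\<^esub> y) = lead x"
    and add_same: "x \<in> nonzero K \<Longrightarrow> y \<in> nonzero K \<Longrightarrow> ord x = 0 \<Longrightarrow> ord y = 0 \<Longrightarrow>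
      lead x \<oplus>\<^bsub>F\<^esub> lead y \<noteq> \<zero>\<^bsub>F\<^esub> \<Longrightarrow>
      x \<oplus>\<^bsub>K\<^esub> y \<in> nonzero K \<and> ord (x \<oplus>\<^bsub>K\<^esub> y) = 0 \<and> lead (x \<oplus>\<^bsub>K\<^esub> y) = lead x \<oplus>\<^bsub>F\<^esub> lead y"
    and add_cancel: "x \<in> nonzero K \<Longrightarrow> y \<in> nonzero K \<Longrightarrow> ord x = 0 \<Longrightarrow> ord y = 0 \<Longrightarrow>
      lead x \<oplus>\<^bsub>F\<^esub> lead y = \<zero>\<^bsub>F\<^esub> \<Longrightarrow> x \<oplus>\<^bsub>K\<^esub> y = \<zero>\<^bsub>K\<^esub> \<or> ord (x \<oplus>\<^bsub>K\<^esub> y) > 0"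

context plain_field
begin

lemma char_zero_solve:
  assumes "char_zero R" "(n::nat) > 0" "a \<in> carrier R"
  obtains b where "b \<in> carrier R" "[n] \<cdot> b = a"
proof -
  let ?n = "[n] \<cdot> \<one>"
  have n: "?n \<in> nonzero R" using assms by (simp add: char_zero_def nonzero_def)
  have "[n] \<cdot> (inv ?n \<otimes> a) = [n] \<cdot> (\<one> \<otimes> (inv ?n \<otimes> a))"
    using nonzero_closed[OF nonzero_inv[OF n]] assms(3) by simp
  also have "\<dots> = ?n \<otimes> (inv ?n \<otimes> a)"
    using nonzero_closed[OF nonzero_inv[OF n]] assms(3) by (intro add_pow_ldistr[symmetric]) auto
  also have "\<dots> = a"
    using nonzero_closed[OF n] nonzero_closed[OF nonzero_inv[OF n]] assms(3) nonzero_r_inv[OF n]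
    by (simp add: m_assoc[symmetric])
  finally show ?thesis using nonzero_closed[OF nonzero_inv[OF n]] assms(3)
    by (intro that[of "inv ?n \<otimes> a"]) auto
qed

lemma char_zero_cancel:
  assumes "char_zero R" "(n::nat) > 0" "a \<in> carrier R" "[n] \<cdot> a = \<zero>"
  shows "a = \<zero>"
proof -
  have "([n] \<cdot> \<one>) \<otimes> a = \<zero>" using add_pow_ldistr[of \<one> a n] assms by simp
  then show ?thesis using assms(1-3) integral_iff[of "[n] \<cdot> \<one>" a] by (auto simp: char_zero_def)
qed

lemma laurent_ordI: "f k \<noteq> \<zero> \<Longrightarrow> (\<And>j. j < k \<Longrightarrow> f j = \<zero>) \<Longrightarrow> laurent_ord R f = k"
  unfolding laurent_ord_def by (rule the_equality) (auto, meson linorder_neqE)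

lemma laurent_ord:
  assumes "f \<in> nonzero G"
  shows "f (laurent_ord R f) \<noteq> \<zero>" "\<And>j. j < laurent_ord R f \<Longrightarrow> f j = \<zero>"
proof -
  have f: "f \<in> carrier G" "f \<noteq> (\<lambda>k. \<zero>)" using assms by (auto simp: nonzero_def laurent_ops)
  obtain a where a: "\<And>k. k < a \<Longrightarrow> f k = \<zero>" using laurent_bound[OF f(1), of 0] by blast
  obtain l where l: "f l \<noteq> \<zero>" using f(2) by blast
  then have "f (a + int (nat (l - a))) \<noteq> \<zero>" using a[of l] by (cases "l < a") auto
  then have ex: "\<exists>n. f (a + int n) \<noteq> \<zero>" by blast
  define n where "n = (LEAST n. f (a + int n) \<noteq> \<zero>)"
  have n: "f (a + int n) \<noteq> \<zero>" unfolding n_def using ex by (rule LeastI_ex)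
  have below: "f j = \<zero>" if "j < a + int n" for j
  proof (cases "j < a")
    case False
    then have "nat (j - a) < n" "a + int (nat (j - a)) = j" using that by auto
    then show ?thesis using not_less_Least[of "nat (j - a)" "\<lambda>n. f (a + int n) \<noteq> \<zero>"] n_def by auto
  qed (rule a)
  have "laurent_ord R f = a + int n" using n below by (rule laurent_ordI)
  then show "f (laurent_ord R f) \<noteq> \<zero>" "\<And>j. j < laurent_ord R f \<Longrightarrow> f j = \<zero>" using n below by auto
qed

lemma laurent_nonzeroI:
  assumes "f \<in> carrier G" "f k \<noteq> \<zero>" "\<And>j. j < k \<Longrightarrow> f j = \<zero>"
  shows "f \<in> nonzero G \<and> laurent_ord R f = k \<and> laurent_lead R f = f k"
proof -
  have ord: "laurent_ord R f = k" using assms by (intro laurent_ordI)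
  have "f \<noteq> \<zero>\<^bsub>G\<^esub>" using assms(2) by (auto simp: laurent_ops)
  then show ?thesis using assms(1) ord by (simp add: nonzero_def laurent_lead_def)
qed

lemma laurent_mult_leading:
  assumes "f \<in> nonzero G" "g \<in> nonzero G"
  shows "f \<otimes>\<^bsub>G\<^esub> g \<in> nonzero G \<and> laurent_ord R (f \<otimes>\<^bsub>G\<^esub> g) = laurent_ord R f + laurent_ord R g \<and>
    laurent_lead R (f \<otimes>\<^bsub>G\<^esub> g) = laurent_lead R f \<otimes> laurent_lead R g"
proof -
  have fg: "f \<in> carrier G" "g \<in> carrier G" using assms by (auto simp: nonzero_def)
  let ?a = "laurent_ord R f" and ?b = "laurent_ord R g"
  have top: "(f \<otimes>\<^bsub>G\<^esub> g) (?a + ?b) = f ?a \<otimes> g ?b"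
    by (rule laurent_mult_lowest[OF fg laurent_ord(2)[OF assms(1)] laurent_ord(2)[OF assms(2)]])
  moreover have "f ?a \<otimes> g ?b \<noteq> \<zero>"
    using laurent_ord(1)[OF assms(1)] laurent_ord(1)[OF assms(2)] laurent_coeff fg by (simp add: integral_iff)
  moreover have "(f \<otimes>\<^bsub>G\<^esub> g) j = \<zero>" if "j < ?a + ?b" for j
    by (rule laurent_mult_below[OF fg laurent_ord(2)[OF assms(1)] laurent_ord(2)[OF assms(2)] that])
  ultimately show ?thesis
    using laurent_nonzeroI[OF laurent_mult_closed[OF fg], of "?a + ?b"] by (simp add: laurent_lead_def)
qed

lemma laurent_one_unit:
  assumes "f \<in> nonzero G" "laurent_ord R f = 0" "laurent_lead R f = \<one>"
  obtains w where "w \<in> laurent_ideal R (Suc 0)" "f = \<one>\<^bsub>G\<^esub> \<oplus>\<^bsub>G\<^esub> w"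
proof -
  interpret G: cring G by (rule laurent_cring)
  have f: "f \<in> carrier G" using assms by (auto simp: nonzero_def)
  have f0: "f 0 = \<one>" using assms by (simp add: laurent_lead_def)
  have "(f \<ominus>\<^bsub>G\<^esub> \<one>\<^bsub>G\<^esub>) k = \<zero>" if "k < 1" for k
    using f0 laurent_ord(2)[OF assms(1)] assms(2) that laurent_diff[OF f G.one_closed, of k]
    by (cases "k = 0") (auto simp: laurent_ops r_neg minus_eq)
  then have "f \<ominus>\<^bsub>G\<^esub> \<one>\<^bsub>G\<^esub> \<in> laurent_ideal R (Suc 0)"
    using f by (simp add: laurent_ideal_def)
  moreover have "f = \<one>\<^bsub>G\<^esub> \<oplus>\<^bsub>G\<^esub> (f \<ominus>\<^bsub>G\<^esub> \<one>\<^bsub>G\<^esub>)"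
    using f by (simp add: G.minus_eq G.a_ac G.r_neg G.r_neg1 G.r_neg2)
  ultimately show ?thesis by (rule that)
qed

lemma laurent_one_unit':
  assumes "w \<in> laurent_ideal R (Suc 0)"
  shows "\<one>\<^bsub>G\<^esub> \<oplus>\<^bsub>G\<^esub> w \<in> nonzero G \<and> laurent_ord R (\<one>\<^bsub>G\<^esub> \<oplus>\<^bsub>G\<^esub> w) = 0 \<and> laurent_lead R (\<one>\<^bsub>G\<^esub> \<oplus>\<^bsub>G\<^esub> w) = \<one>"
proof -
  interpret G: cring G by (rule laurent_cring)
  have w: "w \<in> carrier G" "\<And>k. k < 1 \<Longrightarrow> w k = \<zero>" using assms by (auto simp: laurent_ideal_def)
  then have "(\<one>\<^bsub>G\<^esub> \<oplus>\<^bsub>G\<^esub> w) 0 = \<one>" "\<And>j. j < 0 \<Longrightarrow> (\<one>\<^bsub>G\<^esub> \<oplus>\<^bsub>G\<^esub> w) j = \<zero>" by (auto simp: laurent_ops)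
  then show ?thesis
    using laurent_nonzeroI[of "\<one>\<^bsub>G\<^esub> \<oplus>\<^bsub>G\<^esub> w" 0] w(1) by simp
qed

lemma laurent_monom_leading:
  assumes "a \<in> nonzero R"
  shows "laurent_monom R n a \<in> nonzero G \<and> laurent_ord R (laurent_monom R n a) = n \<and>
    laurent_lead R (laurent_monom R n a) = a"
proof -
  have "laurent_monom R n a \<in> carrier G" using assms by (intro laurent_monom_closed nonzero_closed)
  then show ?thesis
    using laurent_nonzeroI[of "laurent_monom R n a" n] assms by (simp add: laurent_monom_def nonzero_def)
qed

text \<open>Multiplication by a monomial turns a nonzero series into a one-unit, and one-units are
  invertible.\<close>

lemma laurent_field: "field G"
proof -
  interpret G: complete_filtration G "laurent_ideal R" by (rule laurent_filtration)
  show ?thesis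
  proof (rule G.cring_fieldI2)
    have "\<zero>\<^bsub>G\<^esub> 0 \<noteq> \<one>\<^bsub>G\<^esub> 0" by (simp add: laurent_ops)
    then show "\<zero>\<^bsub>G\<^esub> \<noteq> \<one>\<^bsub>G\<^esub>" by metis
  next
    fix f assume f: "f \<in> carrier G" "f \<noteq> \<zero>\<^bsub>G\<^esub>"
    then have fn: "f \<in> nonzero G" by (simp add: nonzero_def)
    let ?c = "f (laurent_ord R f)"
    have c: "?c \<in> nonzero R" using laurent_ord(1)[OF fn] laurent_coeff[OF f(1)] by (simp add: nonzero_def)
    define h where "h = laurent_monom R (- laurent_ord R f) (inv ?c)"
    have h: "h \<in> nonzero G" "laurent_ord R h = - laurent_ord R f" "laurent_lead R h = inv ?c"
      using laurent_monom_leading[OF nonzero_inv[OF c]] unfolding h_def by auto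
    have "f \<otimes>\<^bsub>G\<^esub> h \<in> nonzero G" "laurent_ord R (f \<otimes>\<^bsub>G\<^esub> h) = 0" "laurent_lead R (f \<otimes>\<^bsub>G\<^esub> h) = \<one>"
      using laurent_mult_leading[OF fn h(1)] h nonzero_r_inv[OF c] by (auto simp: laurent_lead_def)
    then obtain w where w: "w \<in> laurent_ideal R (Suc 0)" "f \<otimes>\<^bsub>G\<^esub> h = \<one>\<^bsub>G\<^esub> \<oplus>\<^bsub>G\<^esub> w"
      by (rule laurent_one_unit)
    obtain v where v: "v \<in> laurent_ideal R (Suc 0)" "(\<one>\<^bsub>G\<^esub> \<oplus>\<^bsub>G\<^esub> w) \<otimes>\<^bsub>G\<^esub> (\<one>\<^bsub>G\<^esub> \<oplus>\<^bsub>G\<^esub> v) = \<one>\<^bsub>G\<^esub>"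
      using G.one_unit_inverse[OF w(1)] by blast
    have hc: "h \<in> carrier G" using h(1) by (simp add: nonzero_def)
    have "f \<otimes>\<^bsub>G\<^esub> (h \<otimes>\<^bsub>G\<^esub> (\<one>\<^bsub>G\<^esub> \<oplus>\<^bsub>G\<^esub> v)) = \<one>\<^bsub>G\<^esub>"
      using v(2) f(1) hc G.J_carrier[OF v(1)] unfolding w(2)[symmetric] by (simp add: G.m_assoc)
    then show "\<exists>b\<in>carrier G. f \<otimes>\<^bsub>G\<^esub> b = \<one>\<^bsub>G\<^esub>"
      using hc G.J_carrier[OF v(1)] by (intro bexI[of _ "h \<otimes>\<^bsub>G\<^esub> (\<one>\<^bsub>G\<^esub> \<oplus>\<^bsub>G\<^esub> v)"]) auto
  qed
qed

lemma laurent_char_zero: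
  assumes "char_zero R" shows "char_zero G"
  unfolding char_zero_def
proof (intro allI impI)
  fix n :: nat assume n: "0 < n"
  interpret G: cring G by (rule laurent_cring)
  have "([n] \<cdot>\<^bsub>G\<^esub> \<one>\<^bsub>G\<^esub>) 0 = [n] \<cdot> \<one>" by (simp add: laurent_add_pow) (simp add: laurent_ops)
  moreover have "[n] \<cdot> \<one> \<noteq> \<zero>" using assms n by (simp add: char_zero_def)
  moreover have "\<zero>\<^bsub>G\<^esub> 0 = \<zero>" by (simp add: laurent_ops)
  ultimately show "[n] \<cdot>\<^bsub>G\<^esub> \<one>\<^bsub>G\<^esub> \<noteq> \<zero>\<^bsub>G\<^esub>" by metis
qed

text \<open>One-units have unique \<open>n\<close>-th roots since, in characteristic zero, \<open>n\<close> can be divided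
  by without leaving a step of the filtration.\<close>

lemma laurent_leading_terms:
  assumes char: "char_zero R"
  shows "leading_terms R G (laurent_ord R) (laurent_lead R) (laurent_monom R 0) (laurent_monom R 1 \<one>)"
proof -
  interpret G: complete_filtration G "laurent_ideal R" by (rule laurent_filtration)
  interpret GF: plain_field G using laurent_field by (simp add: plain_field_def)
  show ?thesis
  proof (unfold_locales)
    show "char_zero R" "char_zero G" using char laurent_char_zero by auto
  next
    fix f assume f: "f \<in> nonzero G"
    show "laurent_lead R f \<in> nonzero R"
      using laurent_ord(1)[OF f] laurent_coeff[of f] f by (simp add: nonzero_def laurent_lead_def)
  next
    fix f g assume fg: "f \<in> nonzero G" "g \<in> nonzero G"
    note c = laurent_coeff[OF GF.nonzero_closed[OF fg(1)]] laurent_coeff[OF GF.nonzero_closed[OF fg(2)]]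
    show "laurent_ord R (f \<otimes>\<^bsub>G\<^esub> g) = laurent_ord R f + laurent_ord R g"
      "laurent_lead R (f \<otimes>\<^bsub>G\<^esub> g) = laurent_lead R f \<otimes> laurent_lead R g"
      using laurent_mult_leading[OF fg] by auto
    assume o: "laurent_ord R f = 0" "laurent_ord R g = 0"
    have lead: "laurent_lead R f = f 0" "laurent_lead R g = g 0" using o by (auto simp: laurent_lead_def)
    have neg: "(f \<oplus>\<^bsub>G\<^esub> g) j = \<zero>" if "j < 0" for j
      using laurent_ord(2)[OF fg(1)] laurent_ord(2)[OF fg(2)] o that by (simp add: laurent_ops)
    have zero: "(f \<oplus>\<^bsub>G\<^esub> g) 0 = laurent_lead R f \<oplus> laurent_lead R g" by (simp add: laurent_ops lead)
    have cl: "f \<oplus>\<^bsub>G\<^esub> g \<in> carrier G" using fg by (intro laurent_add_closed GF.nonzero_closed)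
    show "f \<oplus>\<^bsub>G\<^esub> g \<in> nonzero G \<and> laurent_ord R (f \<oplus>\<^bsub>G\<^esub> g) = 0 \<and>
        laurent_lead R (f \<oplus>\<^bsub>G\<^esub> g) = laurent_lead R f \<oplus> laurent_lead R g"
      if "laurent_lead R f \<oplus> laurent_lead R g \<noteq> \<zero>"
      using laurent_nonzeroI[OF cl, of 0] neg zero that by simp
    show "f \<oplus>\<^bsub>G\<^esub> g = \<zero>\<^bsub>G\<^esub> \<or> laurent_ord R (f \<oplus>\<^bsub>G\<^esub> g) > 0"
      if "laurent_lead R f \<oplus> laurent_lead R g = \<zero>"
    proof (cases "f \<oplus>\<^bsub>G\<^esub> g = \<zero>\<^bsub>G\<^esub>")
      case False
      then have "f \<oplus>\<^bsub>G\<^esub> g \<in> nonzero G" using cl by (simp add: nonzero_def)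
      from laurent_ord(1)[OF this] show ?thesis using neg zero that by (metis linorder_neqE)
    qed simp
  next
    fix f g assume f: "f \<in> nonzero G" "laurent_ord R f = 0" and g: "g \<in> carrier G" "g = \<zero>\<^bsub>G\<^esub> \<or> 0 < laurent_ord R g"
    have gz: "g j = \<zero>" if "j < 1" for j
    proof (cases "g = \<zero>\<^bsub>G\<^esub>")
      case False
      then show ?thesis using g that laurent_ord(2)[of g j] by (simp add: nonzero_def)
    qed (simp add: laurent_ops)
    have fz: "f j = \<zero>" if "j < 0" for j using laurent_ord(2)[OF f(1)] f(2) that by simp
    have f0: "f 0 \<noteq> \<zero>" "f 0 \<in> carrier R"
      using laurent_ord(1)[OF f(1)] f laurent_coeff[OF GF.nonzero_closed[OF f(1)]] by auto
    show "f \<oplus>\<^bsub>G\<^esub> g \<in> nonzero G \<and> laurent_ord R (f \<oplus>\<^bsub>G\<^esub> g) = 0 \<and> laurent_lead R (f \<oplus>\<^bsub>G\<^esub> g) = laurent_lead R f"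
      using laurent_nonzeroI[OF laurent_add_closed[OF GF.nonzero_closed[OF f(1)] g(1)], of 0] gz fz f0 f(2)
      by (simp add: laurent_ops laurent_lead_def)
  next
    fix a assume "a \<in> nonzero R"
    from laurent_monom_leading[OF this, of 0]
    show "laurent_monom R 0 a \<in> nonzero G" "laurent_ord R (laurent_monom R 0 a) = 0"
      "laurent_lead R (laurent_monom R 0 a) = a" by auto
  next
    from laurent_monom_leading[OF nonzero_one, of 1]
    show "laurent_monom R 1 \<one> \<in> nonzero G" "laurent_ord R (laurent_monom R 1 \<one>) = 1"
      "laurent_lead R (laurent_monom R 1 \<one>) = \<one>" by auto
  next
    fix f and n :: nat
    assume f: "f \<in> nonzero G" "laurent_ord R f = 0" "laurent_lead R f = \<one>" and n: "0 < n"
    obtain w where w: "w \<in> laurent_ideal R (Suc 0)" "f = \<one>\<^bsub>G\<^esub> \<oplus>\<^bsub>G\<^esub> w"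
      using laurent_one_unit[OF f] by blast
    have "\<exists>v\<in>laurent_ideal R (Suc 0). (\<one>\<^bsub>G\<^esub> \<oplus>\<^bsub>G\<^esub> v) [^]\<^bsub>G\<^esub> n = \<one>\<^bsub>G\<^esub> \<oplus>\<^bsub>G\<^esub> w"
    proof (rule G.one_unit_root[of w 0 n])
      fix i a assume a: "a \<in> laurent_ideal R (0 + i)"
      then have ac: "a \<in> carrier G" "\<And>k. k < int i \<Longrightarrow> a k = \<zero>" by (auto simp: laurent_ideal_def)
      obtain b where b: "b \<in> carrier G" "[n] \<cdot>\<^bsub>G\<^esub> b = a"
        using GF.char_zero_solve[OF laurent_char_zero[OF char] n ac(1)] by blast
      have "b k = \<zero>" if "k < int i" for k
        using char_zero_cancel[OF char n laurent_coeff[OF b(1)]] laurent_add_pow[OF b(1), of n k] b(2) ac(2)[OF that]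
        by simp
      then have "b \<in> laurent_ideal R i" using b(1) by (simp add: laurent_ideal_def)
      moreover have "[n] \<cdot>\<^bsub>G\<^esub> b \<ominus>\<^bsub>G\<^esub> a \<in> laurent_ideal R (Suc (0 + i))"
        unfolding b(2) using ac(1) G.J_zero by (simp add: G.minus_eq G.r_neg)
      ultimately show "\<exists>b\<in>laurent_ideal R i. [n] \<cdot>\<^bsub>G\<^esub> b \<ominus>\<^bsub>G\<^esub> a \<in> laurent_ideal R (Suc (0 + i))" by blast
    qed (use w in simp)
    then show "\<exists>y\<in>nonzero G. laurent_ord R y = 0 \<and> laurent_lead R y = \<one> \<and> y [^]\<^bsub>G\<^esub> n = f"
      using w(2) laurent_one_unit' by metis
    show "f = \<one>\<^bsub>G\<^esub>" if "f [^]\<^bsub>G\<^esub> n = \<one>\<^bsub>G\<^esub>"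
    proof -
      have "w = \<zero>\<^bsub>G\<^esub>"
      proof (rule G.one_unit_root_unique[OF w(1)])
        show "(\<one>\<^bsub>G\<^esub> \<oplus>\<^bsub>G\<^esub> w) [^]\<^bsub>G\<^esub> n = \<one>\<^bsub>G\<^esub>" using that w(2) by simp
        fix i b assume b: "b \<in> laurent_ideal R i" "[n] \<cdot>\<^bsub>G\<^esub> b \<in> laurent_ideal R (Suc i)"
        then have bc: "b \<in> carrier G" by (simp add: laurent_ideal_def)
        have "b k = \<zero>" if "k < int (Suc i)" for k
          using char_zero_cancel[OF char n laurent_coeff[OF bc]] laurent_add_pow[OF bc, of n k] b(2) that
          by (simp add: laurent_ideal_def)
        then show "b \<in> laurent_ideal R (Suc i)" using bc by (simp add: laurent_ideal_def)
      qed
      then show ?thesis using w(2) by simp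
    qed
  qed
qed

end

lemma leading_terms_transport:
  assumes lt: "leading_terms F G ord lead const t" and iso: "\<phi> \<in> ring_iso G K" and K: "field K"
    and \<psi>: "\<And>x. x \<in> carrier G \<Longrightarrow> \<psi> (\<phi> x) = x"
  shows "leading_terms F K (\<lambda>x. ord (\<psi> x)) (\<lambda>x. lead (\<psi> x)) (\<lambda>a. \<phi> (const a)) (\<phi> t)"
proof -
  interpret G: leading_terms F G ord lead const t by (rule lt)
  interpret K: plain_field K using K by (simp add: plain_field_def)
  have hom: "\<phi> \<in> ring_hom G K" and bij: "bij_betw \<phi> (carrier G) (carrier K)" using iso by (auto simp: ring_iso_def)
  interpret h: ring_hom_cring G K \<phi> by unfold_locales (rule hom)
  have nz: "nonzero K = \<phi> ` nonzero G"
  proof -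
    have "\<phi> ` (carrier G - {\<zero>\<^bsub>G\<^esub>}) = \<phi> ` carrier G - \<phi> ` {\<zero>\<^bsub>G\<^esub>}"
      using bij by (intro inj_on_image_set_diff[of \<phi> "carrier G"]) (auto simp: bij_betw_def)
    then show ?thesis using bij by (simp add: nonzero_def bij_betw_def)
  qed
  have crE: thesis if "x \<in> carrier K" "\<And>y. y \<in> carrier G \<Longrightarrow> x = \<phi> y \<Longrightarrow> thesis" for x thesis
    using that bij by (auto simp: bij_betw_def)
  have inj: "\<phi> x = \<phi> y \<longleftrightarrow> x = y" if "x \<in> carrier G" "y \<in> carrier G" for x y
    using \<psi> that by metis
  have zero: "\<phi> x = \<zero>\<^bsub>K\<^esub> \<longleftrightarrow> x = \<zero>\<^bsub>G\<^esub>" "\<phi> x = \<one>\<^bsub>K\<^esub> \<longleftrightarrow> x = \<one>\<^bsub>G\<^esub>" if "x \<in> carrier G" for x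
    using inj[OF that, of "\<zero>\<^bsub>G\<^esub>"] inj[OF that, of "\<one>\<^bsub>G\<^esub>"] by auto
  have pow: "\<phi> x [^]\<^bsub>K\<^esub> (n::nat) = \<phi> (x [^]\<^bsub>G\<^esub> n)" if "x \<in> carrier G" for x n
    using that by (induction n) simp_all
  have mem: "\<phi> x \<in> nonzero K \<longleftrightarrow> x \<in> nonzero G" if "x \<in> carrier G" for x
    using that zero(1)[OF that] h.hom_closed[OF that] by (auto simp: nonzero_def)
  have mult: "\<phi> x \<otimes>\<^bsub>K\<^esub> \<phi> y = \<phi> (x \<otimes>\<^bsub>G\<^esub> y)" "\<phi> x \<oplus>\<^bsub>K\<^esub> \<phi> y = \<phi> (x \<oplus>\<^bsub>G\<^esub> y)"
    if "x \<in> carrier G" "y \<in> carrier G" for x y using that by auto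
  note cl = G.K.nonzero_closed
  show ?thesis
  proof (unfold_locales)
    show "char_zero F" by (rule G.char_F)
    have multiple: "[(n::nat)] \<cdot>\<^bsub>K\<^esub> \<one>\<^bsub>K\<^esub> = \<phi> ([n] \<cdot>\<^bsub>G\<^esub> \<one>\<^bsub>G\<^esub>)" for n by (induction n) simp_all
    show "char_zero K" unfolding char_zero_def multiple
      using G.char_K zero(1) by (auto simp: char_zero_def)
  next
    fix x assume "x \<in> nonzero K"
    then obtain y where "y \<in> nonzero G" "x = \<phi> y" unfolding nz by blast
    then show "lead (\<psi> x) \<in> nonzero F" using cl by (simp add: \<psi> G.lead_nonzero)
  next
    fix x y assume "x \<in> nonzero K" "y \<in> nonzero K"
    then obtain x' y' where xy: "x' \<in> nonzero G" "x = \<phi> x'" "y' \<in> nonzero G" "y = \<phi> y'"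
      unfolding nz by blast
    note c = cl[OF xy(1)] cl[OF xy(3)]
    show "ord (\<psi> (x \<otimes>\<^bsub>K\<^esub> y)) = ord (\<psi> x) + ord (\<psi> y)"
      "lead (\<psi> (x \<otimes>\<^bsub>K\<^esub> y)) = lead (\<psi> x) \<otimes>\<^bsub>F\<^esub> lead (\<psi> y)"
      using xy c by (simp_all add: mult \<psi> G.ord_mult G.lead_mult del: h.hom_mult)
    assume o: "ord (\<psi> x) = 0" "ord (\<psi> y) = 0"
    show "x \<oplus>\<^bsub>K\<^esub> y \<in> nonzero K \<and> ord (\<psi> (x \<oplus>\<^bsub>K\<^esub> y)) = 0 \<and> lead (\<psi> (x \<oplus>\<^bsub>K\<^esub> y)) = lead (\<psi> x) \<oplus>\<^bsub>F\<^esub> lead (\<psi> y)"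
      if "lead (\<psi> x) \<oplus>\<^bsub>F\<^esub> lead (\<psi> y) \<noteq> \<zero>\<^bsub>F\<^esub>"
      using G.add_same[OF xy(1,3)] o that xy c by (simp add: mult \<psi> mem del: h.hom_add)
    show "x \<oplus>\<^bsub>K\<^esub> y = \<zero>\<^bsub>K\<^esub> \<or> 0 < ord (\<psi> (x \<oplus>\<^bsub>K\<^esub> y))"
      if "lead (\<psi> x) \<oplus>\<^bsub>F\<^esub> lead (\<psi> y) = \<zero>\<^bsub>F\<^esub>"
      using G.add_cancel[OF xy(1,3)] o that xy c by (auto simp: mult \<psi> zero simp del: h.hom_add)
  next
    fix x y assume x: "x \<in> nonzero K" "ord (\<psi> x) = 0" and y: "y \<in> carrier K" "y = \<zero>\<^bsub>K\<^esub> \<or> 0 < ord (\<psi> y)"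
    obtain x' where x': "x' \<in> nonzero G" "x = \<phi> x'" using x(1) unfolding nz by blast
    obtain y' where y': "y' \<in> carrier G" "y = \<phi> y'" by (rule crE[OF y(1)])
    note c = cl[OF x'(1)] y'(1)
    show "x \<oplus>\<^bsub>K\<^esub> y \<in> nonzero K \<and> ord (\<psi> (x \<oplus>\<^bsub>K\<^esub> y)) = 0 \<and> lead (\<psi> (x \<oplus>\<^bsub>K\<^esub> y)) = lead (\<psi> x)"
      using G.add_small[OF x'(1) _ y'(1)] x y(2) x' y' c by (auto simp: mult \<psi> mem zero simp del: h.hom_add)
  next
    fix a assume a: "a \<in> nonzero F"
    note c = G.const_nonzero[OF a]
    show "\<phi> (const a) \<in> nonzero K" "ord (\<psi> (\<phi> (const a))) = 0" "lead (\<psi> (\<phi> (const a))) = a"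
      using c cl[OF c] a by (simp_all add: mem \<psi> G.ord_const G.lead_const)
  next
    show "\<phi> t \<in> nonzero K" "ord (\<psi> (\<phi> t)) = 1" "lead (\<psi> (\<phi> t)) = \<one>\<^bsub>F\<^esub>"
      using G.t_nonzero cl[OF G.t_nonzero] by (simp_all add: mem \<psi> G.ord_t G.lead_t)
  next
    fix x and n :: nat
    assume x: "x \<in> nonzero K" "ord (\<psi> x) = 0" "lead (\<psi> x) = \<one>\<^bsub>F\<^esub>" "0 < n"
    then obtain x' where x': "x' \<in> nonzero G" "x = \<phi> x'" unfolding nz by blast
    then have ox: "ord x' = 0" "lead x' = \<one>\<^bsub>F\<^esub>" using x cl \<psi> by auto
    obtain y where y: "y \<in> nonzero G" "ord y = 0" "lead y = \<one>\<^bsub>F\<^esub>" "y [^]\<^bsub>G\<^esub> n = x'"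
      using G.one_unit_has_root[OF x'(1) ox x(4)] by blast
    have "\<phi> y [^]\<^bsub>K\<^esub> n = x" unfolding pow[OF cl[OF y(1)]] y(4) x'(2) ..
    moreover have "\<phi> y \<in> nonzero K" "\<psi> (\<phi> y) = y" using y(1) cl mem \<psi> by auto
    ultimately show "\<exists>y\<in>nonzero K. ord (\<psi> y) = 0 \<and> lead (\<psi> y) = \<one>\<^bsub>F\<^esub> \<and> y [^]\<^bsub>K\<^esub> n = x"
      using y(2,3) by metis
    show "x = \<one>\<^bsub>K\<^esub>" if "x [^]\<^bsub>K\<^esub> n = \<one>\<^bsub>K\<^esub>"
    proof -
      have "x' [^]\<^bsub>G\<^esub> n = \<one>\<^bsub>G\<^esub>" 
        using that unfolding x'(2) pow[OF cl[OF x'(1)]]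
        by (rule zero(2)[THEN iffD1, rotated]) (use x'(1) cl in simp)
      then have "x' = \<one>\<^bsub>G\<^esub>" by (rule G.one_unit_torsion_free[OF x'(1) ox x(4)])
      then show ?thesis using x'(2) by simp
    qed
  qed
qed

lemma iterated_leading_terms:
  assumes K: "field (iterated_laurent L n)" and char: "char_zero (iterated_laurent L n)"
  shows "\<exists>ord lead const t.
    leading_terms (iterated_laurent L n) (iterated_laurent L (Suc n)) ord lead const t"
proof -
  interpret K: plain_field "iterated_laurent L n" using K by (simp add: plain_field_def)
  have inj: "inj_on Series (carrier (laurent_ring (iterated_laurent L n)))" by (simp add: inj_on_def)
  have "field (iterated_laurent L (Suc n))"
    using field.inj_imp_image_ring_is_field[OF K.laurent_field inj] by simp
  moreover have "Series \<in> ring_iso (laurent_ring (iterated_laurent L n)) (iterated_laurent L (Suc n))"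
    using inj_imp_image_ring_iso[OF inj] by simp
  ultimately show ?thesis
    using leading_terms_transport[OF K.laurent_leading_terms[OF char], of Series
        "iterated_laurent L (Suc n)" "\<lambda>x. case x of Series f \<Rightarrow> f"] by auto
qed

section \<open>Passing to Laurent series\<close>

text \<open>The integers are represented as \<open>m k - i\<close> with \<open>0 \<le> i < m\<close>. Remainders are subtracted
  rather than added so that positive integers have a positive \<open>k\<close>; this gives the same
  partition for \<open>{1, 2, ...}\<close> as for \<open>\<int>\<close>.\<close>

lemma ceiling_multiple:
  assumes "(m::nat) > 0"
  shows "\<exists>k' i. i < m \<and> (k::int) = int m * k' - int i \<and> (k > 0 \<longrightarrow> k' > 0)"
proof -
  let ?i = "nat (- k mod int m)" and ?k = "- (- k div int m)"
  have i: "int ?i = - k mod int m" "?i < m" using assms by (simp_all add: nat_less_iff)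
  have "int m * (- k div int m) + int ?i = - k" unfolding i(1) by (rule mult_div_mod_eq)
  then have eq: "k = int m * ?k - int ?i" unfolding mult_minus_right by linarith
  have "?k > 0" if k: "k > 0"
  proof (rule ccontr)
    assume "\<not> ?k > 0"
    then have "int m * ?k \<le> 0" by (intro mult_nonneg_nonpos) auto
    moreover have "0 \<le> int ?i" by (rule of_nat_0_le_iff)
    ultimately show False using eq k by linarith
  qed
  then show ?thesis using i(2) eq by blast
qed

lemma ceiling_multiple_unique:
  assumes "i < m" "j < m" and eq: "int m * k - int i = int m * l - int j"
  shows "i = j"
proof -
  have "int i - int j = int m * (k - l)" using eq by (simp add: right_diff_distrib)
  then have "int m dvd int i - int j" by simp
  then have "int i mod int m = int j mod int m" by (simp only: mod_eq_dvd_iff)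
  then show ?thesis using assms(1,2) by simp
qed

lemma ceiling_multiple_pos:
  assumes "i < m" "k > 0" shows "int m * k - int i > 0"
proof -
  have "int m * 1 \<le> int m * k" using assms(2) by (intro mult_left_mono) auto
  then show ?thesis using assms(1) by linarith
qed

locale tame_extension = leading_terms F K ord lead const t + F: tame_field F A D s q g b c r m M
  for F :: "'a ring" and K :: "'b ring" and ord :: "'b \<Rightarrow> int" and lead :: "'b \<Rightarrow> 'a"
    and const :: "'a \<Rightarrow> 'b" and t :: 'b
    and A D :: "'a set" and s q :: 'a and g b :: "nat \<Rightarrow> 'a" and c r m M :: nat
begin

text \<open>The sets that are determined by order and leading coefficient. All sets of the tame
  structure on \<open>K\<close> are of this form, up to zero, so that statements about them become
  statements about pairs.\<close>

definition lift :: "(int \<times> 'a) set \<Rightarrow> 'b set" where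
  "lift Z = {x \<in> nonzero K. (ord x, lead x) \<in> Z}"

lemma lift_Un: "lift (Z \<union> W) = lift Z \<union> lift W" by (auto simp: lift_def)
lemma lift_Diff: "lift (Z - W) = lift Z - lift W" by (auto simp: lift_def)
lemma lift_UN: "lift (\<Union>i\<in>I. Z i) = (\<Union>i\<in>I. lift (Z i))" by (auto simp: lift_def)
lemma lift_mono: "Z \<subseteq> W \<Longrightarrow> lift Z \<subseteq> lift W" by (auto simp: lift_def)
lemma lift_disjoint: "Z \<inter> W = {} \<Longrightarrow> lift Z \<inter> lift W = {}" by (auto simp: lift_def)
lemma lift_nonzero: "lift Z \<subseteq> nonzero K" by (auto simp: lift_def)

lemma nonzero_lift: "nonzero K = lift (UNIV \<times> nonzero F)"
  using lead_nonzero by (auto simp: lift_def)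

lemma one_leading: "ord \<one>\<^bsub>K\<^esub> = 0" "lead \<one>\<^bsub>K\<^esub> = \<one>\<^bsub>F\<^esub>"
proof -
  note one = K.nonzero_one
  show "ord \<one>\<^bsub>K\<^esub> = 0" using ord_mult[OF one one] by simp
  have "lead \<one>\<^bsub>K\<^esub> \<otimes>\<^bsub>F\<^esub> lead \<one>\<^bsub>K\<^esub> = lead \<one>\<^bsub>K\<^esub> \<otimes>\<^bsub>F\<^esub> \<one>\<^bsub>F\<^esub>"
    using lead_mult[OF one one] F.nonzero_closed[OF lead_nonzero[OF one]] by simp
  then show "lead \<one>\<^bsub>K\<^esub> = \<one>\<^bsub>F\<^esub>"
    using F.nonzero_cancel[OF lead_nonzero[OF one] F.nonzero_closed[OF lead_nonzero[OF one]] F.one_closed]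
    by blast
qed

lemma inv_leading:
  assumes "x \<in> nonzero K"
  shows "ord (inv\<^bsub>K\<^esub> x) = - ord x" "lead x \<otimes>\<^bsub>F\<^esub> lead (inv\<^bsub>K\<^esub> x) = \<one>\<^bsub>F\<^esub>"
    "lead (inv\<^bsub>K\<^esub> x) = inv\<^bsub>F\<^esub> lead x"
proof -
  note i = K.nonzero_inv[OF assms]
  show "ord (inv\<^bsub>K\<^esub> x) = - ord x"
    using ord_mult[OF assms i] K.nonzero_r_inv[OF assms] one_leading by simp
  show l: "lead x \<otimes>\<^bsub>F\<^esub> lead (inv\<^bsub>K\<^esub> x) = \<one>\<^bsub>F\<^esub>"
    using lead_mult[OF assms i] K.nonzero_r_inv[OF assms] one_leading by simp
  show "lead (inv\<^bsub>K\<^esub> x) = inv\<^bsub>F\<^esub> lead x"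
    using F.comm_inv_char[OF F.nonzero_closed[OF lead_nonzero[OF assms]] F.nonzero_closed[OF lead_nonzero[OF i]] l] by simp
qed

lemma pow_leading:
  assumes "x \<in> nonzero K"
  shows "ord (x [^]\<^bsub>K\<^esub> (n::nat)) = int n * ord x" "lead (x [^]\<^bsub>K\<^esub> n) = lead x [^]\<^bsub>F\<^esub> n"
proof -
  have "ord (x [^]\<^bsub>K\<^esub> (n::nat)) = int n * ord x \<and> lead (x [^]\<^bsub>K\<^esub> n) = lead x [^]\<^bsub>F\<^esub> n"
    by (induction n) (simp_all add: one_leading ord_mult lead_mult assms K.nonzero_pow algebra_simps)
  then show "ord (x [^]\<^bsub>K\<^esub> (n::nat)) = int n * ord x" "lead (x [^]\<^bsub>K\<^esub> n) = lead x [^]\<^bsub>F\<^esub> n" by auto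
qed

lemma element_with_leading:
  assumes "l \<in> nonzero F" shows "\<exists>x\<in>nonzero K. ord x = k \<and> lead x = l"
proof -
  have "\<exists>u\<in>nonzero K. ord u = k \<and> lead u = \<one>\<^bsub>F\<^esub>"
  proof (cases k rule: int_cases2)
    case (nonneg n)
    show ?thesis
      by (rule bexI[OF _ K.nonzero_pow[OF t_nonzero, of n]])
        (simp add: nonneg pow_leading[OF t_nonzero] ord_t lead_t)
  next
    case (nonpos n)
    note tn = K.nonzero_pow[OF t_nonzero, of n]
    show ?thesis
      by (rule bexI[OF _ K.nonzero_inv[OF tn]])
        (simp add: nonpos inv_leading[OF tn] pow_leading[OF t_nonzero] ord_t lead_t)
  qed
  then obtain u where "u \<in> nonzero K" "ord u = k" "lead u = \<one>\<^bsub>F\<^esub>" by blast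
  then show ?thesis
    using const_nonzero[OF assms] ord_const[OF assms] lead_const[OF assms] F.nonzero_closed[OF assms]
    by (intro bexI[of _ "u \<otimes>\<^bsub>K\<^esub> const l"]) (simp_all add: ord_mult lead_mult K.nonzero_mult)
qed

definition elem :: "int \<Rightarrow> 'a \<Rightarrow> 'b" where
  "elem k l = (SOME x. x \<in> nonzero K \<and> ord x = k \<and> lead x = l)"

lemma elem:
  assumes "l \<in> nonzero F"
  shows "elem k l \<in> nonzero K" "ord (elem k l) = k" "lead (elem k l) = l"
  using someI_ex[of "\<lambda>x. x \<in> nonzero K \<and> ord x = k \<and> lead x = l"] element_with_leading[OF assms, of k]
  unfolding elem_def by blast+

lemma translate_lift:
  assumes a: "a \<in> nonzero K" and Z: "Z \<subseteq> UNIV \<times> nonzero F"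
  shows "translate K a (lift Z) = lift ((\<lambda>(k, l). (ord a + k, lead a \<otimes>\<^bsub>F\<^esub> l)) ` Z)" (is "_ = lift (?f ` Z)")
proof
  show "translate K a (lift Z) \<subseteq> lift (?f ` Z)"
    using a by (force simp: translate_def lift_def K.nonzero_mult ord_mult lead_mult)
  show "lift (?f ` Z) \<subseteq> translate K a (lift Z)"
  proof
    fix x assume "x \<in> lift (?f ` Z)"
    then obtain k l where x: "x \<in> nonzero K" "(k, l) \<in> Z" "ord x = ord a + k" "lead x = lead a \<otimes>\<^bsub>F\<^esub> l"
      by (auto simp: lift_def)
    have l: "l \<in> carrier F" using x(2) Z F.nonzero_closed by blast
    note i = K.nonzero_inv[OF a]
    have "lead (inv\<^bsub>K\<^esub> a) \<otimes>\<^bsub>F\<^esub> (lead a \<otimes>\<^bsub>F\<^esub> l) = (lead a \<otimes>\<^bsub>F\<^esub> lead (inv\<^bsub>K\<^esub> a)) \<otimes>\<^bsub>F\<^esub> l"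
      using F.nonzero_closed[OF lead_nonzero[OF a]] F.nonzero_closed[OF lead_nonzero[OF i]] l
      by (simp add: F.m_ac)
    then have "lead (inv\<^bsub>K\<^esub> a \<otimes>\<^bsub>K\<^esub> x) = l" "ord (inv\<^bsub>K\<^esub> a \<otimes>\<^bsub>K\<^esub> x) = k"
      using x l inv_leading[OF a] by (simp_all add: lead_mult[OF i x(1)] ord_mult[OF i x(1)])
    then have "inv\<^bsub>K\<^esub> a \<otimes>\<^bsub>K\<^esub> x \<in> lift Z" using x(2) i x(1) by (simp add: lift_def K.nonzero_mult)
    moreover have "x = a \<otimes>\<^bsub>K\<^esub> (inv\<^bsub>K\<^esub> a \<otimes>\<^bsub>K\<^esub> x)"
      using K.nonzero_closed[OF a] K.nonzero_closed[OF i] K.nonzero_closed[OF x(1)] K.nonzero_r_inv[OF a]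
      by (simp add: K.m_assoc[symmetric])
    ultimately show "x \<in> translate K a (lift Z)" unfolding translate_def by blast
  qed
qed

text \<open>An element whose leading term is an \<open>n\<close>-th power is an \<open>n\<close>-th power itself, because
  the remaining factor is a one-unit.\<close>

lemma powers_lift:
  assumes n: "(n::nat) > 0" and Z: "Z \<subseteq> UNIV \<times> nonzero F"
  shows "powers K n (lift Z) = lift ((\<lambda>(k, l). (int n * k, l [^]\<^bsub>F\<^esub> n)) ` Z)" (is "_ = lift (?f ` Z)")
proof
  show "powers K n (lift Z) \<subseteq> lift (?f ` Z)"
    by (force simp: powers_def lift_def K.nonzero_pow pow_leading)
  show "lift (?f ` Z) \<subseteq> powers K n (lift Z)"
  proof
    fix x assume "x \<in> lift (?f ` Z)"
    then obtain k l where x: "x \<in> nonzero K" "(k, l) \<in> Z" "ord x = int n * k" "lead x = l [^]\<^bsub>F\<^esub> n"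
      by (auto simp: lift_def)
    have l: "l \<in> nonzero F" using x(2) Z by blast
    let ?e = "elem k l"
    note e = elem[OF l, of k]
    note en = K.nonzero_pow[OF e(1), of n] and ein = K.nonzero_inv[OF K.nonzero_pow[OF e(1), of n]]
    let ?u = "inv\<^bsub>K\<^esub> (?e [^]\<^bsub>K\<^esub> n) \<otimes>\<^bsub>K\<^esub> x"
    have u: "?u \<in> nonzero K" using ein x(1) by (rule K.nonzero_mult)
    have "ord ?u = 0" using ein x(1,3) e by (simp add: ord_mult inv_leading[OF en] pow_leading)
    moreover have "lead ?u = \<one>\<^bsub>F\<^esub>"
      using ein x(1,4) e F.nonzero_l_inv[OF F.nonzero_pow[OF l]] by (simp add: lead_mult inv_leading(3)[OF en] pow_leading)
    ultimately obtain y where y: "y \<in> nonzero K" "ord y = 0" "lead y = \<one>\<^bsub>F\<^esub>" "y [^]\<^bsub>K\<^esub> n = ?u"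
      using one_unit_has_root[OF u _ _ n] by blast
    have "(?e \<otimes>\<^bsub>K\<^esub> y) [^]\<^bsub>K\<^esub> n = ?e [^]\<^bsub>K\<^esub> n \<otimes>\<^bsub>K\<^esub> y [^]\<^bsub>K\<^esub> n"
      using e(1) y(1) K.nonzero_closed by (intro K.nat_pow_distrib) auto
    also have "\<dots> = (?e [^]\<^bsub>K\<^esub> n \<otimes>\<^bsub>K\<^esub> inv\<^bsub>K\<^esub> (?e [^]\<^bsub>K\<^esub> n)) \<otimes>\<^bsub>K\<^esub> x"
      unfolding y(4) using K.nonzero_closed[OF en] K.nonzero_closed[OF ein] K.nonzero_closed[OF x(1)]
      by (simp add: K.m_assoc)
    also have "\<dots> = x" using K.nonzero_r_inv[OF en] K.nonzero_closed[OF x(1)] by simp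
    finally have "(?e \<otimes>\<^bsub>K\<^esub> y) [^]\<^bsub>K\<^esub> n = x" .
    moreover have "?e \<otimes>\<^bsub>K\<^esub> y \<in> lift Z"
      using e y(1-3) x(2) F.nonzero_closed[OF l] by (simp add: lift_def K.nonzero_mult ord_mult lead_mult)
    ultimately show "x \<in> powers K n (lift Z)" unfolding powers_def by blast
  qed
qed

text \<open>The value group of \<open>K\<close> is the lexicographic product of \<open>\<int>\<close> and the value group of \<open>F\<close>:
  an element is positive if its order is positive, or its order is zero and its leading
  coefficient is positive. The variable \<open>t\<close> supplies the new segment.\<close>

definition "A' = lift (UNIV \<times> A)"
definition "D' = lift ({0<..} \<times> A \<union> {0} \<times> D)"
definition "b' k = (if k < r then const (b k) else t)"

abbreviation "P \<equiv> ball F D g c"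
abbreviation "T \<equiv> unit_ball F D g c"

lemma A_group_translate:
  assumes "a \<in> A" shows "translate F a A = A"
proof
  show "translate F a A \<subseteq> A" using F.A_mult assms by (auto simp: translate_def)
  show "A \<subseteq> translate F a A"
  proof
    fix x assume x: "x \<in> A"
    have nz: "a \<in> nonzero F" "x \<in> nonzero F" using assms x F.A_nonzero by auto
    have "x = a \<otimes>\<^bsub>F\<^esub> (inv\<^bsub>F\<^esub> a \<otimes>\<^bsub>F\<^esub> x)"
      using nz F.nonzero_closed F.nonzero_inv F.nonzero_r_inv[OF nz(1)] by (simp add: F.m_assoc[symmetric])
    moreover have "inv\<^bsub>F\<^esub> a \<otimes>\<^bsub>F\<^esub> x \<in> A" using F.A_mult F.A_inv assms x by simp
    ultimately show "x \<in> translate F a A" unfolding translate_def by blast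
  qed
qed

lemma s_A: "s \<in> A"
proof -
  have "\<zero>\<^bsub>F\<^esub> \<in> P" by (simp add: ball_def)
  then have "\<one>\<^bsub>F\<^esub> \<oplus>\<^bsub>F\<^esub> \<zero>\<^bsub>F\<^esub> \<in> T" unfolding unit_ball_def by blast
  then have "\<one>\<^bsub>F\<^esub> \<in> T" by simp
  then have "s \<otimes>\<^bsub>F\<^esub> \<one>\<^bsub>F\<^esub> \<in> D" using F.D_shift unfolding translate_def by blast
  then show ?thesis using F.D_A F.nonzero_closed[OF F.s_nonzero] by auto
qed

lemma one_T: "\<one>\<^bsub>F\<^esub> \<in> T"
proof -
  have "\<zero>\<^bsub>F\<^esub> \<in> P" by (simp add: ball_def)
  then have "\<one>\<^bsub>F\<^esub> \<oplus>\<^bsub>F\<^esub> \<zero>\<^bsub>F\<^esub> \<in> T" unfolding unit_ball_def by blast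
  then show ?thesis by simp
qed

lemma A_D_T_nonzero: "A \<subseteq> nonzero F" "D \<subseteq> nonzero F" "D \<union> T \<subseteq> nonzero F" "T \<subseteq> nonzero F"
  using F.A_nonzero F.D_A F.T_A by auto

lemma translate_nonzero: "a \<in> nonzero F \<Longrightarrow> S \<subseteq> nonzero F \<Longrightarrow> translate F a S \<subseteq> nonzero F"
  using F.nonzero_mult by (auto simp: translate_def)

lemma translate_const2:
  assumes "a \<in> nonzero F" "Y \<subseteq> nonzero F" "Y' \<subseteq> nonzero F"
  shows "translate K (const a) (lift (X \<times> Y \<union> X' \<times> Y')) = lift (X \<times> translate F a Y \<union> X' \<times> translate F a Y')"
proof -
  have "translate K (const a) (lift (X \<times> Y \<union> X' \<times> Y')) =
      lift ((\<lambda>(k, l). (ord (const a) + k, lead (const a) \<otimes>\<^bsub>F\<^esub> l)) ` (X \<times> Y \<union> X' \<times> Y'))"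
    using assms by (intro translate_lift const_nonzero) auto
  also have "(\<lambda>(k, l). (ord (const a) + k, lead (const a) \<otimes>\<^bsub>F\<^esub> l)) ` (X \<times> Y \<union> X' \<times> Y') =
      X \<times> translate F a Y \<union> X' \<times> translate F a Y'"
    unfolding ord_const[OF assms(1)] lead_const[OF assms(1)] translate_def by force
  finally show ?thesis .
qed

lemma translate_const1:
  assumes "a \<in> nonzero F" "Y \<subseteq> nonzero F"
  shows "translate K (const a) (lift (X \<times> Y)) = lift (X \<times> translate F a Y)"
  using translate_const2[OF assms assms(2), of X X] by simp

text \<open>All elements of positive order are in the ball, since the cosets \<open>g i A\<close> exhaust the
  leading coefficients.\<close>

lemma ball_lift: "ball K D' (\<lambda>i. const (g i)) c = insert \<zero>\<^bsub>K\<^esub> (lift ({0<..} \<times> nonzero F \<union> {0} \<times> (P - {\<zero>\<^bsub>F\<^esub>})))"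
proof -
  have "(\<Union>i<c. translate K (const (g i)) D') =
      (\<Union>i<c. lift ({0<..} \<times> translate F (g i) A \<union> {0} \<times> translate F (g i) D))"
    unfolding D'_def using translate_const2 F.g_nonzero A_D_T_nonzero by auto
  also have "\<dots> = lift ({0<..} \<times> (\<Union>i<c. translate F (g i) A) \<union> {0} \<times> (\<Union>i<c. translate F (g i) D))"
    unfolding lift_UN[symmetric] by (rule arg_cong[of _ _ lift]) auto
  also have "(\<Union>i<c. translate F (g i) A) = nonzero F"
  proof
    show "(\<Union>i<c. translate F (g i) A) \<subseteq> nonzero F"
      using translate_nonzero[OF F.g_nonzero A_D_T_nonzero(1)] by auto
    show "nonzero F \<subseteq> (\<Union>i<c. translate F (g i) A)" using F.g_cover by fastforce
  qed
  also have "(\<Union>i<c. translate F (g i) D) = P - {\<zero>\<^bsub>F\<^esub>}"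
    using translate_nonzero[OF F.g_nonzero A_D_T_nonzero(2)] by (auto simp: ball_def nonzero_def)
  finally show ?thesis unfolding ball_def by simp
qed

lemma minus_one_leading:
  "\<ominus>\<^bsub>K\<^esub> \<one>\<^bsub>K\<^esub> \<in> nonzero K" "ord (\<ominus>\<^bsub>K\<^esub> \<one>\<^bsub>K\<^esub>) = 0" "lead (\<ominus>\<^bsub>K\<^esub> \<one>\<^bsub>K\<^esub>) = \<ominus>\<^bsub>F\<^esub> \<one>\<^bsub>F\<^esub>"
proof -
  show n: "\<ominus>\<^bsub>K\<^esub> \<one>\<^bsub>K\<^esub> \<in> nonzero K"
    using K.one_not_zero K.minus_minus[OF K.one_closed] K.minus_zero unfolding nonzero_def by force
  have "(\<ominus>\<^bsub>K\<^esub> \<one>\<^bsub>K\<^esub>) \<otimes>\<^bsub>K\<^esub> (\<ominus>\<^bsub>K\<^esub> \<one>\<^bsub>K\<^esub>) = \<one>\<^bsub>K\<^esub>" by (simp add: K.l_minus K.r_minus)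
  then show o: "ord (\<ominus>\<^bsub>K\<^esub> \<one>\<^bsub>K\<^esub>) = 0" using ord_mult[OF n n] one_leading by simp
  have "\<one>\<^bsub>K\<^esub> \<oplus>\<^bsub>K\<^esub> \<ominus>\<^bsub>K\<^esub> \<one>\<^bsub>K\<^esub> \<notin> nonzero K" by (simp add: K.r_neg nonzero_def)
  then have "\<one>\<^bsub>F\<^esub> \<oplus>\<^bsub>F\<^esub> lead (\<ominus>\<^bsub>K\<^esub> \<one>\<^bsub>K\<^esub>) = \<zero>\<^bsub>F\<^esub>"
    using add_same[OF K.nonzero_one n one_leading(1) o] one_leading by auto
  then show "lead (\<ominus>\<^bsub>K\<^esub> \<one>\<^bsub>K\<^esub>) = \<ominus>\<^bsub>F\<^esub> \<one>\<^bsub>F\<^esub>"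
    using F.nonzero_closed[OF lead_nonzero[OF n]] by (metis F.minus_equality F.a_comm F.one_closed)
qed

lemma unit_ball_lift: "unit_ball K D' (\<lambda>i. const (g i)) c = lift ({0} \<times> T)"
proof
  show "unit_ball K D' (\<lambda>i. const (g i)) c \<subseteq> lift ({0} \<times> T)"
  proof
    fix y assume "y \<in> unit_ball K D' (\<lambda>i. const (g i)) c"
    then obtain x where y: "y = \<one>\<^bsub>K\<^esub> \<oplus>\<^bsub>K\<^esub> x" and
      x: "x \<in> insert \<zero>\<^bsub>K\<^esub> (lift ({0<..} \<times> nonzero F \<union> {0} \<times> (P - {\<zero>\<^bsub>F\<^esub>})))"
      unfolding unit_ball_def ball_lift by blast
    show "y \<in> lift ({0} \<times> T)"
    proof (cases "x = \<zero>\<^bsub>K\<^esub> \<or> 0 < ord x")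
      case True
      have "x \<in> carrier K" using x lift_nonzero K.nonzero_closed by blast
      from add_small[OF K.nonzero_one one_leading(1) this True]
      show ?thesis using one_leading one_T y by (simp add: lift_def)
    next
      case False
      then have x': "x \<in> nonzero K" "ord x = 0" "lead x \<in> P" using x by (auto simp: lift_def)
      then have T: "\<one>\<^bsub>F\<^esub> \<oplus>\<^bsub>F\<^esub> lead x \<in> T" unfolding unit_ball_def by blast
      then have "\<one>\<^bsub>F\<^esub> \<oplus>\<^bsub>F\<^esub> lead x \<noteq> \<zero>\<^bsub>F\<^esub>" using A_D_T_nonzero by (auto simp: nonzero_def)
      then show ?thesis
        using add_same[OF K.nonzero_one x'(1) one_leading(1) x'(2)] one_leading T y by (simp add: lift_def)
    qed
  qed
  show "lift ({0} \<times> T) \<subseteq> unit_ball K D' (\<lambda>i. const (g i)) c"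
  proof
    fix y assume "y \<in> lift ({0} \<times> T)"
    then have y: "y \<in> nonzero K" "ord y = 0" "lead y \<in> T" by (auto simp: lift_def)
    then obtain l where l: "l \<in> P" "lead y = \<one>\<^bsub>F\<^esub> \<oplus>\<^bsub>F\<^esub> l" unfolding unit_ball_def by blast
    have lc: "l \<in> carrier F" using l(1) F.definable_subset_closed[OF F.definable_ball] by blast
    note m1 = minus_one_leading and yc = K.nonzero_closed[OF y(1)]
    define x where "x = y \<oplus>\<^bsub>K\<^esub> \<ominus>\<^bsub>K\<^esub> \<one>\<^bsub>K\<^esub>"
    have xc: "x \<in> carrier K" using yc by (simp add: x_def)
    have yx: "y = \<one>\<^bsub>K\<^esub> \<oplus>\<^bsub>K\<^esub> x" unfolding x_def using yc by (simp add: K.a_ac K.r_neg)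
    have sum: "lead y \<oplus>\<^bsub>F\<^esub> lead (\<ominus>\<^bsub>K\<^esub> \<one>\<^bsub>K\<^esub>) = l" using l(2) m1(3) lc by (simp add: F.a_ac F.r_neg1 F.r_neg2 F.r_neg)
    have "x \<in> ball K D' (\<lambda>i. const (g i)) c"
    proof (cases "l = \<zero>\<^bsub>F\<^esub>")
      case True
      then have "x = \<zero>\<^bsub>K\<^esub> \<or> 0 < ord x" using add_cancel[OF y(1) m1(1) y(2) m1(2)] sum by (simp add: x_def)
      then show ?thesis unfolding ball_lift lift_def using xc lead_nonzero[of x] by (auto simp: nonzero_def[of K])
    next
      case False
      then have "x \<in> nonzero K \<and> ord x = 0 \<and> lead x = l"
        using add_same[OF y(1) m1(1) y(2) m1(2)] sum by (simp add: x_def)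
      then show ?thesis unfolding ball_lift lift_def using False l(1) by simp
    qed
    then show "y \<in> unit_ball K D' (\<lambda>i. const (g i)) c" unfolding unit_ball_def using yx by blast
  qed
qed

lemma D_unit_ball_lift: "D' \<union> unit_ball K D' (\<lambda>i. const (g i)) c = lift ({0<..} \<times> A \<union> {0} \<times> (D \<union> T))"
  unfolding unit_ball_lift unfolding D'_def lift_Un[symmetric] by (rule arg_cong[of _ _ lift]) auto

lemma power_partition_const:
  assumes S: "S \<subseteq> nonzero F" and part: "power_partition F m N S"
  shows "power_partition K m N (lift ({0} \<times> S))"
proof -
  obtain a where a: "\<forall>j<N. a j \<in> nonzero F" "S = (\<Union>j<N. translate F (a j) (powers F m S))"
    "\<forall>i<N. \<forall>j<N. i \<noteq> j \<longrightarrow> translate F (a i) (powers F m S) \<inter> translate F (a j) (powers F m S) = {}"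
    using part unfolding power_partition_def by blast
  have P: "powers F m S \<subseteq> nonzero F" using S F.nonzero_pow by (auto simp: powers_def)
  have "powers K m (lift ({0} \<times> S)) = lift ((\<lambda>(k, l). (int m * k, l [^]\<^bsub>F\<^esub> m)) ` ({0} \<times> S))"
    using S by (intro powers_lift F.m_pos) auto
  also have "(\<lambda>(k, l). (int m * k, l [^]\<^bsub>F\<^esub> m)) ` ({0} \<times> S) = {0} \<times> powers F m S"
    by (force simp: powers_def)
  finally have p: "powers K m (lift ({0} \<times> S)) = lift ({0} \<times> powers F m S)" .
  have tr: "translate K (const (a j)) (powers K m (lift ({0} \<times> S))) = lift ({0} \<times> translate F (a j) (powers F m S))"
    if "j < N" for j unfolding p using a(1) that P by (intro translate_const1) auto
  have "lift ({0} \<times> S) = (\<Union>j<N. lift ({0} \<times> translate F (a j) (powers F m S)))"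
    unfolding lift_UN[symmetric] by (rule arg_cong[of _ _ lift]) (use a(2) in blast)
  then have "lift ({0} \<times> S) = (\<Union>j<N. translate K (const (a j)) (powers K m (lift ({0} \<times> S))))" using tr by simp
  moreover have "translate K (const (a i)) (powers K m (lift ({0} \<times> S))) \<inter>
      translate K (const (a j)) (powers K m (lift ({0} \<times> S))) = {}" if "i < N" "j < N" "i \<noteq> j" for i j
    unfolding tr[OF that(1)] tr[OF that(2)] by (rule lift_disjoint) (use a(3) that in blast)
  moreover have "\<forall>j<N. const (a j) \<in> nonzero K" using a(1) const_nonzero by blast
  ultimately show ?thesis unfolding power_partition_def by (intro exI[of _ "\<lambda>j. const (a j)"]) blast
qed

text \<open>The orders contribute \<open>m\<close> translates and the leading coefficients \<open>m ^ r\<close> translates,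
  from the partition of \<open>A\<close>.\<close>

lemma power_partition_orders:
  assumes X1: "\<And>k i. k \<in> X \<Longrightarrow> i < m \<Longrightarrow> int m * k - int i \<in> X"
    and X2: "\<And>k. k \<in> X \<Longrightarrow> \<exists>k'\<in>X. \<exists>i<m. k = int m * k' - int i"
  shows "power_partition K m (m ^ Suc r) (lift (X \<times> A))"
proof -
  let ?N = "m ^ r"
  obtain a where a: "\<forall>j<?N. a j \<in> nonzero F" "A = (\<Union>j<?N. translate F (a j) (powers F m A))"
    "\<forall>i<?N. \<forall>j<?N. i \<noteq> j \<longrightarrow> translate F (a i) (powers F m A) \<inter> translate F (a j) (powers F m A) = {}"
    using F.A_partition unfolding power_partition_def by blast
  have N: "?N > 0" using F.m_pos by simp
  define a' where "a' j = elem (- int (j div ?N)) (a (j mod ?N))" for j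
  define Z where "Z j = (\<lambda>k. int m * k - int (j div ?N)) ` X \<times> translate F (a (j mod ?N)) (powers F m A)" for j
  have idx: "j div ?N < m" "j mod ?N < ?N" if "j < m ^ Suc r" for j
    using that N by (auto simp: less_mult_imp_div_less mult.commute)
  have P: "powers F m A \<subseteq> nonzero F" using A_D_T_nonzero(1) F.nonzero_pow by (auto simp: powers_def)
  have p: "powers K m (lift (X \<times> A)) = lift ((\<lambda>k. int m * k) ` X \<times> powers F m A)"
  proof -
    have "powers K m (lift (X \<times> A)) = lift ((\<lambda>(k, l). (int m * k, l [^]\<^bsub>F\<^esub> m)) ` (X \<times> A))"
      using A_D_T_nonzero by (intro powers_lift F.m_pos) auto
    also have "(\<lambda>(k, l). (int m * k, l [^]\<^bsub>F\<^esub> m)) ` (X \<times> A) = (\<lambda>k. int m * k) ` X \<times> powers F m A"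
      by (force simp: powers_def)
    finally show ?thesis .
  qed
  have an: "a (j mod ?N) \<in> nonzero F" if "j < m ^ Suc r" for j using a(1) idx(2)[OF that] by blast
  have tr: "translate K (a' j) (powers K m (lift (X \<times> A))) = lift (Z j)" if "j < m ^ Suc r" for j
  proof -
    note e = elem[OF an[OF that], of "- int (j div ?N)", folded a'_def]
    have "translate K (a' j) (powers K m (lift (X \<times> A))) =
        lift ((\<lambda>(k, l). (ord (a' j) + k, lead (a' j) \<otimes>\<^bsub>F\<^esub> l)) ` ((\<lambda>k. int m * k) ` X \<times> powers F m A))"
      unfolding p using e(1) P by (intro translate_lift) auto
    also have "(\<lambda>(k, l). (ord (a' j) + k, lead (a' j) \<otimes>\<^bsub>F\<^esub> l)) ` ((\<lambda>k. int m * k) ` X \<times> powers F m A) = Z j"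
      unfolding Z_def e(2,3) translate_def by force
    finally show ?thesis .
  qed
  have "X \<times> A = (\<Union>j<m ^ Suc r. Z j)"
  proof
    show "(\<Union>j<m ^ Suc r. Z j) \<subseteq> X \<times> A"
    proof
      fix z assume "z \<in> (\<Union>j<m ^ Suc r. Z j)"
      then obtain j where j: "j < m ^ Suc r" "z \<in> Z j" by blast
      then have "translate F (a (j mod ?N)) (powers F m A) \<subseteq> A" using a(2) idx(2)[OF j(1)] by blast
      then show "z \<in> X \<times> A" using j(2) X1 idx(1)[OF j(1)] unfolding Z_def by auto
    qed
    show "X \<times> A \<subseteq> (\<Union>j<m ^ Suc r. Z j)"
    proof
      fix z assume "z \<in> X \<times> A"
      then obtain k l where z: "z = (k, l)" "k \<in> X" "l \<in> A" by blast
      obtain k' i where k: "k' \<in> X" "i < m" "k = int m * k' - int i" using X2[OF z(2)] by blast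
      obtain j where j: "j < ?N" "l \<in> translate F (a j) (powers F m A)" using a(2) z(3) by blast
      let ?j = "i * ?N + j"
      have "?j div ?N = i" "?j mod ?N = j" using j(1) N by auto
      then have "z \<in> Z ?j" unfolding Z_def using z(1) k j(2) by auto
      moreover have "?j < m ^ Suc r"
      proof -
        have "?j < Suc i * ?N" using j(1) by simp
        also have "\<dots> \<le> m * ?N" using k(2) by (intro mult_le_mono1) simp
        finally show ?thesis by simp
      qed
      ultimately show "z \<in> (\<Union>j<m ^ Suc r. Z j)" by blast
    qed
  qed
  then have "lift (X \<times> A) = (\<Union>j<m ^ Suc r. lift (Z j))" using lift_UN by metis
  then have "lift (X \<times> A) = (\<Union>j<m ^ Suc r. translate K (a' j) (powers K m (lift (X \<times> A))))" using tr by simp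
  moreover have "translate K (a' i) (powers K m (lift (X \<times> A))) \<inter> translate K (a' j) (powers K m (lift (X \<times> A))) = {}"
    if ij: "i < m ^ Suc r" "j < m ^ Suc r" "i \<noteq> j" for i j
    unfolding tr[OF ij(1)] tr[OF ij(2)]
  proof (rule lift_disjoint)
    consider "i mod ?N \<noteq> j mod ?N" | "i div ?N \<noteq> j div ?N" using ij(3) by (metis div_mult_mod_eq)
    then show "Z i \<inter> Z j = {}"
    proof cases
      case 1
      then show ?thesis unfolding Z_def using a(3) idx(2)[OF ij(1)] idx(2)[OF ij(2)] by blast
    next
      case 2
      then have "int m * k - int (i div ?N) \<noteq> int m * k' - int (j div ?N)" for k k'
        using ceiling_multiple_unique idx(1)[OF ij(1)] idx(1)[OF ij(2)] by blast
      then show ?thesis unfolding Z_def by blast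
    qed
  qed
  moreover have "\<forall>j<m ^ Suc r. a' j \<in> nonzero K" using elem(1) an unfolding a'_def by blast
  ultimately show ?thesis unfolding power_partition_def by (intro exI[of _ a']) blast
qed

lemma b'_A: "k < Suc r \<Longrightarrow> b' k \<in> A'"
  using F.b_A F.A_one subsetD[OF A_D_T_nonzero(1) F.b_A] const_nonzero ord_const lead_const t_nonzero lead_t
  by (auto simp: b'_def A'_def lift_def)

text \<open>Over the old \<open>b k\<close>, which have order zero, the condition on squares holds for positive
  order, and for order zero it is the old condition on the leading coefficient; over \<open>t\<close> it
  says that the order is positive, since twice an order is at least one only if it is
  greater than one.\<close>

lemma segment_lift:
  "k < r \<Longrightarrow> segment K D' b' (Suc r) k = lift ({0<..} \<times> A \<union> {0} \<times> segment F D b r k)"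
  "segment K D' b' (Suc r) r = lift ({0<..} \<times> A)"
  "r < k \<Longrightarrow> segment K D' b' (Suc r) k = {}"
proof -
  have sq: "ord (x \<otimes>\<^bsub>K\<^esub> x) = 2 * ord x" "lead (x \<otimes>\<^bsub>K\<^esub> x) = lead x \<otimes>\<^bsub>F\<^esub> lead x" "x \<otimes>\<^bsub>K\<^esub> x \<in> nonzero K"
    if "x \<in> nonzero K" for x using that by (auto simp: ord_mult lead_mult K.nonzero_mult)
  show "segment K D' b' (Suc r) k = lift ({0<..} \<times> A \<union> {0} \<times> segment F D b r k)" if k: "k < r"
  proof -
    note bk = F.b_A[OF k]
    have "translate K (const (b k)) D' = lift ({0<..} \<times> A \<union> {0} \<times> translate F (b k) D)"
      using translate_const2[OF subsetD[OF A_D_T_nonzero(1) bk] A_D_T_nonzero(1,2), of "{0<..}" "{0}"] A_group_translate[OF bk]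
      unfolding D'_def by simp
    then have "segment K D' b' (Suc r) k = {x \<in> D'. x \<otimes>\<^bsub>K\<^esub> x \<in> lift ({0<..} \<times> A \<union> {0} \<times> translate F (b k) D)}"
      using k by (simp add: segment_def b'_def)
    also have "\<dots> = lift ({0<..} \<times> A \<union> {0} \<times> segment F D b r k)"
      using sq F.A_mult F.D_A k unfolding D'_def lift_def segment_def by auto
    finally show ?thesis .
  qed
  show "segment K D' b' (Suc r) r = lift ({0<..} \<times> A)"
  proof -
    have "translate K t D' = lift ((\<lambda>(k, l). (ord t + k, lead t \<otimes>\<^bsub>F\<^esub> l)) ` ({0<..} \<times> A \<union> {0} \<times> D))"
      unfolding D'_def using A_D_T_nonzero by (intro translate_lift t_nonzero) auto
    also have "(\<lambda>(k, l). (ord t + k, lead t \<otimes>\<^bsub>F\<^esub> l)) ` ({0<..} \<times> A \<union> {0} \<times> D) = {1<..} \<times> A \<union> {1} \<times> D"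
    proof -
      have one: "(\<lambda>l. \<one>\<^bsub>F\<^esub> \<otimes>\<^bsub>F\<^esub> l) ` S = S" if "S \<subseteq> nonzero F" for S
      proof -
        have "(\<lambda>l. \<one>\<^bsub>F\<^esub> \<otimes>\<^bsub>F\<^esub> l) ` S = (\<lambda>l. l) ` S"
          using that F.nonzero_closed by (intro image_cong) auto
        then show ?thesis by simp
      qed
      have shift: "(\<lambda>k::int. 1 + k) ` {0<..} = {1<..}"
        by (auto intro!: image_eqI[of _ _ "_ - 1"])
      have "(\<lambda>(k, l). (1 + k, \<one>\<^bsub>F\<^esub> \<otimes>\<^bsub>F\<^esub> l)) ` ({0<..} \<times> A \<union> {0::int} \<times> D) =
          (\<lambda>k. 1 + k) ` {0<..} \<times> (\<lambda>l. \<one>\<^bsub>F\<^esub> \<otimes>\<^bsub>F\<^esub> l) ` A \<union> {1} \<times> (\<lambda>l. \<one>\<^bsub>F\<^esub> \<otimes>\<^bsub>F\<^esub> l) ` D"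
        by force
      then show ?thesis unfolding ord_t lead_t one[OF A_D_T_nonzero(1)] one[OF A_D_T_nonzero(2)] shift .
    qed
    finally have tD: "translate K t D' = lift ({1<..} \<times> A \<union> {1} \<times> D)" .
    show ?thesis
      unfolding segment_def b'_def using sq F.A_mult F.D_A tD
      by (auto simp: D'_def lift_def)
  qed
  show "segment K D' b' (Suc r) k = {}" if "r < k" using that by (simp add: segment_def)
qed

lemma layer_lift:
  "k < r \<Longrightarrow> layer K D' b' (Suc r) k = lift ({0} \<times> layer F D b r k)"
  "layer K D' b' (Suc r) r = lift ({0<..} \<times> A)"
proof -
  show "layer K D' b' (Suc r) k = lift ({0} \<times> layer F D b r k)" if k: "k < r"
  proof (cases "Suc k < r")
    case True
    show ?thesis unfolding layer_def segment_lift(1)[OF k] segment_lift(1)[OF True] lift_Diff[symmetric]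
      by (rule arg_cong[of _ _ lift]) auto
  next
    case False
    then have "Suc k = r" using k by simp
    then show ?thesis unfolding layer_def segment_lift(1)[OF k] \<open>Suc k = r\<close> segment_lift(2) lift_Diff[symmetric]
      by (intro arg_cong[of _ _ lift]) (auto simp: segment_def)
  qed
  show "layer K D' b' (Suc r) r = lift ({0<..} \<times> A)"
    unfolding layer_def segment_lift(2) segment_lift(3)[OF lessI] by simp
qed

lemma A'_powers: "\<exists>C\<subseteq>nonzero K. finite C \<and> A' = (\<Union>a\<in>C. translate K a (powers K M (nonzero K)))"
proof -
  obtain C where C: "C \<subseteq> nonzero F" "finite C" "A = (\<Union>a\<in>C. translate F a (powers F M (nonzero F)))"
    using F.A_powers by blast
  let ?C = "(\<lambda>(i, a). elem (int i) a) ` ({..<M} \<times> C)"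
  have p: "powers K M (nonzero K) = lift ((\<lambda>k. int M * k) ` UNIV \<times> powers F M (nonzero F))"
  proof -
    have "powers K M (nonzero K) = lift ((\<lambda>(k, l). (int M * k, l [^]\<^bsub>F\<^esub> M)) ` (UNIV \<times> nonzero F))"
      unfolding nonzero_lift by (intro powers_lift F.M_pos) auto
    also have "(\<lambda>(k, l). (int M * k, l [^]\<^bsub>F\<^esub> M)) ` (UNIV \<times> nonzero F) = (\<lambda>k. int M * k) ` UNIV \<times> powers F M (nonzero F)"
      by (force simp: powers_def)
    finally show ?thesis .
  qed
  have P: "powers F M (nonzero F) \<subseteq> nonzero F" using F.nonzero_pow by (auto simp: powers_def)
  have tr: "translate K (elem (int i) a) (powers K M (nonzero K)) =
      lift ((\<lambda>k. int i + int M * k) ` UNIV \<times> translate F a (powers F M (nonzero F)))" if "a \<in> C" for i a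
  proof -
    have a: "a \<in> nonzero F" using C(1) that by blast
    have "translate K (elem (int i) a) (powers K M (nonzero K)) = lift ((\<lambda>(k, l). (ord (elem (int i) a) + k, lead (elem (int i) a) \<otimes>\<^bsub>F\<^esub> l)) `
        ((\<lambda>k. int M * k) ` UNIV \<times> powers F M (nonzero F)))"
      unfolding p using P by (intro translate_lift elem[OF a]) auto
    also have "(\<lambda>(k, l). (ord (elem (int i) a) + k, lead (elem (int i) a) \<otimes>\<^bsub>F\<^esub> l)) ` ((\<lambda>k. int M * k) ` UNIV \<times> powers F M (nonzero F)) =
        (\<lambda>k. int i + int M * k) ` UNIV \<times> translate F a (powers F M (nonzero F))"
      unfolding elem[OF a] translate_def by force
    finally show ?thesis .
  qed
  have "A' = (\<Union>x\<in>{..<M} \<times> C. lift ((\<lambda>k. int (fst x) + int M * k) ` UNIV \<times> translate F (snd x) (powers F M (nonzero F))))"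
    unfolding A'_def lift_UN[symmetric]
  proof (rule arg_cong[of _ _ lift], intro subset_antisym subsetI)
    fix z :: "int \<times> 'a" assume "z \<in> UNIV \<times> A"
    then obtain k l a where z: "z = (k, l)" "a \<in> C" "l \<in> translate F a (powers F M (nonzero F))" using C(3) by blast
    have "k = int (nat (k mod int M)) + int M * (k div int M)" using F.M_pos by simp
    moreover have "nat (k mod int M) < M" using F.M_pos by (simp add: nat_less_iff)
    ultimately show "z \<in> (\<Union>x\<in>{..<M} \<times> C. (\<lambda>k. int (fst x) + int M * k) ` UNIV \<times> translate F (snd x) (powers F M (nonzero F)))"
      using z by (intro UN_I[of "(nat (k mod int M), a)"]) (auto intro: image_eqI[of _ _ "k div int M"])
  qed (use C(3) in auto)
  also have "\<dots> = (\<Union>x\<in>{..<M} \<times> C. translate K (elem (int (fst x)) (snd x)) (powers K M (nonzero K)))"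
    using tr by (intro SUP_cong) auto
  also have "\<dots> = (\<Union>a\<in>?C. translate K a (powers K M (nonzero K)))" by (simp add: case_prod_unfold)
  finally have "A' = (\<Union>a\<in>?C. translate K a (powers K M (nonzero K)))" .
  moreover have "?C \<subseteq> nonzero K" using elem(1) C(1) by auto
  moreover have "finite ?C" using C(2) by simp
  ultimately show ?thesis by blast
qed

lemma q_leading:
  assumes "x \<in> nonzero K"
  shows "const q \<otimes>\<^bsub>K\<^esub> x [^]\<^bsub>K\<^esub> m \<in> nonzero K" "ord (const q \<otimes>\<^bsub>K\<^esub> x [^]\<^bsub>K\<^esub> m) = int m * ord x"
    "lead (const q \<otimes>\<^bsub>K\<^esub> x [^]\<^bsub>K\<^esub> m) = q \<otimes>\<^bsub>F\<^esub> lead x [^]\<^bsub>F\<^esub> m"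
  using const_nonzero[OF F.q_nonzero] ord_const[OF F.q_nonzero] lead_const[OF F.q_nonzero] assms
  by (simp_all add: K.nonzero_mult K.nonzero_pow ord_mult lead_mult pow_leading)

lemma zero_multiple: "0 \<in> range (\<lambda>k. int m * k)"
  by (rule image_eqI[of _ _ 0]) auto

lemma powers_A': "powers K m A' = lift ((\<lambda>k. int m * k) ` UNIV \<times> powers F m A)"
proof -
  have "powers K m A' = lift ((\<lambda>(k, l). (int m * k, l [^]\<^bsub>F\<^esub> m)) ` (UNIV \<times> A))"
    unfolding A'_def using A_D_T_nonzero by (intro powers_lift F.m_pos) auto
  also have "(\<lambda>(k, l). (int m * k, l [^]\<^bsub>F\<^esub> m)) ` (UNIV \<times> A) = (\<lambda>k. int m * k) ` UNIV \<times> powers F m A"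
    by (force simp: powers_def)
  finally show ?thesis .
qed

lemma q_powers_A': "translate K (const q) (powers K m A') = lift ((\<lambda>k. int m * k) ` UNIV \<times> translate F q (powers F m A))"
  unfolding powers_A' using A_D_T_nonzero F.nonzero_pow by (intro translate_const1 F.q_nonzero) (auto simp: powers_def)

lemma q_power_lift:
  assumes "x \<in> lift ({0<..} \<times> A \<union> {0} \<times> (D \<union> T))"
  shows "\<one>\<^bsub>K\<^esub> \<oplus>\<^bsub>K\<^esub> const q \<otimes>\<^bsub>K\<^esub> x [^]\<^bsub>K\<^esub> m \<in> powers K m A'"
proof -
  have x: "x \<in> nonzero K" using assms by (simp add: lift_def)
  note y = q_leading[OF x]
  show ?thesis
  proof (cases "ord x = 0")
    case True
    then have "lead x \<in> D \<union> T" using assms by (auto simp: lift_def)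
    then have p: "\<one>\<^bsub>F\<^esub> \<oplus>\<^bsub>F\<^esub> q \<otimes>\<^bsub>F\<^esub> lead x [^]\<^bsub>F\<^esub> m \<in> powers F m A" by (rule F.q_power)
    then have "\<one>\<^bsub>F\<^esub> \<oplus>\<^bsub>F\<^esub> q \<otimes>\<^bsub>F\<^esub> lead x [^]\<^bsub>F\<^esub> m \<in> nonzero F"
      using A_D_T_nonzero F.nonzero_pow by (auto simp: powers_def)
    then have ne: "lead \<one>\<^bsub>K\<^esub> \<oplus>\<^bsub>F\<^esub> lead (const q \<otimes>\<^bsub>K\<^esub> x [^]\<^bsub>K\<^esub> m) \<noteq> \<zero>\<^bsub>F\<^esub>"
      by (simp add: nonzero_def y(3) one_leading)
    have o: "ord (const q \<otimes>\<^bsub>K\<^esub> x [^]\<^bsub>K\<^esub> m) = 0" using y(2) True by simp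
    from add_same[OF K.nonzero_one y(1) one_leading(1) o ne] p
    show ?thesis unfolding powers_A' lift_def by (simp add: y(3) one_leading zero_multiple)
  next
    case False
    then have "ord (const q \<otimes>\<^bsub>K\<^esub> x [^]\<^bsub>K\<^esub> m) > 0" using assms y(2) F.m_pos by (auto simp: lift_def)
    moreover have "\<one>\<^bsub>F\<^esub> \<in> powers F m A" unfolding powers_def using F.A_one by (intro image_eqI[of _ _ "\<one>\<^bsub>F\<^esub>"]) auto
    ultimately show ?thesis
      using add_small[OF K.nonzero_one one_leading(1) K.nonzero_closed[OF y(1)]] one_leading zero_multiple
      unfolding powers_A' lift_def by simp
  qed
qed

text \<open>For \<open>y = q x^m\<close> of negative order, \<open>1 + y = y (1 + 1/y)\<close> has the same leading term as
  \<open>y\<close>.\<close>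

lemma q_not_power_lift:
  assumes x: "x \<in> A'" "x \<notin> lift ({0<..} \<times> A \<union> {0} \<times> (D \<union> T))"
  shows "\<one>\<^bsub>K\<^esub> \<oplus>\<^bsub>K\<^esub> const q \<otimes>\<^bsub>K\<^esub> x [^]\<^bsub>K\<^esub> m \<in> translate K (const q) (powers K m A')"
proof -
  have xn: "x \<in> nonzero K" "lead x \<in> A" using x(1) by (simp_all add: lift_def A'_def)
  note y = q_leading[OF xn(1)]
  let ?y = "const q \<otimes>\<^bsub>K\<^esub> x [^]\<^bsub>K\<^esub> m"
  show ?thesis
  proof (cases "ord x = 0")
    case True
    then have "lead x \<in> A - (D \<union> T)" using x xn by (auto simp: lift_def)
    then have p: "\<one>\<^bsub>F\<^esub> \<oplus>\<^bsub>F\<^esub> q \<otimes>\<^bsub>F\<^esub> lead x [^]\<^bsub>F\<^esub> m \<in> translate F q (powers F m A)" by (rule F.q_not_power)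
    have "powers F m A \<subseteq> nonzero F" using A_D_T_nonzero F.nonzero_pow by (auto simp: powers_def)
    then have "\<one>\<^bsub>F\<^esub> \<oplus>\<^bsub>F\<^esub> q \<otimes>\<^bsub>F\<^esub> lead x [^]\<^bsub>F\<^esub> m \<in> nonzero F"
      using p translate_nonzero[OF F.q_nonzero] by blast
    then have ne: "lead \<one>\<^bsub>K\<^esub> \<oplus>\<^bsub>F\<^esub> lead ?y \<noteq> \<zero>\<^bsub>F\<^esub>"
      by (simp add: nonzero_def y(3) one_leading)
    have o: "ord ?y = 0" using y(2) True by simp
    from add_same[OF K.nonzero_one y(1) one_leading(1) o ne] p
    show ?thesis unfolding q_powers_A' lift_def by (simp add: y(3) one_leading zero_multiple)
  next
    case False
    then have neg: "ord ?y < 0" using x xn y(2) F.m_pos by (auto simp: lift_def mult_less_0_iff)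
    note i = K.nonzero_inv[OF y(1)]
    have small: "\<one>\<^bsub>K\<^esub> \<oplus>\<^bsub>K\<^esub> inv\<^bsub>K\<^esub> ?y \<in> nonzero K \<and> ord (\<one>\<^bsub>K\<^esub> \<oplus>\<^bsub>K\<^esub> inv\<^bsub>K\<^esub> ?y) = 0 \<and> lead (\<one>\<^bsub>K\<^esub> \<oplus>\<^bsub>K\<^esub> inv\<^bsub>K\<^esub> ?y) = \<one>\<^bsub>F\<^esub>"
      using add_small[OF K.nonzero_one one_leading(1) K.nonzero_closed[OF i]] neg
      by (simp add: one_leading inv_leading(1)[OF y(1)])
    have "\<one>\<^bsub>K\<^esub> \<oplus>\<^bsub>K\<^esub> ?y = ?y \<otimes>\<^bsub>K\<^esub> (\<one>\<^bsub>K\<^esub> \<oplus>\<^bsub>K\<^esub> inv\<^bsub>K\<^esub> ?y)"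
      using K.nonzero_closed[OF y(1)] K.nonzero_closed[OF i] K.nonzero_r_inv[OF y(1)]
      by (simp add: K.r_distr K.a_comm)
    then have "\<one>\<^bsub>K\<^esub> \<oplus>\<^bsub>K\<^esub> ?y \<in> nonzero K" "ord (\<one>\<^bsub>K\<^esub> \<oplus>\<^bsub>K\<^esub> ?y) = int m * ord x"
      "lead (\<one>\<^bsub>K\<^esub> \<oplus>\<^bsub>K\<^esub> ?y) = q \<otimes>\<^bsub>F\<^esub> lead x [^]\<^bsub>F\<^esub> m"
      using small y F.nonzero_closed[OF lead_nonzero[OF y(1)]]
      by (simp_all add: K.nonzero_mult ord_mult lead_mult)
    moreover have "q \<otimes>\<^bsub>F\<^esub> lead x [^]\<^bsub>F\<^esub> m \<in> translate F q (powers F m A)"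
      using xn(2) by (auto simp: translate_def powers_def)
    moreover have "int m * ord x \<in> range (\<lambda>k. int m * k)" by (rule rangeI)
    ultimately show ?thesis unfolding q_powers_A' lift_def by simp
  qed
qed

text \<open>The old layers are lifted to order zero and keep their number of copies, and the new
  layer, which consists of the elements of positive order in \<open>A'\<close>, has \<open>m ^ Suc r\<close> copies.
  The index \<open>c\<close> does not change, since every element is \<open>t^k\<close> times one of order zero.\<close>

theorem tame_field_laurent: "tame_field K A' D' (const s) (const q) (\<lambda>i. const (g i)) b' c (Suc r) m M"
proof (unfold_locales)
  let ?T = "unit_ball K D' (\<lambda>i. const (g i)) c"
  show "A' \<subseteq> nonzero K" unfolding A'_def by (rule lift_nonzero)
  show "\<one>\<^bsub>K\<^esub> \<in> A'" using K.nonzero_one one_leading F.A_one by (simp add: A'_def lift_def)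
  show "x \<otimes>\<^bsub>K\<^esub> y \<in> A'" if "x \<in> A'" "y \<in> A'" for x y
    using that F.A_mult by (simp add: A'_def lift_def K.nonzero_mult lead_mult)
  show "inv\<^bsub>K\<^esub> x \<in> A'" if "x \<in> A'" for x
    using that F.A_inv by (simp add: A'_def lift_def K.nonzero_inv inv_leading)
  show "D' \<subseteq> A'" unfolding D'_def A'_def using F.D_A by (intro lift_mono) auto
  show "?T \<subseteq> A'" unfolding unit_ball_lift A'_def using F.T_A by (intro lift_mono) auto
  show "D' \<inter> ?T = {}" unfolding unit_ball_lift unfolding D'_def using F.D_T by (intro lift_disjoint) auto
  show "const s \<in> nonzero K" "const q \<in> nonzero K" using const_nonzero F.s_nonzero F.q_nonzero by auto
  have "translate K (const s) (D' \<union> ?T) = lift ({0<..} \<times> translate F s A \<union> {0} \<times> translate F s (D \<union> T))"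
    unfolding D_unit_ball_lift by (rule translate_const2[OF F.s_nonzero A_D_T_nonzero(1,3)])
  then show "D' = translate K (const s) (D' \<union> ?T)"
    using A_group_translate[OF s_A] F.D_shift unfolding D'_def by simp
  show "const (g i) \<in> nonzero K" if "i < c" for i using const_nonzero F.g_nonzero that by simp
  have gA: "translate K (const (g i)) A' = lift (UNIV \<times> translate F (g i) A)" if "i < c" for i
    unfolding A'_def by (rule translate_const1[OF F.g_nonzero[OF that] A_D_T_nonzero(1)])
  show "\<exists>i<c. x \<in> translate K (const (g i)) A'" if "x \<in> nonzero K" for x
    using F.g_cover[OF lead_nonzero[OF that]] gA that by (auto simp: lift_def)
  show "translate K (const (g i)) A' \<inter> translate K (const (g j)) A' = {}" if "i < c" "j < c" "i \<noteq> j" for i j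
    unfolding gA[OF that(1)] gA[OF that(2)] using F.g_disjoint[OF that] by (intro lift_disjoint) auto
  show "x = \<one>\<^bsub>K\<^esub>" if x: "x \<in> A'" "x [^]\<^bsub>K\<^esub> m = \<one>\<^bsub>K\<^esub>" for x
  proof -
    have xn: "x \<in> nonzero K" "lead x \<in> A" using x(1) by (simp_all add: A'_def lift_def)
    have "int m * ord x = 0" "lead x [^]\<^bsub>F\<^esub> m = \<one>\<^bsub>F\<^esub>"
      using pow_leading[OF xn(1), of m] x(2) one_leading by auto
    then have "ord x = 0" "lead x = \<one>\<^bsub>F\<^esub>" using F.m_pos F.torsion_free[OF xn(2)] by auto
    then show ?thesis using one_unit_torsion_free[OF xn(1) _ _ F.m_pos x(2)] by blast
  qed
  show "\<one>\<^bsub>K\<^esub> \<oplus>\<^bsub>K\<^esub> const q \<otimes>\<^bsub>K\<^esub> x [^]\<^bsub>K\<^esub> m \<in> powers K m A'" if "x \<in> D' \<union> ?T" for x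
    using that q_power_lift unfolding D_unit_ball_lift by blast
  show "\<one>\<^bsub>K\<^esub> \<oplus>\<^bsub>K\<^esub> const q \<otimes>\<^bsub>K\<^esub> x [^]\<^bsub>K\<^esub> m \<in> translate K (const q) (powers K m A')" if "x \<in> A' - (D' \<union> ?T)" for x
    using that q_not_power_lift unfolding D_unit_ball_lift by blast
  show "translate K (const q) (powers K m A') \<inter> powers K m A' = {}"
    unfolding q_powers_A' unfolding powers_A' using F.q_disjoint by (intro lift_disjoint) auto
  show "\<exists>C\<subseteq>nonzero K. finite C \<and> A' = (\<Union>a\<in>C. translate K a (powers K M (nonzero K)))" by (rule A'_powers)
  show "0 < Suc r" "0 < m" "0 < M" using F.m_pos F.M_pos by auto
  show "b' k \<in> A'" if "k < Suc r" for k using b'_A that .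
  show "segment K D' b' (Suc r) 0 = D'"
    unfolding segment_lift(1)[OF F.r_pos] F.segment_0 unfolding D'_def ..
  show "segment K D' b' (Suc r) (Suc k) \<subseteq> segment K D' b' (Suc r) k" for k
  proof -
    consider "Suc k < r" | "Suc k = r" | "r < Suc k" by linarith
    then show ?thesis
    proof cases
      case 1
      then have "k < r" by simp
      show ?thesis unfolding segment_lift(1)[OF 1] segment_lift(1)[OF \<open>k < r\<close>]
        using F.segment_Suc[of k] by (intro lift_mono) blast
    next
      case 2
      then have "k < r" by simp
      show ?thesis unfolding 2 segment_lift(2) segment_lift(1)[OF \<open>k < r\<close>] by (intro lift_mono) blast
    next
      case 3
      then show ?thesis using segment_lift(3) by simp
    qed
  qed
  show "power_partition K m (m ^ Suc k) (layer K D' b' (Suc r) k)" if "k < Suc r" for k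
  proof (cases "k < r")
    case True
    have "layer F D b r k \<subseteq> nonzero F" using F.D_layers True A_D_T_nonzero(2) by blast
    then show ?thesis unfolding layer_lift(1)[OF True] using F.layer_partition[OF True] by (rule power_partition_const)
  next
    case False
    then have "k = r" using that by simp
    show ?thesis unfolding \<open>k = r\<close> layer_lift(2)
    proof (rule power_partition_orders)
      show "int m * k - int i \<in> {0<..}" if "k \<in> {0<..}" "i < m" for k i
        using ceiling_multiple_pos that by simp
      show "\<exists>k'\<in>{0<..}. \<exists>i<m. k = int m * k' - int i" if "k \<in> {0<..}" for k
        using ceiling_multiple[OF F.m_pos, of k] that by auto
    qed
  qed
  show "power_partition K m (m ^ Suc r) A'"
    unfolding A'_def
  proof (rule power_partition_orders)
    show "\<exists>k'\<in>UNIV. \<exists>i<m. k = int m * k' - int i" for k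
      using ceiling_multiple[OF F.m_pos, of k] by auto
  qed auto
qed

end

section \<open>The ring of p-adic integers\<close>

text \<open>An algebraic description of the compact open subgroups \<open>X\<close> of a vector space \<open>V\<close> over
  the p-adic numbers: multiples by powers of \<open>\<pi>\<close> form a basis of neighbourhoods of zero, and
  \<open>X\<close> is separated, complete and finite modulo \<open>\<pi> X\<close>.\<close>

definition compact_lattice :: "'a ring \<Rightarrow> 'a \<Rightarrow> 'a set \<Rightarrow> 'a set \<Rightarrow> bool" where
  "compact_lattice R \<pi> V X \<longleftrightarrow>
     X \<subseteq> V \<and> V \<subseteq> carrier R \<and> \<zero>\<^bsub>R\<^esub> \<in> X \<and> (\<forall>x\<in>X. \<forall>y\<in>X. x \<oplus>\<^bsub>R\<^esub> y \<in> X) \<and> (\<forall>x\<in>X. \<ominus>\<^bsub>R\<^esub> x \<in> X) \<and>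
     (\<forall>x\<in>V. \<exists>i. \<pi> [^]\<^bsub>R\<^esub> (i::nat) \<otimes>\<^bsub>R\<^esub> x \<in> X) \<and>
     (\<forall>x. (\<forall>i. x \<in> translate R (\<pi> [^]\<^bsub>R\<^esub> (i::nat)) X) \<longrightarrow> x = \<zero>\<^bsub>R\<^esub>) \<and>
     (\<exists>C\<subseteq>X. finite C \<and> (\<forall>x\<in>X. \<exists>c\<in>C. x \<ominus>\<^bsub>R\<^esub> c \<in> translate R \<pi> X)) \<and>
     (\<forall>S. (\<forall>i. S i \<in> X \<and> S (Suc i) \<ominus>\<^bsub>R\<^esub> S i \<in> translate R (\<pi> [^]\<^bsub>R\<^esub> i) X) \<longrightarrow>
        (\<exists>x\<in>X. \<forall>i. x \<ominus>\<^bsub>R\<^esub> S i \<in> translate R (\<pi> [^]\<^bsub>R\<^esub> i) X))"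

text \<open>The ideal generated by \<open>p ^ k\<close> in the ring of rationals with denominator prime to
  \<open>p\<close>.\<close>

definition rat_ball :: "nat \<Rightarrow> nat \<Rightarrow> rat set" where
  "rat_ball p k = {q. \<exists>a b. \<not> int p dvd b \<and> q = of_int a * of_nat p ^ k / of_int b}"

locale rational_prime =
  fixes p :: nat
  assumes prime: "Factorial_Ring.prime p"
begin

lemma prime_int: "Factorial_Ring.prime (int p)"
  using prime by simp

lemma p_pos: "p > 0" and p_gt_1: "p > 1"
  using prime prime_gt_0_nat prime_gt_1_nat by auto

lemma of_int_denominator: "\<not> int p dvd b \<Longrightarrow> (of_int b :: rat) \<noteq> 0"
  by auto

lemma rat_ball_zero: "0 \<in> rat_ball p k"
  unfolding rat_ball_def using p_gt_1 by (intro CollectI exI[of _ 0] exI[of _ 1]) simp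

lemma rat_ball_add:
  assumes "x \<in> rat_ball p k" "y \<in> rat_ball p k" shows "x + y \<in> rat_ball p k"
proof -
  obtain a b where x: "\<not> int p dvd b" "x = of_int a * of_nat p ^ k / of_int b" using assms unfolding rat_ball_def by blast
  obtain c d where y: "\<not> int p dvd d" "y = of_int c * of_nat p ^ k / of_int d" using assms unfolding rat_ball_def by blast
  have "x + y = of_int (a * d + c * b) * of_nat p ^ k / of_int (b * d)"
    unfolding x(2) y(2) using of_int_denominator[OF x(1)] of_int_denominator[OF y(1)] by (simp add: field_simps)
  moreover have "\<not> int p dvd b * d" using x(1) y(1) prime_int by (simp add: prime_dvd_mult_iff)
  ultimately show ?thesis unfolding rat_ball_def by blast
qed

lemma rat_ball_mult:
  assumes "x \<in> rat_ball p k" "y \<in> rat_ball p l" shows "x * y \<in> rat_ball p (k + l)"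
proof -
  obtain a b where x: "\<not> int p dvd b" "x = of_int a * of_nat p ^ k / of_int b" using assms unfolding rat_ball_def by blast
  obtain c d where y: "\<not> int p dvd d" "y = of_int c * of_nat p ^ l / of_int d" using assms unfolding rat_ball_def by blast
  have "x * y = of_int (a * c) * of_nat p ^ (k + l) / of_int (b * d)"
    unfolding x(2) y(2) by (simp add: power_add)
  moreover have "\<not> int p dvd b * d" using x(1) y(1) prime_int by (simp add: prime_dvd_mult_iff)
  ultimately show ?thesis unfolding rat_ball_def by blast
qed

lemma rat_ball_int: "of_int a \<in> rat_ball p 0"
  unfolding rat_ball_def using p_gt_1 by (intro CollectI exI[of _ a] exI[of _ 1]) simp

lemma rat_ball_minus: "x \<in> rat_ball p k \<Longrightarrow> - x \<in> rat_ball p k"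
  using rat_ball_mult[OF rat_ball_int[of "-1"], of x k] by simp

lemma rat_ball_diff: "x \<in> rat_ball p k \<Longrightarrow> y \<in> rat_ball p k \<Longrightarrow> x - y \<in> rat_ball p k"
  using rat_ball_add[of x k "- y"] rat_ball_minus by simp

lemma rat_ball_scale: "of_nat p ^ k * x \<in> rat_ball p (k + l) \<longleftrightarrow> x \<in> rat_ball p l"
proof
  have "(of_nat p :: rat) ^ k \<in> rat_ball p k"
    unfolding rat_ball_def using p_gt_1 by (intro CollectI exI[of _ 1]) simp
  then show "x \<in> rat_ball p l \<Longrightarrow> of_nat p ^ k * x \<in> rat_ball p (k + l)" by (rule rat_ball_mult)
next
  assume "of_nat p ^ k * x \<in> rat_ball p (k + l)"
  then obtain a b where "\<not> int p dvd b" "of_nat p ^ k * x = of_int a * of_nat p ^ (k + l) / of_int b"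
    unfolding rat_ball_def by blast
  moreover have "x = of_int a * of_nat p ^ l / of_int b"
  proof -
    have p0: "(of_nat p :: rat) ^ k \<noteq> 0" using p_pos by simp
    have "of_nat p ^ k * x = of_nat p ^ k * (of_int a * of_nat p ^ l / of_int b)"
      using calculation(2) by (simp add: power_add)
    then show ?thesis using p0 by (simp only: mult_cancel_left) simp
  qed
  ultimately show "x \<in> rat_ball p l" unfolding rat_ball_def by blast
qed

lemma rat_ball_antimono: "k \<le> l \<Longrightarrow> rat_ball p l \<subseteq> rat_ball p k"
proof
  fix x assume "k \<le> l" "x \<in> rat_ball p l"
  then obtain a b where *: "\<not> int p dvd b" "x = of_int a * of_nat p ^ (l - k + k) / of_int b"
    unfolding rat_ball_def by auto
  then have "x = of_int (a * int p ^ (l - k)) * of_nat p ^ k / of_int b"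
    by (simp add: power_add)
  then show "x \<in> rat_ball p k" unfolding rat_ball_def using *(1) by blast
qed

lemma rat_ball_absorbing: "\<exists>k. of_nat p ^ k * x \<in> rat_ball p 0"
proof -
  obtain a b where x: "b > 0" "x = of_int a / of_int b"
    by (metis quotient_of_denom_pos quotient_of_div surj_pair)
  have "\<not> is_unit (int p)" using prime_int not_prime_unit by blast
  then obtain b' where b': "b = int p ^ multiplicity (int p) b * b'" "\<not> int p dvd b'"
    using multiplicity_decompose'[of b "int p"] x(1) by (metis mult.commute less_irrefl)
  have "of_nat p ^ multiplicity (int p) b * x = of_int a * of_nat p ^ 0 / of_int b'"
  proof -
    have "(of_int b :: rat) = of_nat p ^ multiplicity (int p) b * of_int b'"
      using arg_cong[OF b'(1), of "of_int :: int \<Rightarrow> rat"] by simp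
    then show ?thesis unfolding x(2) using p_pos by simp
  qed
  then show ?thesis unfolding rat_ball_def using b'(2) by blast
qed

text \<open>The denominator is invertible modulo \<open>p\<close>, by Bezout.\<close>

lemma rat_ball_residue:
  assumes "x \<in> rat_ball p 0" shows "\<exists>a<p. x - of_nat a \<in> rat_ball p 1"
proof -
  obtain a b where x: "\<not> int p dvd b" "x = of_int a / of_int b" using assms unfolding rat_ball_def by auto
  have "coprime (int p) b" using x(1) prime_int prime_imp_coprime by blast
  then obtain u v where uv: "u * int p + v * b = 1" by (metis bezout_int coprime_iff_gcd_eq_1)
  define r where "r = nat ((a * v) mod int p)"
  have r: "r < p" "int r = (a * v) mod int p" unfolding r_def using p_pos by (simp_all add: nat_less_iff)
  have "int p dvd a * v - int r" unfolding r(2) by (metis minus_mod_eq_mult_div dvd_triv_left)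
  moreover have "a - int r * b = a * u * int p + (a * v - int r) * b"
  proof -
    have "a = a * (u * int p + v * b)" using uv by simp
    then show ?thesis by (simp add: algebra_simps)
  qed
  ultimately have "int p dvd a - int r * b" by (metis dvd_add dvd_triv_right dvd_mult2)
  then obtain e where e: "a - int r * b = int p * e" by blast
  have "x - of_nat r = of_int (a - int r * b) / of_int b"
    unfolding x(2) using of_int_denominator[OF x(1)] by (simp add: field_simps)
  also have "\<dots> = of_int e * of_nat p ^ 1 / of_int b" unfolding e by simp
  finally have "x - of_nat r \<in> rat_ball p 1" unfolding rat_ball_def using x(1) by blast
  then show ?thesis using r(1) by blast
qed

lemma rat_ball_separated:
  assumes "\<And>k. x \<in> rat_ball p k" shows "x = 0"
proof (rule ccontr)
  assume x0: "x \<noteq> 0"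
  obtain c d where x: "d > 0" "x = of_int c / of_int d"
    by (metis quotient_of_denom_pos quotient_of_div surj_pair)
  have c0: "c \<noteq> 0" using x0 x by auto
  have "int p ^ k dvd c" for k
  proof -
    obtain a b where ab: "\<not> int p dvd b" "x = of_int a * of_nat p ^ k / of_int b" using assms unfolding rat_ball_def by blast
    have "of_int c * of_int b = (of_int a * of_nat p ^ k * of_int d :: rat)"
      using ab(2) x of_int_denominator[OF ab(1)] by (simp add: field_simps)
    then have "of_int (c * b) = (of_int (a * int p ^ k * d) :: rat)" by simp
    then have "c * b = a * int p ^ k * d" by (simp only: of_int_eq_iff)
    then have "int p ^ k dvd c * b" by (metis dvd_triv_left dvd_mult2 mult.commute)
    moreover have "coprime (int p ^ k) b" using prime_imp_coprime[OF prime_int ab(1)] by simp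
    ultimately show ?thesis using coprime_dvd_mult_left_iff by blast
  qed
  moreover have "\<not> is_unit (int p)" using prime_int not_prime_unit by blast
  ultimately have "\<not> finite {n. int p ^ n dvd c}" by simp
  then show False using finite_divisor_powers[OF c0 \<open>\<not> is_unit (int p)\<close>] by simp
qed

text \<open>This turns estimates of absolute values into memberships in \<open>rat_ball\<close>, which are
  divisibility statements.\<close>

lemma padic_abs_le_iff: "padic_abs p x \<le> real p powi (- int k) \<longleftrightarrow> x \<in> rat_ball p k"
proof (cases "x = 0")
  case True
  then show ?thesis using rat_ball_zero by (simp add: padic_abs_def)
next
  case False
  obtain a b where ab: "quotient_of x = (a, b)" by fastforce
  then have b: "b > 0" and x: "x = of_int a / of_int b" and cop: "coprime a b"
    by (auto intro: quotient_of_denom_pos quotient_of_div quotient_of_coprime)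
  have a0: "a \<noteq> 0" "b \<noteq> 0" using False x b by auto
  note pe = prime_imp_prime_elem[OF prime_int]
  have nu: "\<not> is_unit (int p)" using prime_int not_prime_unit by blast
  let ?m = "multiplicity (int p)"
  have "padic_abs p x = real p powi (int (?m b) - int (?m a))" using False ab by (simp add: padic_abs_def)
  then have "padic_abs p x \<le> real p powi (- int k) \<longleftrightarrow> int (?m b) - int (?m a) \<le> - int k"
    using power_int_increasing[of "int (?m b) - int (?m a)" "- int k" "real p"]
      power_int_strict_increasing[of "- int k" "int (?m b) - int (?m a)" "real p"] p_gt_1
    by (cases "int (?m b) - int (?m a) \<le> - int k") auto
  also have "\<dots> \<longleftrightarrow> k + ?m b \<le> ?m a" by auto
  also have "\<dots> \<longleftrightarrow> x \<in> rat_ball p k"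
  proof
    assume le: "k + ?m b \<le> ?m a"
    obtain b' where b': "b = int p ^ ?m b * b'" "\<not> int p dvd b'"
      using multiplicity_decompose'[OF a0(2) nu] by (metis mult.commute)
    have "int p ^ (k + ?m b) dvd a" using le by (rule multiplicity_dvd')
    then obtain e where e: "a = int p ^ (k + ?m b) * e" by blast
    have "(of_int b :: rat) = of_nat p ^ ?m b * of_int b'"
      using arg_cong[OF b'(1), of "of_int :: int \<Rightarrow> rat"] by simp
    moreover have "(of_int a :: rat) = of_nat p ^ (k + ?m b) * of_int e"
      using arg_cong[OF e, of "of_int :: int \<Rightarrow> rat"] by simp
    ultimately have "x = of_int e * of_nat p ^ k / of_int b'"
      unfolding x using p_pos by (simp add: power_add)
    then show "x \<in> rat_ball p k" unfolding rat_ball_def using b'(2) by blast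
  next
    assume "x \<in> rat_ball p k"
    then obtain e d where ed: "\<not> int p dvd d" "x = of_int e * of_nat p ^ k / of_int d" unfolding rat_ball_def by blast
    have "of_int a * of_int d = (of_int e * of_nat p ^ k * of_int b :: rat)"
      using ed(2) x of_int_denominator[OF ed(1)] a0 by (simp add: field_simps)
    then have "of_int (a * d) = (of_int (e * int p ^ k * b) :: rat)" by simp
    then have eq: "a * d = e * int p ^ k * b" by (simp only: of_int_eq_iff)
    have d0: "d \<noteq> 0" using ed(1) by auto
    have e0: "e \<noteq> 0" using eq a0 d0 by auto
    have "?m (a * d) = ?m a" using a0 d0 pe ed(1) by (simp add: prime_elem_multiplicity_mult_distrib not_dvd_imp_multiplicity_0)
    moreover have "?m (e * int p ^ k * b) = ?m e + k + ?m b"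
      using a0 e0 pe p_pos nu by (simp add: prime_elem_multiplicity_mult_distrib)
    ultimately show "k + ?m b \<le> ?m a" using eq by simp
  qed
  finally show ?thesis .
qed

lemma small_power: "e > 0 \<Longrightarrow> \<exists>k. real p powi (- int k) < e"
proof -
  assume "e > 0"
  then obtain k where "(1 / real p) ^ k < e"
    using real_arch_pow_inv[of e "1 / real p"] p_gt_1 by auto
  then show ?thesis by (intro exI[of _ k]) (simp add: power_int_minus power_divide field_simps)
qed

lemma padic_cauchy_iff: "padic_cauchy p x \<longleftrightarrow> (\<forall>k. \<exists>N. \<forall>i\<ge>N. \<forall>j\<ge>N. x i - x j \<in> rat_ball p k)"
proof
  assume c: "padic_cauchy p x"
  show "\<forall>k. \<exists>N. \<forall>i\<ge>N. \<forall>j\<ge>N. x i - x j \<in> rat_ball p k"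
  proof
    fix k
    have "real p powi (- int k) > 0" using p_pos by simp
    then obtain N where "\<forall>i\<ge>N. \<forall>j\<ge>N. padic_abs p (x i - x j) < real p powi (- int k)"
      using c unfolding padic_cauchy_def by blast
    then show "\<exists>N. \<forall>i\<ge>N. \<forall>j\<ge>N. x i - x j \<in> rat_ball p k" using padic_abs_le_iff less_imp_le by meson
  qed
next
  assume c: "\<forall>k. \<exists>N. \<forall>i\<ge>N. \<forall>j\<ge>N. x i - x j \<in> rat_ball p k"
  show "padic_cauchy p x" unfolding padic_cauchy_def
  proof (intro allI impI)
    fix e :: real assume "e > 0"
    then obtain k where k: "real p powi (- int k) < e" using small_power by blast
    obtain N where "\<forall>i\<ge>N. \<forall>j\<ge>N. x i - x j \<in> rat_ball p k" using c by blast
    then show "\<exists>N. \<forall>i\<ge>N. \<forall>j\<ge>N. padic_abs p (x i - x j) < e" using padic_abs_le_iff k le_less_trans by meson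
  qed
qed

text \<open>Membership is asked for eventually rather than always, which makes the condition
  invariant under null sequences.\<close>

definition ev_ball :: "nat \<Rightarrow> (nat \<Rightarrow> rat) set" where
  "ev_ball k = {x. padic_cauchy p x \<and> (\<exists>N. \<forall>i\<ge>N. x i \<in> rat_ball p k)}"

lemma padic_abs_nonneg: "padic_abs p x \<ge> 0"
  by (simp add: padic_abs_def)

lemma padic_null_iff: "x \<in> padic_null p \<longleftrightarrow> (\<forall>k. \<exists>N. \<forall>i\<ge>N. x i \<in> rat_ball p k)"
proof
  assume x: "x \<in> padic_null p"
  show "\<forall>k. \<exists>N. \<forall>i\<ge>N. x i \<in> rat_ball p k"
  proof
    fix k
    have "real p powi (- int k) > 0" using p_pos by simp
    then obtain N where "\<forall>i\<ge>N. norm (padic_abs p (x i) - 0) < real p powi (- int k)"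
      using x LIMSEQ_D unfolding padic_null_def by blast
    then show "\<exists>N. \<forall>i\<ge>N. x i \<in> rat_ball p k"
      using padic_abs_nonneg by (intro exI[of _ N]) (simp add: padic_abs_le_iff[symmetric] less_imp_le)
  qed
next
  assume x: "\<forall>k. \<exists>N. \<forall>i\<ge>N. x i \<in> rat_ball p k"
  have "(\<lambda>i. padic_abs p (x i)) \<longlonglongrightarrow> 0"
  proof (rule LIMSEQ_I)
    fix e :: real assume "0 < e"
    then obtain k where k: "real p powi (- int k) < e" using small_power by blast
    obtain N where "\<forall>i\<ge>N. x i \<in> rat_ball p k" using x by blast
    then have "\<forall>i\<ge>N. padic_abs p (x i) < e" using padic_abs_le_iff k le_less_trans by meson
    then show "\<exists>N. \<forall>n\<ge>N. norm (padic_abs p (x n) - 0) < e"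
      using padic_abs_nonneg by (intro exI[of _ N]) simp
  qed
  then show "x \<in> padic_null p" by (simp add: padic_null_def)
qed

lemma null_cauchy: "x \<in> padic_null p \<Longrightarrow> padic_cauchy p x"
  unfolding padic_null_iff padic_cauchy_iff by (meson rat_ball_diff)

lemma padic_null_ev_ball: "x \<in> padic_null p \<longleftrightarrow> (\<forall>k. x \<in> ev_ball k)"
  using null_cauchy padic_null_iff unfolding ev_ball_def by auto

lemma cauchy_add:
  assumes "padic_cauchy p x" "padic_cauchy p y" shows "padic_cauchy p (\<lambda>i. x i + y i)"
  unfolding padic_cauchy_iff
proof
  fix k
  obtain N where N: "\<forall>i\<ge>N. \<forall>j\<ge>N. x i - x j \<in> rat_ball p k" using assms(1) unfolding padic_cauchy_iff by blast
  obtain M where M: "\<forall>i\<ge>M. \<forall>j\<ge>M. y i - y j \<in> rat_ball p k" using assms(2) unfolding padic_cauchy_iff by blast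
  have "x i + y i - (x j + y j) \<in> rat_ball p k" if "i \<ge> max N M" "j \<ge> max N M" for i j
    using rat_ball_add[of "x i - x j" k "y i - y j"] N M that by (simp add: algebra_simps)
  then show "\<exists>N. \<forall>i\<ge>N. \<forall>j\<ge>N. x i + y i - (x j + y j) \<in> rat_ball p k" by blast
qed

lemma cauchy_bounded:
  assumes "padic_cauchy p x" shows "\<exists>k N. \<forall>i\<ge>N. of_nat p ^ k * x i \<in> rat_ball p 0"
proof -
  obtain N where N: "\<forall>i\<ge>N. \<forall>j\<ge>N. x i - x j \<in> rat_ball p 0" using assms(1) unfolding padic_cauchy_iff by blast
  obtain k where k: "of_nat p ^ k * x N \<in> rat_ball p 0" using rat_ball_absorbing by blast
  have "of_nat p ^ k * x i \<in> rat_ball p 0" if "i \<ge> N" for i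
  proof -
    have "of_nat p ^ k * (x i - x N) \<in> rat_ball p k" using rat_ball_scale[of k "x i - x N" 0] N that by simp
    then have "of_nat p ^ k * (x i - x N) \<in> rat_ball p 0" using rat_ball_antimono[of 0 k] by auto
    from rat_ball_add[OF this k] show ?thesis by (simp add: algebra_simps)
  qed
  then show ?thesis by blast
qed

lemma rat_ball_mult_bounded:
  assumes "of_nat p ^ k * x \<in> rat_ball p 0" "y \<in> rat_ball p (k + l)" shows "x * y \<in> rat_ball p l"
proof -
  have "(of_nat p ^ k * x) * y \<in> rat_ball p (0 + (k + l))" by (rule rat_ball_mult[OF assms])
  then have "of_nat p ^ k * (x * y) \<in> rat_ball p (k + l)" by (simp add: mult.assoc)
  then show ?thesis by (simp only: rat_ball_scale)
qed

lemma cauchy_mult: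
  assumes "padic_cauchy p x" "padic_cauchy p y" shows "padic_cauchy p (\<lambda>i. x i * y i)"
  unfolding padic_cauchy_iff
proof
  fix l
  obtain k K where k: "\<forall>i\<ge>K. of_nat p ^ k * x i \<in> rat_ball p 0" using cauchy_bounded[OF assms(1)] by blast
  obtain m L where m: "\<forall>i\<ge>L. of_nat p ^ m * y i \<in> rat_ball p 0" using cauchy_bounded[OF assms(2)] by blast
  obtain N where N: "\<forall>i\<ge>N. \<forall>j\<ge>N. x i - x j \<in> rat_ball p (m + l)" using assms(1) unfolding padic_cauchy_iff by blast
  obtain M where M: "\<forall>i\<ge>M. \<forall>j\<ge>M. y i - y j \<in> rat_ball p (k + l)" using assms(2) unfolding padic_cauchy_iff by blast
  let ?B = "max (max K L) (max N M)"
  have "x i * y i - x j * y j \<in> rat_ball p l" if "i \<ge> ?B" "j \<ge> ?B" for i j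
  proof -
    have "x i * (y i - y j) \<in> rat_ball p l" by (rule rat_ball_mult_bounded) (use k M that in auto)
    moreover have "y j * (x i - x j) \<in> rat_ball p l" by (rule rat_ball_mult_bounded) (use m N that in auto)
    ultimately have "x i * (y i - y j) + y j * (x i - x j) \<in> rat_ball p l" by (rule rat_ball_add)
    then show ?thesis by (simp add: algebra_simps)
  qed
  then show "\<exists>N. \<forall>i\<ge>N. \<forall>j\<ge>N. x i * y i - x j * y j \<in> rat_ball p l" by blast
qed

lemma cauchy_const: "padic_cauchy p (\<lambda>i. q)"
  unfolding padic_cauchy_iff using rat_ball_zero by simp

lemma cauchy_scale: "padic_cauchy p x \<Longrightarrow> padic_cauchy p (\<lambda>i. q * x i)"
  using cauchy_mult[OF cauchy_const] .

lemma ev_ball_add: "x \<in> ev_ball k \<Longrightarrow> y \<in> ev_ball k \<Longrightarrow> (\<lambda>i. x i + y i) \<in> ev_ball k"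
proof -
  assume xy: "x \<in> ev_ball k" "y \<in> ev_ball k"
  then obtain N M where "\<forall>i\<ge>N. x i \<in> rat_ball p k" "\<forall>i\<ge>M. y i \<in> rat_ball p k" unfolding ev_ball_def by blast
  then have "\<forall>i\<ge>max N M. x i + y i \<in> rat_ball p k" using rat_ball_add by simp
  then show ?thesis unfolding ev_ball_def using xy cauchy_add unfolding ev_ball_def by blast
qed

lemma ev_ball_mult: "x \<in> ev_ball k \<Longrightarrow> y \<in> ev_ball l \<Longrightarrow> (\<lambda>i. x i * y i) \<in> ev_ball (k + l)"
proof -
  assume xy: "x \<in> ev_ball k" "y \<in> ev_ball l"
  then obtain N M where "\<forall>i\<ge>N. x i \<in> rat_ball p k" "\<forall>i\<ge>M. y i \<in> rat_ball p l" unfolding ev_ball_def by blast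
  then have "\<forall>i\<ge>max N M. x i * y i \<in> rat_ball p (k + l)" using rat_ball_mult by simp
  then show ?thesis unfolding ev_ball_def using xy cauchy_mult unfolding ev_ball_def by blast
qed

lemma ev_ball_const: "q \<in> rat_ball p k \<Longrightarrow> (\<lambda>i. q) \<in> ev_ball k"
  unfolding ev_ball_def using cauchy_const by blast

lemma ev_ball_minus: "x \<in> ev_ball k \<Longrightarrow> (\<lambda>i. - x i) \<in> ev_ball k"
  using ev_ball_mult[OF ev_ball_const[OF rat_ball_int[of "-1"]], of x k] by simp

lemma ev_ball_diff: "x \<in> ev_ball k \<Longrightarrow> y \<in> ev_ball k \<Longrightarrow> (\<lambda>i. x i - y i) \<in> ev_ball k"
  using ev_ball_add[OF _ ev_ball_minus, of x k y] by simp

lemma ev_ball_antimono: "k \<le> l \<Longrightarrow> ev_ball l \<subseteq> ev_ball k"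
  using rat_ball_antimono unfolding ev_ball_def by blast

lemma ev_ball_scale: "(\<lambda>i. of_nat p ^ k * x i) \<in> ev_ball (k + l) \<longleftrightarrow> x \<in> ev_ball l"
proof
  assume x: "(\<lambda>i. of_nat p ^ k * x i) \<in> ev_ball (k + l)"
  have "padic_cauchy p (\<lambda>i. inverse (of_nat p ^ k) * (of_nat p ^ k * x i))"
    by (rule cauchy_scale) (use x in \<open>simp add: ev_ball_def\<close>)
  moreover have "(\<lambda>i. inverse (of_nat p ^ k) * (of_nat p ^ k * x i)) = x"
    using p_pos by (simp add: mult.assoc[symmetric])
  ultimately show "x \<in> ev_ball l" using x unfolding ev_ball_def mem_Collect_eq rat_ball_scale by simp
next
  assume "x \<in> ev_ball l"
  then show "(\<lambda>i. of_nat p ^ k * x i) \<in> ev_ball (k + l)"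
    unfolding ev_ball_def mem_Collect_eq rat_ball_scale using cauchy_scale by blast
qed

abbreviation "C \<equiv> padic_cauchy_ring p"
abbreviation "N \<equiv> padic_null p"

lemma C_simps: "carrier C = {x. padic_cauchy p x}" "x \<otimes>\<^bsub>C\<^esub> y = (\<lambda>i. x i * y i)" "\<one>\<^bsub>C\<^esub> = (\<lambda>i. 1)"
  "\<zero>\<^bsub>C\<^esub> = (\<lambda>i. 0)" "x \<oplus>\<^bsub>C\<^esub> y = (\<lambda>i. x i + y i)"
  by (simp_all add: padic_cauchy_ring_def)

lemma C_cring: "cring C"
proof (rule cringI)
  show "abelian_group C"
  proof (rule abelian_groupI)
    fix x assume "x \<in> carrier C"
    then have "(\<lambda>i. (-1) * x i) \<in> carrier C" unfolding C_simps using cauchy_scale by blast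
    moreover have "(\<lambda>i. (-1) * x i) \<oplus>\<^bsub>C\<^esub> x = \<zero>\<^bsub>C\<^esub>" by (simp add: C_simps)
    ultimately show "\<exists>y\<in>carrier C. y \<oplus>\<^bsub>C\<^esub> x = \<zero>\<^bsub>C\<^esub>" by blast
  qed (auto simp: C_simps cauchy_add cauchy_const algebra_simps)
  show "comm_monoid C"
    by (rule comm_monoidI) (auto simp: C_simps cauchy_mult cauchy_const algebra_simps)
qed (auto simp: C_simps algebra_simps)

lemma N_ideal: "ideal N C"
proof -
  interpret C: cring C by (rule C_cring)
  have null_add: "(\<lambda>i. x i + y i) \<in> N" if "x \<in> N" "y \<in> N" for x y
    using that ev_ball_add unfolding padic_null_ev_ball by blast
  have null_mult: "(\<lambda>i. y i * x i) \<in> N" if x: "x \<in> N" and y: "padic_cauchy p y" for x y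
    unfolding padic_null_iff
  proof
    fix l
    obtain k K where k: "\<forall>i\<ge>K. of_nat p ^ k * y i \<in> rat_ball p 0" using cauchy_bounded[OF y] by blast
    obtain M where "\<forall>i\<ge>M. x i \<in> rat_ball p (k + l)" using x unfolding padic_null_iff by blast
    then have "\<forall>i\<ge>max K M. y i * x i \<in> rat_ball p l" using k rat_ball_mult_bounded by auto
    then show "\<exists>N. \<forall>i\<ge>N. y i * x i \<in> rat_ball p l" by blast
  qed
  have minus: "\<ominus>\<^bsub>C\<^esub> x = (\<lambda>i. - x i)" if "padic_cauchy p x" for x
    using that cauchy_scale[OF that, of "-1"] by (intro C.minus_equality) (simp_all add: C_simps)
  have "subgroup N (add_monoid C)"
  proof (rule C.add.subgroupI)
    show "N \<subseteq> carrier C" using null_cauchy by (auto simp: C_simps)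
    have "(\<lambda>i. 0) \<in> N" unfolding padic_null_iff using rat_ball_zero by simp
    then show "N \<noteq> {}" by blast
    show "\<ominus>\<^bsub>C\<^esub> x \<in> N" if "x \<in> N" for x
      using null_mult[OF that cauchy_const[of "-1"]] minus[OF null_cauchy[OF that]] by simp
    show "x \<oplus>\<^bsub>C\<^esub> y \<in> N" if "x \<in> N" "y \<in> N" for x y
      using null_add[OF that] by (simp add: C_simps)
  qed
  then show ?thesis
  proof (rule idealI[OF C.ring_axioms])
    fix a x assume "a \<in> N" "x \<in> carrier C"
    then show "x \<otimes>\<^bsub>C\<^esub> a \<in> N" "a \<otimes>\<^bsub>C\<^esub> x \<in> N" using null_mult[of a x] by (auto simp: C_simps mult.commute)
  qed
qed

abbreviation "Q \<equiv> padic_field p"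

definition seq_class :: "(nat \<Rightarrow> rat) \<Rightarrow> (nat \<Rightarrow> rat) set" where
  "seq_class x = a_r_coset C N x"

definition padic_integers :: "(nat \<Rightarrow> rat) set set" where
  "padic_integers = seq_class ` ev_ball 0"

lemma class_hom: "ring_hom_cring C Q seq_class"
proof -
  interpret I: ideal N C by (rule N_ideal)
  have "a_r_coset C N \<in> ring_hom C (C Quot N)" by (rule I.rcos_ring_hom)
  moreover have "seq_class = a_r_coset C N" by (rule ext) (simp add: seq_class_def)
  ultimately have "seq_class \<in> ring_hom C Q" by (simp add: padic_field_def)
  moreover have "cring Q" unfolding padic_field_def by (rule I.quotient_is_cring[OF C_cring])
  ultimately show ?thesis using C_cring by (simp add: ring_hom_cring_def ring_hom_cring_axioms_def)
qed

lemma carrier_Q: "carrier Q = seq_class ` {x. padic_cauchy p x}"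
  unfolding padic_field_def FactRing_def A_RCOSETS_def' seq_class_def by (auto simp: C_simps)

lemma C_diff:
  assumes "padic_cauchy p x" "padic_cauchy p y" shows "x \<ominus>\<^bsub>C\<^esub> y = (\<lambda>i. x i - y i)"
proof -
  interpret C: cring C by (rule C_cring)
  have "\<ominus>\<^bsub>C\<^esub> y = (\<lambda>i. - y i)"
    using assms cauchy_scale[OF assms(2), of "-1"] by (intro C.minus_equality) (simp_all add: C_simps)
  then show ?thesis by (simp add: a_minus_def C_simps)
qed

lemma class_eq_iff:
  assumes "padic_cauchy p x" "padic_cauchy p y"
  shows "seq_class x = seq_class y \<longleftrightarrow> (\<lambda>i. x i - y i) \<in> N"
proof -
  interpret C: cring C by (rule C_cring)
  show ?thesis
    using C.quotient_eq_iff_same_a_r_cos[OF N_ideal, of x y] assms C_diff[OF assms]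
    by (simp add: seq_class_def C_simps)
qed

lemma class_mem_iff:
  assumes "padic_cauchy p x" shows "seq_class x \<in> seq_class ` ev_ball k \<longleftrightarrow> x \<in> ev_ball k"
proof
  assume "seq_class x \<in> seq_class ` ev_ball k"
  then obtain y where y: "y \<in> ev_ball k" "seq_class x = seq_class y" by blast
  then have "(\<lambda>i. x i - y i) \<in> N" using class_eq_iff assms unfolding ev_ball_def by blast
  then have "(\<lambda>i. x i - y i) \<in> ev_ball k" unfolding padic_null_ev_ball by blast
  from ev_ball_add[OF this y(1)] show "x \<in> ev_ball k" by simp
qed blast

lemma ev_ball_cauchy: "x \<in> ev_ball k \<Longrightarrow> padic_cauchy p x"
  by (simp add: ev_ball_def)

lemma class_ops:
  assumes "padic_cauchy p x" "padic_cauchy p y"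
  shows "seq_class x \<oplus>\<^bsub>Q\<^esub> seq_class y = seq_class (\<lambda>i. x i + y i)"
    "seq_class x \<otimes>\<^bsub>Q\<^esub> seq_class y = seq_class (\<lambda>i. x i * y i)"
    "seq_class x \<ominus>\<^bsub>Q\<^esub> seq_class y = seq_class (\<lambda>i. x i - y i)"
    "\<ominus>\<^bsub>Q\<^esub> seq_class x = seq_class (\<lambda>i. - x i)"
proof -
  interpret h: ring_hom_cring C Q seq_class by (rule class_hom)
  have xy: "x \<in> carrier C" "y \<in> carrier C" using assms by (simp_all add: C_simps)
  show "seq_class x \<oplus>\<^bsub>Q\<^esub> seq_class y = seq_class (\<lambda>i. x i + y i)"
    "seq_class x \<otimes>\<^bsub>Q\<^esub> seq_class y = seq_class (\<lambda>i. x i * y i)"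
    using h.hom_add[OF xy] h.hom_mult[OF xy] by (simp_all add: C_simps)
  have "seq_class (x \<ominus>\<^bsub>C\<^esub> y) = seq_class x \<ominus>\<^bsub>Q\<^esub> seq_class y"
    using xy by (simp add: a_minus_def)
  then show "seq_class x \<ominus>\<^bsub>Q\<^esub> seq_class y = seq_class (\<lambda>i. x i - y i)"
    using C_diff[OF assms] by simp
  have "\<ominus>\<^bsub>C\<^esub> x = (\<lambda>i. - x i)"
    using assms cauchy_scale[OF assms(1), of "-1"] xy
    by (intro h.R.minus_equality) (simp_all add: C_simps)
  then show "\<ominus>\<^bsub>Q\<^esub> seq_class x = seq_class (\<lambda>i. - x i)" using h.hom_a_inv[OF xy(1)] by simp
qed

lemma class_constants:
  "\<zero>\<^bsub>Q\<^esub> = seq_class (\<lambda>i. 0)" "\<one>\<^bsub>Q\<^esub> = seq_class (\<lambda>i. 1)"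
  "[(n::nat)] \<cdot>\<^bsub>Q\<^esub> \<one>\<^bsub>Q\<^esub> = seq_class (\<lambda>i. of_nat n)"
  "seq_class (\<lambda>i. q) [^]\<^bsub>Q\<^esub> n = seq_class (\<lambda>i. q ^ n)"
proof -
  interpret h: ring_hom_cring C Q seq_class by (rule class_hom)
  show z: "\<zero>\<^bsub>Q\<^esub> = seq_class (\<lambda>i. 0)" using h.hom_zero by (simp add: C_simps)
  show o: "\<one>\<^bsub>Q\<^esub> = seq_class (\<lambda>i. 1)" using h.hom_one by (simp add: C_simps)
  show "[(n::nat)] \<cdot>\<^bsub>Q\<^esub> \<one>\<^bsub>Q\<^esub> = seq_class (\<lambda>i. of_nat n)"
  proof (induction n)
    case (Suc n)
    then have "[(Suc n)] \<cdot>\<^bsub>Q\<^esub> \<one>\<^bsub>Q\<^esub> = seq_class (\<lambda>i. of_nat n) \<oplus>\<^bsub>Q\<^esub> seq_class (\<lambda>i. 1)"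
      using o by simp
    then show ?case by (simp add: class_ops cauchy_const add.commute)
  qed (simp add: z)
  show "seq_class (\<lambda>i. q) [^]\<^bsub>Q\<^esub> n = seq_class (\<lambda>i. q ^ n)"
    by (induction n) (simp_all add: o class_ops cauchy_const mult.commute)
qed

abbreviation "pQ \<equiv> [p] \<cdot>\<^bsub>Q\<^esub> \<one>\<^bsub>Q\<^esub>"

lemma pi_pow: "pQ [^]\<^bsub>Q\<^esub> k = seq_class (\<lambda>i. of_nat p ^ k)"
  unfolding class_constants(3) by (rule class_constants(4))

lemma translate_integers: "translate Q (pQ [^]\<^bsub>Q\<^esub> k) padic_integers = seq_class ` ev_ball k"
proof
  show "translate Q (pQ [^]\<^bsub>Q\<^esub> k) padic_integers \<subseteq> seq_class ` ev_ball k"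
  proof
    fix y assume "y \<in> translate Q (pQ [^]\<^bsub>Q\<^esub> k) padic_integers"
    then obtain x where x: "x \<in> ev_ball 0" "y = pQ [^]\<^bsub>Q\<^esub> k \<otimes>\<^bsub>Q\<^esub> seq_class x"
      unfolding translate_def padic_integers_def by blast
    then have "y = seq_class (\<lambda>i. of_nat p ^ k * x i)"
      unfolding pi_pow by (simp add: class_ops cauchy_const ev_ball_cauchy)
    moreover have "(\<lambda>i. of_nat p ^ k * x i) \<in> ev_ball k" using ev_ball_scale[of k x 0] x(1) by simp
    ultimately show "y \<in> seq_class ` ev_ball k" by blast
  qed
  show "seq_class ` ev_ball k \<subseteq> translate Q (pQ [^]\<^bsub>Q\<^esub> k) padic_integers"
  proof
    fix y assume "y \<in> seq_class ` ev_ball k"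
    then obtain x where x: "x \<in> ev_ball k" "y = seq_class x" by blast
    define z where "z i = inverse (of_nat p ^ k) * x i" for i
    have xz: "x = (\<lambda>i. of_nat p ^ k * z i)" unfolding z_def using p_pos by (simp add: mult.assoc[symmetric])
    then have z: "z \<in> ev_ball 0" using ev_ball_scale[of k z 0] x(1) by simp
    have "y = pQ [^]\<^bsub>Q\<^esub> k \<otimes>\<^bsub>Q\<^esub> seq_class z"
      unfolding pi_pow x(2) using z xz by (simp add: class_ops cauchy_const ev_ball_cauchy)
    then show "y \<in> translate Q (pQ [^]\<^bsub>Q\<^esub> k) padic_integers"
      unfolding translate_def padic_integers_def using z by blast
  qed
qed

lemma padic_char_zero: "char_zero Q"
  unfolding char_zero_def
proof (intro allI impI notI)
  fix n :: nat assume n: "0 < n" "[n] \<cdot>\<^bsub>Q\<^esub> \<one>\<^bsub>Q\<^esub> = \<zero>\<^bsub>Q\<^esub>"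
  then have "(\<lambda>i. of_nat n - 0) \<in> N"
    unfolding class_constants(3) class_constants(1) by (subst (asm) class_eq_iff) (auto simp: cauchy_const)
  then have "(of_nat n :: rat) \<in> rat_ball p k" for k unfolding padic_null_iff by auto
  then have "(of_nat n :: rat) = 0" by (rule rat_ball_separated)
  then show False using n(1) by simp
qed

lemma padic_integers_mult: "x \<in> padic_integers \<Longrightarrow> y \<in> padic_integers \<Longrightarrow> x \<otimes>\<^bsub>Q\<^esub> y \<in> padic_integers"
  unfolding padic_integers_def using ev_ball_mult[of _ 0 _ 0] by (fastforce simp: class_ops ev_ball_cauchy)

lemma padic_integers_one: "\<one>\<^bsub>Q\<^esub> \<in> padic_integers"
  unfolding padic_integers_def class_constants using ev_ball_const[OF rat_ball_int[of 1]] by simp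

lemma padic_integers_residues:
  assumes "x \<in> ev_ball 0" shows "\<exists>a<p. (\<lambda>i. x i - of_nat a) \<in> ev_ball 1"
proof -
  obtain M where M: "\<forall>i\<ge>M. x i \<in> rat_ball p 0" using assms unfolding ev_ball_def by blast
  obtain K where K: "\<forall>i\<ge>K. \<forall>j\<ge>K. x i - x j \<in> rat_ball p 1"
    using ev_ball_cauchy[OF assms] unfolding padic_cauchy_iff by blast
  let ?j = "max M K"
  obtain a where a: "a < p" "x ?j - of_nat a \<in> rat_ball p 1" using rat_ball_residue[of "x ?j"] M by auto
  have "x i - of_nat a \<in> rat_ball p 1" if "i \<ge> K" for i
    using rat_ball_add[of "x i - x ?j" 1 "x ?j - of_nat a"] K that a(2) by simp
  moreover have "padic_cauchy p (\<lambda>i. x i + (- of_nat a))" by (rule cauchy_add[OF ev_ball_cauchy[OF assms] cauchy_const])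
  ultimately show ?thesis unfolding ev_ball_def using a(1) by auto
qed

text \<open>Each of the Cauchy sequences \<open>y i\<close> is replaced by a rational number \<open>q i\<close> that is
  close to it; the sequence of these numbers represents the limit.\<close>

lemma padic_integers_complete:
  assumes y: "\<And>i. y i \<in> ev_ball 0" "\<And>i. (\<lambda>j. y (Suc i) j - y i j) \<in> ev_ball i"
  shows "\<exists>x\<in>ev_ball 0. \<forall>i. (\<lambda>j. x j - y i j) \<in> ev_ball i"
proof -
  have "\<exists>q\<in>rat_ball p 0. (\<lambda>j. y i j - q) \<in> ev_ball i" for i
  proof -
    obtain M where M: "\<forall>j\<ge>M. y i j \<in> rat_ball p 0" using y(1) unfolding ev_ball_def by blast
    obtain K where K: "\<forall>j\<ge>K. \<forall>l\<ge>K. y i j - y i l \<in> rat_ball p i"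
      using ev_ball_cauchy[OF y(1)] unfolding padic_cauchy_iff by blast
    have "padic_cauchy p (\<lambda>j. y i j + (- y i (max M K)))"
      by (rule cauchy_add[OF ev_ball_cauchy[OF y(1)] cauchy_const])
    then have "(\<lambda>j. y i j - y i (max M K)) \<in> ev_ball i" unfolding ev_ball_def mem_Collect_eq
      using K by (intro conjI exI[of _ "max M K"]) simp_all
    then show ?thesis using M by (intro bexI[of _ "y i (max M K)"]) auto
  qed
  then obtain q where q: "\<And>i. q i \<in> rat_ball p 0" "\<And>i. (\<lambda>j. y i j - q i) \<in> ev_ball i" by metis
  have const: "r \<in> rat_ball p k" if "(\<lambda>j::nat. r) \<in> ev_ball k" for r k using that unfolding ev_ball_def by auto
  have step: "q (Suc i) - q i \<in> rat_ball p i" for i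
  proof -
    have "(\<lambda>j. y (Suc i) j - q (Suc i)) \<in> ev_ball i" using q(2)[of "Suc i"] ev_ball_antimono[of i "Suc i"] by auto
    from ev_ball_add[OF ev_ball_diff[OF y(2) this] q(2)] show ?thesis by (intro const) simp
  qed
  have far: "q (i + d) - q i \<in> rat_ball p i" for i d
  proof (induction d)
    case (Suc d)
    have "q (Suc (i + d)) - q (i + d) \<in> rat_ball p i" using step[of "i + d"] rat_ball_antimono[of i "i + d"] by auto
    from rat_ball_add[OF this Suc] show ?case by simp
  qed (simp add: rat_ball_zero)
  have far': "q j - q i \<in> rat_ball p i" if "i \<le> j" for i j using far[of i "j - i"] that by simp
  have "padic_cauchy p q" unfolding padic_cauchy_iff
  proof
    fix k
    have "q i - q j \<in> rat_ball p k" if "i \<ge> k" "j \<ge> k" for i j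
      using rat_ball_diff[OF far'[OF that(1)] far'[OF that(2)]] by simp
    then show "\<exists>N. \<forall>i\<ge>N. \<forall>j\<ge>N. q i - q j \<in> rat_ball p k" by blast
  qed
  then have "q \<in> ev_ball 0" unfolding ev_ball_def using q(1) by blast
  moreover have "(\<lambda>j. q j - y i j) \<in> ev_ball i" for i
  proof -
    have "padic_cauchy p (\<lambda>j. q j + (- q i))" by (rule cauchy_add[OF \<open>padic_cauchy p q\<close> cauchy_const])
    then have "(\<lambda>j. q j - q i) \<in> ev_ball i" unfolding ev_ball_def using far' by auto
    from ev_ball_diff[OF this q(2)] show ?thesis by simp
  qed
  ultimately show ?thesis by blast
qed

theorem padic_integers_lattice: "compact_lattice Q pQ (carrier Q) padic_integers"
  unfolding compact_lattice_def
proof (intro conjI allI ballI impI)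
  interpret h: ring_hom_cring C Q seq_class by (rule class_hom)
  show "padic_integers \<subseteq> carrier Q" unfolding padic_integers_def carrier_Q using ev_ball_cauchy by blast
  show "carrier Q \<subseteq> carrier Q" ..
  show "\<zero>\<^bsub>Q\<^esub> \<in> padic_integers"
    unfolding padic_integers_def class_constants using ev_ball_const[OF rat_ball_zero] by blast
  have pi1: "translate Q pQ padic_integers = seq_class ` ev_ball 1"
    using translate_integers[of 1] by simp
  show "x \<oplus>\<^bsub>Q\<^esub> y \<in> padic_integers" if "x \<in> padic_integers" "y \<in> padic_integers" for x y
    using that ev_ball_add[of _ 0] unfolding padic_integers_def by (fastforce simp: class_ops ev_ball_cauchy)
  show "\<ominus>\<^bsub>Q\<^esub> x \<in> padic_integers" if "x \<in> padic_integers" for x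
  proof -
    obtain a where "a \<in> ev_ball 0" "x = seq_class a" using \<open>x \<in> padic_integers\<close> unfolding padic_integers_def by blast
    then show ?thesis using ev_ball_minus[of a 0] class_ops(4)[of a a] ev_ball_cauchy unfolding padic_integers_def by auto
  qed
  show "\<exists>i. pQ [^]\<^bsub>Q\<^esub> (i::nat) \<otimes>\<^bsub>Q\<^esub> x \<in> padic_integers" if x: "x \<in> carrier Q" for x
  proof -
    obtain y where y: "padic_cauchy p y" "x = seq_class y" using x unfolding carrier_Q by blast
    obtain k where "\<exists>N. \<forall>i\<ge>N. of_nat p ^ k * y i \<in> rat_ball p 0" using cauchy_bounded[OF y(1)] by blast
    then have "(\<lambda>i. of_nat p ^ k * y i) \<in> ev_ball 0" unfolding ev_ball_def using cauchy_scale[OF y(1)] by blast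
    moreover have "pQ [^]\<^bsub>Q\<^esub> k \<otimes>\<^bsub>Q\<^esub> x = seq_class (\<lambda>i. of_nat p ^ k * y i)"
      unfolding pi_pow y(2) by (rule class_ops(2)[OF cauchy_const y(1)])
    ultimately have "pQ [^]\<^bsub>Q\<^esub> k \<otimes>\<^bsub>Q\<^esub> x \<in> padic_integers"
      unfolding padic_integers_def by simp
    then show ?thesis ..
  qed
  show "x = \<zero>\<^bsub>Q\<^esub>" if x: "\<forall>i. x \<in> translate Q (pQ [^]\<^bsub>Q\<^esub> (i::nat)) padic_integers" for x
  proof -
    have "x \<in> seq_class ` ev_ball 0" using x[rule_format, of 0] unfolding translate_integers .
    then obtain y where y: "y \<in> ev_ball 0" "x = seq_class y" by blast
    have "y \<in> ev_ball k" for k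
      using x[rule_format, of k] class_mem_iff[OF ev_ball_cauchy[OF y(1)], of k] unfolding translate_integers y(2) by simp
    then have "y \<in> N" unfolding padic_null_ev_ball by blast
    then have "seq_class y = seq_class (\<lambda>i. 0)"
      using class_eq_iff[OF ev_ball_cauchy[OF y(1)] cauchy_const, of 0] by simp
    then show ?thesis using y(2) by (simp add: class_constants)
  qed
  show "\<exists>D\<subseteq>padic_integers. finite D \<and> (\<forall>x\<in>padic_integers. \<exists>c\<in>D. x \<ominus>\<^bsub>Q\<^esub> c \<in> translate Q pQ padic_integers)"
  proof (intro exI[of _ "(\<lambda>a. seq_class (\<lambda>i. of_nat a)) ` {..<p}"] conjI ballI)
    show "(\<lambda>a. seq_class (\<lambda>i. of_nat a)) ` {..<p} \<subseteq> padic_integers"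
    proof -
      have "(\<lambda>i. of_nat a) \<in> ev_ball 0" for a using ev_ball_const[OF rat_ball_int[of "int a"]] by simp
      then show ?thesis unfolding padic_integers_def by blast
    qed
    fix x assume "x \<in> padic_integers"
    then obtain y where y: "y \<in> ev_ball 0" "x = seq_class y" unfolding padic_integers_def by blast
    then obtain a where a: "a < p" "(\<lambda>i. y i - of_nat a) \<in> ev_ball 1" using padic_integers_residues by blast
    have "x \<ominus>\<^bsub>Q\<^esub> seq_class (\<lambda>i. of_nat a) = seq_class (\<lambda>i. y i - of_nat a)"
      unfolding y(2) by (rule class_ops(3)[OF ev_ball_cauchy[OF y(1)] cauchy_const])
    then show "\<exists>c\<in>(\<lambda>a. seq_class (\<lambda>i. of_nat a)) ` {..<p}. x \<ominus>\<^bsub>Q\<^esub> c \<in> translate Q pQ padic_integers"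
      unfolding pi1 using a by auto
  qed simp
  fix S assume S: "\<forall>i. S i \<in> padic_integers \<and> S (Suc i) \<ominus>\<^bsub>Q\<^esub> S i \<in> translate Q (pQ [^]\<^bsub>Q\<^esub> i) padic_integers"
  then have "\<forall>i. \<exists>y. y \<in> ev_ball 0 \<and> S i = seq_class y" unfolding padic_integers_def by blast
  then obtain y where y: "\<And>i. y i \<in> ev_ball 0" "\<And>i. S i = seq_class (y i)" by metis
  have diff: "seq_class u \<ominus>\<^bsub>Q\<^esub> seq_class v \<in> translate Q (pQ [^]\<^bsub>Q\<^esub> i) padic_integers \<longleftrightarrow> (\<lambda>j. u j - v j) \<in> ev_ball i"
    if uv: "u \<in> ev_ball 0" "v \<in> ev_ball 0" for u v i
    unfolding translate_integers class_ops(3)[OF uv[THEN ev_ball_cauchy]]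
    by (rule class_mem_iff[OF ev_ball_cauchy[OF ev_ball_diff[OF uv]]])
  have "(\<lambda>j. y (Suc i) j - y i j) \<in> ev_ball i" for i
    using S[rule_format, of i] diff[OF y(1) y(1)] unfolding y(2) by blast
  then obtain x where x: "x \<in> ev_ball 0" "\<And>i. (\<lambda>j. x j - y i j) \<in> ev_ball i"
    using padic_integers_complete[of y, OF y(1)] by blast
  show "\<exists>x\<in>padic_integers. \<forall>i. x \<ominus>\<^bsub>Q\<^esub> S i \<in> translate Q (pQ [^]\<^bsub>Q\<^esub> i) padic_integers"
  proof (rule bexI[of _ "seq_class x"])
    show "\<forall>i. seq_class x \<ominus>\<^bsub>Q\<^esub> S i \<in> translate Q (pQ [^]\<^bsub>Q\<^esub> i) padic_integers"
      unfolding y(2) using diff[OF x(1) y(1)] x(2) by blast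
  qed (use x(1) in \<open>auto simp: padic_integers_def\<close>)
qed

end

section \<open>A compact lattice in a finite extension\<close>

lemma compact_latticeD:
  assumes "compact_lattice R \<pi> V X"
  shows "X \<subseteq> V" "V \<subseteq> carrier R" "\<zero>\<^bsub>R\<^esub> \<in> X" "\<And>x y. x \<in> X \<Longrightarrow> y \<in> X \<Longrightarrow> x \<oplus>\<^bsub>R\<^esub> y \<in> X"
    "\<And>x. x \<in> X \<Longrightarrow> \<ominus>\<^bsub>R\<^esub> x \<in> X" "\<And>x. x \<in> V \<Longrightarrow> \<exists>i. \<pi> [^]\<^bsub>R\<^esub> (i::nat) \<otimes>\<^bsub>R\<^esub> x \<in> X"
    "\<And>x. (\<And>i::nat. x \<in> translate R (\<pi> [^]\<^bsub>R\<^esub> i) X) \<Longrightarrow> x = \<zero>\<^bsub>R\<^esub>"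
    "\<exists>C\<subseteq>X. finite C \<and> (\<forall>x\<in>X. \<exists>c\<in>C. x \<ominus>\<^bsub>R\<^esub> c \<in> translate R \<pi> X)"
    "\<And>S. (\<And>i::nat. S i \<in> X) \<Longrightarrow> (\<And>i. S (Suc i) \<ominus>\<^bsub>R\<^esub> S i \<in> translate R (\<pi> [^]\<^bsub>R\<^esub> i) X) \<Longrightarrow>
       \<exists>x\<in>X. \<forall>i. x \<ominus>\<^bsub>R\<^esub> S i \<in> translate R (\<pi> [^]\<^bsub>R\<^esub> i) X"
  using assms unfolding compact_lattice_def by blast+

lemma compact_lattice_hom:
  assumes h: "ring_hom_cring R S h" and inj: "inj_on h (carrier R)" and \<pi>: "\<pi> \<in> carrier R"
    and lat: "compact_lattice R \<pi> V X"
  shows "compact_lattice S (h \<pi>) (h ` V) (h ` X)"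
proof -
  interpret ring_hom_cring R S h by (rule h)
  note lat = compact_latticeD[OF lat]
  have cl: "x \<in> carrier R" if "x \<in> X" for x using lat(1,2) that by blast
  have tr: "translate S (h \<pi> [^]\<^bsub>S\<^esub> (i::nat)) (h ` X) = h ` translate R (\<pi> [^]\<^bsub>R\<^esub> i) X" for i
  proof -
    have "h (\<pi> [^]\<^bsub>R\<^esub> i \<otimes>\<^bsub>R\<^esub> x) = h \<pi> [^]\<^bsub>S\<^esub> i \<otimes>\<^bsub>S\<^esub> h x" if "x \<in> X" for x
    proof -
      have "h (\<pi> [^]\<^bsub>R\<^esub> i) = h \<pi> [^]\<^bsub>S\<^esub> i" using \<pi> by (induction i) simp_all
      then show ?thesis using \<pi> cl[OF that] by simp
    qed
    then show ?thesis unfolding translate_def by (auto simp: image_image)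
  qed
  have tr1: "translate S (h \<pi>) (h ` X) = h ` translate R \<pi> X" using tr[of 1] \<pi> by simp
  have diff: "h x \<ominus>\<^bsub>S\<^esub> h y = h (x \<ominus>\<^bsub>R\<^esub> y)" if "x \<in> carrier R" "y \<in> carrier R" for x y
    using that by (simp add: a_minus_def)
  have trc: "translate R (\<pi> [^]\<^bsub>R\<^esub> (i::nat)) X \<subseteq> carrier R" for i using \<pi> cl by (auto simp: translate_def)
  have injD: "x = y" if "h x = h y" "x \<in> carrier R" "y \<in> carrier R" for x y
    using inj that by (auto dest: inj_onD)
  show ?thesis unfolding compact_lattice_def
  proof (intro conjI allI ballI impI)
    show "h ` X \<subseteq> h ` V" "h ` V \<subseteq> carrier S" using lat(1,2) by auto
    show "\<zero>\<^bsub>S\<^esub> \<in> h ` X" using lat(3) by (metis hom_zero image_eqI)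
    show "x \<oplus>\<^bsub>S\<^esub> y \<in> h ` X" if xy: "x \<in> h ` X" "y \<in> h ` X" for x y
    proof -
      obtain x' y' where xy: "x' \<in> X" "y' \<in> X" "x = h x'" "y = h y'" using xy by blast
      then have "x \<oplus>\<^bsub>S\<^esub> y = h (x' \<oplus>\<^bsub>R\<^esub> y')" using cl by simp
      then show ?thesis using lat(4)[OF xy(1,2)] by blast
    qed
    show "\<ominus>\<^bsub>S\<^esub> x \<in> h ` X" if x: "x \<in> h ` X" for x
    proof -
      obtain x' where x: "x' \<in> X" "x = h x'" using x by blast
      then have "\<ominus>\<^bsub>S\<^esub> x = h (\<ominus>\<^bsub>R\<^esub> x')" using cl by simp
      then show ?thesis using lat(5)[OF x(1)] by blast
    qed
    show "\<exists>i::nat. h \<pi> [^]\<^bsub>S\<^esub> i \<otimes>\<^bsub>S\<^esub> x \<in> h ` X" if x: "x \<in> h ` V" for x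
    proof -
      obtain x' where x: "x' \<in> V" "x = h x'" using x by blast
      obtain i where i: "\<pi> [^]\<^bsub>R\<^esub> (i::nat) \<otimes>\<^bsub>R\<^esub> x' \<in> X" using lat(6)[OF x(1)] by blast
      have "h (\<pi> [^]\<^bsub>R\<^esub> i) = h \<pi> [^]\<^bsub>S\<^esub> i" using \<pi> by (induction i) simp_all
      then have "h \<pi> [^]\<^bsub>S\<^esub> i \<otimes>\<^bsub>S\<^esub> x = h (\<pi> [^]\<^bsub>R\<^esub> i \<otimes>\<^bsub>R\<^esub> x')" using x lat(2) \<pi> by auto
      then show ?thesis using i by blast
    qed
    show "x = \<zero>\<^bsub>S\<^esub>" if x: "\<forall>i::nat. x \<in> translate S (h \<pi> [^]\<^bsub>S\<^esub> i) (h ` X)" for x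
    proof -
      have "\<forall>i. \<exists>y. y \<in> translate R (\<pi> [^]\<^bsub>R\<^esub> (i::nat)) X \<and> x = h y" using x unfolding tr by blast
      then obtain y where y: "\<And>i. y i \<in> translate R (\<pi> [^]\<^bsub>R\<^esub> (i::nat)) X" "\<And>i. x = h (y i)" by metis
      have "y i = y 0" for i using injD[of "y i" "y 0"] y trc by (metis subsetD)
      then have "y 0 = \<zero>\<^bsub>R\<^esub>" using y(1) by (intro lat(7)) metis
      then show ?thesis using y(2)[of 0] by simp
    qed
    obtain C where C: "C \<subseteq> X" "finite C" "\<forall>x\<in>X. \<exists>c\<in>C. x \<ominus>\<^bsub>R\<^esub> c \<in> translate R \<pi> X" using lat(8) by blast
    show "\<exists>C\<subseteq>h ` X. finite C \<and> (\<forall>x\<in>h ` X. \<exists>c\<in>C. x \<ominus>\<^bsub>S\<^esub> c \<in> translate S (h \<pi>) (h ` X))"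
    proof (intro exI[of _ "h ` C"] conjI ballI)
      fix x assume "x \<in> h ` X"
      then obtain x' where x: "x' \<in> X" "x = h x'" by blast
      then obtain c where c: "c \<in> C" "x' \<ominus>\<^bsub>R\<^esub> c \<in> translate R \<pi> X" using C by blast
      have "x \<ominus>\<^bsub>S\<^esub> h c = h (x' \<ominus>\<^bsub>R\<^esub> c)" unfolding x(2) using cl x(1) c(1) C(1) by (intro diff) auto
      then show "\<exists>c\<in>h ` C. x \<ominus>\<^bsub>S\<^esub> c \<in> translate S (h \<pi>) (h ` X)" unfolding tr1 using c by blast
    qed (use C in auto)
    fix T assume T: "\<forall>i. T i \<in> h ` X \<and> T (Suc i) \<ominus>\<^bsub>S\<^esub> T i \<in> translate S (h \<pi> [^]\<^bsub>S\<^esub> i) (h ` X)"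
    then have "\<forall>i. \<exists>y. y \<in> X \<and> T i = h y" by blast
    then obtain y where y: "\<And>i. y i \<in> X" "\<And>i. T i = h (y i)" by metis
    have dm: "h u \<ominus>\<^bsub>S\<^esub> h v \<in> translate S (h \<pi> [^]\<^bsub>S\<^esub> i) (h ` X) \<longleftrightarrow> u \<ominus>\<^bsub>R\<^esub> v \<in> translate R (\<pi> [^]\<^bsub>R\<^esub> i) X"
      if uv: "u \<in> X" "v \<in> X" for u v and i :: nat
    proof
      assume "h u \<ominus>\<^bsub>S\<^esub> h v \<in> translate S (h \<pi> [^]\<^bsub>S\<^esub> i) (h ` X)"
      then obtain z where z: "z \<in> translate R (\<pi> [^]\<^bsub>R\<^esub> i) X" "h (u \<ominus>\<^bsub>R\<^esub> v) = h z"
        unfolding tr diff[OF uv[THEN cl]] by blast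
      then have "u \<ominus>\<^bsub>R\<^esub> v = z" using trc uv[THEN cl] by (intro injD) auto
      then show "u \<ominus>\<^bsub>R\<^esub> v \<in> translate R (\<pi> [^]\<^bsub>R\<^esub> i) X" using z(1) by simp
    next
      assume "u \<ominus>\<^bsub>R\<^esub> v \<in> translate R (\<pi> [^]\<^bsub>R\<^esub> i) X"
      then show "h u \<ominus>\<^bsub>S\<^esub> h v \<in> translate S (h \<pi> [^]\<^bsub>S\<^esub> i) (h ` X)"
        unfolding tr diff[OF uv[THEN cl]] by (rule imageI)
    qed
    have "\<And>i. y (Suc i) \<ominus>\<^bsub>R\<^esub> y i \<in> translate R (\<pi> [^]\<^bsub>R\<^esub> i) X"
      using T dm[OF y(1) y(1)] unfolding y(2) by blast
    then obtain x where x: "x \<in> X" "\<forall>i. x \<ominus>\<^bsub>R\<^esub> y i \<in> translate R (\<pi> [^]\<^bsub>R\<^esub> i) X"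
      using lat(9)[of y, OF y(1)] by blast
    then show "\<exists>x\<in>h ` X. \<forall>i. x \<ominus>\<^bsub>S\<^esub> T i \<in> translate S (h \<pi> [^]\<^bsub>S\<^esub> i) (h ` X)"
      unfolding y(2) using dm[OF x(1) y(1)] by blast
  qed
qed

context plain_field
begin

lemma line_extension_diff:
  assumes "a \<in> carrier R" "b \<in> carrier R" "e \<in> carrier R" "v \<in> carrier R" "w \<in> carrier R"
  shows "(a \<otimes> e \<oplus> v) \<ominus> (b \<otimes> e \<oplus> w) = (a \<ominus> b) \<otimes> e \<oplus> (v \<ominus> w)"
  using assms by (simp add: minus_eq l_distr minus_add l_minus a_ac)

lemma lattice_pow_closed:
  assumes "\<pi> \<in> carrier R" "X \<subseteq> carrier R" "\<And>x. x \<in> X \<Longrightarrow> \<pi> \<otimes> x \<in> X" "x \<in> X"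
  shows "\<pi> [^] (i::nat) \<otimes> x \<in> X"
proof (induction i)
  case (Suc i)
  have "\<pi> [^] Suc i \<otimes> x = \<pi> \<otimes> (\<pi> [^] i \<otimes> x)"
    using assms(1,2,4) by (auto simp: m_ac)
  then show ?case using assms(3)[OF Suc] by simp
qed (use assms in auto)

text \<open>Independence of \<open>e\<close> makes the coordinates with respect to the line and to \<open>W\<close> unique,
  and both coordinates of a Cauchy sequence are Cauchy sequences.\<close>

lemma compact_lattice_line_extension:
  assumes Z: "compact_lattice R \<pi> K Z" and Z1: "\<pi> \<in> Z" and Zm: "\<And>x y. x \<in> Z \<Longrightarrow> y \<in> Z \<Longrightarrow> x \<otimes> y \<in> Z"
    and X: "compact_lattice R \<pi> W X" and ZX: "\<And>z x. z \<in> Z \<Longrightarrow> x \<in> X \<Longrightarrow> z \<otimes> x \<in> X"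
    and K: "\<And>x y. x \<in> K \<Longrightarrow> y \<in> K \<Longrightarrow> x \<ominus> y \<in> K" and W: "\<And>x y. x \<in> W \<Longrightarrow> y \<in> W \<Longrightarrow> x \<ominus> y \<in> W"
    and e: "e \<in> carrier R" and indep: "\<And>k. k \<in> K \<Longrightarrow> k \<otimes> e \<in> W \<Longrightarrow> k = \<zero>"
  shows "compact_lattice R \<pi> (line_extension K e W) (line_extension Z e X)"
proof -
  note Zl = compact_latticeD[OF Z] and Xl = compact_latticeD[OF X]
  have c: "\<And>x. x \<in> Z \<Longrightarrow> x \<in> carrier R" "\<And>x. x \<in> X \<Longrightarrow> x \<in> carrier R"
    "\<And>x. x \<in> K \<Longrightarrow> x \<in> carrier R" "\<And>x. x \<in> W \<Longrightarrow> x \<in> carrier R"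
    "\<And>x. x \<in> Z \<Longrightarrow> x \<in> K" "\<And>x. x \<in> X \<Longrightarrow> x \<in> W"
    using Zl(1,2) Xl(1,2) by auto
  have \<pi>: "\<pi> \<in> carrier R" using c(1) Z1 by blast
  have unique: "a = b \<and> v = w" if eq: "a \<otimes> e \<oplus> v = b \<otimes> e \<oplus> w" and m: "a \<in> K" "b \<in> K" "v \<in> W" "w \<in> W" for a b v w
  proof -
    have "(a \<ominus> b) \<otimes> e \<oplus> (v \<ominus> w) = \<zero>"
      using line_extension_diff[OF c(3)[OF m(1)] c(3)[OF m(2)] e c(4)[OF m(3)] c(4)[OF m(4)]] eq c m e
      by (simp add: r_neg minus_eq)
    then have "(a \<ominus> b) \<otimes> e = \<ominus> (v \<ominus> w)" using c m e by (intro sum_zero_eq_neg) auto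
    also have "\<dots> = w \<ominus> v" using c m by (simp add: minus_eq minus_add a_comm)
    finally have "(a \<ominus> b) \<otimes> e \<in> W" using W m by simp
    then have "a \<ominus> b = \<zero>" using K m indep by blast
    then have "a = b" using c m by simp
    have ae: "a \<otimes> e \<in> carrier R" using c m e by simp
    have "v = \<ominus> (a \<otimes> e) \<oplus> (a \<otimes> e \<oplus> v)" using ae c(4)[OF m(3)] by (simp add: r_neg1 r_neg2)
    also have "\<dots> = \<ominus> (a \<otimes> e) \<oplus> (a \<otimes> e \<oplus> w)" using eq \<open>a = b\<close> by simp
    also have "\<dots> = w" using ae c(4)[OF m(4)] by (simp add: r_neg1 r_neg2)
    finally have "v = w" .
    then show ?thesis using \<open>a = b\<close> by simp
  qed
  have pZ: "\<pi> [^] (i::nat) \<otimes> z \<in> Z" if "z \<in> Z" for i z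
    by (rule lattice_pow_closed[OF \<pi> _ Zm[OF Z1] that]) (use c(1) in blast)
  have pX: "\<pi> [^] (i::nat) \<otimes> x \<in> X" if "x \<in> X" for i x
    by (rule lattice_pow_closed[OF \<pi> _ ZX[OF Z1] that]) (use c(2) in blast)
  have distr: "a \<otimes> (z \<otimes> e \<oplus> x) = (a \<otimes> z) \<otimes> e \<oplus> a \<otimes> x" if "a \<in> carrier R" "z \<in> carrier R" "x \<in> carrier R" for a z x
    using that e by (simp add: r_distr m_assoc)
  have tr: "translate R (\<pi> [^] (i::nat)) (line_extension Z e X) =
      line_extension (translate R (\<pi> [^] i) Z) e (translate R (\<pi> [^] i) X)" for i
  proof (rule Set.set_eqI)
    fix u
    have "u \<in> translate R (\<pi> [^] i) (line_extension Z e X) \<longleftrightarrow> (\<exists>z\<in>Z. \<exists>x\<in>X. u = \<pi> [^] i \<otimes> (z \<otimes> e \<oplus> x))"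
      unfolding translate_def image_iff Bex_def line_extension_mem_iff by blast
    also have "\<dots> \<longleftrightarrow> (\<exists>z\<in>Z. \<exists>x\<in>X. u = (\<pi> [^] i \<otimes> z) \<otimes> e \<oplus> \<pi> [^] i \<otimes> x)"
      using distr[OF nat_pow_closed[OF \<pi>]] c(1,2) by (intro bex_cong refl) auto
    also have "\<dots> \<longleftrightarrow> u \<in> line_extension (translate R (\<pi> [^] i) Z) e (translate R (\<pi> [^] i) X)"
      unfolding line_extension_mem_iff by (auto simp: translate_def)
    finally show "u \<in> translate R (\<pi> [^] i) (line_extension Z e X) \<longleftrightarrow>
        u \<in> line_extension (translate R (\<pi> [^] i) Z) e (translate R (\<pi> [^] i) X)" .
  qed
  have tr1: "translate R \<pi> (line_extension Z e X) = line_extension (translate R \<pi> Z) e (translate R \<pi> X)"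
    using tr[of 1] \<pi> by simp
  have tZ: "translate R (\<pi> [^] (i::nat)) Z \<subseteq> Z" "translate R (\<pi> [^] (i::nat)) X \<subseteq> X" for i
    using pZ pX by (auto simp: translate_def)
  show ?thesis unfolding compact_lattice_def
  proof (intro conjI allI ballI impI)
    show "line_extension Z e X \<subseteq> line_extension K e W"
      using c(5,6) unfolding subset_iff line_extension_mem_iff by blast
    show "line_extension K e W \<subseteq> carrier R"
      using c(3,4) e by (auto simp: line_extension_mem_iff)
    show "\<zero> \<in> line_extension Z e X"
      unfolding line_extension_mem_iff using Zl(3) Xl(3) e by (intro bexI[of _ \<zero>]) auto
    show "u \<oplus> v \<in> line_extension Z e X" if uv: "u \<in> line_extension Z e X" "v \<in> line_extension Z e X" for u v
    proof -
      obtain z x z' x' where *: "z \<in> Z" "x \<in> X" "u = z \<otimes> e \<oplus> x" "z' \<in> Z" "x' \<in> X" "v = z' \<otimes> e \<oplus> x'"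
        using uv unfolding line_extension_mem_iff by blast
      have "u \<oplus> v = (z \<oplus> z') \<otimes> e \<oplus> (x \<oplus> x')"
        unfolding * using * c e by (simp add: l_distr a_ac)
      then show ?thesis unfolding line_extension_mem_iff using Zl(4) Xl(4) * by blast
    qed
    show "\<ominus> u \<in> line_extension Z e X" if u: "u \<in> line_extension Z e X" for u
    proof -
      obtain z x where *: "z \<in> Z" "x \<in> X" "u = z \<otimes> e \<oplus> x" using u unfolding line_extension_mem_iff by blast
      have "\<ominus> u = (\<ominus> z) \<otimes> e \<oplus> (\<ominus> x)" unfolding *(3) using * c e by (simp add: minus_add l_minus)
      then show ?thesis unfolding line_extension_mem_iff using Zl(5) Xl(5) * by blast
    qed
    show "\<exists>i::nat. \<pi> [^] i \<otimes> u \<in> line_extension Z e X" if u: "u \<in> line_extension K e W" for u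
    proof -
      obtain k w where *: "k \<in> K" "w \<in> W" "u = k \<otimes> e \<oplus> w" using u unfolding line_extension_mem_iff by blast
      obtain i j where ij: "\<pi> [^] (i::nat) \<otimes> k \<in> Z" "\<pi> [^] (j::nat) \<otimes> w \<in> X" using Zl(6) Xl(6) * by blast
      have "\<pi> [^] (i + j) \<otimes> k = \<pi> [^] j \<otimes> (\<pi> [^] i \<otimes> k)" "\<pi> [^] (i + j) \<otimes> w = \<pi> [^] i \<otimes> (\<pi> [^] j \<otimes> w)"
        using \<pi> c(3)[OF *(1)] c(4)[OF *(2)] by (simp_all add: nat_pow_mult[symmetric] m_ac)
      then have "\<pi> [^] (i + j) \<otimes> k \<in> Z" "\<pi> [^] (i + j) \<otimes> w \<in> X" using pZ[OF ij(1)] pX[OF ij(2)] by auto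
      then have "\<pi> [^] (i + j) \<otimes> u \<in> line_extension Z e X"
        unfolding *(3) line_extension_mem_iff using distr[OF nat_pow_closed[OF \<pi>] c(3)[OF *(1)] c(4)[OF *(2)]] by blast
      then show ?thesis by blast
    qed
    show "u = \<zero>" if u: "\<forall>i::nat. u \<in> translate R (\<pi> [^] i) (line_extension Z e X)" for u
    proof -
      have "\<forall>i. \<exists>z x. z \<in> translate R (\<pi> [^] (i::nat)) Z \<and> x \<in> translate R (\<pi> [^] i) X \<and> u = z \<otimes> e \<oplus> x"
        using u unfolding tr line_extension_mem_iff by blast
      then obtain z x where zx: "\<And>i. z i \<in> translate R (\<pi> [^] (i::nat)) Z" "\<And>i. x i \<in> translate R (\<pi> [^] i) X"
        "\<And>i. u = z i \<otimes> e \<oplus> x i" by metis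
      have m: "z i \<in> K" "x i \<in> W" for i using zx(1,2) tZ c(5,6) by blast+
      have eq: "z i = z 0 \<and> x i = x 0" for i
        by (rule unique) (use zx(3) m in auto)
      have "z 0 = \<zero>" by (rule Zl(7)) (use zx(1) eq in metis)
      moreover have "x 0 = \<zero>" by (rule Xl(7)) (use zx(2) eq in metis)
      ultimately show ?thesis using zx(3)[of 0] e by simp
    qed
    obtain C where C: "C \<subseteq> Z" "finite C" "\<forall>x\<in>Z. \<exists>c\<in>C. x \<ominus> c \<in> translate R \<pi> Z" using Zl(8) by blast
    obtain D where D: "D \<subseteq> X" "finite D" "\<forall>x\<in>X. \<exists>c\<in>D. x \<ominus> c \<in> translate R \<pi> X" using Xl(8) by blast
    show "\<exists>C\<subseteq>line_extension Z e X. finite C \<and> (\<forall>x\<in>line_extension Z e X. \<exists>c\<in>C. x \<ominus> c \<in> translate R \<pi> (line_extension Z e X))"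
    proof (intro exI[of _ "(\<lambda>(c, d). c \<otimes> e \<oplus> d) ` (C \<times> D)"] conjI ballI)
      show "(\<lambda>(c, d). c \<otimes> e \<oplus> d) ` (C \<times> D) \<subseteq> line_extension Z e X"
      proof
        fix u assume "u \<in> (\<lambda>(c, d). c \<otimes> e \<oplus> d) ` (C \<times> D)"
        then obtain a d where "a \<in> C" "d \<in> D" "u = a \<otimes> e \<oplus> d" by auto
        then show "u \<in> line_extension Z e X" unfolding line_extension_mem_iff using C(1) D(1) by blast
      qed
      fix u assume "u \<in> line_extension Z e X"
      then obtain z x where *: "z \<in> Z" "x \<in> X" "u = z \<otimes> e \<oplus> x" unfolding line_extension_mem_iff by blast
      obtain a where a: "a \<in> C" "z \<ominus> a \<in> translate R \<pi> Z" using C(3) *(1) by blast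
      obtain d where d: "d \<in> D" "x \<ominus> d \<in> translate R \<pi> X" using D(3) *(2) by blast
      have "u \<ominus> (a \<otimes> e \<oplus> d) = (z \<ominus> a) \<otimes> e \<oplus> (x \<ominus> d)"
        unfolding *(3) using * c e a(1) d(1) C(1) D(1) by (intro line_extension_diff) auto
      then have "u \<ominus> (a \<otimes> e \<oplus> d) \<in> translate R \<pi> (line_extension Z e X)"
        unfolding tr1 line_extension_mem_iff using a(2) d(2) by blast
      then show "\<exists>c\<in>(\<lambda>(c, d). c \<otimes> e \<oplus> d) ` (C \<times> D). u \<ominus> c \<in> translate R \<pi> (line_extension Z e X)"
        using a(1) d(1) by force
    qed (use C D in auto)
    fix S assume S: "\<forall>i. S i \<in> line_extension Z e X \<and> S (Suc i) \<ominus> S i \<in> translate R (\<pi> [^] i) (line_extension Z e X)"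
    then have "\<forall>i. \<exists>z x. z \<in> Z \<and> x \<in> X \<and> S i = z \<otimes> e \<oplus> x" unfolding line_extension_mem_iff by blast
    then obtain z x where zx: "\<And>i. z i \<in> Z" "\<And>i. x i \<in> X" "\<And>i. S i = z i \<otimes> e \<oplus> x i" by metis
    have diffS: "(z' \<otimes> e \<oplus> x') \<ominus> S i = (z' \<ominus> z i) \<otimes> e \<oplus> (x' \<ominus> x i)" if "z' \<in> Z" "x' \<in> X" for z' x' i
      unfolding zx(3) using that zx c e by (intro line_extension_diff) auto
    have "z (Suc i) \<ominus> z i \<in> translate R (\<pi> [^] i) Z \<and> x (Suc i) \<ominus> x i \<in> translate R (\<pi> [^] i) X" for i
    proof -
      have "S (Suc i) \<ominus> S i \<in> line_extension (translate R (\<pi> [^] i) Z) e (translate R (\<pi> [^] i) X)"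
        using S unfolding tr by blast
      then obtain z' x' where *: "z' \<in> translate R (\<pi> [^] i) Z" "x' \<in> translate R (\<pi> [^] i) X"
        "S (Suc i) \<ominus> S i = z' \<otimes> e \<oplus> x'" unfolding line_extension_mem_iff by blast
      then have "(z (Suc i) \<ominus> z i) \<otimes> e \<oplus> (x (Suc i) \<ominus> x i) = z' \<otimes> e \<oplus> x'"
        using diffS[OF zx(1) zx(2), of "Suc i" "Suc i" i] zx(3)[of "Suc i"] by simp
      moreover have "z (Suc i) \<ominus> z i \<in> K" "x (Suc i) \<ominus> x i \<in> W" using K W zx(1,2) c(5,6) by auto
      moreover have "z' \<in> K" "x' \<in> W" using * tZ c(5,6) by blast+
      ultimately have "z (Suc i) \<ominus> z i = z' \<and> x (Suc i) \<ominus> x i = x'" by (intro unique)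
      then show ?thesis using * by simp
    qed
    then obtain z' x' where z': "z' \<in> Z" "\<forall>i. z' \<ominus> z i \<in> translate R (\<pi> [^] i) Z"
      and x': "x' \<in> X" "\<forall>i. x' \<ominus> x i \<in> translate R (\<pi> [^] i) X"
      using Zl(9)[of z, OF zx(1)] Xl(9)[of x, OF zx(2)] by blast
    have "(z' \<otimes> e \<oplus> x') \<ominus> S i \<in> translate R (\<pi> [^] i) (line_extension Z e X)" for i
      unfolding tr diffS[OF z'(1) x'(1)] line_extension_mem_iff using z'(2) x'(2) by blast
    moreover have "z' \<otimes> e \<oplus> x' \<in> line_extension Z e X" unfolding line_extension_mem_iff using z'(1) x'(1) by blast
    ultimately show "\<exists>u\<in>line_extension Z e X. \<forall>i. u \<ominus> S i \<in> translate R (\<pi> [^] i) (line_extension Z e X)" by blast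
  qed
qed

lemma line_extension_closed:
  assumes "\<And>x y. x \<in> Z \<Longrightarrow> y \<in> Z \<Longrightarrow> x \<otimes> y \<in> Z" "\<And>z x. z \<in> Z \<Longrightarrow> x \<in> X \<Longrightarrow> z \<otimes> x \<in> X"
    "Z \<subseteq> carrier R" "X \<subseteq> carrier R" "e \<in> carrier R" "z \<in> Z" "u \<in> line_extension Z e X"
  shows "z \<otimes> u \<in> line_extension Z e X"
proof -
  obtain a x where *: "a \<in> Z" "x \<in> X" "u = a \<otimes> e \<oplus> x" using assms(7) unfolding line_extension_mem_iff by blast
  have "z \<otimes> u = (z \<otimes> a) \<otimes> e \<oplus> z \<otimes> x"
    unfolding *(3) using * assms(3-6) by (auto simp: r_distr m_assoc subset_iff)
  then show ?thesis unfolding line_extension_mem_iff using assms(1,2,6) * by blast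
qed

lemma Span_bounded:
  assumes X: "compact_lattice R \<pi> (carrier R) X" and \<pi>: "\<pi> \<in> carrier R"
    and \<pi>X: "\<And>x. x \<in> X \<Longrightarrow> \<pi> \<otimes> x \<in> X"
    and Z: "Z \<subseteq> carrier R" and ZX: "\<And>z x. z \<in> Z \<Longrightarrow> x \<in> X \<Longrightarrow> z \<otimes> x \<in> X"
    and x: "x \<in> carrier R" and Us: "set Us \<subseteq> carrier R"
  shows "\<exists>i. \<forall>y\<in>Span Z Us. \<pi> [^] (i::nat) \<otimes> (x \<otimes> y) \<in> X"
  using Us
proof (induction Us)
  case Nil
  then show ?case using x \<pi> compact_latticeD(3)[OF X] by simp
next
  case (Cons e Us)
  note Xl = compact_latticeD[OF X]
  obtain i where i: "\<forall>y\<in>Span Z Us. \<pi> [^] (i::nat) \<otimes> (x \<otimes> y) \<in> X" using Cons by auto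
  have e: "e \<in> carrier R" using Cons.prems by simp
  obtain j where j: "\<pi> [^] (j::nat) \<otimes> (x \<otimes> e) \<in> X" using Xl(6)[of "x \<otimes> e"] x e by auto
  have S: "Span Z Us \<subseteq> carrier R" using Cons.prems by (intro Span_in_carrier Z) simp
  have "\<pi> [^] (i + j) \<otimes> (x \<otimes> y) \<in> X" if y: "y \<in> Span Z (e # Us)" for y
  proof -
    obtain z v where *: "z \<in> Z" "v \<in> Span Z Us" "y = z \<otimes> e \<oplus> v"
      using y by (auto simp: line_extension_mem_iff)
    have cl: "z \<in> carrier R" "v \<in> carrier R" using * Z S by auto
    have p: "\<pi> [^] (i + j) = \<pi> [^] i \<otimes> \<pi> [^] j" using \<pi> by (simp add: nat_pow_mult)
    have "\<pi> [^] (i + j) \<otimes> (x \<otimes> y) = \<pi> [^] i \<otimes> (z \<otimes> (\<pi> [^] j \<otimes> (x \<otimes> e))) \<oplus> \<pi> [^] j \<otimes> (\<pi> [^] i \<otimes> (x \<otimes> v))"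
      unfolding *(3) p using cl x e \<pi> by (simp add: r_distr m_ac)
    moreover have "\<pi> [^] i \<otimes> (z \<otimes> (\<pi> [^] j \<otimes> (x \<otimes> e))) \<in> X"
      by (rule lattice_pow_closed[OF \<pi> Xl(1) \<pi>X ZX[OF *(1) j]])
    moreover have "\<pi> [^] j \<otimes> (\<pi> [^] i \<otimes> (x \<otimes> v)) \<in> X"
      by (rule lattice_pow_closed[OF \<pi> Xl(1) \<pi>X bspec[OF i *(2)]])
    ultimately show ?thesis using Xl(4) by simp
  qed
  then show ?case by blast
qed

lemma Span_Span_bounded:
  assumes X: "compact_lattice R \<pi> (carrier R) X" and \<pi>: "\<pi> \<in> carrier R"
    and \<pi>X: "\<And>x. x \<in> X \<Longrightarrow> \<pi> \<otimes> x \<in> X"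
    and Z: "Z \<subseteq> carrier R" and ZX: "\<And>z x. z \<in> Z \<Longrightarrow> x \<in> X \<Longrightarrow> z \<otimes> x \<in> X"
    and Us: "set Us \<subseteq> carrier R" and Vs: "set Vs \<subseteq> carrier R"
  shows "\<exists>i. \<forall>x\<in>Span Z Vs. \<forall>y\<in>Span Z Us. \<pi> [^] (i::nat) \<otimes> (x \<otimes> y) \<in> X"
  using Vs
proof (induction Vs)
  case Nil
  have "Span Z Us \<subseteq> carrier R" by (rule Span_in_carrier[OF Z Us])
  then have "\<forall>x\<in>Span Z []. \<forall>y\<in>Span Z Us. \<pi> [^] (0::nat) \<otimes> (x \<otimes> y) \<in> X"
    using compact_latticeD(3)[OF X] by (auto simp del: Span.simps simp: Span.simps[of Z "[]"])
  then show ?case by blast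
next
  case (Cons e Vs)
  note Xl = compact_latticeD[OF X]
  obtain i where i: "\<forall>x\<in>Span Z Vs. \<forall>y\<in>Span Z Us. \<pi> [^] (i::nat) \<otimes> (x \<otimes> y) \<in> X" using Cons by auto
  have e: "e \<in> carrier R" using Cons.prems by simp
  obtain j where j: "\<forall>y\<in>Span Z Us. \<pi> [^] (j::nat) \<otimes> (e \<otimes> y) \<in> X"
    using Span_bounded[OF X \<pi> \<pi>X Z ZX e Us] by blast
  have SV: "Span Z Vs \<subseteq> carrier R" using Cons.prems by (intro Span_in_carrier Z) simp
  have SU: "Span Z Us \<subseteq> carrier R" by (rule Span_in_carrier[OF Z Us])
  have "\<pi> [^] (i + j) \<otimes> (x \<otimes> y) \<in> X" if x: "x \<in> Span Z (e # Vs)" and y: "y \<in> Span Z Us" for x y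
  proof -
    obtain z v where *: "z \<in> Z" "v \<in> Span Z Vs" "x = z \<otimes> e \<oplus> v"
      using x by (auto simp: line_extension_mem_iff)
    have cl: "z \<in> carrier R" "v \<in> carrier R" "y \<in> carrier R" using * Z SV SU y by auto
    have p: "\<pi> [^] (i + j) = \<pi> [^] i \<otimes> \<pi> [^] j" using \<pi> by (simp add: nat_pow_mult)
    have "\<pi> [^] (i + j) \<otimes> (x \<otimes> y) = \<pi> [^] i \<otimes> (z \<otimes> (\<pi> [^] j \<otimes> (e \<otimes> y))) \<oplus> \<pi> [^] j \<otimes> (\<pi> [^] i \<otimes> (v \<otimes> y))"
      unfolding *(3) p using cl e \<pi> by (simp add: l_distr r_distr m_ac)
    moreover have "\<pi> [^] i \<otimes> (z \<otimes> (\<pi> [^] j \<otimes> (e \<otimes> y))) \<in> X"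
      by (rule lattice_pow_closed[OF \<pi> Xl(1) \<pi>X ZX[OF *(1) bspec[OF j y]]])
    moreover have "\<pi> [^] j \<otimes> (\<pi> [^] i \<otimes> (v \<otimes> y)) \<in> X"
      by (rule lattice_pow_closed[OF \<pi> Xl(1) \<pi>X bspec[OF bspec[OF i *(2)] y]])
    ultimately show ?thesis using Xl(4) by simp
  qed
  then show ?case by blast
qed

end

text \<open>The lattice is the span of a basis over the p-adic integers. It need not be a ring nor
  contain \<open>1\<close>, but multiplication by an element maps the finitely many basis vectors into a
  multiple of the lattice. So products are controlled up to a fixed power of \<open>p\<close>, which
  replaces an extension of the valuation to \<open>L\<close>.\<close>

theorem (in rational_prime) extension_lattice:
  fixes L :: "'a ring"
  assumes ext: "finite_field_extension Q L"
  shows "\<exists>X N. compact_lattice L ([p] \<cdot>\<^bsub>L\<^esub> \<one>\<^bsub>L\<^esub>) (carrier L) X \<and>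
      (\<forall>x\<in>X. \<forall>y\<in>X. ([p] \<cdot>\<^bsub>L\<^esub> \<one>\<^bsub>L\<^esub>) [^]\<^bsub>L\<^esub> (N::nat) \<otimes>\<^bsub>L\<^esub> (x \<otimes>\<^bsub>L\<^esub> y) \<in> X) \<and>
      (\<forall>x\<in>carrier L. \<exists>i. \<forall>y\<in>X. ([p] \<cdot>\<^bsub>L\<^esub> \<one>\<^bsub>L\<^esub>) [^]\<^bsub>L\<^esub> (i::nat) \<otimes>\<^bsub>L\<^esub> (x \<otimes>\<^bsub>L\<^esub> y) \<in> X)"
    and "char_zero L"
proof -
  obtain h where Q: "field Q" and L: "field L" and h: "h \<in> ring_hom Q L"
    and fin: "ring.finite_dimension L (h ` carrier Q) (carrier L)"
    using ext unfolding finite_field_extension_def by blast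
  interpret Q: plain_field Q using Q by (simp add: plain_field_def)
  interpret L: plain_field L using L by (simp add: plain_field_def)
  interpret h: ring_hom_cring Q L h by unfold_locales (rule h)
  let ?\<pi> = "[p] \<cdot>\<^bsub>L\<^esub> \<one>\<^bsub>L\<^esub>" and ?Z = "h ` padic_integers" and ?K = "h ` carrier Q"
  have mult: "h ([(n::nat)] \<cdot>\<^bsub>Q\<^esub> \<one>\<^bsub>Q\<^esub>) = [n] \<cdot>\<^bsub>L\<^esub> \<one>\<^bsub>L\<^esub>" for n by (induction n) simp_all
  have nz: "h x \<noteq> \<zero>\<^bsub>L\<^esub>" if x: "x \<in> carrier Q" "x \<noteq> \<zero>\<^bsub>Q\<^esub>" for x
  proof
    have xn: "x \<in> nonzero Q" using x by (simp add: nonzero_def)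
    assume "h x = \<zero>\<^bsub>L\<^esub>"
    then have "h (x \<otimes>\<^bsub>Q\<^esub> inv\<^bsub>Q\<^esub> x) = \<zero>\<^bsub>L\<^esub>"
      using x Q.nonzero_closed[OF Q.nonzero_inv[OF xn]] by simp
    then show False using Q.nonzero_r_inv[OF xn] by simp
  qed
  have inj: "inj_on h (carrier Q)"
  proof (rule inj_onI)
    fix x y assume xy: "x \<in> carrier Q" "y \<in> carrier Q" "h x = h y"
    then have "h (x \<ominus>\<^bsub>Q\<^esub> y) = \<zero>\<^bsub>L\<^esub>" by (simp add: a_minus_def L.r_neg)
    then have "x \<ominus>\<^bsub>Q\<^esub> y = \<zero>\<^bsub>Q\<^esub>" using nz[of "x \<ominus>\<^bsub>Q\<^esub> y"] xy by auto
    then show "x = y" using xy by simp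
  qed
  show "char_zero L"
    unfolding char_zero_def mult[symmetric]
    using padic_char_zero nz by (auto simp: char_zero_def simp del: h.hom_add)
  have Zlat: "compact_lattice L ?\<pi> ?K ?Z"
    using compact_lattice_hom[OF h.ring_hom_cring_axioms inj _ padic_integers_lattice] by (simp add: mult)
  have int: "padic_integers \<subseteq> carrier Q" using compact_latticeD(1)[OF padic_integers_lattice] .
  have Zmult: "x \<otimes>\<^bsub>L\<^esub> y \<in> ?Z" if xy: "x \<in> ?Z" "y \<in> ?Z" for x y
  proof -
    obtain x' y' where *: "x' \<in> padic_integers" "y' \<in> padic_integers" "x = h x'" "y = h y'" using xy by blast
    then have "x \<otimes>\<^bsub>L\<^esub> y = h (x' \<otimes>\<^bsub>Q\<^esub> y')" using subsetD[OF int *(1)] subsetD[OF int *(2)] by simp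
    then show ?thesis using padic_integers_mult[OF *(1,2)] by blast
  qed
  note Zadd = compact_latticeD(4)[OF Zlat] and Zzero = compact_latticeD(3)[OF Zlat]
  have Z1: "\<one>\<^bsub>L\<^esub> \<in> ?Z" using padic_integers_one by (metis h.hom_one image_eqI)
  have "[(n::nat)] \<cdot>\<^bsub>L\<^esub> \<one>\<^bsub>L\<^esub> \<in> ?Z" for n
  proof (induction n)
    case (Suc n)
    then show ?case using Zadd[OF Suc Z1] by simp
  qed (use Zzero in simp)
  then have Z\<pi>: "?\<pi> \<in> ?Z" .
  have Zc: "?Z \<subseteq> carrier L" using int by auto
  have "ring_hom_ring Q L h" by unfold_locales (rule h)
  then have K: "subfield ?K L"
    by (rule ring_hom_ring.img_is_subfield(2)[OF _ Q.carrier_is_subfield L.one_not_zero])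
  obtain n where "ring.dimension L n ?K (carrier L)" using L.finite_dimensionE'[OF fin] by blast
  then obtain Us where Us: "set Us \<subseteq> carrier L" "L.independent ?K Us" "L.Span ?K Us = carrier L"
    using L.exists_base[OF K] by blast
  have lat: "compact_lattice L ?\<pi> (L.Span ?K Us) (L.Span ?Z Us) \<and> (\<forall>z\<in>?Z. \<forall>x\<in>L.Span ?Z Us. z \<otimes>\<^bsub>L\<^esub> x \<in> L.Span ?Z Us)"
    using Us(1,2)
  proof (induction Us)
    case Nil
    have "translate L a {\<zero>\<^bsub>L\<^esub>} = {\<zero>\<^bsub>L\<^esub>}" if "a \<in> carrier L" for a using that by (simp add: translate_def)
    then have "compact_lattice L ?\<pi> {\<zero>\<^bsub>L\<^esub>} {\<zero>\<^bsub>L\<^esub>}" unfolding compact_lattice_def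
      by (auto intro!: exI[of _ "{\<zero>\<^bsub>L\<^esub>}"] simp: a_minus_def)
    then show ?case using Zc by auto
  next
    case (Cons e Us)
    have e: "e \<in> carrier L" and Us: "set Us \<subseteq> carrier L" using Cons.prems by auto
    have ind: "L.independent ?K Us" "e \<notin> L.Span ?K Us" using L.independent_backwards[OF Cons.prems(2)] by auto
    have IH: "compact_lattice L ?\<pi> (L.Span ?K Us) (L.Span ?Z Us)"
      "\<And>z x. z \<in> ?Z \<Longrightarrow> x \<in> L.Span ?Z Us \<Longrightarrow> z \<otimes>\<^bsub>L\<^esub> x \<in> L.Span ?Z Us"
      using Cons.IH[OF Us ind(1)] by auto
    have "compact_lattice L ?\<pi> (L.line_extension ?K e (L.Span ?K Us)) (L.line_extension ?Z e (L.Span ?Z Us))"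
    proof (rule L.compact_lattice_line_extension[OF Zlat Z\<pi> Zmult IH _ _ e])
      show "x \<ominus>\<^bsub>L\<^esub> y \<in> ?K" if "x \<in> ?K" "y \<in> ?K" for x y
        using that subringE(5,7)[OF subfieldE(1)[OF K]] by (simp add: a_minus_def)
      show "x \<ominus>\<^bsub>L\<^esub> y \<in> L.Span ?K Us" if "x \<in> L.Span ?K Us" "y \<in> L.Span ?K Us" for x y
        using that L.Span_subgroup_props(3,4)[OF K Us] by (simp add: a_minus_def del: L.Span.simps)
      show "k = \<zero>\<^bsub>L\<^esub>" if "k \<in> ?K" "k \<otimes>\<^bsub>L\<^esub> e \<in> L.Span ?K Us" for k
        using that L.Span_m_inv_simprule[OF K Us _ e, of k] ind(2) by auto
    qed
    moreover have "z \<otimes>\<^bsub>L\<^esub> x \<in> L.line_extension ?Z e (L.Span ?Z Us)"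
      if "z \<in> ?Z" "x \<in> L.line_extension ?Z e (L.Span ?Z Us)" for z x
      by (rule L.line_extension_closed[OF Zmult IH(2) Zc _ e that])
        (use compact_latticeD(1,2)[OF IH(1)] in auto)
    ultimately show ?case by simp
  qed
  define X where "X = L.Span ?Z Us"
  have X: "compact_lattice L ?\<pi> (carrier L) X" and ZX: "\<And>z x. z \<in> ?Z \<Longrightarrow> x \<in> X \<Longrightarrow> z \<otimes>\<^bsub>L\<^esub> x \<in> X"
    using lat unfolding X_def Us(3) by auto
  have \<pi>: "?\<pi> \<in> carrier L" using Z\<pi> Zc by blast
  obtain N where "\<forall>x\<in>X. \<forall>y\<in>X. ?\<pi> [^]\<^bsub>L\<^esub> (N::nat) \<otimes>\<^bsub>L\<^esub> (x \<otimes>\<^bsub>L\<^esub> y) \<in> X"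
    using L.Span_Span_bounded[OF X \<pi> ZX[OF Z\<pi>] Zc ZX Us(1) Us(1), folded X_def] by blast
  moreover have "\<forall>x\<in>carrier L. \<exists>i. \<forall>y\<in>X. ?\<pi> [^]\<^bsub>L\<^esub> (i::nat) \<otimes>\<^bsub>L\<^esub> (x \<otimes>\<^bsub>L\<^esub> y) \<in> X"
    using L.Span_bounded[OF X \<pi> ZX[OF Z\<pi>] Zc ZX _ Us(1), folded X_def] by blast
  ultimately show "\<exists>X N. compact_lattice L ?\<pi> (carrier L) X \<and>
      (\<forall>x\<in>X. \<forall>y\<in>X. ?\<pi> [^]\<^bsub>L\<^esub> (N::nat) \<otimes>\<^bsub>L\<^esub> (x \<otimes>\<^bsub>L\<^esub> y) \<in> X) \<and>
      (\<forall>x\<in>carrier L. \<exists>i. \<forall>y\<in>X. ?\<pi> [^]\<^bsub>L\<^esub> (i::nat) \<otimes>\<^bsub>L\<^esub> (x \<otimes>\<^bsub>L\<^esub> y) \<in> X)"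
    using X by blast
qed

section \<open>Finite extensions of the p-adic numbers as bases of the tower\<close>

context plain_field
begin

definition zpow :: "'a \<Rightarrow> int \<Rightarrow> 'a" where
  "zpow x k = (if 0 \<le> k then x [^] nat k else inv (x [^] nat (- k)))"

lemma zpow_nat: "zpow x (int n) = x [^] n"
  unfolding zpow_def by (simp only: of_nat_0_le_iff if_True nat_int)

lemma zpow_0 [simp]: "zpow x 0 = \<one>"
  by (simp add: zpow_def)

lemma zpow_neg: "zpow x (- int n) = inv (x [^] n)"
proof (cases "n = 0")
  case False
  then have "\<not> 0 \<le> - int n" "nat (- (- int n)) = n" by auto
  then show ?thesis unfolding zpow_def by (simp only: if_False)
qed simp

lemma zpow_nonzero: "x \<in> nonzero R \<Longrightarrow> zpow x k \<in> nonzero R"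
  by (cases k rule: int_cases2) (simp_all only: zpow_nat zpow_neg nonzero_pow nonzero_inv)

lemma zpow_succ:
  assumes x: "x \<in> nonzero R" shows "zpow x (k + 1) = x \<otimes> zpow x k"
proof (cases "0 \<le> k")
  case True
  then obtain n where "k = int n" using nonneg_int_cases by blast
  then show ?thesis
    using zpow_nat[of x "Suc n"] zpow_nat[of x n] nonzero_closed[OF x] by (simp add: m_comm add.commute)
next
  case False
  then obtain n where n: "k = - int (Suc n)"
    by (metis add.inverse_inverse int_cases3 nat_less_le negative_zle neg_0_le_iff_le not_le of_nat_0_le_iff not0_implies_Suc of_nat_0 add.inverse_neutral)
  then have k1: "k + 1 = - int n" by simp
  let ?a = "x [^] n"
  have a: "?a \<in> nonzero R" "?a \<otimes> x \<in> nonzero R" using x by (simp_all add: nonzero_pow nonzero_mult)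
  note cl = nonzero_closed[OF x] nonzero_closed[OF a(1)] nonzero_closed[OF nonzero_inv[OF a(1)]]
    nonzero_closed[OF nonzero_inv[OF a(2)]]
  have "?a \<otimes> (x \<otimes> inv (?a \<otimes> x)) = ?a \<otimes> inv ?a"
    using cl nonzero_r_inv[OF a(2)] nonzero_r_inv[OF a(1)] by (simp add: m_assoc[symmetric])
  then have "x \<otimes> inv (?a \<otimes> x) = inv ?a" using nonzero_cancel[OF a(1)] cl by simp
  moreover have "zpow x k = inv (?a \<otimes> x)" unfolding n zpow_neg by simp
  ultimately show ?thesis unfolding k1 zpow_neg by simp
qed

lemma zpow_add:
  assumes x: "x \<in> nonzero R" shows "zpow x (k + l) = zpow x k \<otimes> zpow x l"
proof (induction k rule: int_induct[of _ 0])
  case base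
  show ?case using nonzero_closed[OF zpow_nonzero[OF x]] by simp
next
  case (step1 i)
  have "zpow x (i + 1 + l) = x \<otimes> zpow x (i + l)" using zpow_succ[OF x, of "i + l"] by (simp add: ac_simps)
  then show ?case using step1 zpow_succ[OF x, of i] nonzero_closed[OF x] nonzero_closed[OF zpow_nonzero[OF x]]
    by (simp add: m_assoc)
next
  case (step2 i)
  have "x \<otimes> zpow x (i - 1 + l) = zpow x (i + l)" using zpow_succ[OF x, of "i - 1 + l"] by (simp add: algebra_simps)
  also have "\<dots> = x \<otimes> (zpow x (i - 1) \<otimes> zpow x l)"
    using step2 zpow_succ[OF x, of "i - 1"] nonzero_closed[OF x] nonzero_closed[OF zpow_nonzero[OF x]]
    by (simp add: m_assoc)
  finally show ?case using nonzero_cancel[OF x] nonzero_closed[OF zpow_nonzero[OF x]] by simp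
qed

lemma zpow_pow:
  assumes x: "x \<in> nonzero R" shows "zpow x k [^] (n::nat) = zpow x (int n * k)"
proof (induction n)
  case (Suc n)
  have "zpow x (int (Suc n) * k) = zpow x (int n * k) \<otimes> zpow x k"
    unfolding zpow_add[OF x, symmetric] by (simp add: algebra_simps)
  then show ?case using Suc by simp
qed simp

lemma zpow_inv:
  assumes x: "x \<in> nonzero R" shows "inv (zpow x k) = zpow x (- k)"
proof -
  have "zpow x k \<otimes> zpow x (- k) = \<one>" unfolding zpow_add[OF x, symmetric] by simp
  then show ?thesis
    using comm_inv_char nonzero_closed[OF zpow_nonzero[OF x]] by simp
qed

lemma coset_eq:
  assumes H: "H \<subseteq> nonzero R" "\<And>x y. x \<in> H \<Longrightarrow> y \<in> H \<Longrightarrow> x \<otimes> y \<in> H" "\<And>x. x \<in> H \<Longrightarrow> inv x \<in> H"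
    and y: "y \<in> nonzero R" and z: "z \<in> translate R y H"
  shows "translate R z H = translate R y H"
proof -
  obtain h where h: "h \<in> H" "z = y \<otimes> h" using z by (auto simp: translate_def)
  have hn: "h \<in> nonzero R" using h H by blast
  note cl = nonzero_closed[OF y] nonzero_closed[OF hn] nonzero_closed[OF nonzero_inv[OF hn]]
  show ?thesis
  proof
    show "translate R z H \<subseteq> translate R y H"
    proof
      fix w assume "w \<in> translate R z H"
      then obtain k where k: "k \<in> H" "w = (y \<otimes> h) \<otimes> k" using h(2) by (auto simp: translate_def)
      then have "w = y \<otimes> (h \<otimes> k)" using cl H(1) nonzero_closed by (simp add: m_assoc subset_iff)
      then show "w \<in> translate R y H" using H(2)[OF h(1) k(1)] by (auto simp: translate_def)
    qed
    show "translate R y H \<subseteq> translate R z H"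
    proof
      fix w assume "w \<in> translate R y H"
      then obtain k where k: "k \<in> H" "w = y \<otimes> k" by (auto simp: translate_def)
      have kc: "k \<in> carrier R" using k(1) H(1) nonzero_closed by blast
      have "z \<otimes> (inv h \<otimes> k) = y \<otimes> ((h \<otimes> inv h) \<otimes> k)" unfolding h(2) using cl kc by (simp add: m_assoc)
      then have "w = z \<otimes> (inv h \<otimes> k)" using nonzero_r_inv[OF hn] kc k(2) by simp
      then show "w \<in> translate R z H" using H(2)[OF H(3)[OF h(1)] k(1)] by (auto simp: translate_def)
    qed
  qed
qed

lemma coset_representatives:
  assumes H: "H \<subseteq> nonzero R" "\<one> \<in> H" "\<And>x y. x \<in> H \<Longrightarrow> y \<in> H \<Longrightarrow> x \<otimes> y \<in> H" "\<And>x. x \<in> H \<Longrightarrow> inv x \<in> H"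
    and B: "finite B" "B \<subseteq> nonzero R" "\<And>x. x \<in> nonzero R \<Longrightarrow> \<exists>y\<in>B. x \<in> translate R y H"
  shows "\<exists>(c::nat) y. (\<forall>i<c. y i \<in> nonzero R) \<and> (\<forall>x\<in>nonzero R. \<exists>i<c. x \<in> translate R (y i) H) \<and>
    (\<forall>i<c. \<forall>j<c. i \<noteq> j \<longrightarrow> translate R (y i) H \<inter> translate R (y j) H = {})"
proof -
  let ?C = "(\<lambda>y. translate R y H) ` B"
  have "finite ?C" using B(1) by simp
  then obtain f where f: "bij_betw f {0..<card ?C} ?C" using ex_bij_betw_nat_finite by blast
  have "\<forall>i\<in>{0..<card ?C}. \<exists>y. y \<in> nonzero R \<and> translate R y H = f i"
  proof
    fix i assume "i \<in> {0..<card ?C}"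
    then have "f i \<in> ?C" using bij_betw_imp_surj_on[OF f] by blast
    then show "\<exists>y. y \<in> nonzero R \<and> translate R y H = f i" using B(2) by blast
  qed
  then obtain y where y: "\<And>i. i \<in> {0..<card ?C} \<Longrightarrow> y i \<in> nonzero R \<and> translate R (y i) H = f i" by metis
  have "\<exists>i<card ?C. x \<in> translate R (y i) H" if x: "x \<in> nonzero R" for x
  proof -
    obtain z where z: "z \<in> B" "x \<in> translate R z H" using B(3)[OF x] by blast
    then have "translate R z H \<in> f ` {0..<card ?C}" using f by (auto simp: bij_betw_def)
    then obtain i where i: "i \<in> {0..<card ?C}" "translate R z H = f i" by blast
    then show ?thesis using y[OF i(1)] z(2) by auto
  qed
  moreover have "translate R (y i) H \<inter> translate R (y j) H = {}" if ij: "i < card ?C" "j < card ?C" "i \<noteq> j" for i j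
  proof (rule ccontr)
    have i: "y i \<in> nonzero R" "translate R (y i) H = f i" and j: "y j \<in> nonzero R" "translate R (y j) H = f j"
      using y ij by auto
    assume "translate R (y i) H \<inter> translate R (y j) H \<noteq> {}"
    then obtain z where z: "z \<in> translate R (y i) H" "z \<in> translate R (y j) H" by blast
    have "f i = f j" using coset_eq[OF H(1,3,4) i(1) z(1)] coset_eq[OF H(1,3,4) j(1) z(2)] i j by simp
    then show False using f ij by (auto simp: bij_betw_def inj_on_def)
  qed
  moreover have "\<forall>i<card ?C. y i \<in> nonzero R" using y by simp
  ultimately show ?thesis by (intro exI[of _ "card ?C"] exI[of _ y]) blast
qed

text \<open>Among \<open>1, x, ..., x^c\<close> two elements lie in the same of the \<open>c\<close> cosets, so \<open>x^d\<close> is in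
  \<open>H\<close> for some \<open>d\<close> with \<open>1 \<le> d \<le> c\<close>, and such \<open>d\<close> divide the factorial of \<open>c\<close>.\<close>

lemma power_in_subgroup:
  assumes H: "\<one> \<in> H" "\<And>x y. x \<in> H \<Longrightarrow> y \<in> H \<Longrightarrow> x \<otimes> y \<in> H" "\<And>x. x \<in> H \<Longrightarrow> inv x \<in> H" "H \<subseteq> nonzero R"
    and cover: "\<And>x. x \<in> nonzero R \<Longrightarrow> \<exists>i<c. x \<in> translate R (g i) H" and g: "\<And>i. i < c \<Longrightarrow> g i \<in> nonzero R"
    and x: "x \<in> nonzero R"
  shows "x [^] (fact c :: nat) \<in> H"
proof -
  note xc = nonzero_closed[OF x]
  have "\<exists>i<c. x [^] n \<in> translate R (g i) H" for n :: nat by (rule cover[OF nonzero_pow[OF x]])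
  then obtain \<iota> where \<iota>: "\<And>n::nat. \<iota> n < c \<and> x [^] n \<in> translate R (g (\<iota> n)) H" by metis
  have "\<not> inj_on \<iota> {..c}"
  proof
    assume "inj_on \<iota> {..c}"
    then have "card {..c} \<le> card {..<c}" by (rule card_inj_on_le) (use \<iota> in auto)
    then show False by simp
  qed
  then obtain i j where "i \<le> c" "j \<le> c" "i \<noteq> j" "\<iota> i = \<iota> j" unfolding inj_on_def by auto
  then obtain i d where d: "d > 0" "d \<le> c" "\<iota> i = \<iota> (i + d)"
    by (metis add_diff_inverse_nat diff_le_self le_trans less_imp_le nat_neq_iff zero_less_diff not_less)
  obtain h h' where h: "h \<in> H" "x [^] i = g (\<iota> i) \<otimes> h" "h' \<in> H" "x [^] (i + d) = g (\<iota> i) \<otimes> h'"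
    using \<iota>[of i] \<iota>[of "i + d"] d(3) unfolding translate_def by auto
  have gn: "g (\<iota> i) \<in> nonzero R" using g \<iota> by blast
  have hn: "h \<in> nonzero R" "h' \<in> nonzero R" using h H(4) by auto
  note cl = nonzero_closed[OF gn] nonzero_closed[OF hn(1)] nonzero_closed[OF hn(2)] nonzero_closed[OF nonzero_inv[OF hn(1)]]
  have "g (\<iota> i) \<otimes> h' = g (\<iota> i) \<otimes> (h \<otimes> x [^] d)"
    using h(2,4) cl xc by (simp add: nat_pow_mult[symmetric] m_assoc)
  then have "h' = h \<otimes> x [^] d" using nonzero_cancel[OF gn] cl xc by simp
  then have "inv h \<otimes> h' = x [^] d" using nonzero_l_inv[OF hn(1)] cl xc by (simp add: m_assoc[symmetric])
  then have xd: "x [^] d \<in> H" using H(2)[OF H(3)[OF h(1)] h(3)] by simp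
  obtain k where k: "(fact c :: nat) = d * k" using dvd_fact[of d c] d by (auto elim: dvdE)
  have "(x [^] d) [^] k \<in> H" by (induction k) (auto simp: H(1) xd H(2))
  then show ?thesis using xc unfolding k by (simp add: nat_pow_pow)
qed

end

text \<open>A finite extension of the p-adic numbers with the lattice provided by
  \<open>extension_lattice\<close>.\<close>

locale lattice_field = plain_field R for R :: "'a ring" (structure) +
  fixes p :: nat and \<pi> :: 'a and X :: "'a set" and N :: nat
  assumes \<pi>_eq: "\<pi> = [p] \<cdot> \<one>" and p_pos: "p > 0" and char: "char_zero R"
    and lattice: "compact_lattice R \<pi> (carrier R) X"
    and X_mult: "x \<in> X \<Longrightarrow> y \<in> X \<Longrightarrow> \<pi> [^] N \<otimes> (x \<otimes> y) \<in> X"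
    and X_bounded: "x \<in> carrier R \<Longrightarrow> \<exists>i. \<forall>y\<in>X. \<pi> [^] (i::nat) \<otimes> (x \<otimes> y) \<in> X"
begin

lemmas X_props = compact_latticeD[OF lattice]

lemma X_closed: "x \<in> X \<Longrightarrow> x \<in> carrier R" using X_props(1) by blast

lemma \<pi>_nonzero: "\<pi> \<in> nonzero R"
  using char p_pos unfolding \<pi>_eq by (simp add: nonzero_def char_zero_def)

lemmas \<pi>_closed = nonzero_closed[OF \<pi>_nonzero]

lemma \<pi>_mult: "x \<in> carrier R \<Longrightarrow> \<pi> \<otimes> x = [p] \<cdot> x"
  using add_pow_ldistr[of \<one> x p] unfolding \<pi>_eq by simp

lemma X_multiple: "x \<in> X \<Longrightarrow> [(n::nat)] \<cdot> x \<in> X"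
  by (induction n) (auto simp: X_props(3) intro: X_props(4))

lemma X_\<pi>: "x \<in> X \<Longrightarrow> \<pi> \<otimes> x \<in> X"
  using \<pi>_mult X_multiple X_closed by simp

lemma X_\<pi>_pow: "x \<in> X \<Longrightarrow> \<pi> [^] (i::nat) \<otimes> x \<in> X"
  by (rule lattice_pow_closed[OF \<pi>_closed X_props(1) X_\<pi>])

text \<open>The additional factor \<open>\<pi> ^ N\<close> makes the filtration multiplicative.\<close>

definition J :: "nat \<Rightarrow> 'a set" where "J i = translate R (\<pi> [^] (N + i)) X"

lemma J_iff: "x \<in> J i \<longleftrightarrow> (\<exists>y\<in>X. x = \<pi> [^] (N + i) \<otimes> y)"
  by (auto simp: J_def translate_def)

lemma J_subset_pow: "J i \<subseteq> translate R (\<pi> [^] i) X"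
proof
  fix x assume "x \<in> J i"
  then obtain y where y: "y \<in> X" "x = \<pi> [^] (N + i) \<otimes> y" unfolding J_iff by blast
  then have "x = \<pi> [^] i \<otimes> (\<pi> [^] N \<otimes> y)"
    using \<pi>_closed X_closed by (simp add: nat_pow_mult[symmetric] m_ac)
  then show "x \<in> translate R (\<pi> [^] i) X" using X_\<pi>_pow[OF y(1)] by (auto simp: translate_def)
qed

lemma translate_diff_mem:
  assumes "x \<in> translate R (\<pi> [^] (i::nat)) X" "y \<in> translate R (\<pi> [^] i) X"
  shows "x \<oplus> y \<in> translate R (\<pi> [^] i) X" "\<ominus> x \<in> translate R (\<pi> [^] i) X"
proof -
  obtain a b where *: "a \<in> X" "x = \<pi> [^] i \<otimes> a" "b \<in> X" "y = \<pi> [^] i \<otimes> b" using assms by (auto simp: translate_def)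
  note cl = \<pi>_closed X_closed[OF *(1)] X_closed[OF *(3)]
  have "x \<oplus> y = \<pi> [^] i \<otimes> (a \<oplus> b)" "\<ominus> x = \<pi> [^] i \<otimes> (\<ominus> a)" using cl * by (simp_all add: r_distr r_minus)
  then show "x \<oplus> y \<in> translate R (\<pi> [^] i) X" "\<ominus> x \<in> translate R (\<pi> [^] i) X"
    using X_props(4)[OF *(1,3)] X_props(5)[OF *(1)] by (auto simp: translate_def)
qed

lemma J_filtration: "complete_filtration R J"
proof (intro complete_filtration.intro complete_filtration_axioms.intro)
  show "cring R" by (rule cring_axioms)
next
  fix i j x y
  show "J i \<subseteq> carrier R" unfolding J_def translate_def using \<pi>_closed X_closed by auto
  show "\<zero> \<in> J i" unfolding J_iff using X_props(3) \<pi>_closed by (intro bexI[of _ \<zero>]) auto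
  show "x \<oplus> y \<in> J i" if "x \<in> J i" "y \<in> J i" using translate_diff_mem(1) that unfolding J_def by blast
  show "\<ominus> x \<in> J i" if "x \<in> J i" using translate_diff_mem(2) that unfolding J_def by blast
  show "J (Suc i) \<subseteq> J i"
  proof
    fix x assume "x \<in> J (Suc i)"
    then obtain y where y: "y \<in> X" "x = \<pi> [^] (N + Suc i) \<otimes> y" unfolding J_iff by blast
    then have "x = \<pi> [^] (N + i) \<otimes> (\<pi> \<otimes> y)" using \<pi>_closed X_closed by (simp add: m_assoc)
    then show "x \<in> J i" unfolding J_iff using X_\<pi>[OF y(1)] by blast
  qed
  show "x \<otimes> y \<in> J (i + j)" if xy: "x \<in> J i" "y \<in> J j"
  proof -
    obtain a b where *: "a \<in> X" "x = \<pi> [^] (N + i) \<otimes> a" "b \<in> X" "y = \<pi> [^] (N + j) \<otimes> b"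
      using xy unfolding J_iff by blast
    have "x \<otimes> y = \<pi> [^] (N + (i + j)) \<otimes> (\<pi> [^] N \<otimes> (a \<otimes> b))"
      unfolding * using \<pi>_closed X_closed[OF *(1)] X_closed[OF *(3)] by (simp add: nat_pow_mult[symmetric] m_ac)
    then show ?thesis unfolding J_iff using X_mult[OF *(1,3)] by blast
  qed
  show "x = \<zero>" if "\<And>i. x \<in> J i" using X_props(7) that J_subset_pow by blast
next
  fix S :: "nat \<Rightarrow> 'a" assume S: "\<And>i. S i \<in> carrier R" "\<And>i. S (Suc i) \<ominus> S i \<in> J i"
  let ?u = "\<pi> [^] N"
  have u: "?u \<in> nonzero R" by (rule nonzero_pow[OF \<pi>_nonzero])
  note uc = nonzero_closed[OF u] nonzero_closed[OF nonzero_inv[OF u]]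
  define Y where "Y i = inv ?u \<otimes> (S i \<ominus> S 0)" for i
  have Yc: "Y i \<in> carrier R" for i unfolding Y_def using uc S(1) by simp
  have uY: "?u \<otimes> Y i = S i \<ominus> S 0" for i
    unfolding Y_def using uc S(1) nonzero_r_inv[OF u] by (simp add: m_assoc[symmetric])
  have step: "Y (Suc i) \<ominus> Y i \<in> translate R (\<pi> [^] i) X" for i
  proof -
    obtain y where y: "y \<in> X" "S (Suc i) \<ominus> S i = \<pi> [^] (N + i) \<otimes> y" using S(2) unfolding J_iff by blast
    have "?u \<otimes> (Y (Suc i) \<ominus> Y i) = (S (Suc i) \<ominus> S 0) \<ominus> (S i \<ominus> S 0)"
      using uc Yc uY by (simp add: minus_eq r_distr r_minus)
    also have "\<dots> = S (Suc i) \<ominus> S i" using S(1) by (simp add: minus_eq minus_add a_ac r_neg r_neg1 r_neg2)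
    also have "\<dots> = ?u \<otimes> (\<pi> [^] i \<otimes> y)" unfolding y(2) using \<pi>_closed X_closed[OF y(1)]
      by (simp add: nat_pow_mult[symmetric] m_assoc)
    finally have "Y (Suc i) \<ominus> Y i = \<pi> [^] i \<otimes> y"
      using nonzero_cancel[OF u] Yc \<pi>_closed X_closed[OF y(1)] by simp
    then show ?thesis using y(1) by (auto simp: translate_def)
  qed
  have YX: "Y i \<in> X" for i
  proof (induction i)
    case 0
    then show ?case unfolding Y_def using uc S(1) X_props(3) by (simp add: r_neg minus_eq)
  next
    case (Suc i)
    have "Y (Suc i) \<ominus> Y i \<in> X" using step[of i] X_\<pi>_pow by (auto simp: translate_def)
    then have "(Y (Suc i) \<ominus> Y i) \<oplus> Y i \<in> X" using Suc by (rule X_props(4))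
    moreover have "(Y (Suc i) \<ominus> Y i) \<oplus> Y i = Y (Suc i)" using Yc by (simp add: minus_eq a_assoc l_neg)
    ultimately show ?case by simp
  qed
  obtain x where x: "x \<in> X" "\<And>i. x \<ominus> Y i \<in> translate R (\<pi> [^] i) X"
    using X_props(9)[of Y] YX step by blast
  have "(S 0 \<oplus> ?u \<otimes> x) \<ominus> S i \<in> J i" for i
  proof -
    obtain y where y: "y \<in> X" "x \<ominus> Y i = \<pi> [^] i \<otimes> y" using x(2)[of i] by (auto simp: translate_def)
    have "(S 0 \<oplus> ?u \<otimes> x) \<ominus> S i = ?u \<otimes> x \<ominus> (S i \<ominus> S 0)"
      using S(1) uc X_closed[OF x(1)] by (simp add: minus_eq minus_add a_ac)
    also have "\<dots> = ?u \<otimes> (x \<ominus> Y i)"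
      unfolding uY[symmetric] using uc Yc X_closed[OF x(1)] by (simp add: minus_eq r_distr r_minus)
    also have "\<dots> = \<pi> [^] (N + i) \<otimes> y"
      unfolding y(2) using \<pi>_closed X_closed[OF y(1)] by (simp add: nat_pow_mult[symmetric] m_assoc)
    finally show ?thesis unfolding J_iff using y(1) by blast
  qed
  then show "\<exists>x\<in>carrier R. \<forall>i. x \<ominus> S i \<in> J i"
    using S(1) uc X_closed[OF x(1)] by (intro bexI[of _ "S 0 \<oplus> ?u \<otimes> x"]) auto
qed

sublocale J: complete_filtration R J by (rule J_filtration)

definition T :: "'a set" where "T = (\<lambda>x. \<one> \<oplus> x) ` J 1"

lemma T_one: "\<one> \<in> T"
  unfolding T_def using J.J_zero by (intro image_eqI[of _ _ \<zero>]) auto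

lemma T_closed: "u \<in> T \<Longrightarrow> u \<in> carrier R"
  unfolding T_def using J.J_carrier by auto

lemma T_J: assumes "u \<in> T" "x \<in> J i" shows "u \<otimes> x \<in> J i"
proof -
  obtain a where a: "a \<in> J 1" "u = \<one> \<oplus> a" using assms(1) unfolding T_def by blast
  have "u \<otimes> x = x \<oplus> a \<otimes> x" unfolding a(2) using J.J_carrier[OF a(1)] J.J_carrier[OF assms(2)] by (simp add: l_distr)
  moreover have "a \<otimes> x \<in> J i" by (rule J.J_mult_le[OF a(1) assms(2)]) simp
  ultimately show ?thesis using J.J_add[OF assms(2)] by simp
qed

lemma T_mult: assumes "u \<in> T" "v \<in> T" shows "u \<otimes> v \<in> T"
proof -
  obtain a b where a: "a \<in> J 1" "u = \<one> \<oplus> a" and b: "b \<in> J 1" "v = \<one> \<oplus> b" using assms unfolding T_def by blast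
  have "u \<otimes> v = \<one> \<oplus> (a \<oplus> u \<otimes> b)"
    unfolding b(2) using T_closed[OF assms(1)] J.J_carrier[OF a(1)] J.J_carrier[OF b(1)] a(2) by (simp add: r_distr a_assoc)
  moreover have "a \<oplus> u \<otimes> b \<in> J 1" by (rule J.J_add[OF a(1) T_J[OF assms(1) b(1)]])
  ultimately show ?thesis unfolding T_def by blast
qed

lemma T_inverse: assumes "u \<in> T" shows "u \<in> nonzero R" "inv u \<in> T"
proof -
  obtain a where a: "a \<in> J 1" "u = \<one> \<oplus> a" using assms unfolding T_def by blast
  obtain w where w: "w \<in> J 1" "u \<otimes> (\<one> \<oplus> w) = \<one>" using J.one_unit_inverse[of a] a by auto
  have wc: "\<one> \<oplus> w \<in> carrier R" using J.J_carrier[OF w(1)] by simp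
  show "u \<in> nonzero R" unfolding nonzero_iff using w(2) wc T_closed[OF assms] one_not_zero by auto
  have "inv u = \<one> \<oplus> w" using comm_inv_char[OF T_closed[OF assms] wc w(2)] .
  then show "inv u \<in> T" unfolding T_def using w(1) by blast
qed

lemma T_pow: "u \<in> T \<Longrightarrow> u [^] (n::nat) \<in> T"
  by (induction n) (auto simp: T_one T_mult)

lemma \<pi>_J: assumes "x \<in> J i" shows "\<pi> \<otimes> x \<in> J (Suc i)"
proof -
  obtain y where y: "y \<in> X" "x = \<pi> [^] (N + i) \<otimes> y" using assms unfolding J_iff by blast
  have "\<pi> \<otimes> x = \<pi> [^] (N + Suc i) \<otimes> y" unfolding y(2) using \<pi>_closed X_closed[OF y(1)] by (simp add: m_ac)
  then show ?thesis unfolding J_iff using y(1) by blast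
qed

lemma \<pi>_pow_J: assumes "x \<in> J i" shows "\<pi> [^] (n::nat) \<otimes> x \<in> J (n + i)"
proof (induction n)
  case (Suc n)
  have "\<pi> [^] Suc n \<otimes> x = \<pi> \<otimes> (\<pi> [^] n \<otimes> x)" using \<pi>_closed J.J_carrier[OF assms] by (simp add: m_ac)
  then show ?case using \<pi>_J[OF Suc] by simp
qed (use assms J.J_carrier in auto)

lemma absorb: assumes "x \<in> carrier R" shows "\<exists>n. \<pi> [^] (n::nat) \<otimes> x \<in> J i"
proof -
  obtain n where n: "\<pi> [^] (n::nat) \<otimes> x \<in> X" using X_props(6)[OF assms] by blast
  have "\<pi> [^] (N + i + n) \<otimes> x = \<pi> [^] (N + i) \<otimes> (\<pi> [^] n \<otimes> x)"
    using \<pi>_closed assms by (simp add: nat_pow_mult[symmetric] m_assoc)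
  then show ?thesis using n unfolding J_iff by blast
qed

abbreviation "e k \<equiv> zpow \<pi> k"

lemmas e_nonzero = zpow_nonzero[OF \<pi>_nonzero] and e_add = zpow_add[OF \<pi>_nonzero]
lemmas e_closed = nonzero_closed[OF e_nonzero]

text \<open>Multiplication by a one-unit maps \<open>J 1\<close> onto itself. If \<open>\<pi> ^ k\<close> with \<open>k > 0\<close> were a
  one-unit, \<open>J 1\<close> would be contained in all \<open>J i\<close> and be zero.\<close>

lemma \<pi>_pow_T: assumes "\<pi> [^] (k::nat) \<in> T" shows "k = 0"
proof (rule ccontr)
  assume k: "k \<noteq> 0"
  have sub: "x \<in> J (k * n + 1)" if x: "x \<in> J 1" for x n
  proof -
    let ?u = "(\<pi> [^] k) [^] n"
    have u: "?u \<in> T" by (rule T_pow[OF assms])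
    have "inv ?u \<otimes> x \<in> J 1" using T_J[OF T_inverse(2)[OF u] x] .
    from \<pi>_pow_J[OF this, of "k * n"] have "\<pi> [^] (k * n) \<otimes> (inv ?u \<otimes> x) \<in> J (k * n + 1)" .
    moreover have "\<pi> [^] (k * n) = ?u" using \<pi>_closed by (simp add: nat_pow_pow)
    moreover have "?u \<otimes> (inv ?u \<otimes> x) = x"
      using nonzero_r_inv[OF T_inverse(1)[OF u]] nonzero_closed[OF nonzero_inv[OF T_inverse(1)[OF u]]] T_closed[OF u] J.J_carrier[OF x]
      by (simp add: m_assoc[symmetric])
    ultimately show ?thesis by simp
  qed
  have zero: "x = \<zero>" if x: "x \<in> J 1" for x
  proof (rule J.J_separated)
    fix i
    have "i \<le> k * i + 1" using k by (cases k) auto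
    then show "x \<in> J i" using sub[OF x, of i] J.J_antimono[of i "k * i + 1"] by blast
  qed
  obtain n where "\<pi> [^] (n::nat) \<otimes> \<one> \<in> J 1" using absorb[OF one_closed] by blast
  then have "\<pi> [^] n = \<zero>" using zero \<pi>_closed by simp
  then show False using nonzero_pow[OF \<pi>_nonzero, of n] by (simp add: nonzero_def)
qed

lemma e_T: assumes "e k \<in> T" shows "k = 0"
proof (cases k rule: int_cases2)
  case (nonneg n)
  have "n = 0" by (rule \<pi>_pow_T) (use assms in \<open>simp only: nonneg zpow_nat\<close>)
  then show ?thesis using nonneg by simp
next
  case (nonpos n)
  have "inv (e k) \<in> T" by (rule T_inverse(2)[OF assms])
  then have "e (int n) \<in> T" unfolding zpow_inv[OF \<pi>_nonzero] nonpos by simp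
  then have "n = 0" by (intro \<pi>_pow_T) (simp only: zpow_nat)
  then show ?thesis using nonpos by simp
qed

lemma e_unique: assumes "e k \<otimes> u = e l \<otimes> v" "u \<in> T" "v \<in> T" shows "k = l"
proof -
  note cl = e_closed T_closed[OF assms(2)] T_closed[OF assms(3)] T_closed[OF T_inverse(2)[OF assms(2)]]
  have "e (k - l) \<otimes> (u \<otimes> inv u) = e (- l) \<otimes> ((e k \<otimes> u) \<otimes> inv u)"
    using cl e_add[of "- l" k] by (simp add: m_assoc)
  also have "\<dots> = e (- l) \<otimes> ((e l \<otimes> v) \<otimes> inv u)" using assms(1) by simp
  also have "\<dots> = (e (- l) \<otimes> e l) \<otimes> (v \<otimes> inv u)" using cl by (simp add: m_assoc)
  also have "\<dots> = v \<otimes> inv u" using cl e_add[of "- l" l, symmetric] by simp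
  finally have "e (k - l) = v \<otimes> inv u" using nonzero_r_inv[OF T_inverse(1)[OF assms(2)]] cl by simp
  then have "e (k - l) \<in> T" using T_mult[OF assms(3) T_inverse(2)[OF assms(2)]] by simp
  then show ?thesis using e_T by fastforce
qed

text \<open>Compactness: each point of \<open>X\<close> has a neighbourhood inside \<open>\<pi> X\<close> or inside a single
  coset of \<open>T\<close>. If finitely many cosets were not enough, the same would be true for one of
  the finitely many residue classes modulo \<open>\<pi>\<close>, then for one of its classes modulo \<open>\<pi> ^ 2\<close>,
  and so on, and the limit of these classes would be a point without such a neighbourhood.\<close>

lemma lattice_covered:
  "\<exists>B\<subseteq>nonzero R. finite B \<and> (\<forall>x\<in>X. x \<in> translate R \<pi> X \<or> (\<exists>y\<in>B. x \<in> translate R y T))"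
proof (rule ccontr)
  assume not: "\<not> ?thesis"
  define good where "good S \<longleftrightarrow> (\<exists>B\<subseteq>nonzero R. finite B \<and> (\<forall>x\<in>S. x \<in> translate R \<pi> X \<or> (\<exists>y\<in>B. x \<in> translate R y T)))" for S
  define nbhd where "nbhd y i = {x \<in> X. x \<ominus> y \<in> translate R (\<pi> [^] (i::nat)) X}" for y i
  obtain C where C: "C \<subseteq> X" "finite C" "\<forall>x\<in>X. \<exists>c\<in>C. x \<ominus> c \<in> translate R \<pi> X" using X_props(8) by blast
  have good_UN: "good (\<Union>c\<in>C'. S c)" if fin: "finite C'" and g: "\<And>c. c \<in> C' \<Longrightarrow> good (S c)" for S and C' :: "'a set"
  proof -
    obtain B where B: "\<And>c. c \<in> C' \<Longrightarrow> B c \<subseteq> nonzero R \<and> finite (B c) \<and>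
        (\<forall>x\<in>S c. x \<in> translate R \<pi> X \<or> (\<exists>y\<in>B c. x \<in> translate R y T))"
      using g unfolding good_def by metis
    show ?thesis unfolding good_def
      by (rule exI[of _ "\<Union>c\<in>C'. B c"]) (use B fin in blast)
  qed
  have good_mono: "good S" if "good S'" "S \<subseteq> S'" for S S' using that unfolding good_def by blast
  have step: "\<exists>y'. (y' \<in> X \<and> \<not> good (nbhd y' (Suc i))) \<and> y' \<ominus> y \<in> translate R (\<pi> [^] i) X"
    if y: "y \<in> X \<and> \<not> good (nbhd y i)" for y i
  proof -
    have sub: "nbhd y i \<subseteq> (\<Union>c\<in>C. nbhd (y \<oplus> \<pi> [^] i \<otimes> c) (Suc i))"
    proof
      fix x assume x: "x \<in> nbhd y i"
      then obtain z where z: "z \<in> X" "x \<ominus> y = \<pi> [^] i \<otimes> z" unfolding nbhd_def translate_def by blast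
      obtain c where c: "c \<in> C" "z \<ominus> c \<in> translate R \<pi> X" using C(3) z(1) by blast
      then obtain w where w: "w \<in> X" "z \<ominus> c = \<pi> \<otimes> w" unfolding translate_def by blast
      have cl: "x \<in> carrier R" "y \<in> carrier R" "z \<in> carrier R" "c \<in> carrier R" "w \<in> carrier R"
        using x y z c w C(1) X_closed unfolding nbhd_def by auto
      have "x \<ominus> (y \<oplus> \<pi> [^] i \<otimes> c) = (x \<ominus> y) \<ominus> \<pi> [^] i \<otimes> c"
        using cl \<pi>_closed by (simp add: minus_eq minus_add a_ac)
      also have "\<dots> = \<pi> [^] i \<otimes> (z \<ominus> c)"
        unfolding z(2) using cl \<pi>_closed by (simp add: minus_eq r_distr r_minus)
      also have "\<dots> = \<pi> [^] Suc i \<otimes> w" unfolding w(2) using cl \<pi>_closed by (simp add: m_assoc)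
      finally have "x \<in> nbhd (y \<oplus> \<pi> [^] i \<otimes> c) (Suc i)"
        using x w(1) unfolding nbhd_def translate_def by blast
      then show "x \<in> (\<Union>c\<in>C. nbhd (y \<oplus> \<pi> [^] i \<otimes> c) (Suc i))" using c(1) by blast
    qed
    have "\<exists>c\<in>C. \<not> good (nbhd (y \<oplus> \<pi> [^] i \<otimes> c) (Suc i))"
      using good_UN[OF C(2), of "\<lambda>c. nbhd (y \<oplus> \<pi> [^] i \<otimes> c) (Suc i)"] good_mono[OF _ sub] y by blast
    then obtain c where c: "c \<in> C" "\<not> good (nbhd (y \<oplus> \<pi> [^] i \<otimes> c) (Suc i))" by blast
    have cX: "c \<in> X" using c(1) C(1) by blast
    have "(y \<oplus> \<pi> [^] i \<otimes> c) \<ominus> y = \<pi> [^] i \<otimes> c"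
      using X_closed[OF cX] X_closed y \<pi>_closed by (simp add: minus_eq a_ac r_neg r_neg1 r_neg2)
    moreover have "y \<oplus> \<pi> [^] i \<otimes> c \<in> X" using y X_\<pi>_pow[OF cX] X_props(4) by blast
    ultimately show ?thesis using c(2) cX unfolding translate_def by blast
  qed
  have "\<exists>Y. \<forall>i. (Y i \<in> X \<and> \<not> good (nbhd (Y i) i)) \<and> Y (Suc i) \<ominus> Y i \<in> translate R (\<pi> [^] i) X"
  proof (rule dependent_nat_choice)
    have "nbhd \<zero> 0 = X" unfolding nbhd_def translate_def using X_closed by (auto simp: minus_eq)
    then have "\<not> good (nbhd \<zero> 0)" using not unfolding good_def by simp
    then show "\<exists>y. y \<in> X \<and> \<not> good (nbhd y 0)" using X_props(3) by blast
  qed (rule step)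
  then obtain Y where Y: "\<And>i. Y i \<in> X" "\<And>i. \<not> good (nbhd (Y i) i)" "\<And>i. Y (Suc i) \<ominus> Y i \<in> translate R (\<pi> [^] i) X"
    by blast
  obtain y where y: "y \<in> X" "\<And>i. y \<ominus> Y i \<in> translate R (\<pi> [^] i) X" using X_props(9)[of Y] Y by blast
  note yc = X_closed[OF y(1)] and Yc = X_closed[OF Y(1)]
  have nb: "nbhd (Y i) i \<subseteq> nbhd y i" for i
  proof
    fix x assume x: "x \<in> nbhd (Y i) i"
    then have xc: "x \<in> carrier R" "x \<ominus> Y i \<in> translate R (\<pi> [^] i) X" using X_closed unfolding nbhd_def by auto
    have "x \<ominus> y = (x \<ominus> Y i) \<oplus> \<ominus> (y \<ominus> Y i)"
    proof -
      have "\<ominus> (y \<ominus> Y i) = Y i \<ominus> y" using yc Yc by (simp add: minus_eq minus_add a_comm)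
      then show ?thesis using xc(1) yc Yc by (simp add: minus_eq a_assoc r_neg1 r_neg2)
    qed
    then show "x \<in> nbhd y i" using x translate_diff_mem(1)[OF xc(2) translate_diff_mem(2)[OF y(2) y(2)]]
      unfolding nbhd_def by simp
  qed
  then have bad: "\<not> good (nbhd y i)" for i using Y(2) good_mono by blast
  show False
  proof (cases "y \<in> translate R \<pi> X")
    case True
    have "x \<in> translate R \<pi> X" if x: "x \<in> nbhd y 1" for x
    proof -
      have "x \<ominus> y \<in> translate R (\<pi> [^] (1::nat)) X" "x \<in> carrier R" using x X_closed unfolding nbhd_def by auto
      then have "(x \<ominus> y) \<oplus> y \<in> translate R (\<pi> [^] (1::nat)) X"
        using True \<pi>_closed by (intro translate_diff_mem(1)) auto
      moreover have "(x \<ominus> y) \<oplus> y = x" using yc \<open>x \<in> carrier R\<close> by (simp add: minus_eq a_assoc l_neg)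
      ultimately show ?thesis using \<pi>_closed by simp
    qed
    then have "good (nbhd y 1)" unfolding good_def by (intro exI[of _ "{}"]) auto
    then show False using bad by blast
  next
    case False
    have "\<zero> \<in> translate R \<pi> X" unfolding translate_def using X_props(3) \<pi>_closed by (intro image_eqI[of _ _ \<zero>]) auto
    then have yn: "y \<in> nonzero R" using False yc by (auto simp: nonzero_iff)
    let ?w = "y \<otimes> \<pi> [^] (N + 1)"
    have w: "?w \<in> nonzero R" using yn \<pi>_nonzero by (simp only: nonzero_mult nonzero_pow)
    note wi = nonzero_closed[OF nonzero_inv[OF w]] nonzero_closed[OF w]
    obtain i where i: "\<forall>z\<in>X. \<pi> [^] (i::nat) \<otimes> (inv ?w \<otimes> z) \<in> X" using X_bounded[OF wi(1)] by blast
    have "x \<in> translate R y T" if x: "x \<in> nbhd y i" for x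
    proof -
      obtain z where z: "z \<in> X" "x \<ominus> y = \<pi> [^] i \<otimes> z" using x unfolding nbhd_def translate_def by blast
      have xc: "x \<in> carrier R" using x X_closed unfolding nbhd_def by auto
      let ?v = "\<pi> [^] i \<otimes> (inv ?w \<otimes> z)"
      have vX: "?v \<in> X" using i z(1) by blast
      have "?w \<otimes> ?v = (?w \<otimes> inv ?w) \<otimes> (\<pi> [^] i \<otimes> z)" using wi \<pi>_closed X_closed[OF z(1)]
        by (metis (no_types, lifting) m_assoc m_lcomm m_closed nat_pow_closed)
      then have wv: "?w \<otimes> ?v = x \<ominus> y" using nonzero_r_inv[OF w] \<pi>_closed X_closed[OF z(1)] z(2) by simp
      have jv: "\<pi> [^] (N + 1) \<otimes> ?v \<in> J 1" using vX unfolding J_iff by blast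
      have "y \<otimes> (\<one> \<oplus> \<pi> [^] (N + 1) \<otimes> ?v) = y \<oplus> ?w \<otimes> ?v"
        using yc \<pi>_closed X_closed[OF vX] by (simp only: r_distr m_assoc m_closed nat_pow_closed one_closed r_one)
      also have "\<dots> = x" unfolding wv using yc xc by (simp add: minus_eq a_ac r_neg r_neg1 r_neg2)
      finally show ?thesis unfolding translate_def T_def using jv by blast
    qed
    then have "good (nbhd y i)" unfolding good_def using yn by (intro exI[of _ "{y}"]) auto
    then show False using bad by blast
  qed
qed

text \<open>As \<open>m - 1 = p\<close>, multiplication by \<open>m\<close> is the identity modulo the next step of the
  filtration. So \<open>x \<mapsto> x^m\<close> is bijective on the one-units, while it multiplies values by
  \<open>m > 1\<close>.\<close>

abbreviation "m \<equiv> Suc p"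

lemma T_powers: "powers R m T = T"
proof
  show "powers R m T \<subseteq> T" using T_pow unfolding powers_def by blast
  show "T \<subseteq> powers R m T"
  proof
    fix u assume "u \<in> T"
    then obtain a where a: "a \<in> J (0 + Suc 0)" "u = \<one> \<oplus> a" unfolding T_def by auto
    have "\<exists>w\<in>J (Suc 0). (\<one> \<oplus> w) [^] m = \<one> \<oplus> a"
    proof (rule J.one_unit_root[OF a(1)])
      fix i x assume "x \<in> J (0 + i)"
      then have x: "x \<in> J i" by simp
      have "[m] \<cdot> x \<ominus> x = \<pi> \<otimes> x"
        using J.J_carrier[OF x] \<pi>_mult by (simp add: minus_eq a_assoc r_neg)
      then show "\<exists>b\<in>J i. [m] \<cdot> b \<ominus> x \<in> J (Suc (0 + i))" using x \<pi>_J[OF x] by (intro bexI[of _ x]) auto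
    qed
    then obtain w where w: "w \<in> J (Suc 0)" "(\<one> \<oplus> w) [^] m = \<one> \<oplus> a" by blast
    have "\<one> \<oplus> w \<in> T" unfolding T_def using w(1) by simp
    moreover have "u = (\<one> \<oplus> w) [^] m" using w(2) a(2) by (rule_tac sym) simp
    ultimately show "u \<in> powers R m T" unfolding powers_def by blast
  qed
qed

lemma T_torsion_free: assumes "u \<in> T" "u [^] m = \<one>" shows "u = \<one>"
proof -
  obtain w where w: "w \<in> J (Suc 0)" "u = \<one> \<oplus> w" using assms(1) unfolding T_def by auto
  have "w = \<zero>"
  proof (rule J.one_unit_root_unique[OF w(1)])
    show "(\<one> \<oplus> w) [^] m = \<one>" using assms(2) w(2) by simp
    fix i b assume b: "b \<in> J i" "[m] \<cdot> b \<in> J (Suc i)"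
    note bc = J.J_carrier[OF b(1)]
    have "[m] \<cdot> b \<ominus> \<pi> \<otimes> b \<in> J (Suc i)" by (rule J.J_diff[OF b(2) \<pi>_J[OF b(1)]])
    moreover have "[m] \<cdot> b \<ominus> \<pi> \<otimes> b = b" using bc \<pi>_mult by (simp add: minus_eq a_ac r_neg r_neg1 r_neg2)
    ultimately show "b \<in> J (Suc i)" by simp
  qed
  then show ?thesis using w(2) by simp
qed

text \<open>The powers of \<open>\<pi>\<close> with exponents in \<open>E S\<close>, times one-units. They take the role of the
  elements with value in a given set.\<close>

definition graded :: "nat \<Rightarrow> int set \<Rightarrow> 'a set" where
  "graded E S = {e (int E * k) \<otimes> u |k u. k \<in> S \<and> u \<in> T}"

lemma gradedI: "k \<in> S \<Longrightarrow> u \<in> T \<Longrightarrow> e (int E * k) \<otimes> u \<in> graded E S"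
  unfolding graded_def by blast

lemma graded_nonzero: "graded E S \<subseteq> nonzero R"
  unfolding graded_def using nonzero_mult[OF e_nonzero T_inverse(1)] by blast

lemma graded_mult: assumes "x \<in> graded E S" "y \<in> graded E S'" "\<And>k l. k \<in> S \<Longrightarrow> l \<in> S' \<Longrightarrow> k + l \<in> S''"
  shows "x \<otimes> y \<in> graded E S''"
proof -
  obtain k u l v where *: "k \<in> S" "u \<in> T" "x = e (int E * k) \<otimes> u" "l \<in> S'" "v \<in> T" "y = e (int E * l) \<otimes> v"
    using assms(1,2) unfolding graded_def by blast
  have "x \<otimes> y = e (int E * (k + l)) \<otimes> (u \<otimes> v)"
    unfolding *(3,6) using e_closed T_closed[OF *(2)] T_closed[OF *(5)] by (simp add: distrib_left e_add m_ac)
  then show ?thesis using gradedI[OF assms(3)[OF *(1,4)] T_mult[OF *(2,5)]] by simp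
qed

lemma graded_inv: assumes "x \<in> graded E UNIV" shows "inv x \<in> graded E UNIV"
proof -
  obtain k u where *: "u \<in> T" "x = e (int E * k) \<otimes> u" using assms unfolding graded_def by blast
  have cl: "u \<in> carrier R" "inv u \<in> carrier R" using T_closed * T_inverse(2) by auto
  have "x \<otimes> (e (int E * - k) \<otimes> inv u) = (e (int E * k) \<otimes> e (int E * - k)) \<otimes> (u \<otimes> inv u)"
    unfolding *(2) using cl e_closed by (simp add: m_ac)
  also have "\<dots> = \<one>" using nonzero_r_inv[OF T_inverse(1)[OF *(1)]] e_add[of "int E * k" "int E * - k", symmetric] by simp
  finally have "inv x = e (int E * - k) \<otimes> inv u"
    unfolding *(2) using cl e_closed by (intro comm_inv_char) simp_all
  then show ?thesis using gradedI[OF UNIV_I T_inverse(2)[OF *(1)], of E "- k"] by simp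
qed

lemma graded_0: "graded E {0} = T"
proof -
  have "e (int E * 0) \<otimes> u = u" if "u \<in> T" for u using T_closed[OF that] by simp
  then show ?thesis unfolding graded_def by force
qed

lemma graded_Un: "graded E (S \<union> S') = graded E S \<union> graded E S'"
  unfolding graded_def by blast

lemma graded_UN: "graded E (\<Union>i\<in>I. S i) = (\<Union>i\<in>I. graded E (S i))"
  unfolding graded_def by blast

lemma graded_mono: "S \<subseteq> S' \<Longrightarrow> graded E S \<subseteq> graded E S'"
  unfolding graded_def by blast

lemma graded_mem_iff:
  assumes "E > 0" "u \<in> T" shows "e (int E * k) \<otimes> u \<in> graded E S \<longleftrightarrow> k \<in> S"
proof
  assume "e (int E * k) \<otimes> u \<in> graded E S"
  then obtain l v where *: "l \<in> S" "v \<in> T" "e (int E * k) \<otimes> u = e (int E * l) \<otimes> v" unfolding graded_def by blast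
  then have "int E * k = int E * l" using e_unique assms(2) by blast
  then show "k \<in> S" using *(1) assms(1) by simp
qed (rule gradedI[OF _ assms(2)])

lemma graded_disjoint:
  assumes "E > 0" "S \<inter> S' = {}" shows "graded E S \<inter> graded E S' = {}"
proof (rule ccontr)
  assume "graded E S \<inter> graded E S' \<noteq> {}"
  then obtain x where x: "x \<in> graded E S" "x \<in> graded E S'" by blast
  then obtain k u where "k \<in> S" "u \<in> T" "x = e (int E * k) \<otimes> u" unfolding graded_def by blast
  then show False using x(2) graded_mem_iff[OF assms(1)] assms(2) by blast
qed

lemma graded_translate: "translate R (e (int E * j)) (graded E S) = graded E ((\<lambda>k. j + k) ` S)"
proof -
  have "e (int E * j) \<otimes> (e (int E * k) \<otimes> u) = e (int E * (j + k)) \<otimes> u" if "u \<in> T" for k u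
    using e_closed T_closed[OF that] by (simp add: distrib_left e_add m_assoc)
  then show ?thesis unfolding translate_def graded_def by (fastforce simp: image_iff)
qed

text \<open>As all one-units are \<open>m\<close>-th powers of one-units, only the exponents of \<open>\<pi>\<close> are
  affected.\<close>

lemma graded_powers: "powers R m (graded E S) = graded E ((\<lambda>k. int m * k) ` S)"
proof -
  have pow: "(e (int E * k) \<otimes> u) [^] m = e (int E * (int m * k)) \<otimes> u [^] m" if "u \<in> T" for k u
  proof -
    have "(e (int E * k) \<otimes> u) [^] m = e (int E * k) [^] m \<otimes> u [^] m"
      using e_closed T_closed[OF that] by (rule nat_pow_distrib)
    then show ?thesis unfolding zpow_pow[OF \<pi>_nonzero] by (simp only: mult.left_commute)
  qed
  show ?thesis
  proof
    show "powers R m (graded E S) \<subseteq> graded E ((\<lambda>k. int m * k) ` S)"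
    proof
      fix x assume "x \<in> powers R m (graded E S)"
      then obtain k u where *: "k \<in> S" "u \<in> T" "x = (e (int E * k) \<otimes> u) [^] m" unfolding powers_def graded_def by blast
      show "x \<in> graded E ((\<lambda>k. int m * k) ` S)" unfolding *(3) pow[OF *(2)] by (rule gradedI[OF imageI[OF *(1)] T_pow[OF *(2)]])
    qed
    show "graded E ((\<lambda>k. int m * k) ` S) \<subseteq> powers R m (graded E S)"
    proof
      fix x assume "x \<in> graded E ((\<lambda>k. int m * k) ` S)"
      then obtain k v where *: "k \<in> S" "v \<in> T" "x = e (int E * (int m * k)) \<otimes> v" unfolding graded_def by blast
      then obtain u where u: "u \<in> T" "v = u [^] m" using T_powers unfolding powers_def by blast
      have "x = (e (int E * k) \<otimes> u) [^] m" unfolding *(3) u(2) pow[OF u(1)] ..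
      then show "x \<in> powers R m (graded E S)" unfolding powers_def using gradedI[OF *(1) u(1)] by blast
    qed
  qed
qed

lemma graded_partition:
  assumes E: "E > 0" and S1: "\<And>k i. k \<in> S \<Longrightarrow> i < m \<Longrightarrow> int m * k - int i \<in> S"
    and S2: "\<And>k. k \<in> S \<Longrightarrow> \<exists>k'\<in>S. \<exists>i<m. k = int m * k' - int i"
  shows "power_partition R m m (graded E S)"
proof -
  let ?Z = "\<lambda>j. (\<lambda>k. - int j + k) ` (\<lambda>k. int m * k) ` S"
  have tr: "translate R (e (int E * - int j)) (powers R m (graded E S)) = graded E (?Z j)" for j
    unfolding graded_powers by (rule graded_translate)
  have "S = (\<Union>j<m. ?Z j)"
  proof
    show "(\<Union>j<m. ?Z j) \<subseteq> S" using S1 by (auto simp: algebra_simps)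
    show "S \<subseteq> (\<Union>j<m. ?Z j)"
    proof
      fix k assume "k \<in> S"
      then obtain k' i where *: "k' \<in> S" "i < m" "k = int m * k' - int i" using S2 by blast
      then have "k = - int i + int m * k'" by simp
      then show "k \<in> (\<Union>j<m. ?Z j)" using *(1,2) by blast
    qed
  qed
  then have "graded E S = (\<Union>j<m. graded E (?Z j))" using graded_UN[of E ?Z "{..<m}"] by simp
  moreover have "graded E (?Z i) \<inter> graded E (?Z j) = {}" if ij: "i < m" "j < m" "i \<noteq> j" for i j
  proof (rule graded_disjoint[OF E])
    have "- int i + int m * k \<noteq> - int j + int m * l" for k l
      using ceiling_multiple_unique[OF ij(1,2), of k l] ij(3) by auto
    then show "?Z i \<inter> ?Z j = {}" by blast
  qed
  ultimately show ?thesis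
    unfolding power_partition_def using e_nonzero tr by (intro exI[of _ "\<lambda>j. e (int E * - int j)"]) simp
qed

text \<open>Multiplied by a suitable power of \<open>\<pi>\<close>, a nonzero element lies in \<open>X\<close> but not in \<open>\<pi> X\<close>,
  and such elements are in finitely many cosets of \<open>T\<close>.\<close>

lemma nonzero_covered:
  "\<exists>B\<subseteq>nonzero R. finite B \<and> (\<forall>x\<in>nonzero R. \<exists>y\<in>B. x \<in> translate R y (graded 1 UNIV))"
proof -
  obtain B where B: "B \<subseteq> nonzero R" "finite B" "\<forall>x\<in>X. x \<in> translate R \<pi> X \<or> (\<exists>y\<in>B. x \<in> translate R y T)"
    using lattice_covered by blast
  have "\<exists>y\<in>B. x \<in> translate R y (graded 1 UNIV)" if x: "x \<in> nonzero R" for x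
  proof -
    note xc = nonzero_closed[OF x]
    obtain n where n: "\<pi> [^] (n::nat) \<otimes> x \<in> X" using X_props(6)[OF xc] by blast
    let ?x = "\<pi> [^] n \<otimes> x"
    have xn: "?x \<in> nonzero R" using nonzero_mult[OF nonzero_pow[OF \<pi>_nonzero] x] .
    have ex: "\<exists>i. ?x \<notin> translate R (\<pi> [^] (i::nat)) X"
      using X_props(7)[of ?x] xn unfolding nonzero_iff by blast
    define i where "i = (LEAST i. ?x \<notin> translate R (\<pi> [^] (i::nat)) X)"
    have i: "?x \<notin> translate R (\<pi> [^] i) X" unfolding i_def using ex by (rule LeastI_ex)
    have "?x \<in> translate R (\<pi> [^] (0::nat)) X" unfolding translate_def using n X_closed[OF n] by (intro image_eqI[of _ _ ?x]) auto
    then have "i \<noteq> 0" using i by metis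
    then obtain j where j: "i = Suc j" using not0_implies_Suc by blast
    then have "?x \<in> translate R (\<pi> [^] j) X"
      using not_less_Least[of j "\<lambda>i. ?x \<notin> translate R (\<pi> [^] i) X"] unfolding i_def[symmetric] by simp
    then obtain z where z: "z \<in> X" "?x = \<pi> [^] j \<otimes> z" unfolding translate_def by blast
    have "z \<notin> translate R \<pi> X"
    proof
      assume "z \<in> translate R \<pi> X"
      then obtain w where w: "w \<in> X" "z = \<pi> \<otimes> w" unfolding translate_def by blast
      then have "?x = \<pi> [^] i \<otimes> w" unfolding z(2) j using \<pi>_closed X_closed[OF w(1)] by (simp add: m_assoc)
      then show False using i w(1) unfolding translate_def by blast
    qed
    then obtain y u where y: "y \<in> B" "u \<in> T" "z = y \<otimes> u" using B(3) z(1) unfolding translate_def by blast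
    have yc: "y \<in> carrier R" using y(1) B(1) nonzero_closed by blast
    have "e (- int n) \<otimes> ?x = (e (- int n) \<otimes> e (int n)) \<otimes> x"
      unfolding zpow_nat using \<pi>_closed xc e_closed by (simp add: m_assoc)
    also have "\<dots> = x" unfolding e_add[symmetric] using xc by simp
    finally have "x = e (- int n) \<otimes> (e (int j) \<otimes> (y \<otimes> u))" unfolding z(2) y(3) zpow_nat by simp
    also have "\<dots> = y \<otimes> ((e (- int n) \<otimes> e (int j)) \<otimes> u)"
      using yc T_closed[OF y(2)] e_closed by (simp add: m_ac)
    also have "e (- int n) \<otimes> e (int j) = e (int 1 * (- int n + int j))"
      by (simp only: of_nat_1 mult_1 e_add)
    finally show ?thesis using y(1) gradedI[OF UNIV_I y(2), of 1 "- int n + int j"] unfolding translate_def by blast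
  qed
  then show ?thesis using B(1,2) by blast
qed

lemma normalising_exponent:
  assumes E: "E > 0" and x: "x \<in> nonzero R"
  shows "\<exists>k. \<forall>l. e (int E * l) \<otimes> x \<in> J 1 \<longleftrightarrow> k < l"
proof -
  note xc = nonzero_closed[OF x]
  have up: "e (int E * l') \<otimes> x \<in> J 1" if l: "e (int E * l) \<otimes> x \<in> J 1" "l \<le> l'" for l l'
  proof -
    let ?n = "nat (int E * (l' - l))"
    have "0 \<le> int E * (l' - l)" using l(2) by simp
    then have "int E * l' = int ?n + int E * l" by (simp only: nat_0_le right_diff_distrib diff_add_cancel)
    then have "e (int E * l') \<otimes> x = \<pi> [^] ?n \<otimes> (e (int E * l) \<otimes> x)"
      using xc e_closed \<pi>_closed by (simp only: e_add zpow_nat m_assoc nat_pow_closed)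
    moreover have "\<pi> [^] ?n \<otimes> (e (int E * l) \<otimes> x) \<in> J 1"
      using \<pi>_pow_J[OF l(1), of ?n] J.J_antimono[of 1 "?n + 1"] by auto
    ultimately show ?thesis by simp
  qed
  obtain n where n: "\<pi> [^] (n::nat) \<otimes> x \<in> J 1" using absorb[OF xc] by blast
  have "e (int E * int n) \<otimes> x \<in> J 1"
  proof -
    have "E * n = (E - 1) * n + n" using E by (cases E) auto
    then have "int E * int n = int ((E - 1) * n + n)" by (metis of_nat_mult)
    then have "e (int E * int n) \<otimes> x = \<pi> [^] ((E - 1) * n) \<otimes> (\<pi> [^] n \<otimes> x)"
      using xc \<pi>_closed by (simp only: zpow_nat nat_pow_mult[symmetric] m_assoc nat_pow_closed)
    then show ?thesis using \<pi>_pow_J[OF n, of "(E - 1) * n"] J.J_antimono[of 1 "(E - 1) * n + 1"] by auto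
  qed
  moreover have "\<exists>l. e (int E * l) \<otimes> x \<notin> J 1"
  proof (rule ccontr)
    assume "\<not> (\<exists>l. e (int E * l) \<otimes> x \<notin> J 1)"
    then have all: "e (int E * l) \<otimes> x \<in> J 1" for l by blast
    have "x \<in> J i" for i
    proof -
      have "x = (e (int (E * i)) \<otimes> e (int E * - int i)) \<otimes> x"
        unfolding e_add[symmetric] using xc by simp
      then have "x = \<pi> [^] (E * i) \<otimes> (e (int E * - int i) \<otimes> x)"
        using xc e_closed \<pi>_closed by (simp only: zpow_nat m_assoc nat_pow_closed)
      moreover have "\<pi> [^] (E * i) \<otimes> (e (int E * - int i) \<otimes> x) \<in> J (E * i + 1)" by (rule \<pi>_pow_J[OF all])
      moreover have "i \<le> E * i + 1" using E by (cases E) auto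
      ultimately show ?thesis using J.J_antimono by (metis subsetD)
    qed
    then show False using J.J_separated x unfolding nonzero_iff by blast
  qed
  then obtain l0 where l0: "e (int E * l0) \<otimes> x \<notin> J 1" by blast
  ultimately have lt: "l0 < int n" using up[of "int n" l0] by (meson not_le)
  have ex: "\<exists>d. e (int E * (l0 + int d)) \<otimes> x \<in> J 1"
  proof
    show "e (int E * (l0 + int (nat (int n - l0)))) \<otimes> x \<in> J 1"
      using \<open>e (int E * int n) \<otimes> x \<in> J 1\<close> lt by simp
  qed
  define d where "d = (LEAST d. e (int E * (l0 + int d)) \<otimes> x \<in> J 1)"
  have d: "e (int E * (l0 + int d)) \<otimes> x \<in> J 1" unfolding d_def using ex by (rule LeastI_ex)
  have "d \<noteq> 0" using d l0 by (intro notI) simp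
  then obtain d' where d': "d = Suc d'" using not0_implies_Suc by blast
  have nd: "e (int E * (l0 + int d')) \<otimes> x \<notin> J 1"
    using not_less_Least[of d' "\<lambda>d. e (int E * (l0 + int d)) \<otimes> x \<in> J 1"] d' unfolding d_def[symmetric] by simp
  have "e (int E * l) \<otimes> x \<in> J 1 \<longleftrightarrow> l0 + int d' < l" for l
  proof
    assume "e (int E * l) \<otimes> x \<in> J 1"
    then show "l0 + int d' < l" using nd up[of l "l0 + int d'"] by (meson not_le)
  next
    assume "l0 + int d' < l"
    then have "l0 + int d \<le> l" using d' by simp
    then show "e (int E * l) \<otimes> x \<in> J 1" by (rule up[OF d])
  qed
  then show ?thesis by blast
qed

text \<open>The powers of \<open>\<pi>\<close> with exponents below \<open>E\<close> represent the cosets of \<open>graded E UNIV\<close> in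
  \<open>graded 1 UNIV\<close>, which itself has finite index; so the number of cosets is divisible by
  \<open>E\<close>. Representatives can be multiplied by powers of \<open>\<pi> ^ E\<close>, which shifts the threshold
  from which on the translated powers fall into \<open>J 1\<close>; it is moved to \<open>0\<close>.\<close>

lemma coset_representatives_graded:
  assumes E: "E > 0"
  shows "\<exists>c g. E dvd c \<and> (\<forall>i<c. g i \<in> nonzero R) \<and> (\<forall>x\<in>nonzero R. \<exists>i<c. x \<in> translate R (g i) (graded E UNIV)) \<and>
    (\<forall>i<c. \<forall>j<c. i \<noteq> j \<longrightarrow> translate R (g i) (graded E UNIV) \<inter> translate R (g j) (graded E UNIV) = {}) \<and>
    (\<forall>i<c. \<forall>l. e (int E * l) \<otimes> g i \<in> J 1 \<longleftrightarrow> 0 < l)"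
proof -
  let ?H = "graded 1 UNIV" and ?A = "graded E UNIV"
  obtain B where B: "B \<subseteq> nonzero R" "finite B" "\<forall>x\<in>nonzero R. \<exists>y\<in>B. x \<in> translate R y ?H"
    using nonzero_covered by blast
  have one: "\<one> \<in> graded E' UNIV" for E'
    using gradedI[OF UNIV_I T_one, of E' 0] by simp
  have "\<exists>(c::nat) y. (\<forall>i<c. y i \<in> nonzero R) \<and> (\<forall>x\<in>nonzero R. \<exists>i<c. x \<in> translate R (y i) ?H) \<and>
    (\<forall>i<c. \<forall>j<c. i \<noteq> j \<longrightarrow> translate R (y i) ?H \<inter> translate R (y j) ?H = {})"
    by (rule coset_representatives[OF graded_nonzero one _ graded_inv B(2,1)]) (use B(3) graded_mult in blast)+
  then obtain c' y where y: "\<And>i. i < c' \<Longrightarrow> y i \<in> nonzero R"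
    "\<And>x. x \<in> nonzero R \<Longrightarrow> \<exists>i<c'. x \<in> translate R (y i) ?H"
    "\<And>i j. i < (c'::nat) \<Longrightarrow> j < c' \<Longrightarrow> i \<noteq> j \<Longrightarrow> translate R (y i) ?H \<inter> translate R (y j) ?H = {}" by metis
  define c where "c = c' * E"
  have idx: "i div E < c'" "i mod E < E" if "i < c" for i
    using that E by (simp_all add: c_def less_mult_imp_div_less)
  define h where "h i = e (int (i mod E)) \<otimes> y (i div E)" for i
  have h: "h i \<in> nonzero R" if "i < c" for i unfolding h_def by (rule nonzero_mult[OF e_nonzero y(1)[OF idx(1)[OF that]]])
  have "\<exists>k. \<forall>l. e (int E * l) \<otimes> h i \<in> J 1 \<longleftrightarrow> k < l" if "i < c" for i
    by (rule normalising_exponent[OF E h[OF that]])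
  then obtain \<kappa> where \<kappa>: "\<And>i l. i < c \<Longrightarrow> e (int E * l) \<otimes> h i \<in> J 1 \<longleftrightarrow> \<kappa> i < l" by metis
  define g where "g i = e (int E * \<kappa> i) \<otimes> h i" for i
  have g: "g i \<in> nonzero R" if "i < c" for i unfolding g_def by (rule nonzero_mult[OF e_nonzero h[OF that]])
  have g_form: "g i \<otimes> (e (int E * k) \<otimes> u) = y (i div E) \<otimes> (e (int (i mod E) + int E * (\<kappa> i + k)) \<otimes> u)"
    if "i < c" "u \<in> T" for i k u
    unfolding g_def h_def distrib_left e_add
    using e_closed nonzero_closed[OF y(1)[OF idx(1)[OF that(1)]]] T_closed[OF that(2)] by (simp add: m_ac)
  have "\<exists>i<c. x \<in> translate R (g i) ?A" if x: "x \<in> nonzero R" for x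
  proof -
    obtain i k u where *: "i < c'" "u \<in> T" "x = y i \<otimes> (e (int 1 * k) \<otimes> u)"
      using y(2)[OF x] unfolding translate_def graded_def by blast
    let ?r = "nat (k mod int E)"
    have r: "?r < E" "int ?r = k mod int E" using E by (simp_all add: nat_less_iff)
    let ?i = "i * E + ?r"
    have i: "?i div E = i" "?i mod E = ?r" using r(1) by auto
    have "?i < Suc i * E" using r(1) by simp
    also have "\<dots> \<le> c" unfolding c_def using *(1) by (intro mult_le_mono1) simp
    finally have ic: "?i < c" .
    let ?l = "k div int E - \<kappa> ?i"
    have "g ?i \<otimes> (e (int E * ?l) \<otimes> u) = y i \<otimes> (e (int ?r + int E * (k div int E)) \<otimes> u)"
      unfolding g_form[OF ic *(2)] i by simp
    also have "int ?r + int E * (k div int E) = int 1 * k" unfolding r(2) by simp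
    finally have "x = g ?i \<otimes> (e (int E * ?l) \<otimes> u)" using *(3) by simp
    then show ?thesis using ic gradedI[OF UNIV_I *(2)] unfolding translate_def by blast
  qed
  moreover have "translate R (g i) ?A \<inter> translate R (g j) ?A = {}" if ij: "i < c" "j < c" "i \<noteq> j" for i j
  proof (rule ccontr)
    assume "translate R (g i) ?A \<inter> translate R (g j) ?A \<noteq> {}"
    then obtain k u l v where *: "u \<in> T" "v \<in> T" "g i \<otimes> (e (int E * k) \<otimes> u) = g j \<otimes> (e (int E * l) \<otimes> v)"
      unfolding translate_def graded_def by blast
    let ?a = "int (i mod E) + int E * (\<kappa> i + k)" and ?b = "int (j mod E) + int E * (\<kappa> j + l)"
    have eq: "y (i div E) \<otimes> (e ?a \<otimes> u) = y (j div E) \<otimes> (e ?b \<otimes> v)"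
      using *(3) unfolding g_form[OF ij(1) *(1)] g_form[OF ij(2) *(2)] .
    have "e ?a \<otimes> u \<in> ?H" "e ?b \<otimes> v \<in> ?H"
      using gradedI[OF UNIV_I *(1), of 1 ?a] gradedI[OF UNIV_I *(2), of 1 ?b] by simp_all
    then have "translate R (y (i div E)) ?H \<inter> translate R (y (j div E)) ?H \<noteq> {}"
      using eq unfolding translate_def by blast
    then have d: "i div E = j div E" using y(3) idx(1)[OF ij(1)] idx(1)[OF ij(2)] by blast
    have "e ?a \<otimes> u = e ?b \<otimes> v"
      using eq nonzero_cancel[OF y(1)[OF idx(1)[OF ij(2)]]] e_closed T_closed[OF *(1)] T_closed[OF *(2)] unfolding d by simp
    then have "?a = ?b" using e_unique *(1,2) by blast
    then have "?a mod int E = ?b mod int E" by simp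
    then have "int (i mod E) mod int E = int (j mod E) mod int E" by simp
    then have "i mod E = j mod E" using E by simp
    then show False using d ij(3) by (metis div_mult_mod_eq)
  qed
  moreover have "e (int E * l) \<otimes> g i \<in> J 1 \<longleftrightarrow> 0 < l" if i: "i < c" for i l
  proof -
    have "e (int E * l) \<otimes> g i = e (int E * (l + \<kappa> i)) \<otimes> h i"
      unfolding g_def distrib_left e_add using e_closed nonzero_closed[OF h[OF i]] by (simp add: m_assoc)
    then show ?thesis using \<kappa>[OF i, of "l + \<kappa> i"] by simp
  qed
  moreover have "E dvd c" by (simp add: c_def)
  ultimately show ?thesis using g by (intro exI[of _ c] exI[of _ g]) blast
qed

text \<open>Division by \<open>M\<close> loses a bounded number of steps of the filtration, which Newton
  iteration tolerates for one-units that are close enough to \<open>1\<close>.\<close>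

lemma one_units_powers:
  assumes M: "(M::nat) > 0"
  shows "\<exists>f. \<forall>a\<in>J (Suc f). \<exists>y\<in>nonzero R. y [^] M = \<one> \<oplus> a"
proof -
  let ?M = "[M] \<cdot> \<one>"
  have Mn: "?M \<in> nonzero R" using char M by (simp add: char_zero_def nonzero_def)
  note iM = nonzero_closed[OF nonzero_inv[OF Mn]]
  obtain f where f: "\<forall>y\<in>X. \<pi> [^] (f::nat) \<otimes> (inv ?M \<otimes> y) \<in> X" using X_bounded[OF iM] by blast
  have "\<exists>y\<in>nonzero R. y [^] M = \<one> \<oplus> a" if a: "a \<in> J (Suc (f + f))" for a
  proof -
    have "\<exists>w\<in>J (Suc f). (\<one> \<oplus> w) [^] M = \<one> \<oplus> a"
    proof (rule J.one_unit_root)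
      show "a \<in> J (f + Suc f)" using a by simp
      fix i x assume "x \<in> J (f + i)"
      then obtain z where z: "z \<in> X" "x = \<pi> [^] (N + (f + i)) \<otimes> z" unfolding J_iff by blast
      have zc: "z \<in> carrier R" using X_closed[OF z(1)] .
      let ?b = "\<pi> [^] (N + i) \<otimes> (\<pi> [^] f \<otimes> (inv ?M \<otimes> z))"
      have b: "?b \<in> J i" unfolding J_iff using f z(1) by blast
      have "[M] \<cdot> ?b = ?M \<otimes> ?b" using J.J_carrier[OF b] add_pow_ldistr[of \<one> ?b M] by simp
      also have "\<dots> = (?M \<otimes> inv ?M) \<otimes> x"
        unfolding z(2) using nonzero_closed[OF Mn] iM zc \<pi>_closed by (simp add: nat_pow_mult[symmetric] m_ac)
      also have "\<dots> = x" using nonzero_r_inv[OF Mn] z(2) zc \<pi>_closed by simp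
      finally have "[M] \<cdot> ?b \<ominus> x = \<zero>" using z(2) zc \<pi>_closed by (simp add: minus_eq r_neg)
      then show "\<exists>b\<in>J i. [M] \<cdot> b \<ominus> x \<in> J (Suc (f + i))" using b J.J_zero by (intro bexI[of _ ?b]) auto
    qed
    then obtain w where w: "w \<in> J (Suc f)" "(\<one> \<oplus> w) [^] M = \<one> \<oplus> a" by blast
    have "\<one> \<oplus> w \<in> T" unfolding T_def using w(1) J.J_antimono[of 1 "Suc f"] by auto
    then show ?thesis using w(2) T_inverse(1) by blast
  qed
  then show ?thesis by blast
qed

lemma J_covered: "\<exists>C\<subseteq>J 1. finite C \<and> (\<forall>x\<in>J 1. \<exists>c\<in>C. x \<ominus> c \<in> J (Suc i))"
proof (induction i)
  case 0
  show ?case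
  proof (intro exI[of _ "{\<zero>}"] conjI ballI)
    fix x assume "x \<in> J 1"
    then show "\<exists>c\<in>{\<zero>}. x \<ominus> c \<in> J (Suc 0)" using J.J_carrier by (simp add: minus_eq)
  qed (use J.J_zero in auto)
next
  case (Suc i)
  then obtain C where C: "C \<subseteq> J 1" "finite C" "\<forall>x\<in>J 1. \<exists>c\<in>C. x \<ominus> c \<in> J (Suc i)" by blast
  obtain D where D: "D \<subseteq> X" "finite D" "\<forall>x\<in>X. \<exists>c\<in>D. x \<ominus> c \<in> translate R \<pi> X" using X_props(8) by blast
  let ?f = "\<lambda>(c, d). c \<oplus> \<pi> [^] (N + Suc i) \<otimes> d"
  show ?case
  proof (intro exI[of _ "?f ` (C \<times> D)"] conjI ballI)
    show "?f ` (C \<times> D) \<subseteq> J 1"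
    proof
      fix x assume "x \<in> ?f ` (C \<times> D)"
      then obtain c d where *: "c \<in> C" "d \<in> D" "x = c \<oplus> \<pi> [^] (N + Suc i) \<otimes> d" by auto
      have "\<pi> [^] (N + Suc i) \<otimes> d \<in> J (Suc i)" unfolding J_iff using * D(1) by blast
      then have "\<pi> [^] (N + Suc i) \<otimes> d \<in> J 1" using J.J_antimono[of 1 "Suc i"] by auto
      then show "x \<in> J 1" unfolding *(3) using * C(1) by (intro J.J_add) auto
    qed
    fix x assume x: "x \<in> J 1"
    then obtain c where c: "c \<in> C" "x \<ominus> c \<in> J (Suc i)" using C(3) by blast
    then obtain z where z: "z \<in> X" "x \<ominus> c = \<pi> [^] (N + Suc i) \<otimes> z" unfolding J_iff by blast
    obtain d where d: "d \<in> D" "z \<ominus> d \<in> translate R \<pi> X" using D(3) z(1) by blast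
    then obtain w where w: "w \<in> X" "z \<ominus> d = \<pi> \<otimes> w" unfolding translate_def by blast
    have cl: "x \<in> carrier R" "c \<in> carrier R" "z \<in> carrier R" "d \<in> carrier R" "w \<in> carrier R"
      using x c(1) C(1) J.J_carrier z(1) d(1) D(1) w(1) X_closed by blast+
    define P where "P = \<pi> [^] (N + Suc i)"
    have P: "P \<in> carrier R" unfolding P_def using \<pi>_closed by simp
    have "x \<ominus> (c \<oplus> P \<otimes> d) = (x \<ominus> c) \<ominus> P \<otimes> d"
      using cl P by (simp add: minus_eq minus_add a_ac)
    also have "\<dots> = P \<otimes> (z \<ominus> d)"
      unfolding z(2) P_def[symmetric] using cl P by (simp add: minus_eq r_distr r_minus)
    also have "\<dots> = \<pi> [^] (N + Suc (Suc i)) \<otimes> w" unfolding w(2) P_def using cl \<pi>_closed by (simp add: m_ac)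
    finally have "x \<ominus> (c \<oplus> \<pi> [^] (N + Suc i) \<otimes> d) \<in> J (Suc (Suc i))" unfolding J_iff P_def using w(1) by blast
    then show "\<exists>c\<in>?f ` (C \<times> D). x \<ominus> c \<in> J (Suc (Suc i))" using c(1) d(1) by force
  qed (use C D in auto)
qed

text \<open>Modulo \<open>M\<close>-th powers, exponents of \<open>\<pi> ^ E\<close> matter only modulo \<open>M\<close>, and one-units only
  up to the neighbourhood of \<open>1\<close> that consists of \<open>M\<close>-th powers; both leave finitely many
  possibilities.\<close>

lemma graded_powers_cover:
  assumes E: "E > 0" and M: "(M::nat) > 0" and powM: "\<And>y. y \<in> nonzero R \<Longrightarrow> y [^] M \<in> graded E UNIV"
  shows "\<exists>C\<subseteq>nonzero R. finite C \<and> graded E UNIV = (\<Union>a\<in>C. translate R a (powers R M (nonzero R)))"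
proof -
  obtain f where f: "\<forall>a\<in>J (Suc f). \<exists>y\<in>nonzero R. y [^] M = \<one> \<oplus> a" using one_units_powers[OF M] by blast
  obtain C where C: "C \<subseteq> J 1" "finite C" "\<forall>x\<in>J 1. \<exists>c\<in>C. x \<ominus> c \<in> J (Suc f)" using J_covered by blast
  let ?a = "\<lambda>(r, c). e (int E * int r) \<otimes> (\<one> \<oplus> c)"
  let ?C = "?a ` ({..<M} \<times> C)"
  have CA: "?C \<subseteq> graded E UNIV"
  proof
    fix x assume "x \<in> ?C"
    then obtain r c where "c \<in> C" "x = e (int E * int r) \<otimes> (\<one> \<oplus> c)" by auto
    then show "x \<in> graded E UNIV" using C(1) unfolding graded_def T_def by blast
  qed
  have "graded E UNIV = (\<Union>a\<in>?C. translate R a (powers R M (nonzero R)))"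
  proof
    show "(\<Union>a\<in>?C. translate R a (powers R M (nonzero R))) \<subseteq> graded E UNIV"
    proof
      fix x assume "x \<in> (\<Union>a\<in>?C. translate R a (powers R M (nonzero R)))"
      then obtain a y where *: "a \<in> ?C" "y \<in> nonzero R" "x = a \<otimes> y [^] M" unfolding translate_def powers_def by blast
      have "a \<in> graded E UNIV" using *(1) CA by blast
      then show "x \<in> graded E UNIV" unfolding *(3) using powM[OF *(2)] graded_mult by blast
    qed
    show "graded E UNIV \<subseteq> (\<Union>a\<in>?C. translate R a (powers R M (nonzero R)))"
    proof
      fix x assume "x \<in> graded E UNIV"
      then obtain k u where ku: "u \<in> T" "x = e (int E * k) \<otimes> u" unfolding graded_def by blast
      obtain v where v: "v \<in> J 1" "u = \<one> \<oplus> v" using ku(1) unfolding T_def by blast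
      obtain c where c: "c \<in> C" "v \<ominus> c \<in> J (Suc f)" using C(3) v(1) by blast
      have cT: "\<one> \<oplus> c \<in> T" unfolding T_def using c(1) C(1) by blast
      note cn = T_inverse[OF cT]
      have cl: "v \<in> carrier R" "c \<in> carrier R" "inv (\<one> \<oplus> c) \<in> carrier R"
        using J.J_carrier v(1) c(1) C(1) T_closed[OF cn(2)] by blast+
      let ?j = "inv (\<one> \<oplus> c) \<otimes> (v \<ominus> c)"
      have j: "?j \<in> J (Suc f)" by (rule T_J[OF cn(2) c(2)])
      have "(\<one> \<oplus> c) \<otimes> (\<one> \<oplus> ?j) = (\<one> \<oplus> c) \<oplus> ((\<one> \<oplus> c) \<otimes> inv (\<one> \<oplus> c)) \<otimes> (v \<ominus> c)"
        using cl by (simp only: r_distr m_assoc m_closed one_closed r_one minus_closed a_closed)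
      also have "\<dots> = \<one> \<oplus> (c \<oplus> (v \<ominus> c))"
        unfolding nonzero_r_inv[OF cn(1)] using cl by (simp add: a_assoc)
      also have "c \<oplus> (v \<ominus> c) = v" using cl by (simp add: minus_eq a_comm[of v] r_neg2)
      also have "\<one> \<oplus> v = u" using v(2) ..
      finally have u: "u = (\<one> \<oplus> c) \<otimes> (\<one> \<oplus> ?j)" ..
      obtain y where y: "y \<in> nonzero R" "y [^] M = \<one> \<oplus> ?j" using f j by blast
      let ?r = "nat (k mod int M)" and ?l = "k div int M"
      have r: "?r < M" "int ?r = k mod int M" using M by (simp_all add: nat_less_iff)
      let ?z = "e (int E * ?l) \<otimes> y"
      have z: "?z \<in> nonzero R" by (rule nonzero_mult[OF e_nonzero y(1)])
      have "?z [^] M = e (int E * ?l) [^] M \<otimes> y [^] M"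
        using e_closed nonzero_closed[OF y(1)] by (rule nat_pow_distrib)
      then have zM: "?z [^] M = e (int M * (int E * ?l)) \<otimes> (\<one> \<oplus> ?j)" unfolding zpow_pow[OF \<pi>_nonzero] y(2) .
      have "int E * int ?r + int M * (int E * ?l) = int E * (k mod int M + int M * ?l)"
        unfolding r(2) by (simp only: distrib_left mult.left_commute)
      then have k: "int E * k = int E * int ?r + int M * (int E * ?l)" by simp
      have "x = (e (int E * int ?r) \<otimes> (\<one> \<oplus> c)) \<otimes> ?z [^] M"
        unfolding ku(2) zM k e_add using e_closed T_closed[OF cT] J.J_carrier[OF j] by (subst u) (simp add: m_ac)
      then show "x \<in> (\<Union>a\<in>?C. translate R a (powers R M (nonzero R)))"
        using r(1) c(1) z unfolding translate_def powers_def by force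
    qed
  qed
  moreover have "?C \<subseteq> nonzero R" using CA graded_nonzero by blast
  moreover have "finite ?C" using C(2) by simp
  ultimately show ?thesis by blast
qed

text \<open>With \<open>v(\<pi>) = 1\<close>, the group \<open>A\<close> has value group \<open>E \<int>\<close> and \<open>s = \<pi> ^ E\<close>. Taking \<open>E\<close>
  divisible by all \<open>m ^ Suc k - 1\<close> with \<open>k < r0\<close> makes \<open>c\<close> divisible by them. The element
  \<open>q = \<pi> ^ a\<close> has \<open>a\<close> large enough that \<open>1 + q u\<close> is a one-unit for one-units \<open>u\<close>, and small
  compared to \<open>E\<close>: then \<open>q x^m\<close> stays inside \<open>J 1\<close> for \<open>x\<close> of value at least \<open>0\<close>, its
  inverse is inside \<open>J 1\<close> for \<open>x\<close> of negative value, that is of value at most \<open>- E\<close>, and \<open>q\<close>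
  is not an \<open>m\<close>-th power times a one-unit.\<close>

theorem tame_field_lattice:
  "\<exists>A D s q g b c M. tame_field R A D s q g b c 1 m M \<and> (\<forall>k<r0. m ^ Suc k - 1 dvd c)"
proof -
  obtain a0 where a0: "\<pi> [^] (a0::nat) \<otimes> \<one> \<in> J 1" using absorb[OF one_closed] by blast
  define a where "a = Suc a0"
  have a: "\<pi> [^] a \<in> J 1"
    using \<pi>_J[OF a0] \<pi>_closed J.J_antimono[of 1 "Suc 1"] unfolding a_def by (auto simp: m_comm)
  define P where "P = (\<Prod>k<r0. m ^ Suc k - 1)"
  \<comment> \<open>The factor \<open>2 * a\<close> leaves room for \<open>m E - a \<ge> a\<close>, needed for negative values.\<close>
  define E where "E = 2 * a * P"
  have "m ^ Suc k - 1 > 0" for k using p_pos one_less_power[of m "Suc k"] by simp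
  then have P: "P > 0" unfolding P_def by (intro prod_pos) blast
  have a_pos: "0 < a" by (simp add: a_def)
  have "2 * a * 1 \<le> E" unfolding E_def using P by (intro mult_le_mono2) simp
  then have aE: "2 * a \<le> E" and E: "E > 0" using a_pos by simp_all
  then have aE': "0 < a" "a < m * E" using a_pos by simp_all
  obtain c g where cg: "E dvd c" "\<And>i. i < c \<Longrightarrow> g i \<in> nonzero R"
    "\<And>x. x \<in> nonzero R \<Longrightarrow> \<exists>i<c. x \<in> translate R (g i) (graded E UNIV)"
    "\<And>i j. i < c \<Longrightarrow> j < c \<Longrightarrow> i \<noteq> j \<Longrightarrow> translate R (g i) (graded E UNIV) \<inter> translate R (g j) (graded E UNIV) = {}"
    "\<And>i l. i < c \<Longrightarrow> e (int E * l) \<otimes> g i \<in> J 1 \<longleftrightarrow> 0 < l"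
    using coset_representatives_graded[OF E] by metis
  let ?A = "graded E UNIV" and ?D = "graded E {0<..}" and ?s = "e (int E)" and ?q = "\<pi> [^] a"
  have s: "?s = e (int E * 1)" by simp
  have one: "\<one> \<in> ?A" using gradedI[OF UNIV_I T_one, of E 0] by simp
  have A_mult: "x \<otimes> y \<in> ?A" if "x \<in> ?A" "y \<in> ?A" for x y by (rule graded_mult[OF that]) simp
  have ball: "ball R ?D g c = J 1"
  proof
    have "g i \<otimes> (e (int E * k) \<otimes> u) \<in> J 1" if "i < c" "k > 0" "u \<in> T" for i k u
    proof -
      have "g i \<otimes> (e (int E * k) \<otimes> u) = u \<otimes> (e (int E * k) \<otimes> g i)"
        using nonzero_closed[OF cg(2)[OF that(1)]] e_closed T_closed[OF that(3)] by (simp add: m_ac)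
      then show ?thesis using T_J[OF that(3)] cg(5)[OF that(1)] that(2) by simp
    qed
    then show "ball R ?D g c \<subseteq> J 1" using J.J_zero unfolding ball_def translate_def graded_def by auto
    show "J 1 \<subseteq> ball R ?D g c"
    proof
      fix x assume x: "x \<in> J 1"
      show "x \<in> ball R ?D g c"
      proof (cases "x = \<zero>")
        case False
        then have "x \<in> nonzero R" using J.J_carrier[OF x] unfolding nonzero_iff by blast
        then obtain i k u where *: "i < c" "u \<in> T" "x = g i \<otimes> (e (int E * k) \<otimes> u)"
          using cg(3) unfolding translate_def graded_def by blast
        have "e (int E * k) \<otimes> g i = (u \<otimes> inv u) \<otimes> (e (int E * k) \<otimes> g i)"
          using nonzero_r_inv[OF T_inverse(1)[OF *(2)]] e_closed nonzero_closed[OF cg(2)[OF *(1)]] by simp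
        also have "\<dots> = inv u \<otimes> x"
          unfolding *(3) using e_closed nonzero_closed[OF cg(2)[OF *(1)]] T_closed[OF *(2)] T_closed[OF T_inverse(2)[OF *(2)]]
          by (simp add: m_ac)
        finally have "e (int E * k) \<otimes> g i \<in> J 1" using T_J[OF T_inverse(2)[OF *(2)] x] by simp
        then have "k > 0" using cg(5)[OF *(1)] by blast
        then have "x \<in> translate R (g i) ?D" unfolding *(3) translate_def graded_def using *(2) by blast
        then show ?thesis using *(1) unfolding ball_def by blast
      qed (simp add: ball_def)
    qed
  qed
  have T: "unit_ball R ?D g c = graded E {0}" unfolding unit_ball_def ball graded_0 T_def ..
  have DT: "?D \<union> unit_ball R ?D g c = graded E {0..}" unfolding T graded_Un[symmetric] by (rule arg_cong[of _ _ "graded E"]) auto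
  have shift: "(\<lambda>k::int. 1 + k) ` {0..} = {0<..}"
  proof
    show "{0<..} \<subseteq> (\<lambda>k::int. 1 + k) ` {0..}"
    proof
      fix k :: int assume "k \<in> {0<..}"
      then show "k \<in> (\<lambda>k. 1 + k) ` {0..}" by (intro image_eqI[of _ _ "k - 1"]) auto
    qed
  qed auto
  have pT: "T \<subseteq> powers R m ?A" using graded_mono[of "{0}" UNIV E] T_powers unfolding graded_0 powers_def by blast
  have pow: "(e (int E * k) \<otimes> u) [^] m = e (int m * (int E * k)) \<otimes> u [^] m" if "u \<in> T" for k u
    using nat_pow_distrib[OF e_closed T_closed[OF that]] unfolding zpow_pow[OF \<pi>_nonzero] .
  have q: "?q = e (int a)" by (simp only: zpow_nat)
  have pos: "\<one> \<oplus> ?q \<otimes> x [^] m \<in> T" if x: "x \<in> graded E {0..}" for x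
  proof -
    obtain k u where *: "k \<ge> 0" "u \<in> T" "x = e (int E * k) \<otimes> u" using x unfolding graded_def by auto
    have "int m * (int E * k) = int (m * (E * nat k))" using *(1) by (simp only: of_nat_mult nat_0_le)
    then have "?q \<otimes> x [^] m = u [^] m \<otimes> (\<pi> [^] (m * (E * nat k)) \<otimes> ?q)"
      unfolding *(3) pow[OF *(2)] using \<pi>_closed T_closed[OF *(2)] by (simp only: zpow_nat) (simp add: m_ac)
    moreover have "\<pi> [^] (m * (E * nat k)) \<otimes> ?q \<in> J 1"
      using \<pi>_pow_J[OF a, of "m * (E * nat k)"] J.J_antimono[of 1 "m * (E * nat k) + 1"] by auto
    ultimately have "?q \<otimes> x [^] m \<in> J 1" using T_J[OF T_pow[OF *(2)]] by metis
    then show ?thesis unfolding T_def by blast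
  qed
  \<comment> \<open>For \<open>y = q x^m\<close> and its inverse \<open>z\<close>, write \<open>1 + y\<close> as \<open>y (1 + z)\<close>, where \<open>1 + z\<close> is a
    one-unit and hence an \<open>m\<close>-th power.\<close>
  have neg: "\<one> \<oplus> ?q \<otimes> x [^] m \<in> translate R ?q (powers R m ?A)" if x: "x \<in> ?A - graded E {0..}" for x
  proof -
    obtain k u where *: "u \<in> T" "x = e (int E * k) \<otimes> u" using x unfolding graded_def by blast
    then have k: "k < 0" using x gradedI[of k "{0..}" u E] by fastforce
    let ?v = "inv u [^] m"
    have v: "?v \<in> T" by (rule T_pow[OF T_inverse(2)[OF *(1)]])
    obtain l where l: "- k = int (Suc l)" using k by (metis gr0_implies_Suc neg_0_less_iff_less zero_less_imp_eq_int)
    have n: "a + a \<le> m * (E * Suc l)"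
    proof -
      have "a + a \<le> E * Suc l" using aE by simp
      then show ?thesis by simp
    qed
    define n where "n = m * (E * Suc l) - (a + a)"
    have "int m * (int E * - k) = int (m * (E * Suc l))" unfolding l by (simp only: of_nat_mult)
    then have ex: "- (int m * (int E * k)) = int n + int a + int a" using n unfolding n_def by simp
    let ?y = "?q \<otimes> x [^] m" and ?z = "\<pi> [^] n \<otimes> ?q \<otimes> ?v"
    note cl = \<pi>_closed T_closed[OF *(1)] T_closed[OF T_inverse(2)[OF *(1)]] e_closed T_closed[OF v]
    have xA: "x \<in> ?A" using x by blast
    have xn: "x \<in> nonzero R" using xA graded_nonzero by blast
    have yn: "?y \<in> nonzero R" by (rule nonzero_mult[OF nonzero_pow[OF \<pi>_nonzero] nonzero_pow[OF xn]])
    have uv: "u [^] m \<otimes> ?v = \<one>"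
      using nat_pow_distrib[of u "inv u" m] nonzero_r_inv[OF T_inverse(1)[OF *(1)]] cl by simp
    have "?y \<otimes> ?z = (e (int a) \<otimes> e (int m * (int E * k)) \<otimes> e (int n) \<otimes> e (int a)) \<otimes> (u [^] m \<otimes> ?v)"
      unfolding *(2) pow[OF *(1)] zpow_nat using cl by (simp add: m_ac)
    also have "\<dots> = e (int a + int m * (int E * k) + int n + int a)" unfolding uv e_add using cl by simp
    also have "int a + int m * (int E * k) + int n + int a = 0" using ex by linarith
    finally have yz: "?y \<otimes> ?z = \<one>" by simp
    have "?z = ?v \<otimes> (\<pi> [^] n \<otimes> ?q)" using cl by (simp add: m_ac)
    moreover have "\<pi> [^] n \<otimes> ?q \<in> J 1" using \<pi>_pow_J[OF a, of n] J.J_antimono[of 1 "n + 1"] by auto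
    ultimately have "?z \<in> J 1" using T_J[OF v] by simp
    then have "\<one> \<oplus> ?z \<in> T" unfolding T_def by blast
    then obtain w where w: "w \<in> ?A" "\<one> \<oplus> ?z = w [^] m" using pT unfolding powers_def by blast
    have wc: "w \<in> carrier R" using w(1) graded_nonzero nonzero_closed by blast
    have "\<one> \<oplus> ?y = ?y \<otimes> (\<one> \<oplus> ?z)"
      using yz nonzero_closed[OF yn] cl by (simp add: r_distr a_comm)
    also have "\<dots> = ?q \<otimes> (x \<otimes> w) [^] m"
      unfolding w(2) using nonzero_closed[OF xn] wc cl by (simp add: nat_pow_distrib m_ac)
    finally show ?thesis using A_mult[OF xA w(1)] unfolding translate_def powers_def by blast
  qed
  have qdisj: "translate R ?q (powers R m ?A) \<inter> powers R m ?A = {}"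
  proof (rule ccontr)
    assume "translate R ?q (powers R m ?A) \<inter> powers R m ?A \<noteq> {}"
    then obtain k u l v where *: "u \<in> T" "v \<in> T" "?q \<otimes> (e (int E * k) \<otimes> u) [^] m = (e (int E * l) \<otimes> v) [^] m"
      unfolding translate_def powers_def graded_def by blast
    have "e (int a + int m * (int E * k)) \<otimes> u [^] m = e (int m * (int E * l)) \<otimes> v [^] m"
      using *(3) unfolding pow[OF *(1)] pow[OF *(2)] q e_add
      using e_closed T_closed[OF *(1)] by (simp only: m_assoc nat_pow_closed)
    then have "int a + int m * (int E * k) = int m * (int E * l)" using e_unique T_pow *(1,2) by blast
    then have "int a = int (m * E) * (l - k)" by (simp add: algebra_simps)
    then have "int (m * E) dvd int a" by simp
    then have "m * E dvd a" by (simp only: of_nat_dvd_iff)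
    then show False using aE' by (auto dest: dvd_imp_le)
  qed
  \<comment> \<open>There is a single segment for the value group \<open>\<int>\<close>: twice a positive multiple of \<open>E\<close> is
    greater than \<open>E\<close>.\<close>
  have seg0: "segment R ?D (\<lambda>_. ?s) 1 0 = ?D"
  proof -
    have "x \<otimes> x \<in> translate R ?s ?D" if x: "x \<in> ?D" for x
    proof -
      have "x \<otimes> x \<in> graded E {2..}" by (rule graded_mult[OF x x]) auto
      moreover have "{2..} = (\<lambda>k::int. 1 + k) ` {0<..}"
      proof
        show "{2..} \<subseteq> (\<lambda>k::int. 1 + k) ` {0<..}"
        proof
          fix k :: int assume "k \<in> {2..}"
          then show "k \<in> (\<lambda>k. 1 + k) ` {0<..}" by (intro image_eqI[of _ _ "k - 1"]) auto
        qed
      qed auto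
      ultimately show ?thesis unfolding s graded_translate by simp
    qed
    then show ?thesis unfolding segment_def by auto
  qed
  have seg1: "segment R ?D (\<lambda>_. ?s) 1 (Suc k) = {}" for k by (simp add: segment_def)
  have layer0: "layer R ?D (\<lambda>_. ?s) 1 0 = ?D" unfolding layer_def seg0 seg1 by simp
  have c_pos: "c > 0" using cg(3)[of \<one>] one_not_zero by (auto simp: nonzero_iff)
  have M: "(fact c :: nat) > 0" by simp
  have powM: "y [^] (fact c :: nat) \<in> ?A" if "y \<in> nonzero R" for y
    using one A_mult graded_inv graded_nonzero cg(3) cg(2) that by (rule power_in_subgroup)
  have part: "power_partition R m m (graded E S)" if "S = UNIV \<or> S = {0<..}" for S
  proof (rule graded_partition[OF E])
    show "int m * k - int i \<in> S" if "k \<in> S" "i < m" for k i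
    proof -
      have "int m * k - int i > 0" if "k > 0" using ceiling_multiple_pos[OF \<open>i < m\<close> that] .
      then show ?thesis using \<open>k \<in> S\<close> \<open>S = UNIV \<or> S = {0<..}\<close> by auto
    qed
    show "\<exists>k'\<in>S. \<exists>i<m. k = int m * k' - int i" if "k \<in> S" for k
      using ceiling_multiple[of m k] \<open>k \<in> S\<close> \<open>S = UNIV \<or> S = {0<..}\<close> by auto
  qed
  have "tame_field R ?A ?D ?s ?q g (\<lambda>_. ?s) c 1 m (fact c)"
  proof (intro tame_field.intro tame_field_axioms.intro)
    show "plain_field R" by (rule plain_field_axioms)
    show "?A \<subseteq> nonzero R" by (rule graded_nonzero)
    show "?D \<subseteq> ?A" "unit_ball R ?D g c \<subseteq> ?A" unfolding T by (simp_all add: graded_mono)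
    show "?D \<inter> unit_ball R ?D g c = {}" unfolding T by (rule graded_disjoint[OF E]) simp
    show "?D = translate R ?s (?D \<union> unit_ball R ?D g c)" unfolding DT s graded_translate shift ..
    show "x = \<one>" if x: "x \<in> ?A" "x [^] m = \<one>" for x
    proof -
      obtain k u where *: "u \<in> T" "x = e (int E * k) \<otimes> u" using x(1) unfolding graded_def by blast
      have "e (int m * (int E * k)) \<otimes> u [^] m = e 0 \<otimes> \<one>" using x(2) unfolding *(2) pow[OF *(1)] by simp
      then have "int m * (int E * k) = 0" using e_unique T_pow[OF *(1)] T_one by blast
      then have "k = 0" using E by simp
      then have "x = u" using *(2) T_closed[OF *(1)] by simp
      then show ?thesis using T_torsion_free *(1) x(2) by blast
    qed
    show "\<one> \<oplus> ?q \<otimes> x [^] m \<in> powers R m ?A" if "x \<in> ?D \<union> unit_ball R ?D g c" for x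
      using pos that pT unfolding DT by blast
    show "\<one> \<oplus> ?q \<otimes> x [^] m \<in> translate R ?q (powers R m ?A)" if "x \<in> ?A - (?D \<union> unit_ball R ?D g c)" for x
      using neg that unfolding DT by blast
    show "\<exists>C\<subseteq>nonzero R. finite C \<and> ?A = (\<Union>a\<in>C. translate R a (powers R (fact c) (nonzero R)))"
      by (rule graded_powers_cover[OF E M powM])
    show "?s \<in> ?A" using gradedI[OF UNIV_I T_one, of E 1] e_closed by simp
    show "power_partition R m (m ^ Suc k) (layer R ?D (\<lambda>_. ?s) 1 k)" if "k < 1" for k
      using part[of "{0<..}"] that layer0 by simp
    show "power_partition R m (m ^ 1) ?A" using part[of UNIV] by simp
  qed (use one A_mult graded_inv e_nonzero cg(2-4) nonzero_pow[OF \<pi>_nonzero] qdisj seg0 seg1 in \<open>auto simp: segment_def\<close>)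
  moreover have "m ^ Suc k - 1 dvd c" if "k < r0" for k
  proof -
    have "m ^ Suc k - 1 dvd P" unfolding P_def using that by (intro dvd_prodI) auto
    then have "m ^ Suc k - 1 dvd E" unfolding E_def by (rule dvd_mult)
    then show ?thesis using cg(1) by (rule dvd_trans)
  qed
  ultimately show ?thesis by blast
qed

end

section \<open>The tower of Laurent series fields\<close>

lemma finite_field_extension_image_ring:
  assumes ext: "finite_field_extension F L" and inj: "inj_on \<phi> (carrier L)"
  shows "finite_field_extension F (image_ring \<phi> L)"
proof -
  let ?L = "image_ring \<phi> L"
  obtain h where F: "field F" and L: "field L" and h: "h \<in> ring_hom F L"
    and fin: "ring.finite_dimension L (h ` carrier F) (carrier L)"
    using ext unfolding finite_field_extension_def by blast
  interpret F: field F by (rule F)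
  interpret L: field L by (rule L)
  interpret L': field ?L by (rule L.inj_imp_image_ring_is_field[OF inj])
  have iso: "\<phi> \<in> ring_iso L ?L" by (rule inj_imp_image_ring_iso[OF inj])
  then have \<phi>: "\<phi> \<in> ring_hom L ?L" by (simp add: ring_iso_def)
  interpret \<phi>: ring_hom_ring L ?L \<phi> by unfold_locales (rule \<phi>)
  interpret h: ring_hom_ring F L h by unfold_locales (rule h)
  have K: "subfield (h ` carrier F) L" by (rule h.img_is_subfield(2)[OF F.carrier_is_subfield L.one_not_zero])
  obtain n where "L.dimension n (h ` carrier F) (carrier L)" using fin by blast
  then have "L'.dimension n (\<phi> ` h ` carrier F) (\<phi> ` carrier L)"
    by (rule \<phi>.inj_hom_dimension[OF K L'.one_not_zero inj])
  then have "L'.finite_dimension ((\<phi> \<circ> h) ` carrier F) (carrier ?L)"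
    unfolding image_ring_carrier image_comp by (rule L'.finite_dimensionI)
  moreover have "\<phi> \<circ> h \<in> ring_hom F ?L" by (rule ring_hom_trans[OF h \<phi>])
  ultimately show ?thesis
    unfolding finite_field_extension_def using F L'.field_axioms by blast
qed

lemma tame_field_padic_extension:
  assumes p: "Factorial_Ring.prime p" and ext: "finite_field_extension (padic_field p) L"
  shows "char_zero L" and "\<exists>A D s q g b c M. tame_field L A D s q g b c 1 (Suc p) M \<and> (\<forall>k<r0. Suc p ^ Suc k - 1 dvd c)"
proof -
  interpret rational_prime p by unfold_locales (rule p)
  obtain X N where X: "compact_lattice L ([p] \<cdot>\<^bsub>L\<^esub> \<one>\<^bsub>L\<^esub>) (carrier L) X"
      "\<And>x y. x \<in> X \<Longrightarrow> y \<in> X \<Longrightarrow> ([p] \<cdot>\<^bsub>L\<^esub> \<one>\<^bsub>L\<^esub>) [^]\<^bsub>L\<^esub> (N::nat) \<otimes>\<^bsub>L\<^esub> (x \<otimes>\<^bsub>L\<^esub> y) \<in> X"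
      "\<And>x. x \<in> carrier L \<Longrightarrow> \<exists>i. \<forall>y\<in>X. ([p] \<cdot>\<^bsub>L\<^esub> \<one>\<^bsub>L\<^esub>) [^]\<^bsub>L\<^esub> (i::nat) \<otimes>\<^bsub>L\<^esub> (x \<otimes>\<^bsub>L\<^esub> y) \<in> X"
    using extension_lattice(1)[OF ext] by metis
  show char: "char_zero L" by (rule extension_lattice(2)[OF ext])
  have "field L" using ext by (simp add: finite_field_extension_def)
  then interpret lattice_field L p "[p] \<cdot>\<^bsub>L\<^esub> \<one>\<^bsub>L\<^esub>" X N
    using X char p
    by (intro lattice_field.intro lattice_field_axioms.intro plain_field.intro) (auto simp: prime_gt_0_nat)
  show "\<exists>A D s q g b c M. tame_field L A D s q g b c 1 (Suc p) M \<and> (\<forall>k<r0. Suc p ^ Suc k - 1 dvd c)"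
    by (rule tame_field_lattice)
qed

text \<open>The numbers \<open>c\<close>, \<open>m\<close> and \<open>M\<close> are those of the base field, while the number of layers
  grows with \<open>n\<close>. So the base has to be chosen with \<open>n\<close> in mind, with \<open>c\<close> divisible by
  \<open>m ^ Suc k - 1\<close> for all \<open>k \<le> n\<close>.\<close>

lemma tame_field_iterated_laurent:
  assumes "tame_field (iterated_laurent L 0) A D s q g b c 1 m M" "char_zero (iterated_laurent L 0)"
  shows "char_zero (iterated_laurent L n) \<and>
    (\<exists>A D s q g b. tame_field (iterated_laurent L n) A D s q g b c (Suc n) m M)"
proof (induction n)
  case 0
  show ?case using assms unfolding One_nat_def by blast
next
  case (Suc n)
  then obtain A D s q g b where char: "char_zero (iterated_laurent L n)"
    and F: "tame_field (iterated_laurent L n) A D s q g b c (Suc n) m M" by blast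
  interpret F: tame_field "iterated_laurent L n" A D s q g b c "Suc n" m M by (rule F)
  obtain ord lead const t where
    lt: "leading_terms (iterated_laurent L n) (iterated_laurent L (Suc n)) ord lead const t"
    using iterated_leading_terms[OF F.field_axioms char] by blast
  interpret tame_extension "iterated_laurent L n" "iterated_laurent L (Suc n)" ord lead const t A D s q g b c "Suc n" m M
    by (rule tame_extension.intro[OF lt F])
  show ?case using tame_field_laurent char_K by blast
qed

theorem theorem1:
  fixes p n :: nat and L :: "'a ring" and K :: "'a tower ring"
  assumes "Factorial_Ring.prime p"
    and "finite_field_extension (padic_field p) L"
    and "K = iterated_laurent L n"
  shows "carrier (K0 K) = {\<zero>\<^bsub>K0 K\<^esub>} \<and>
         (\<exists>f. definable_bij K f {[x] |x. x \<in> carrier K} {[x] |x. x \<in> carrier K - {\<zero>\<^bsub>K\<^esub>}})"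
proof -
  let ?K0 = "iterated_laurent L 0"
  have ext: "finite_field_extension (padic_field p) ?K0"
    unfolding iterated_laurent.simps(1) by (rule finite_field_extension_image_ring[OF assms(2)]) (simp add: inj_on_def)
  obtain A D s q g b c M where base: "tame_field ?K0 A D s q g b c 1 (Suc p) M"
    and c: "\<forall>k<Suc n. Suc p ^ Suc k - 1 dvd c"
    using tame_field_padic_extension(2)[OF assms(1) ext] by metis
  obtain A D s q g b where "tame_field K A D s q g b c (Suc n) (Suc p) M"
    using tame_field_iterated_laurent[OF base tame_field_padic_extension(1)[OF assms(1) ext]] unfolding assms(3) by blast
  then interpret tame_field K A D s q g b c "Suc n" "Suc p" M .
  obtain f where f: "definable_bij K f {[x] |x. x \<in> carrier K} {[x] |x. x \<in> carrier K - {\<zero>\<^bsub>K\<^esub>}}"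
    using definable_bij_nonzero c by blast
  then show ?thesis using K0_trivial by blast
qed

end
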